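(* Let $(\mathcal U,\mathcal V)$ be a cotorsion pair in a triangulated category $\mathcal T$, with heart $\underline{\mathcal H}$ and associated cohomological functor $\mathbb H:\mathcal T\to\underline{\mathcal H}$. Then the following hold. (1) There exists a natural equivalence $\Psi:\underline{\mathcal H}\xrightarrow{\sim}\mathsf{lex}\,\mathcal U[-1]$ which sends $\pi(H)$ to $\mathcal T(-,H)|_{\mathcal U[-1]}$ for any $H\in\mathcal H$. (2) The cohomological functor $\mathbb H$ is isomorphic to the composed functor $$\mathcal T\xrightarrow{\mathbb Y_{\mathcal U[-1]}}\operatorname{mod}\mathcal U[-1]\xrightarrow{\;Q\;}\mathsf{lex}\,\mathcal U[-1]\xrightarrow{\Psi^{-1}}\underline{\mathcal H}.$$
   Context: All categories and functors are additive; subcategories are full, additive and closed under isomorphisms. $\mathcal T$ is a triangulated category with translation $[1]$. A pair $(\mathcal U,\mathcal V)$ of full subcategories of $\mathcal T$, both closed under direct summands, is a cotorsion pair if $\mathcal T(U,V[1])=0$ for all $U\in\mathcal U$, $V\in\mathcal V$, and every object $X\in\mathcal T$ admits a triangle $U\to X\to V[1]\to U[1]$ with $U\in\mathcal U$, $V\in\mathcal V$. For classes $\mathcal A,\mathcal B$ of objects, $\mathcal A*\mathcal B$ is the class of objects $X$ in a triangle $A\to X\to B\to A[1]$ with $A\in\mathcal A$, $B\in\mathcal B$. Put $\mathcal W=\mathcal U\cap\mathcal V$, $\mathcal T^+=\mathcal W*\mathcal V[1]$, $\mathcal T^-=\mathcal U[-1]*\mathcal W$, $\mathcal H=\mathcal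 T^+\cap\mathcal T^-$. For a subcategory $\mathcal W\subseteq\mathcal S\subseteq\mathcal T$, $\underline{\mathcal S}=\mathcal S/[\mathcal W]$ is the quotient by the ideal of morphisms factoring through an object of $\mathcal W$, and $\pi:\mathcal S\to\underline{\mathcal S}$ is the quotient functor. The heart of $(\mathcal U,\mathcal V)$ is $\underline{\mathcal H}$; it is abelian. It is known (Nakaoka, Abe–Nakaoka) that the inclusion $\underline{\mathcal T}^+\hookrightarrow\underline{\mathcal T}$ has a left adjoint $\tau^+$, the inclusion $\underline{\mathcal T}^-\hookrightarrow\underline{\mathcal T}$ has a right adjoint $\tau^-$, $\tau^-\tau^+\cong\tau^+\tau^-$ takes values in $\underline{\mathcal H}$, and $\mathbb H:=\tau^-\circ\tau^+\circ\pi:\mathcal T\to\underline{\mathcal H}$ is cohomological (it sends triangles $X\to Y\to Z\to X[1]$ to exact sequences $\mathbb HX\to\mathbb HY\to\mathbb HZ\to\mathbb HX[1]$). The extension-closed subcategory $\mathcal U[-1]$ is an extriangulated category: a conflation in $\mathcal U[-1]$ is a sequence $Z\to Y\to X$ of objects of $\mathcal U[-1]$ that completes to a triangle $Z\to Y\to X\to Z[1]$ in $\mathcal T$; the morphism $Y\to X$ in it is then a deflation. $\operatorname{mod}\mathcal U[-1]$ is the abelian category of finitely presented contravariant functors $F:\mathcal U[-1]\to\mathsf{Ab}$ (cokernels of morphisms between representable functors). $\mathsf{lex}\,\mathcal U[-1]\subseteq\operatorname{mod}\mathcal U[-1]$ is the full subcategory of functors $F$ with $0\to F(X)\to F(Y)\to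 F(Z)$ exact for every conflation $Z\to Y\to X$. $\mathsf{def}\,\mathcal U[-1]\subseteq\operatorname{mod}\mathcal U[-1]$ is the Serre subcategory of functors isomorphic to the cokernel of $(-,Y)\xrightarrow{f\circ-}(-,X)$ for some deflation $f:Y\to X$. The inclusion $\mathsf{lex}\,\mathcal U[-1]\hookrightarrow\operatorname{mod}\mathcal U[-1]$ has an exact left adjoint $Q$, which is (up to an equivalence $\operatorname{mod}\mathcal U[-1]/\mathsf{def}\,\mathcal U[-1]\simeq\mathsf{lex}\,\mathcal U[-1]$) the Serre quotient functor with respect to $\mathsf{def}\,\mathcal U[-1]$. $\mathbb Y_{\mathcal U[-1]}$ is the restricted Yoneda functor $X\mapsto\mathcal T(-,X)|_{\mathcal U[-1]}$. *)

theory Defs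
  imports "HOL-Algebra.Coset"
begin

section \<open>Preadditive and additive categories\<close>

text \<open>
  Every Hom-set is a group object \<open>Mor C X Y\<close>, commutative by assumption and written
  multiplicatively as always in HOL-Algebra: \<open>f \<otimes> g\<close> is the sum of morphisms, \<open>\<one>\<close> the zero
  morphism and \<open>inv f\<close> the negative. Every morphism knows its source and target, so composition
  needs no object arguments.
\<close>

record ('o, 'm) precat =
  Ob   :: "'o set"
  Mor  :: "'o \<Rightarrow> 'o \<Rightarrow> 'm monoid"
  Src  :: "'m \<Rightarrow> 'o"
  Tgt  :: "'m \<Rightarrow> 'o"
  Comp :: "'m \<Rightarrow> 'm \<Rightarrow> 'm"  (infixl \<open>\<bullet>\<index>\<close> 70)
  Ide  :: "'o \<Rightarrow> 'm"

abbreviation Hom :: "('o, 'm, 'z) precat_scheme \<Rightarrow> 'o \<Rightarrow> 'o \<Rightarrow> 'm set"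
  where "Hom C X Y \<equiv> carrier (Mor C X Y)"

abbreviation Zero :: "('o, 'm, 'z) precat_scheme \<Rightarrow> 'o \<Rightarrow> 'o \<Rightarrow> 'm"
  where "Zero C X Y \<equiv> \<one>\<^bsub>Mor C X Y\<^esub>"

locale preadditive_category =
  fixes C :: "('o, 'm, 'z) precat_scheme" (structure)
  assumes hom_comm_group: "\<lbrakk>X \<in> Ob C; Y \<in> Ob C\<rbrakk> \<Longrightarrow> comm_group (Mor C X Y)"
    and Src_Hom: "\<lbrakk>X \<in> Ob C; Y \<in> Ob C; f \<in> Hom C X Y\<rbrakk> \<Longrightarrow> Src C f = X"
    and Tgt_Hom: "\<lbrakk>X \<in> Ob C; Y \<in> Ob C; f \<in> Hom C X Y\<rbrakk> \<Longrightarrow> Tgt C f = Y"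
    and Ide_closed: "X \<in> Ob C \<Longrightarrow> Ide C X \<in> Hom C X X"
    and Comp_closed:
      "\<lbrakk>X \<in> Ob C; Y \<in> Ob C; Z \<in> Ob C; f \<in> Hom C X Y; g \<in> Hom C Y Z\<rbrakk> \<Longrightarrow> g \<bullet> f \<in> Hom C X Z"
    and Comp_Ide: "\<lbrakk>X \<in> Ob C; Y \<in> Ob C; f \<in> Hom C X Y\<rbrakk> \<Longrightarrow> f \<bullet> Ide C X = f"
    and Ide_Comp: "\<lbrakk>X \<in> Ob C; Y \<in> Ob C; f \<in> Hom C X Y\<rbrakk> \<Longrightarrow> Ide C Y \<bullet> f = f"
    and Comp_assoc:
      "\<lbrakk>X \<in> Ob C; Y \<in> Ob C; Z \<in> Ob C; W \<in> Ob C; f \<in> Hom C X Y; g \<in> Hom C Y Z; h \<in> Hom C Z W\<rbrakk>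
        \<Longrightarrow> (h \<bullet> g) \<bullet> f = h \<bullet> (g \<bullet> f)"
    and Comp_add_left:
      "\<lbrakk>X \<in> Ob C; Y \<in> Ob C; Z \<in> Ob C; f \<in> Hom C X Y; g \<in> Hom C Y Z; g' \<in> Hom C Y Z\<rbrakk>
        \<Longrightarrow> (g \<otimes>\<^bsub>Mor C Y Z\<^esub> g') \<bullet> f = (g \<bullet> f) \<otimes>\<^bsub>Mor C X Z\<^esub> (g' \<bullet> f)"
    and Comp_add_right:
      "\<lbrakk>X \<in> Ob C; Y \<in> Ob C; Z \<in> Ob C; f \<in> Hom C X Y; f' \<in> Hom C X Y; g \<in> Hom C Y Z\<rbrakk>
        \<Longrightarrow> g \<bullet> (f \<otimes>\<^bsub>Mor C X Y\<^esub> f') = (g \<bullet> f) \<otimes>\<^bsub>Mor C X Z\<^esub> (g \<bullet> f')"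

definition iso_in :: "('o, 'm, 'z) precat_scheme \<Rightarrow> 'o \<Rightarrow> 'o \<Rightarrow> 'm \<Rightarrow> bool" where
  "iso_in C X Y f \<longleftrightarrow> f \<in> Hom C X Y \<and>
     (\<exists>g \<in> Hom C Y X. g \<bullet>\<^bsub>C\<^esub> f = Ide C X \<and> f \<bullet>\<^bsub>C\<^esub> g = Ide C Y)"

definition isomorphic :: "('o, 'm, 'z) precat_scheme \<Rightarrow> 'o \<Rightarrow> 'o \<Rightarrow> bool" where
  "isomorphic C X Y \<longleftrightarrow> (\<exists>f. iso_in C X Y f)"

definition zero_object :: "('o, 'm, 'z) precat_scheme \<Rightarrow> 'o \<Rightarrow> bool" where
  "zero_object C Z \<longleftrightarrow> Z \<in> Ob C \<and>
     (\<forall>X \<in> Ob C. Hom C X Z = {Zero C X Z} \<and> Hom C Z X = {Zero C Z X})"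

definition biproduct :: "('o, 'm, 'z) precat_scheme \<Rightarrow> 'o \<Rightarrow> 'o \<Rightarrow> 'o \<Rightarrow> bool" where
  "biproduct C X Y P \<longleftrightarrow> P \<in> Ob C \<and>
     (\<exists>i \<in> Hom C X P. \<exists>j \<in> Hom C Y P. \<exists>p \<in> Hom C P X. \<exists>q \<in> Hom C P Y.
        p \<bullet>\<^bsub>C\<^esub> i = Ide C X \<and> q \<bullet>\<^bsub>C\<^esub> j = Ide C Y \<and>
        p \<bullet>\<^bsub>C\<^esub> j = Zero C Y X \<and> q \<bullet>\<^bsub>C\<^esub> i = Zero C X Y \<and>
        (i \<bullet>\<^bsub>C\<^esub> p) \<otimes>\<^bsub>Mor C P P\<^esub> (j \<bullet>\<^bsub>C\<^esub> q) = Ide C P)"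

locale additive_category = preadditive_category +
  assumes zero_object_exists: "\<exists>Z. zero_object C Z"
    and biproduct_exists: "\<lbrakk>X \<in> Ob C; Y \<in> Ob C\<rbrakk> \<Longrightarrow> \<exists>P. biproduct C X Y P"

definition opposite :: "('o, 'm, 'z) precat_scheme \<Rightarrow> ('o, 'm) precat" where
  "opposite C = \<lparr>Ob = Ob C, Mor = (\<lambda>X Y. Mor C Y X), Src = Tgt C, Tgt = Src C,
     Comp = (\<lambda>g f. f \<bullet>\<^bsub>C\<^esub> g), Ide = Ide C\<rparr>"

definition full_subcat :: "('o, 'm, 'z) precat_scheme \<Rightarrow> 'o set \<Rightarrow> ('o, 'm) precat" where
  "full_subcat C S =
     \<lparr>Ob = S, Mor = Mor C, Src = Src C, Tgt = Tgt C, Comp = Comp C, Ide = Ide C\<rparr>"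

text \<open>Object classes of the subcategories considered: full, additive, closed under isomorphisms.\<close>

definition additive_subcat :: "('o, 'm, 'z) precat_scheme \<Rightarrow> 'o set \<Rightarrow> bool" where
  "additive_subcat C S \<longleftrightarrow> S \<subseteq> Ob C \<and>
     (\<exists>Z \<in> S. zero_object C Z) \<and>
     (\<forall>X \<in> S. \<forall>Y \<in> S. \<forall>P. biproduct C X Y P \<longrightarrow> P \<in> S) \<and>
     (\<forall>X \<in> S. \<forall>Y \<in> Ob C. isomorphic C X Y \<longrightarrow> Y \<in> S)"

definition closed_under_summands :: "('o, 'm, 'z) precat_scheme \<Rightarrow> 'o set \<Rightarrow> bool" where
  "closed_under_summands C S \<longleftrightarrow>
     (\<forall>X \<in> Ob C. \<forall>Y \<in> Ob C. \<forall>P \<in> S. biproduct C X Y P \<longrightarrow> X \<in> S \<and> Y \<in> S)"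

definition is_cokernel :: "('o, 'm, 'z) precat_scheme \<Rightarrow> 'o \<Rightarrow> 'o \<Rightarrow> 'o \<Rightarrow> 'm \<Rightarrow> 'm \<Rightarrow> bool" where
  "is_cokernel C A B K f p \<longleftrightarrow> A \<in> Ob C \<and> B \<in> Ob C \<and> K \<in> Ob C \<and>
     f \<in> Hom C A B \<and> p \<in> Hom C B K \<and> p \<bullet>\<^bsub>C\<^esub> f = Zero C A K \<and>
     (\<forall>L \<in> Ob C. \<forall>q \<in> Hom C B L. q \<bullet>\<^bsub>C\<^esub> f = Zero C A L \<longrightarrow>
        (\<exists>!u. u \<in> Hom C K L \<and> u \<bullet>\<^bsub>C\<^esub> p = q))"


section \<open>Functors, natural transformations, equivalences and adjunctions\<close>

record ('o, 'm, 'p, 'n) cfunctor =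
  fobj :: "'o \<Rightarrow> 'p"
  farr :: "'m \<Rightarrow> 'n"

definition id_functor :: "('o, 'm, 'o, 'm) cfunctor" where
  "id_functor = \<lparr>fobj = (\<lambda>X. X), farr = (\<lambda>f. f)\<rparr>"

definition comp_functor ::
  "('p, 'n, 'q, 'k) cfunctor \<Rightarrow> ('o, 'm, 'p, 'n) cfunctor \<Rightarrow> ('o, 'm, 'q, 'k) cfunctor"
  (infixl \<open>\<circ>\<^sub>F\<close> 55) where
  "G \<circ>\<^sub>F F = \<lparr>fobj = fobj G \<circ> fobj F, farr = farr G \<circ> farr F\<rparr>"

definition additive_functor ::
  "('o, 'm, 'y) precat_scheme \<Rightarrow> ('p, 'n, 'z) precat_scheme \<Rightarrow> ('o, 'm, 'p, 'n) cfunctor \<Rightarrow> bool" where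
  "additive_functor C D F \<longleftrightarrow>
     (\<forall>X \<in> Ob C. fobj F X \<in> Ob D) \<and>
     (\<forall>X \<in> Ob C. \<forall>Y \<in> Ob C. farr F \<in> hom (Mor C X Y) (Mor D (fobj F X) (fobj F Y))) \<and>
     (\<forall>X \<in> Ob C. farr F (Ide C X) = Ide D (fobj F X)) \<and>
     (\<forall>X \<in> Ob C. \<forall>Y \<in> Ob C. \<forall>Z \<in> Ob C. \<forall>f \<in> Hom C X Y. \<forall>g \<in> Hom C Y Z.
        farr F (g \<bullet>\<^bsub>C\<^esub> f) = farr F g \<bullet>\<^bsub>D\<^esub> farr F f)"

definition nat_trans ::
  "('o, 'm, 'y) precat_scheme \<Rightarrow> ('p, 'n, 'z) precat_scheme \<Rightarrow>
   ('o, 'm, 'p, 'n) cfunctor \<Rightarrow> ('o, 'm, 'p, 'n) cfunctor \<Rightarrow> ('o \<Rightarrow> 'n) \<Rightarrow> bool" where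
  "nat_trans C D F G \<eta> \<longleftrightarrow>
     additive_functor C D F \<and> additive_functor C D G \<and>
     (\<forall>X \<in> Ob C. \<eta> X \<in> Hom D (fobj F X) (fobj G X)) \<and>
     (\<forall>X \<in> Ob C. \<forall>Y \<in> Ob C. \<forall>f \<in> Hom C X Y. \<eta> Y \<bullet>\<^bsub>D\<^esub> farr F f = farr G f \<bullet>\<^bsub>D\<^esub> \<eta> X)"

definition nat_isomorphic ::
  "('o, 'm, 'y) precat_scheme \<Rightarrow> ('p, 'n, 'z) precat_scheme \<Rightarrow>
   ('o, 'm, 'p, 'n) cfunctor \<Rightarrow> ('o, 'm, 'p, 'n) cfunctor \<Rightarrow> bool" where
  "nat_isomorphic C D F G \<longleftrightarrow>
     (\<exists>\<eta>. nat_trans C D F G \<eta> \<and> (\<forall>X \<in> Ob C. iso_in D (fobj F X) (fobj G X) (\<eta> X)))"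

definition quasi_inverse ::
  "('o, 'm, 'y) precat_scheme \<Rightarrow> ('p, 'n, 'z) precat_scheme \<Rightarrow>
   ('o, 'm, 'p, 'n) cfunctor \<Rightarrow> ('p, 'n, 'o, 'm) cfunctor \<Rightarrow> bool" where
  "quasi_inverse C D F G \<longleftrightarrow>
     additive_functor C D F \<and> additive_functor D C G \<and>
     nat_isomorphic C C id_functor (G \<circ>\<^sub>F F) \<and> nat_isomorphic D D (F \<circ>\<^sub>F G) id_functor"

definition category_equivalence ::
  "('o, 'm, 'y) precat_scheme \<Rightarrow> ('p, 'n, 'z) precat_scheme \<Rightarrow> ('o, 'm, 'p, 'n) cfunctor \<Rightarrow> bool" where
  "category_equivalence C D F \<longleftrightarrow> (\<exists>G. quasi_inverse C D F G)"

text \<open>\<open>L : C \<rightarrow> D\<close> is left adjoint to \<open>R : D \<rightarrow> C\<close>.\<close>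

definition adjoint ::
  "('o, 'm, 'y) precat_scheme \<Rightarrow> ('p, 'n, 'z) precat_scheme \<Rightarrow>
   ('o, 'm, 'p, 'n) cfunctor \<Rightarrow> ('p, 'n, 'o, 'm) cfunctor \<Rightarrow> bool" where
  "adjoint C D L R \<longleftrightarrow>
     additive_functor C D L \<and> additive_functor D C R \<and>
     (\<exists>\<eta> \<epsilon>. nat_trans C C id_functor (R \<circ>\<^sub>F L) \<eta> \<and> nat_trans D D (L \<circ>\<^sub>F R) id_functor \<epsilon> \<and>
        (\<forall>X \<in> Ob C. \<epsilon> (fobj L X) \<bullet>\<^bsub>D\<^esub> farr L (\<eta> X) = Ide D (fobj L X)) \<and>
        (\<forall>Y \<in> Ob D. farr R (\<epsilon> Y) \<bullet>\<^bsub>C\<^esub> \<eta> (fobj R Y) = Ide C (fobj R Y)))"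

text \<open>
  The category of additive functors \<open>C \<rightarrow> D\<close>. A morphism is a triple of source functor, target
  functor and components; the components are fixed outside \<open>Ob C\<close>, so that equal natural
  transformations are equal morphisms. The values of a functor off \<open>C\<close> are not normalised:
  functors that differ only there are isomorphic via identity components.
\<close>

definition functor_cat ::
  "('o, 'm, 'y) precat_scheme \<Rightarrow> ('p, 'n, 'z) precat_scheme \<Rightarrow>
   (('o, 'm, 'p, 'n) cfunctor,
    ('o, 'm, 'p, 'n) cfunctor \<times> ('o, 'm, 'p, 'n) cfunctor \<times> ('o \<Rightarrow> 'n)) precat" where
  "functor_cat C D =
     \<lparr>Ob = {F. additive_functor C D F},
      Mor = (\<lambda>F G.
        \<lparr>carrier = {(F, G, \<eta>) | \<eta>. nat_trans C D F G \<eta> \<and> \<eta> \<in> extensional (Ob C)},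
         monoid.mult = (\<lambda>(_, _, \<eta>) (_, _, \<theta>).
           (F, G, \<lambda>X \<in> Ob C. \<eta> X \<otimes>\<^bsub>Mor D (fobj F X) (fobj G X)\<^esub> \<theta> X)),
         one = (F, G, \<lambda>X \<in> Ob C. Zero D (fobj F X) (fobj G X))\<rparr>),
      Src = (\<lambda>(F, _, _). F),
      Tgt = (\<lambda>(_, G, _). G),
      Comp = (\<lambda>(_, H, \<theta>) (F, _, \<eta>). (F, H, \<lambda>X \<in> Ob C. \<theta> X \<bullet>\<^bsub>D\<^esub> \<eta> X)),
      Ide = (\<lambda>F. (F, F, \<lambda>X \<in> Ob C. Ide D (fobj F X)))\<rparr>"


section \<open>Abelian groups, representable and finitely presented functors\<close>

type_synonym 'e ab_arrow = "'e monoid \<times> 'e monoid \<times> ('e \<Rightarrow> 'e)"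

definition Ab :: "('e monoid, 'e ab_arrow) precat" where
  "Ab =
     \<lparr>Ob = {A. comm_group A},
      Mor = (\<lambda>A B.
        \<lparr>carrier = {(A, B, \<phi>) | \<phi>. \<phi> \<in> hom A B \<and> \<phi> \<in> extensional (carrier A)},
         monoid.mult = (\<lambda>(_, _, \<phi>) (_, _, \<psi>). (A, B, \<lambda>x \<in> carrier A. \<phi> x \<otimes>\<^bsub>B\<^esub> \<psi> x)),
         one = (A, B, \<lambda>x \<in> carrier A. \<one>\<^bsub>B\<^esub>)\<rparr>),
      Src = (\<lambda>(A, _, _). A),
      Tgt = (\<lambda>(_, B, _). B),
      Comp = (\<lambda>(_, D, \<psi>) (A, _, \<phi>). (A, D, \<lambda>x \<in> carrier A. \<psi> (\<phi> x))),
      Ide = (\<lambda>A. (A, A, \<lambda>x \<in> carrier A. x))\<rparr>"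

definition ab_fun :: "'e ab_arrow \<Rightarrow> 'e \<Rightarrow> 'e" where
  "ab_fun = (\<lambda>(_, _, \<phi>). \<phi>)"

text \<open>
  Contravariant functors from \<open>C\<close> to abelian groups. The groups live on the type of morphisms
  of \<open>C\<close>. This type carries the values of the representable functors and, up to isomorphism, all
  their quotients, hence a copy of every finitely presented functor.
\<close>

type_synonym ('o, 'm) presheaf = "('o, 'm, 'm monoid, 'm ab_arrow) cfunctor"

type_synonym ('o, 'm) presheaf_arrow =
  "('o, 'm) presheaf \<times> ('o, 'm) presheaf \<times> ('o \<Rightarrow> 'm ab_arrow)"

definition presheaf_cat ::
  "('o, 'm, 'z) precat_scheme \<Rightarrow> (('o, 'm) presheaf, ('o, 'm) presheaf_arrow) precat" where
  "presheaf_cat C = functor_cat (opposite C) Ab"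

definition representable :: "('o, 'm, 'z) precat_scheme \<Rightarrow> 'o \<Rightarrow> ('o, 'm) presheaf" where
  "representable C X =
     \<lparr>fobj = (\<lambda>Z. Mor C Z X),
      farr = (\<lambda>f. (Mor C (Tgt C f) X, Mor C (Src C f) X, \<lambda>g \<in> Hom C (Tgt C f) X. g \<bullet>\<^bsub>C\<^esub> f))\<rparr>"

text \<open>
  \<open>X \<mapsto> C(-, X)\<close> restricted to the full subcategory on \<open>S\<close>. The restriction of \<open>C(-, X)\<close> is
  \<open>representable C X\<close> itself, regarded as an object of \<open>presheaf_cat (full_subcat C S)\<close>.
\<close>

definition restricted_yoneda ::
  "('o, 'm, 'z) precat_scheme \<Rightarrow> 'o set \<Rightarrow>
   ('o, 'm, ('o, 'm) presheaf, ('o, 'm) presheaf_arrow) cfunctor" where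
  "restricted_yoneda C S =
     \<lparr>fobj = representable C,
      farr = (\<lambda>f. (representable C (Src C f), representable C (Tgt C f),
        \<lambda>Z \<in> S. (Mor C Z (Src C f), Mor C Z (Tgt C f), \<lambda>g \<in> Hom C Z (Src C f). f \<bullet>\<^bsub>C\<^esub> g)))\<rparr>"

definition finitely_presented :: "('o, 'm, 'z) precat_scheme \<Rightarrow> ('o, 'm) presheaf \<Rightarrow> bool" where
  "finitely_presented C F \<longleftrightarrow>
     (\<exists>X \<in> Ob C. \<exists>Y \<in> Ob C. \<exists>f \<in> Hom C X Y. \<exists>p.
        is_cokernel (presheaf_cat C) (representable C X) (representable C Y) F
          (farr (restricted_yoneda C (Ob C)) f) p)"

definition mod_cat ::
  "('o, 'm, 'z) precat_scheme \<Rightarrow> (('o, 'm) presheaf, ('o, 'm) presheaf_arrow) precat" where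
  "mod_cat C = full_subcat (presheaf_cat C) {F. finitely_presented C F}"


section \<open>Ideal quotients\<close>

definition factor_ideal :: "('o, 'm, 'z) precat_scheme \<Rightarrow> 'o set \<Rightarrow> 'o \<Rightarrow> 'o \<Rightarrow> 'm set" where
  "factor_ideal C W X Y =
     {f \<in> Hom C X Y. \<exists>P \<in> W. \<exists>a \<in> Hom C X P. \<exists>b \<in> Hom C P Y. f = b \<bullet>\<^bsub>C\<^esub> a}"

definition ideal_class :: "('o, 'm, 'z) precat_scheme \<Rightarrow> 'o set \<Rightarrow> 'm \<Rightarrow> 'm set" where
  "ideal_class C W f =
     factor_ideal C W (Src C f) (Tgt C f) #>\<^bsub>Mor C (Src C f) (Tgt C f)\<^esub> f"

text \<open>
  The union in the composition is one of equal classes: \<open>b \<bullet> a\<close> modulo the ideal depends only on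
  the classes of \<open>b\<close> and \<open>a\<close>.
\<close>

definition quotient_cat :: "('o, 'm, 'z) precat_scheme \<Rightarrow> 'o set \<Rightarrow> ('o, 'm set) precat" where
  "quotient_cat C W =
     \<lparr>Ob = Ob C,
      Mor = (\<lambda>X Y. Mor C X Y Mod factor_ideal C W X Y),
      Src = (\<lambda>A. the_elem (Src C ` A)),
      Tgt = (\<lambda>A. the_elem (Tgt C ` A)),
      Comp = (\<lambda>B A. \<Union>b \<in> B. \<Union>a \<in> A. ideal_class C W (b \<bullet>\<^bsub>C\<^esub> a)),
      Ide = (\<lambda>X. ideal_class C W (Ide C X))\<rparr>"

definition quotient_functor ::
  "('o, 'm, 'z) precat_scheme \<Rightarrow> 'o set \<Rightarrow> ('o, 'm, 'o, 'm set) cfunctor" where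
  "quotient_functor C W = \<lparr>fobj = (\<lambda>X. X), farr = ideal_class C W\<rparr>"


section \<open>Triangulated categories\<close>

record ('o, 'm) tricat = "('o, 'm) precat" +
  Shift :: "('o, 'm, 'o, 'm) cfunctor"
  Dist  :: "('m \<times> 'm \<times> 'm) set"

abbreviation shift_ob :: "('o, 'm, 'z) tricat_scheme \<Rightarrow> 'o \<Rightarrow> 'o"
  where "shift_ob T \<equiv> fobj (Shift T)"

abbreviation shift_arr :: "('o, 'm, 'z) tricat_scheme \<Rightarrow> 'm \<Rightarrow> 'm"
  where "shift_arr T \<equiv> farr (Shift T)"

text \<open>A distinguished triangle \<open>X \<rightarrow> Y \<rightarrow> Z \<rightarrow> X[1]\<close> with morphisms \<open>f\<close>, \<open>g\<close>, \<open>h\<close>.\<close>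

definition triangle ::
  "('o, 'm, 'z) tricat_scheme \<Rightarrow> 'o \<Rightarrow> 'o \<Rightarrow> 'o \<Rightarrow> 'm \<Rightarrow> 'm \<Rightarrow> 'm \<Rightarrow> bool" where
  "triangle T X Y Z f g h \<longleftrightarrow> X \<in> Ob T \<and> Y \<in> Ob T \<and> Z \<in> Ob T \<and>
     f \<in> Hom T X Y \<and> g \<in> Hom T Y Z \<and> h \<in> Hom T Z (shift_ob T X) \<and> (f, g, h) \<in> Dist T"

text \<open>The translation is only required to be an autoequivalence.\<close>

locale triangulated_category = additive_category T
  for T :: "('o, 'm, 'z) tricat_scheme" (structure) +
  assumes shift_equivalence: "category_equivalence T T (Shift T)"
    and triangle_iso:
      "\<lbrakk>triangle T X Y Z f g h; X' \<in> Ob T; Y' \<in> Ob T; Z' \<in> Ob T;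
        f' \<in> Hom T X' Y'; g' \<in> Hom T Y' Z'; h' \<in> Hom T Z' (shift_ob T X');
        iso_in T X X' a; iso_in T Y Y' b; iso_in T Z Z' c;
        b \<bullet> f = f' \<bullet> a; c \<bullet> g = g' \<bullet> b; shift_arr T a \<bullet> h = h' \<bullet> c\<rbrakk>
       \<Longrightarrow> triangle T X' Y' Z' f' g' h'"
    and triangle_Ide:
      "\<lbrakk>X \<in> Ob T; zero_object T Z\<rbrakk>
       \<Longrightarrow> triangle T X X Z (Ide T X) (Zero T X Z) (Zero T Z (shift_ob T X))"
    and triangle_exists:
      "\<lbrakk>X \<in> Ob T; Y \<in> Ob T; f \<in> Hom T X Y\<rbrakk> \<Longrightarrow> \<exists>Z g h. triangle T X Y Z f g h"
    and triangle_rotate: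
      "\<lbrakk>X \<in> Ob T; Y \<in> Ob T; Z \<in> Ob T;
        f \<in> Hom T X Y; g \<in> Hom T Y Z; h \<in> Hom T Z (shift_ob T X)\<rbrakk>
       \<Longrightarrow> triangle T X Y Z f g h \<longleftrightarrow>
           triangle T Y Z (shift_ob T X) g h
             (inv\<^bsub>Mor T (shift_ob T X) (shift_ob T Y)\<^esub> (shift_arr T f))"
    and triangle_morphism:
      "\<lbrakk>triangle T X Y Z f g h; triangle T X' Y' Z' f' g' h';
        a \<in> Hom T X X'; b \<in> Hom T Y Y'; b \<bullet> f = f' \<bullet> a\<rbrakk>
       \<Longrightarrow> \<exists>c \<in> Hom T Z Z'. c \<bullet> g = g' \<bullet> b \<and> shift_arr T a \<bullet> h = h' \<bullet> c"
    and octahedral: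
      "\<lbrakk>triangle T X Y A f f\<^sub>1 f\<^sub>2; triangle T Y Z B g g\<^sub>1 g\<^sub>2; triangle T X Z D (g \<bullet> f) h\<^sub>1 h\<^sub>2\<rbrakk>
       \<Longrightarrow> \<exists>u v. triangle T A D B u v (shift_arr T f\<^sub>1 \<bullet> g\<^sub>2) \<and>
             u \<bullet> f\<^sub>1 = h\<^sub>1 \<bullet> g \<and> h\<^sub>2 \<bullet> u = f\<^sub>2 \<and>
             v \<bullet> h\<^sub>1 = g\<^sub>1 \<and> g\<^sub>2 \<bullet> v = shift_arr T f \<bullet> h\<^sub>2"

text \<open>The isomorphism-closed classes \<open>S[1]\<close> and \<open>S[-1]\<close>.\<close>

definition shift_class :: "('o, 'm, 'z) tricat_scheme \<Rightarrow> 'o set \<Rightarrow> 'o set" where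
  "shift_class T S = {X \<in> Ob T. \<exists>Y \<in> S. isomorphic T (shift_ob T Y) X}"

definition unshift_class :: "('o, 'm, 'z) tricat_scheme \<Rightarrow> 'o set \<Rightarrow> 'o set" where
  "unshift_class T S = {X \<in> Ob T. \<exists>Y \<in> S. isomorphic T (shift_ob T X) Y}"

definition star :: "('o, 'm, 'z) tricat_scheme \<Rightarrow> 'o set \<Rightarrow> 'o set \<Rightarrow> 'o set" where
  "star T \<A> \<B> = {X. \<exists>A \<in> \<A>. \<exists>B \<in> \<B>. \<exists>f g h. triangle T A X B f g h}"


section \<open>Cotorsion pairs and their hearts\<close>

definition cotorsion_pair :: "('o, 'm, 'z) tricat_scheme \<Rightarrow> 'o set \<Rightarrow> 'o set \<Rightarrow> bool" where
  "cotorsion_pair T U V \<longleftrightarrow>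
     additive_subcat T U \<and> additive_subcat T V \<and>
     closed_under_summands T U \<and> closed_under_summands T V \<and>
     (\<forall>X \<in> U. \<forall>Y \<in> V. Hom T X (shift_ob T Y) = {Zero T X (shift_ob T Y)}) \<and>
     (\<forall>X \<in> Ob T. \<exists>A \<in> U. \<exists>B \<in> V. \<exists>f g h. triangle T A X (shift_ob T B) f g h)"

definition tplus :: "('o, 'm, 'z) tricat_scheme \<Rightarrow> 'o set \<Rightarrow> 'o set \<Rightarrow> 'o set" where
  "tplus T U V = star T (U \<inter> V) (shift_class T V)"

definition tminus :: "('o, 'm, 'z) tricat_scheme \<Rightarrow> 'o set \<Rightarrow> 'o set \<Rightarrow> 'o set" where
  "tminus T U V = star T (unshift_class T U) (U \<inter> V)"

definition heart_objects :: "('o, 'm, 'z) tricat_scheme \<Rightarrow> 'o set \<Rightarrow> 'o set \<Rightarrow> 'o set" where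
  "heart_objects T U V = tplus T U V \<inter> tminus T U V"

definition stable_cat ::
  "('o, 'm, 'z) tricat_scheme \<Rightarrow> 'o set \<Rightarrow> 'o set \<Rightarrow> 'o set \<Rightarrow> ('o, 'm set) precat" where
  "stable_cat T U V S = quotient_cat (full_subcat T S) (U \<inter> V)"

definition heart :: "('o, 'm, 'z) tricat_scheme \<Rightarrow> 'o set \<Rightarrow> 'o set \<Rightarrow> ('o, 'm set) precat" where
  "heart T U V = stable_cat T U V (heart_objects T U V)"

text \<open>
  \<open>t\<^sub>p\<close> and \<open>t\<^sub>m\<close> stand for the adjoints \<open>\<tau>\<^sup>+\<close> and \<open>\<tau>\<^sup>-\<close>, which are determined up to natural
  isomorphism. If \<open>U \<inter> V \<subseteq> S\<close>, the residue classes between objects of \<open>S\<close> are the same in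
  \<open>stable_cat T U V S\<close> and \<open>stable_cat T U V (Ob T)\<close>, so \<open>id_functor\<close> is the inclusion.
\<close>

definition is_tau_plus ::
  "('o, 'm, 'z) tricat_scheme \<Rightarrow> 'o set \<Rightarrow> 'o set \<Rightarrow> ('o, 'm set, 'o, 'm set) cfunctor \<Rightarrow> bool" where
  "is_tau_plus T U V t\<^sub>p \<longleftrightarrow>
     adjoint (stable_cat T U V (Ob T)) (stable_cat T U V (tplus T U V)) t\<^sub>p id_functor"

definition is_tau_minus ::
  "('o, 'm, 'z) tricat_scheme \<Rightarrow> 'o set \<Rightarrow> 'o set \<Rightarrow> ('o, 'm set, 'o, 'm set) cfunctor \<Rightarrow> bool" where
  "is_tau_minus T U V t\<^sub>m \<longleftrightarrow>
     adjoint (stable_cat T U V (tminus T U V)) (stable_cat T U V (Ob T)) id_functor t\<^sub>m"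

definition heart_functor ::
  "('o, 'm, 'z) tricat_scheme \<Rightarrow> 'o set \<Rightarrow> 'o set \<Rightarrow>
   ('o, 'm set, 'o, 'm set) cfunctor \<Rightarrow> ('o, 'm set, 'o, 'm set) cfunctor \<Rightarrow>
   ('o, 'm, 'o, 'm set) cfunctor" where
  "heart_functor T U V t\<^sub>p t\<^sub>m = t\<^sub>m \<circ>\<^sub>F t\<^sub>p \<circ>\<^sub>F quotient_functor T (U \<inter> V)"


section \<open>Left exact functors on an extension-closed subcategory\<close>

definition conflation ::
  "('o, 'm, 'z) tricat_scheme \<Rightarrow> 'o set \<Rightarrow> 'o \<Rightarrow> 'o \<Rightarrow> 'o \<Rightarrow> 'm \<Rightarrow> 'm \<Rightarrow> bool" where
  "conflation T S Z Y X a b \<longleftrightarrow> Z \<in> S \<and> Y \<in> S \<and> X \<in> S \<and> (\<exists>h. triangle T Z Y X a b h)"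

text \<open>Exactness of \<open>0 \<rightarrow> F(X) \<rightarrow> F(Y) \<rightarrow> F(Z)\<close> for every conflation \<open>Z \<rightarrow> Y \<rightarrow> X\<close>.\<close>

definition left_exact :: "('o, 'm, 'z) tricat_scheme \<Rightarrow> 'o set \<Rightarrow> ('o, 'm) presheaf \<Rightarrow> bool" where
  "left_exact T S F \<longleftrightarrow>
     (\<forall>Z Y X a b. conflation T S Z Y X a b \<longrightarrow>
        inj_on (ab_fun (farr F b)) (carrier (fobj F X)) \<and>
        ab_fun (farr F b) ` carrier (fobj F X) = kernel (fobj F Y) (fobj F Z) (ab_fun (farr F a)))"

definition lex_cat ::
  "('o, 'm, 'z) tricat_scheme \<Rightarrow> 'o set \<Rightarrow> (('o, 'm) presheaf, ('o, 'm) presheaf_arrow) precat" where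
  "lex_cat T S =
     full_subcat (mod_cat (full_subcat T S)) {F \<in> Ob (mod_cat (full_subcat T S)). left_exact T S F}"

end

theory Submission
  imports Defs
begin

text \<open>
  Let \<open>\<A> = U[-1]\<close>. A map from an object of \<open>\<A>\<close> to an object of \<open>U\<close> is killed by composing it with
  a suitable deflation of \<open>\<A>\<close>, and deflations pull back, so they behave like the coverings of a topology on \<open>\<A>\<close> whose sheaves are the left exact functors.

  The object \<open>X\<close> lies in \<open>T\<^sup>+\<close> if and only if \<open>T(-, X)\<close> is left exact on \<open>\<A>\<close>. For arbitrary \<open>X\<close> the
  reflection into \<open>T\<^sup>+\<close> is the cone of a map \<open>E \<rightarrow> U\<^sub>0 \<rightarrow> X\<close> with \<open>E\<close> in \<open>\<A>\<close> and \<open>U\<^sub>0\<close> in \<open>U\<close>; hence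
  \<open>T(-, X) \<rightarrow> T(-, \<tau>\<^sup>+ X)\<close> is a local isomorphism. The coreflection \<open>\<tau>\<^sup>-\<close> does not change the restriction
  to \<open>\<A>\<close>. Thus \<open>T(-, X) \<rightarrow> T(-, \<tau>\<^sup>- \<tau>\<^sup>+ X)\<close> is the reflection (sheafification) of \<open>T(-, X)\<close> into the
  left exact functors, which is part (2). The functor \<open>\<Psi>\<close> is full and faithful because every object of
  \<open>T\<^sup>-\<close> has a presentation by objects of \<open>\<A>\<close> up to \<open>U \<inter> V\<close>; it is dense because the cokernel of
  \<open>T(-, X) \<rightarrow> T(-, Y)\<close> embeds into \<open>T(-, C)\<close> for the cone \<open>C\<close>, this embedding is again a local isomorphism, and
  a local isomorphism between left exact functors is an isomorphism.
\<close>

section \<open>Morphisms in preadditive categories\<close>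

text \<open>Why a deflation can kill a map \<open>v : B -> U2\<close> from an object of
  \<open>A\<close> to an object of \<open>U\<close>: up to isomorphism \<open>U2\<close> is a
  translate \<open>Z[1]\<close> with \<open>Z\<close> in \<open>A\<close>, so \<open>v\<close> is
  the connecting morphism of a triangle \<open>Z -> D -> B -> Z[1]\<close>, and \<open>D\<close>
  lies in \<open>A\<close> because \<open>A\<close> is closed under extensions. Every obstruction
  with values in \<open>U\<close> therefore vanishes on a covering. The obstacle is that the two
  adjoints and \<open>Q\<close> are known through universal properties alone, and those of the
  adjoints hold only modulo maps through \<open>U \<inter> V\<close>. Two devices deal with this.
  Maps from \<open>A\<close> to \<open>V\<close> are zero, so congruent morphisms agree after
  composition with any map from \<open>A\<close>, and equations between residue classes become
  equations in \<open>T\<close>. And no sheafification is constructed: a map from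
  \<open>T(-, N)\<close>, for \<open>N\<close> in \<open>T^-\<close>, to a left exact
  \<open>F\<close> is given by the Yoneda lemma on a presentation \<open>D -> E -> N\<close> with
  \<open>D\<close> and \<open>E\<close> in \<open>A\<close>; the element of \<open>F(E)\<close> that
  this takes is found on a covering and descended by left exactness.\<close>

lemma full_subcat_simps [simp]:
  "Ob (full_subcat C S) = S" "Mor (full_subcat C S) = Mor C" "Src (full_subcat C S) = Src C"
  "Tgt (full_subcat C S) = Tgt C" "Comp (full_subcat C S) = Comp C" "Ide (full_subcat C S) = Ide C"
  by (simp_all add: full_subcat_def)

context preadditive_category
begin

text \<open>Tests a morphism against its own source and target. In this form the facts about
  composition become rewrite rules conditioned on \<open>Src\<close> and \<open>Tgt\<close>, and no
  object has to be guessed when they are applied.\<close>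

definition arr :: "'m \<Rightarrow> bool" where
  "arr f \<longleftrightarrow> Src C f \<in> Ob C \<and> Tgt C f \<in> Ob C \<and> f \<in> Hom C (Src C f) (Tgt C f)"

abbreviation in_hom :: "'m \<Rightarrow> 'o \<Rightarrow> 'o \<Rightarrow> bool"  (\<open>\<guillemotleft>_ : _ \<rightarrow> _\<guillemotright>\<close>)
  where "\<guillemotleft>f : X \<rightarrow> Y\<guillemotright> \<equiv> arr f \<and> Src C f = X \<and> Tgt C f = Y"

abbreviation par :: "'m \<Rightarrow> 'm \<Rightarrow> bool"
  where "par f g \<equiv> arr f \<and> arr g \<and> Src C g = Src C f \<and> Tgt C g = Tgt C f"

text \<open>The group is recovered from the endpoints of the first summand, so that sums, like
  composites, carry no object arguments.\<close>

definition add :: "'m \<Rightarrow> 'm \<Rightarrow> 'm"  (infixl \<open>\<boxplus>\<close> 65)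
  where "f \<boxplus> g = f \<otimes>\<^bsub>Mor C (Src C f) (Tgt C f)\<^esub> g"

definition neg :: "'m \<Rightarrow> 'm"
  where "neg f = inv\<^bsub>Mor C (Src C f) (Tgt C f)\<^esub> f"

definition dif :: "'m \<Rightarrow> 'm \<Rightarrow> 'm"  (infixl \<open>\<boxminus>\<close> 65)
  where "f \<boxminus> g = f \<boxplus> neg g"

abbreviation zero :: "'o \<Rightarrow> 'o \<Rightarrow> 'm" where "zero X Y \<equiv> Zero C X Y"

lemma in_hom_iff: "\<guillemotleft>f : X \<rightarrow> Y\<guillemotright> \<longleftrightarrow> X \<in> Ob C \<and> Y \<in> Ob C \<and> f \<in> Hom C X Y"
  using Src_Hom Tgt_Hom unfolding arr_def by metis

lemma in_homI: "\<lbrakk>X \<in> Ob C; Y \<in> Ob C; f \<in> Hom C X Y\<rbrakk> \<Longrightarrow> \<guillemotleft>f : X \<rightarrow> Y\<guillemotright>"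
  using in_hom_iff by blast

lemma in_homD: assumes "\<guillemotleft>f : X \<rightarrow> Y\<guillemotright>" shows "X \<in> Ob C" "Y \<in> Ob C" "f \<in> Hom C X Y"
  using assms in_hom_iff by blast+

lemma arr_Src [simp]: "arr f \<Longrightarrow> Src C f \<in> Ob C"
  and arr_Tgt [simp]: "arr f \<Longrightarrow> Tgt C f \<in> Ob C"
  and arr_Hom [simp]: "arr f \<Longrightarrow> f \<in> Hom C (Src C f) (Tgt C f)"
  by (simp_all add: arr_def)

lemma comp_in_hom:
  assumes "arr f" "arr g" "Src C g = Tgt C f"
  shows "\<guillemotleft>g \<bullet> f : Src C f \<rightarrow> Tgt C g\<guillemotright>"
  using assms Comp_closed in_hom_iff unfolding arr_def by metis

lemma arr_comp [simp]:
  assumes "arr f" "arr g" "Src C g = Tgt C f"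
  shows "arr (g \<bullet> f)" "Src C (g \<bullet> f) = Src C f" "Tgt C (g \<bullet> f) = Tgt C g"
  using comp_in_hom assms by blast+

lemma arr_Ide [simp]:
  assumes "X \<in> Ob C"
  shows "arr (Ide C X)" "Src C (Ide C X) = X" "Tgt C (Ide C X) = X"
  using Ide_closed assms in_hom_iff by blast+

lemma comp_Ide [simp]: "arr f \<Longrightarrow> Src C f = X \<Longrightarrow> f \<bullet> Ide C X = f"
  using Comp_Ide arr_def by metis

lemma Ide_comp [simp]: "arr f \<Longrightarrow> Tgt C f = X \<Longrightarrow> Ide C X \<bullet> f = f"
  using Ide_Comp arr_def by metis

lemma comp_assoc:
  assumes "arr f" "arr g" "arr h" "Src C g = Tgt C f" "Src C h = Tgt C g"
  shows "(h \<bullet> g) \<bullet> f = h \<bullet> (g \<bullet> f)"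
  using assms Comp_assoc unfolding arr_def by metis

lemma Hom_group: "\<lbrakk>X \<in> Ob C; Y \<in> Ob C\<rbrakk> \<Longrightarrow> group (Mor C X Y)"
  using hom_comm_group comm_group_def by blast

lemma arr_zero [simp]:
  assumes "X \<in> Ob C" "Y \<in> Ob C"
  shows "arr (zero X Y)" "Src C (zero X Y) = X" "Tgt C (zero X Y) = Y"
  using group.is_monoid[OF Hom_group[OF assms]] monoid.one_closed in_homI[OF assms] by blast+

lemma arr_add [simp]:
  assumes "par f g"
  shows "arr (f \<boxplus> g)" "Src C (f \<boxplus> g) = Src C f" "Tgt C (f \<boxplus> g) = Tgt C f"
proof -
  interpret comm_group "Mor C (Src C f) (Tgt C f)" using assms hom_comm_group by simp
  have "f \<boxplus> g \<in> Hom C (Src C f) (Tgt C f)"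
    using assms unfolding add_def by (metis m_closed arr_Hom)
  then show "arr (f \<boxplus> g)" "Src C (f \<boxplus> g) = Src C f" "Tgt C (f \<boxplus> g) = Tgt C f"
    using assms in_homI arr_Src arr_Tgt by blast+
qed

lemma arr_neg [simp]:
  assumes "arr f"
  shows "arr (neg f)" "Src C (neg f) = Src C f" "Tgt C (neg f) = Tgt C f"
proof -
  interpret comm_group "Mor C (Src C f) (Tgt C f)" using assms hom_comm_group by simp
  have "neg f \<in> Hom C (Src C f) (Tgt C f)"
    using assms unfolding neg_def by (metis inv_closed arr_Hom)
  then show "arr (neg f)" "Src C (neg f) = Src C f" "Tgt C (neg f) = Tgt C f"
    using assms in_homI arr_Src arr_Tgt by blast+
qed

lemma add_assoc: "\<lbrakk>par f g; par f h\<rbrakk> \<Longrightarrow> (f \<boxplus> g) \<boxplus> h = f \<boxplus> (g \<boxplus> h)"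
proof -
  assume *: "par f g" "par f h"
  interpret comm_group "Mor C (Src C f) (Tgt C f)" using * hom_comm_group by simp
  have "g \<in> Hom C (Src C f) (Tgt C f)" "h \<in> Hom C (Src C f) (Tgt C f)"
    using * arr_Hom by metis+
  moreover have "(f \<boxplus> g) \<boxplus> h = (f \<boxplus> g) \<otimes>\<^bsub>Mor C (Src C f) (Tgt C f)\<^esub> h"
    "f \<boxplus> (g \<boxplus> h) = f \<otimes>\<^bsub>Mor C (Src C f) (Tgt C f)\<^esub> (g \<boxplus> h)"
    using * arr_add[of f g] by (simp_all only: add_def[of "f \<boxplus> g"] add_def[of f "g \<boxplus> h"])
  moreover have "f \<boxplus> g = f \<otimes>\<^bsub>Mor C (Src C f) (Tgt C f)\<^esub> g" "g \<boxplus> h = g \<otimes>\<^bsub>Mor C (Src C f) (Tgt C f)\<^esub> h"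
    using * by (simp_all only: add_def)
  ultimately show ?thesis using * arr_Hom[of f] by (simp add: m_assoc)
qed

lemma add_comm: "par f g \<Longrightarrow> f \<boxplus> g = g \<boxplus> f"
proof -
  assume *: "par f g"
  interpret comm_group "Mor C (Src C f) (Tgt C f)" using * hom_comm_group by simp
  have "g \<in> Hom C (Src C f) (Tgt C f)"
    using * arr_Hom by metis
  then show ?thesis using * by (simp add: add_def m_comm)
qed

lemma add_zero [simp]: assumes "arr f" "Src C f = X" "Tgt C f = Y"
  shows "f \<boxplus> zero X Y = f" "zero X Y \<boxplus> f = f"
proof -
  interpret comm_group "Mor C X Y" using assms hom_comm_group arr_Src arr_Tgt by metis
  show "f \<boxplus> zero X Y = f" "zero X Y \<boxplus> f = f"
    using assms arr_Hom[of f] arr_zero[of X Y] arr_Src[of f] arr_Tgt[of f] by (simp_all add: add_def)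
qed

lemma add_neg [simp]: "\<lbrakk>arr f; Src C f = X; Tgt C f = Y\<rbrakk> \<Longrightarrow> f \<boxplus> neg f = zero X Y"
proof -
  assume *: "arr f" "Src C f = X" "Tgt C f = Y"
  interpret comm_group "Mor C X Y" using * hom_comm_group arr_Src arr_Tgt by metis
  show ?thesis using * arr_Hom[of f] by (simp add: add_def neg_def)
qed

lemma add_left_cancel: "\<lbrakk>par f g; par f h\<rbrakk> \<Longrightarrow> f \<boxplus> g = f \<boxplus> h \<longleftrightarrow> g = h"
proof -
  assume *: "par f g" "par f h"
  interpret comm_group "Mor C (Src C f) (Tgt C f)" using * hom_comm_group by simp
  have "g \<in> Hom C (Src C f) (Tgt C f)" "h \<in> Hom C (Src C f) (Tgt C f)"
    using * arr_Hom by metis+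
  then show ?thesis using * arr_Hom[of f] unfolding add_def by simp
qed

lemma comp_add_left:
  assumes "par g g'" "arr f" "Src C g = Tgt C f"
  shows "(g \<boxplus> g') \<bullet> f = g \<bullet> f \<boxplus> g' \<bullet> f"
  using assms Comp_add_left[of "Src C f" "Tgt C f" "Tgt C g" f g g'] arr_Hom[of f] arr_Hom[of g] arr_Hom[of g']
  by (simp add: add_def)

lemma comp_add_right:
  assumes "par f f'" "arr g" "Src C g = Tgt C f"
  shows "g \<bullet> (f \<boxplus> f') = g \<bullet> f \<boxplus> g \<bullet> f'"
  using assms Comp_add_right[of "Src C f" "Tgt C f" "Tgt C g" f f' g] arr_Hom[of f] arr_Hom[of g] arr_Hom[of f']
  by (simp add: add_def)

lemma comp_zero [simp]:
  assumes "arr g" "Src C g = Y" "X \<in> Ob C"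
  shows "g \<bullet> zero X Y = zero X (Tgt C g)"
proof -
  have Y: "Y \<in> Ob C" using assms by auto
  have "g \<bullet> zero X Y \<boxplus> g \<bullet> zero X Y = g \<bullet> (zero X Y \<boxplus> zero X Y)"
    using assms Y by (subst comp_add_right) auto
  also have "\<dots> = g \<bullet> zero X Y \<boxplus> zero X (Tgt C g)" using assms Y by simp
  finally show ?thesis using add_left_cancel[of "g \<bullet> zero X Y" "g \<bullet> zero X Y" "zero X (Tgt C g)"] assms Y
    by simp
qed

lemma zero_comp [simp]:
  assumes "arr f" "Tgt C f = Y" "Z \<in> Ob C"
  shows "zero Y Z \<bullet> f = zero (Src C f) Z"
proof -
  have Y: "Y \<in> Ob C" using assms by auto
  have "zero Y Z \<bullet> f \<boxplus> zero Y Z \<bullet> f = (zero Y Z \<boxplus> zero Y Z) \<bullet> f"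
    using assms Y by (subst comp_add_left) auto
  also have "\<dots> = zero Y Z \<bullet> f \<boxplus> zero (Src C f) Z" using assms Y by simp
  finally show ?thesis using add_left_cancel[of "zero Y Z \<bullet> f" "zero Y Z \<bullet> f" "zero (Src C f) Z"] assms Y
    by simp
qed

lemma add_idem: "\<lbrakk>\<guillemotleft>f : X \<rightarrow> Y\<guillemotright>; f \<boxplus> f = f\<rbrakk> \<Longrightarrow> f = zero X Y"
  using add_left_cancel[of f f "zero X Y"] by auto

lemma neg_unique: "\<lbrakk>par f g; f \<boxplus> g = zero (Src C f) (Tgt C f)\<rbrakk> \<Longrightarrow> neg f = g"
  using add_left_cancel[of f "neg f" g] by simp

lemma neg_neg [simp]: "arr f \<Longrightarrow> neg (neg f) = f"
  by (rule neg_unique) (simp_all add: add_comm[of "neg f" f])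

lemma comp_neg [simp]: "\<lbrakk>arr f; arr g; Src C g = Tgt C f\<rbrakk> \<Longrightarrow> g \<bullet> neg f = neg (g \<bullet> f)"
  using comp_add_right[of f "neg f" g] by (intro neg_unique[symmetric]) auto

lemma neg_comp [simp]: "\<lbrakk>arr f; arr g; Src C g = Tgt C f\<rbrakk> \<Longrightarrow> neg g \<bullet> f = neg (g \<bullet> f)"
  using comp_add_left[of g "neg g" f] by (intro neg_unique[symmetric]) auto

lemma neg_zero [simp]: "\<lbrakk>X \<in> Ob C; Y \<in> Ob C\<rbrakk> \<Longrightarrow> neg (zero X Y) = zero X Y"
  by (intro neg_unique) auto

lemma arr_dif [simp]:
  assumes "par f g"
  shows "arr (f \<boxminus> g)" "Src C (f \<boxminus> g) = Src C f" "Tgt C (f \<boxminus> g) = Tgt C f"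
  using assms by (auto simp: dif_def)

lemma dif_eq_zero:
  assumes "par f g" "f \<boxminus> g = zero (Src C f) (Tgt C f)" shows "f = g"
proof -
  have "neg f = neg g" using assms by (intro neg_unique) (auto simp: dif_def)
  then show ?thesis using assms neg_neg by metis
qed

lemma dif_self [simp]: "\<lbrakk>arr f; Src C f = X; Tgt C f = Y\<rbrakk> \<Longrightarrow> f \<boxminus> f = zero X Y"
  by (simp add: dif_def)

lemma dif_add_cancel: "par f g \<Longrightarrow> (f \<boxminus> g) \<boxplus> g = f"
  by (simp add: dif_def add_assoc add_comm[of "neg g" g])

lemma comp_dif_left:
  "\<lbrakk>par g g'; arr f; Src C g = Tgt C f\<rbrakk> \<Longrightarrow> (g \<boxminus> g') \<bullet> f = g \<bullet> f \<boxminus> g' \<bullet> f"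
  by (simp add: dif_def comp_add_left)

lemma comp_dif_right:
  "\<lbrakk>par f f'; arr g; Src C g = Tgt C f\<rbrakk> \<Longrightarrow> g \<bullet> (f \<boxminus> f') = g \<bullet> f \<boxminus> g \<bullet> f'"
  by (simp add: dif_def comp_add_right)

lemma iso_inE:
  assumes "iso_in C X Y f" "X \<in> Ob C" "Y \<in> Ob C"
  obtains g where "\<guillemotleft>f : X \<rightarrow> Y\<guillemotright>" "\<guillemotleft>g : Y \<rightarrow> X\<guillemotright>" "g \<bullet> f = Ide C X" "f \<bullet> g = Ide C Y"
  using assms in_homI unfolding iso_in_def by metis

lemma iso_inI:
  assumes "\<guillemotleft>f : X \<rightarrow> Y\<guillemotright>" "\<guillemotleft>g : Y \<rightarrow> X\<guillemotright>" "g \<bullet> f = Ide C X" "f \<bullet> g = Ide C Y"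
  shows "iso_in C X Y f"
  using assms in_homD(3) unfolding iso_in_def by blast

lemma iso_in_Ide: "X \<in> Ob C \<Longrightarrow> iso_in C X X (Ide C X)"
  by (rule iso_inI[where g = "Ide C X"]) auto

lemma iso_in_comp:
  assumes "iso_in C X Y f" "iso_in C Y Z g" "X \<in> Ob C" "Y \<in> Ob C" "Z \<in> Ob C"
  shows "iso_in C X Z (g \<bullet> f)"
proof -
  obtain f' where f: "\<guillemotleft>f : X \<rightarrow> Y\<guillemotright>" "\<guillemotleft>f' : Y \<rightarrow> X\<guillemotright>" "f' \<bullet> f = Ide C X" "f \<bullet> f' = Ide C Y"
    using iso_inE[OF assms(1,3,4)] .
  obtain g' where g: "\<guillemotleft>g : Y \<rightarrow> Z\<guillemotright>" "\<guillemotleft>g' : Z \<rightarrow> Y\<guillemotright>" "g' \<bullet> g = Ide C Y" "g \<bullet> g' = Ide C Z"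
    using iso_inE[OF assms(2,4,5)] .
  have "(f' \<bullet> g') \<bullet> (g \<bullet> f) = f' \<bullet> ((g' \<bullet> g) \<bullet> f)" using f(1,2) g(1,2) by (simp add: comp_assoc)
  moreover have "(g \<bullet> f) \<bullet> (f' \<bullet> g') = g \<bullet> ((f \<bullet> f') \<bullet> g')" using f(1,2) g(1,2) by (simp add: comp_assoc)
  ultimately show ?thesis using f g by (intro iso_inI[where g = "f' \<bullet> g'"]) simp_all
qed

lemma isomorphic_sym: "\<lbrakk>isomorphic C X Y; X \<in> Ob C; Y \<in> Ob C\<rbrakk> \<Longrightarrow> isomorphic C Y X"
  unfolding isomorphic_def iso_in_def by blast

lemma isomorphic_refl: "X \<in> Ob C \<Longrightarrow> isomorphic C X X"
  unfolding isomorphic_def using iso_in_Ide by blast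

lemma preadditive_full_subcat:
  assumes "S \<subseteq> Ob C" shows "preadditive_category (full_subcat C S)"
proof (rule preadditive_category.intro; unfold full_subcat_simps)
  note ob = subsetD[OF assms]
  show "comm_group (Mor C X Y)" if "X \<in> S" "Y \<in> S" for X Y
    using that by (intro hom_comm_group ob)
  show "Src C f = X" "Tgt C f = Y" if "X \<in> S" "Y \<in> S" "f \<in> Hom C X Y" for X Y f
    using that Src_Hom Tgt_Hom ob by blast+
  show "Ide C X \<in> Hom C X X" if "X \<in> S" for X
    using that by (intro Ide_closed ob)
  show "g \<bullet> f \<in> Hom C X Z" if "X \<in> S" "Y \<in> S" "Z \<in> S" "f \<in> Hom C X Y" "g \<in> Hom C Y Z" for X Y Z f g
    using that by (intro Comp_closed[of X Y Z] ob)
  show "f \<bullet> Ide C X = f" "Ide C Y \<bullet> f = f" if "X \<in> S" "Y \<in> S" "f \<in> Hom C X Y" for X Y f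
    using that Comp_Ide Ide_Comp ob by blast+
  show "(h \<bullet> g) \<bullet> f = h \<bullet> (g \<bullet> f)"
    if "X \<in> S" "Y \<in> S" "Z \<in> S" "W \<in> S" "f \<in> Hom C X Y" "g \<in> Hom C Y Z" "h \<in> Hom C Z W" for X Y Z W f g h
    using that by (intro Comp_assoc[of X Y Z W] ob)
  show "(g \<otimes>\<^bsub>Mor C Y Z\<^esub> g') \<bullet> f = (g \<bullet> f) \<otimes>\<^bsub>Mor C X Z\<^esub> (g' \<bullet> f)"
    if "X \<in> S" "Y \<in> S" "Z \<in> S" "f \<in> Hom C X Y" "g \<in> Hom C Y Z" "g' \<in> Hom C Y Z" for X Y Z f g g'
    using that by (intro Comp_add_left[of X Y Z] ob)
  show "g \<bullet> (f \<otimes>\<^bsub>Mor C X Y\<^esub> f') = (g \<bullet> f) \<otimes>\<^bsub>Mor C X Z\<^esub> (g \<bullet> f')"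
    if "X \<in> S" "Y \<in> S" "Z \<in> S" "f \<in> Hom C X Y" "f' \<in> Hom C X Y" "g \<in> Hom C Y Z" for X Y Z f f' g
    using that by (intro Comp_add_right[of X Y Z] ob)
qed

end

section \<open>Additive functors and equivalences\<close>

lemma additive_functor_ob: "\<lbrakk>additive_functor C D F; X \<in> Ob C\<rbrakk> \<Longrightarrow> fobj F X \<in> Ob D"
  by (simp add: additive_functor_def)

lemma additive_functor_Hom:
  "\<lbrakk>additive_functor C D F; X \<in> Ob C; Y \<in> Ob C; f \<in> Hom C X Y\<rbrakk> \<Longrightarrow> farr F f \<in> Hom D (fobj F X) (fobj F Y)"
  unfolding additive_functor_def hom_def by blast

lemma additive_functor_mult:
  "\<lbrakk>additive_functor C D F; X \<in> Ob C; Y \<in> Ob C; f \<in> Hom C X Y; g \<in> Hom C X Y\<rbrakk>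
   \<Longrightarrow> farr F (f \<otimes>\<^bsub>Mor C X Y\<^esub> g) = farr F f \<otimes>\<^bsub>Mor D (fobj F X) (fobj F Y)\<^esub> farr F g"
  unfolding additive_functor_def hom_def by blast

lemma additive_functor_Ide:
  "\<lbrakk>additive_functor C D F; X \<in> Ob C\<rbrakk> \<Longrightarrow> farr F (Ide C X) = Ide D (fobj F X)"
  by (simp add: additive_functor_def)

lemma additive_functor_Comp:
  "\<lbrakk>additive_functor C D F; X \<in> Ob C; Y \<in> Ob C; Z \<in> Ob C; f \<in> Hom C X Y; g \<in> Hom C Y Z\<rbrakk>
   \<Longrightarrow> farr F (g \<bullet>\<^bsub>C\<^esub> f) = farr F g \<bullet>\<^bsub>D\<^esub> farr F f"
  unfolding additive_functor_def by blast

lemma additive_functorI: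
  assumes "\<And>X. X \<in> Ob C \<Longrightarrow> fobj F X \<in> Ob D"
    and "\<And>X Y f. \<lbrakk>X \<in> Ob C; Y \<in> Ob C; f \<in> Hom C X Y\<rbrakk> \<Longrightarrow> farr F f \<in> Hom D (fobj F X) (fobj F Y)"
    and "\<And>X Y f g. \<lbrakk>X \<in> Ob C; Y \<in> Ob C; f \<in> Hom C X Y; g \<in> Hom C X Y\<rbrakk>
      \<Longrightarrow> farr F (f \<otimes>\<^bsub>Mor C X Y\<^esub> g) = farr F f \<otimes>\<^bsub>Mor D (fobj F X) (fobj F Y)\<^esub> farr F g"
    and "\<And>X. X \<in> Ob C \<Longrightarrow> farr F (Ide C X) = Ide D (fobj F X)"
    and "\<And>X Y Z f g. \<lbrakk>X \<in> Ob C; Y \<in> Ob C; Z \<in> Ob C; f \<in> Hom C X Y; g \<in> Hom C Y Z\<rbrakk>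
      \<Longrightarrow> farr F (g \<bullet>\<^bsub>C\<^esub> f) = farr F g \<bullet>\<^bsub>D\<^esub> farr F f"
  shows "additive_functor C D F"
  using assms unfolding additive_functor_def hom_def by blast

lemma comp_functor_simps [simp]:
  "fobj (G \<circ>\<^sub>F F) X = fobj G (fobj F X)" "farr (G \<circ>\<^sub>F F) f = farr G (farr F f)"
  by (simp_all add: comp_functor_def)

lemma id_functor_simps [simp]: "fobj id_functor X = X" "farr id_functor f = f"
  by (simp_all add: id_functor_def)

lemma additive_functor_comp:
  assumes F: "additive_functor C D F" and G: "additive_functor D E G"
  shows "additive_functor C E (G \<circ>\<^sub>F F)"
proof (rule additive_functorI)
  fix X Y Z f g assume *: "X \<in> Ob C" "Y \<in> Ob C" "Z \<in> Ob C" "f \<in> Hom C X Y" "g \<in> Hom C Y Z"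
  show "farr (G \<circ>\<^sub>F F) (g \<bullet>\<^bsub>C\<^esub> f) = farr (G \<circ>\<^sub>F F) g \<bullet>\<^bsub>E\<^esub> farr (G \<circ>\<^sub>F F) f"
    using additive_functor_Comp[OF F *] * additive_functor_Hom[OF F] additive_functor_ob[OF F]
    by (simp add: additive_functor_Comp[OF G, of "fobj F X" "fobj F Y" "fobj F Z"])
qed (auto simp: additive_functor_ob[OF F] additive_functor_ob[OF G] additive_functor_Ide[OF F]
      additive_functor_Ide[OF G] additive_functor_Hom[OF F] additive_functor_Hom[OF G]
      additive_functor_mult[OF F] additive_functor_mult[OF G])

lemma additive_functor_full_subcat:
  assumes "additive_functor C D F" "\<And>X. X \<in> Ob C \<Longrightarrow> fobj F X \<in> S"
  shows "additive_functor C (full_subcat D S) F"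
  using assms by (simp add: additive_functor_def)

lemma additive_functor_restrict:
  assumes F: "additive_functor C D F" and S: "S \<subseteq> Ob C"
  shows "additive_functor (full_subcat C S) D F"
proof (rule additive_functorI; unfold full_subcat_simps)
  fix X Y Z f g assume "X \<in> S" "Y \<in> S" "Z \<in> S" "f \<in> Hom C X Y" "g \<in> Hom C Y Z"
  then show "farr F (g \<bullet>\<^bsub>C\<^esub> f) = farr F g \<bullet>\<^bsub>D\<^esub> farr F f"
    using additive_functor_Comp[OF F] S by blast
qed (use S in \<open>auto simp: subset_iff additive_functor_ob[OF F] additive_functor_Ide[OF F] additive_functor_Hom[OF F]
      additive_functor_mult[OF F]\<close>)

locale additive_functor_between = C: preadditive_category C + D: preadditive_category D
  for C :: "('o, 'm, 'y) precat_scheme" (structure) and D :: "('p, 'n, 'z) precat_scheme" (structure) +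
  fixes F :: "('o, 'm, 'p, 'n) cfunctor"
  assumes additive: "additive_functor C D F"
begin

lemma ob [simp]: "X \<in> Ob C \<Longrightarrow> fobj F X \<in> Ob D"
  by (rule additive_functor_ob[OF additive])

lemma arr_in_hom: "C.arr f \<Longrightarrow> D.in_hom (farr F f) (fobj F (Src C f)) (fobj F (Tgt C f))"
  by (rule D.in_homI) (auto intro: additive_functor_Hom[OF additive])

lemma arr [simp]:
  assumes "C.arr f"
  shows "D.arr (farr F f)" "Src D (farr F f) = fobj F (Src C f)" "Tgt D (farr F f) = fobj F (Tgt C f)"
  using arr_in_hom[OF assms] by auto

lemma Ide [simp]: "X \<in> Ob C \<Longrightarrow> farr F (Ide C X) = Ide D (fobj F X)"
  by (rule additive_functor_Ide[OF additive])

lemma comp: "\<lbrakk>C.arr f; C.arr g; Src C g = Tgt C f\<rbrakk> \<Longrightarrow> farr F (g \<bullet>\<^bsub>C\<^esub> f) = farr F g \<bullet>\<^bsub>D\<^esub> farr F f"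
  using additive_functor_Comp[OF additive, of "Src C f" "Tgt C f" "Tgt C g" f g] C.arr_Hom[of g] by simp

lemma add: "C.par f g \<Longrightarrow> farr F (C.add f g) = D.add (farr F f) (farr F g)"
  using additive_functor_mult[OF additive, of "Src C f" "Tgt C f" f g]  C.arr_Hom[of g]
  by (simp add: C.add_def D.add_def)

lemma zero [simp]:
  assumes "X \<in> Ob C" "Y \<in> Ob C" shows "farr F (C.zero X Y) = D.zero (fobj F X) (fobj F Y)"
proof -
  have "D.add (farr F (C.zero X Y)) (farr F (C.zero X Y)) = farr F (C.zero X Y)"
    using assms add[of "C.zero X Y" "C.zero X Y"] by simp
  then show ?thesis using assms by (intro D.add_idem) simp_all
qed

lemma neg: "C.arr f \<Longrightarrow> farr F (C.neg f) = D.neg (farr F f)"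
  using add[of f "C.neg f"] by (intro D.neg_unique[symmetric]) simp_all

lemma iso: assumes "iso_in C X Y f" "X \<in> Ob C" "Y \<in> Ob C" shows "iso_in D (fobj F X) (fobj F Y) (farr F f)"
proof -
  obtain g where g: "C.in_hom f X Y" "C.in_hom g Y X" "g \<bullet>\<^bsub>C\<^esub> f = Ide C X" "f \<bullet>\<^bsub>C\<^esub> g = Ide C Y"
    using C.iso_inE[OF assms] .
  show ?thesis
  proof (rule D.iso_inI)
    show "farr F g \<bullet>\<^bsub>D\<^esub> farr F f = Ide D (fobj F X)" using g assms comp[of f g] by simp
    show "farr F f \<bullet>\<^bsub>D\<^esub> farr F g = Ide D (fobj F Y)" using g assms comp[of g f] by simp
  qed (use g in simp_all)
qed

section \<open>Equivalences as full, faithful and dense functors\<close>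

definition faithful where
  "faithful \<longleftrightarrow> (\<forall>f g. C.par f g \<longrightarrow> farr F f = farr F g \<longrightarrow> f = g)"

definition full where
  "full \<longleftrightarrow> (\<forall>X \<in> Ob C. \<forall>Y \<in> Ob C. \<forall>h. D.in_hom h (fobj F X) (fobj F Y) \<longrightarrow>
     (\<exists>f. C.in_hom f X Y \<and> farr F f = h))"

end

context preadditive_category
begin

lemma iso_mono:
  assumes "iso_in C X Y f" "\<guillemotleft>a : Z \<rightarrow> X\<guillemotright>" "\<guillemotleft>b : Z \<rightarrow> X\<guillemotright>" "Y \<in> Ob C" "f \<bullet> a = f \<bullet> b"
  shows "a = b"
proof -
  have X: "X \<in> Ob C" using assms(2) arr_Tgt by metis
  obtain g where g: "\<guillemotleft>f : X \<rightarrow> Y\<guillemotright>" "\<guillemotleft>g : Y \<rightarrow> X\<guillemotright>" "g \<bullet> f = Ide C X" "f \<bullet> g = Ide C Y"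
    using iso_inE[OF assms(1) X assms(4)] .
  have "(g \<bullet> f) \<bullet> a = (g \<bullet> f) \<bullet> b" using g(1,2) assms by (simp add: comp_assoc)
  then show ?thesis using g assms by simp
qed

lemma iso_epi:
  assumes "iso_in C X Y f" "\<guillemotleft>a : Y \<rightarrow> Z\<guillemotright>" "\<guillemotleft>b : Y \<rightarrow> Z\<guillemotright>" "X \<in> Ob C" "a \<bullet> f = b \<bullet> f"
  shows "a = b"
proof -
  have Y: "Y \<in> Ob C" using assms(2) arr_Src by metis
  obtain g where g: "\<guillemotleft>f : X \<rightarrow> Y\<guillemotright>" "\<guillemotleft>g : Y \<rightarrow> X\<guillemotright>" "g \<bullet> f = Ide C X" "f \<bullet> g = Ide C Y"
    using iso_inE[OF assms(1) assms(4) Y] .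
  have "a \<bullet> (f \<bullet> g) = b \<bullet> (f \<bullet> g)" using g(1,2) assms by (simp add: comp_assoc[symmetric])
  then show ?thesis using g assms by simp
qed

end

lemma nat_transI:
  assumes "additive_functor C D F" "additive_functor C D G"
    and "\<And>X. X \<in> Ob C \<Longrightarrow> \<eta> X \<in> Hom D (fobj F X) (fobj G X)"
    and "\<And>X Y f. \<lbrakk>X \<in> Ob C; Y \<in> Ob C; f \<in> Hom C X Y\<rbrakk> \<Longrightarrow> \<eta> Y \<bullet>\<^bsub>D\<^esub> farr F f = farr G f \<bullet>\<^bsub>D\<^esub> \<eta> X"
  shows "nat_trans C D F G \<eta>"
  using assms unfolding nat_trans_def by blast

lemma nat_trans_component:
  "\<lbrakk>nat_trans C D F G \<eta>; X \<in> Ob C\<rbrakk> \<Longrightarrow> \<eta> X \<in> Hom D (fobj F X) (fobj G X)"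
  unfolding nat_trans_def by blast

lemma nat_trans_natural:
  "\<lbrakk>nat_trans C D F G \<eta>; X \<in> Ob C; Y \<in> Ob C; f \<in> Hom C X Y\<rbrakk>
   \<Longrightarrow> \<eta> Y \<bullet>\<^bsub>D\<^esub> farr F f = farr G f \<bullet>\<^bsub>D\<^esub> \<eta> X"
  unfolding nat_trans_def by blast

context additive_functor_between
begin

text \<open>The unit makes \<open>F\<close> faithful, since it recovers \<open>f\<close> from
  \<open>G (F f)\<close>; the counit does the same for \<open>G\<close>. Fullness follows by
  conjugating \<open>G h\<close> with the unit and then cancelling \<open>G\<close>.\<close>

lemma
  assumes "category_equivalence C D F"
  shows equivalence_faithful: faithful and equivalence_full: full
    and equivalence_ess_surj: "\<And>Y. Y \<in> Ob D \<Longrightarrow> \<exists>X \<in> Ob C. isomorphic D (fobj F X) Y"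
proof -
  obtain G where "quasi_inverse C D F G" using assms unfolding category_equivalence_def by blast
  then obtain \<eta> \<epsilon> where G: "additive_functor D C G"
    and \<eta>: "nat_trans C C id_functor (G \<circ>\<^sub>F F) \<eta>" "\<And>X. X \<in> Ob C \<Longrightarrow> iso_in C X (fobj G (fobj F X)) (\<eta> X)"
    and \<epsilon>: "nat_trans D D (F \<circ>\<^sub>F G) id_functor \<epsilon>" "\<And>Y. Y \<in> Ob D \<Longrightarrow> iso_in D (fobj F (fobj G Y)) Y (\<epsilon> Y)"
    unfolding quasi_inverse_def nat_isomorphic_def by auto
  interpret G: additive_functor_between D C G by unfold_locales (rule G)
  have \<eta>_in: "C.in_hom (\<eta> X) X (fobj G (fobj F X))" if "X \<in> Ob C" for X
    using nat_trans_component[OF \<eta>(1) that] that by (intro C.in_homI) simp_all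
  have \<epsilon>_in: "D.in_hom (\<epsilon> Y) (fobj F (fobj G Y)) Y" if "Y \<in> Ob D" for Y
    using nat_trans_component[OF \<epsilon>(1) that] that by (intro D.in_homI) simp_all
  have \<eta>_nat: "\<eta> (Tgt C f) \<bullet>\<^bsub>C\<^esub> f = farr G (farr F f) \<bullet>\<^bsub>C\<^esub> \<eta> (Src C f)" if "C.arr f" for f
    using nat_trans_natural[OF \<eta>(1), of "Src C f" "Tgt C f" f] that by simp
  have \<epsilon>_nat: "\<epsilon> (Tgt D f) \<bullet>\<^bsub>D\<^esub> farr F (farr G f) = f \<bullet>\<^bsub>D\<^esub> \<epsilon> (Src D f)" if "D.arr f" for f
    using nat_trans_natural[OF \<epsilon>(1), of "Src D f" "Tgt D f" f] that by simp
  show faithful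
    unfolding faithful_def
  proof (intro allI impI)
    fix f g assume fg: "C.par f g" and eq: "farr F f = farr F g"
    have "\<eta> (Tgt C f) \<bullet>\<^bsub>C\<^esub> f = \<eta> (Tgt C f) \<bullet>\<^bsub>C\<^esub> g" using \<eta>_nat[of f] \<eta>_nat[of g] fg eq by simp
    then show "f = g" using C.iso_mono[OF \<eta>(2), of "Tgt C f" f "Src C f" g] fg by simp
  qed
  have G_faithful: "f = g" if fg: "D.par f g" and eq: "farr G f = farr G g" for f g
  proof -
    have "f \<bullet>\<^bsub>D\<^esub> \<epsilon> (Src D f) = g \<bullet>\<^bsub>D\<^esub> \<epsilon> (Src D f)" using \<epsilon>_nat[of f] \<epsilon>_nat[of g] fg eq by simp
    then show "f = g" using D.iso_epi[OF \<epsilon>(2), of "Src D f" f "Tgt D f" g] fg by simp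
  qed
  show full
    unfolding full_def
  proof (intro ballI allI impI)
    fix X Y h assume X: "X \<in> Ob C" and Y: "Y \<in> Ob C" and h: "D.in_hom h (fobj F X) (fobj F Y)"
    obtain j where j: "C.in_hom j (fobj G (fobj F Y)) Y" "j \<bullet>\<^bsub>C\<^esub> \<eta> Y = Ide C Y"
      "\<eta> Y \<bullet>\<^bsub>C\<^esub> j = Ide C (fobj G (fobj F Y))"
      using C.iso_inE[OF \<eta>(2)[OF Y] Y] Y by auto
    define f where "f = j \<bullet>\<^bsub>C\<^esub> (farr G h \<bullet>\<^bsub>C\<^esub> \<eta> X)"
    note \<eta>_in[OF X] \<eta>_in[OF Y]
    then have f: "C.in_hom f X Y" unfolding f_def using h j(1) by simp
    have "farr G (farr F f) \<bullet>\<^bsub>C\<^esub> \<eta> X = (\<eta> Y \<bullet>\<^bsub>C\<^esub> j) \<bullet>\<^bsub>C\<^esub> (farr G h \<bullet>\<^bsub>C\<^esub> \<eta> X)"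
      using \<eta>_nat[of f] f h j(1) \<eta>_in[OF X] \<eta>_in[OF Y] unfolding f_def by (simp add: C.comp_assoc)
    also have "\<dots> = farr G h \<bullet>\<^bsub>C\<^esub> \<eta> X"
      using j(3) h \<eta>_in[OF X] by simp
    finally have "farr G (farr F f) = farr G h"
      using C.iso_epi[OF \<eta>(2)[OF X], of "farr G (farr F f)" "fobj G (fobj F Y)" "farr G h"] f h X by simp
    then have "farr F f = h" using G_faithful[of "farr F f" h] f h by simp
    then show "\<exists>f. C.in_hom f X Y \<and> farr F f = h" using f by blast
  qed
  show "\<exists>X \<in> Ob C. isomorphic D (fobj F X) Y" if "Y \<in> Ob D" for Y
    using \<epsilon>(2)[OF that] G.ob[OF that] unfolding isomorphic_def by blast
qed

text \<open>A quasi-inverse is assembled from chosen isomorphisms \<open>i Y : F (g Y) -> Y\<close>.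
  On arrows it is the unique morphism that makes \<open>i\<close> natural, so each functor law
  reduces to checking one square.\<close>

lemma equivalenceI:
  assumes faithful: faithful and full: full
    and ess_surj: "\<And>Y. Y \<in> Ob D \<Longrightarrow> \<exists>X \<in> Ob C. isomorphic D (fobj F X) Y"
  shows "category_equivalence C D F"
proof -
  have "\<exists>g i j. \<forall>Y \<in> Ob D. g Y \<in> Ob C \<and> D.in_hom (i Y) (fobj F (g Y)) Y \<and> D.in_hom (j Y) Y (fobj F (g Y)) \<and>
      j Y \<bullet>\<^bsub>D\<^esub> i Y = Ide D (fobj F (g Y)) \<and> i Y \<bullet>\<^bsub>D\<^esub> j Y = Ide D Y"
  proof -
    have "\<exists>X i j. X \<in> Ob C \<and> D.in_hom i (fobj F X) Y \<and> D.in_hom j Y (fobj F X) \<and>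
      j \<bullet>\<^bsub>D\<^esub> i = Ide D (fobj F X) \<and> i \<bullet>\<^bsub>D\<^esub> j = Ide D Y" if Y: "Y \<in> Ob D" for Y
    proof -
      obtain X i where X: "X \<in> Ob C" and i: "iso_in D (fobj F X) Y i"
        using ess_surj[OF Y] unfolding isomorphic_def by blast
      show ?thesis using D.iso_inE[OF i ob[OF X] Y] X by metis
    qed
    then show ?thesis by metis
  qed
  then obtain g i j where g [simp]: "\<And>Y. Y \<in> Ob D \<Longrightarrow> g Y \<in> Ob C"
    and i: "\<And>Y. Y \<in> Ob D \<Longrightarrow> D.in_hom (i Y) (fobj F (g Y)) Y"
    and j: "\<And>Y. Y \<in> Ob D \<Longrightarrow> D.in_hom (j Y) Y (fobj F (g Y))"
    and ji: "\<And>Y. Y \<in> Ob D \<Longrightarrow> j Y \<bullet>\<^bsub>D\<^esub> i Y = Ide D (fobj F (g Y))"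
    and ij: "\<And>Y. Y \<in> Ob D \<Longrightarrow> i Y \<bullet>\<^bsub>D\<^esub> j Y = Ide D Y"
    by metis
  have i_iso: "iso_in D (fobj F (g Y)) Y (i Y)" and j_iso: "iso_in D Y (fobj F (g Y)) (j Y)" if "Y \<in> Ob D" for Y
    using D.iso_inI[OF i j ji ij] D.iso_inI[OF j i ij ji] that by blast+
  have unique: "f = f'" if "C.par f f'" "farr F f = farr F f'" for f f'
    using faithful that unfolding faithful_def by blast
  define G where "G = \<lparr>fobj = g,
    farr = (\<lambda>h. SOME f. C.in_hom f (g (Src D h)) (g (Tgt D h)) \<and> i (Tgt D h) \<bullet>\<^bsub>D\<^esub> farr F f = h \<bullet>\<^bsub>D\<^esub> i (Src D h))\<rparr>"
  have [simp]: "fobj G = g" by (simp add: G_def)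
  have G1: "C.in_hom (farr G h) (g (Src D h)) (g (Tgt D h)) \<and>
      i (Tgt D h) \<bullet>\<^bsub>D\<^esub> farr F (farr G h) = h \<bullet>\<^bsub>D\<^esub> i (Src D h)" if h: "D.arr h" for h
  proof -
    let ?k = "j (Tgt D h) \<bullet>\<^bsub>D\<^esub> (h \<bullet>\<^bsub>D\<^esub> i (Src D h))"
    note ii = i[OF D.arr_Src[OF h]] i[OF D.arr_Tgt[OF h]] j[OF D.arr_Tgt[OF h]]
    then have "D.in_hom ?k (fobj F (g (Src D h))) (fobj F (g (Tgt D h)))" using h by simp
    then obtain f where f: "C.in_hom f (g (Src D h)) (g (Tgt D h))" "farr F f = ?k"
      using full h unfolding full_def by (meson D.arr_Src D.arr_Tgt g)
    have "i (Tgt D h) \<bullet>\<^bsub>D\<^esub> ?k = (i (Tgt D h) \<bullet>\<^bsub>D\<^esub> j (Tgt D h)) \<bullet>\<^bsub>D\<^esub> (h \<bullet>\<^bsub>D\<^esub> i (Src D h))"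
      using ii h by (simp add: D.comp_assoc)
    also have "\<dots> = h \<bullet>\<^bsub>D\<^esub> i (Src D h)" using ii h ij by simp
    finally have "i (Tgt D h) \<bullet>\<^bsub>D\<^esub> farr F f = h \<bullet>\<^bsub>D\<^esub> i (Src D h)" using f by simp
    with f(1) have "\<exists>f. C.in_hom f (g (Src D h)) (g (Tgt D h)) \<and> i (Tgt D h) \<bullet>\<^bsub>D\<^esub> farr F f = h \<bullet>\<^bsub>D\<^esub> i (Src D h)"
      by blast
    from someI_ex[OF this] show ?thesis by (simp add: G_def)
  qed
  have G_arr [simp]: "C.arr (farr G h)" "Src C (farr G h) = g (Src D h)" "Tgt C (farr G h) = g (Tgt D h)"
    if "D.arr h" for h using G1[OF that] by blast+
  have G_eq: "i (Tgt D h) \<bullet>\<^bsub>D\<^esub> farr F (farr G h) = h \<bullet>\<^bsub>D\<^esub> i (Src D h)" if "D.arr h" for h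
    using G1[OF that] by blast
  have GI: "farr G h = f" if "D.in_hom h Y Y'" "C.in_hom f (g Y) (g Y')" "i Y' \<bullet>\<^bsub>D\<^esub> farr F f = h \<bullet>\<^bsub>D\<^esub> i Y" for f h Y Y'
  proof -
    have obs: "Y \<in> Ob D" "Y' \<in> Ob D" using that D.in_homD by blast+
    have "farr F (farr G h) = farr F f"
      using that G_eq[of h] obs
      by (intro D.iso_mono[OF i_iso[of Y'], of "farr F (farr G h)" "fobj F (g Y)" "farr F f"]) simp_all
    then show ?thesis using unique[of "farr G h" f] that by simp
  qed
  have G: "additive_functor D C G"
  proof (rule additive_functorI)
    show "fobj G X \<in> Ob C" if "X \<in> Ob D" for X using that by simp
    show "farr G f \<in> Hom C (fobj G X) (fobj G Y)" if "X \<in> Ob D" "Y \<in> Ob D" "f \<in> Hom D X Y" for X Y f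
      using C.arr_Hom[of "farr G f"] D.in_homI[OF that] by simp
    show "farr G (Ide D X) = Ide C (fobj G X)" if "X \<in> Ob D" for X
      using that i[OF that] by (intro GI[of _ X X]) simp_all
    show "farr G (f \<otimes>\<^bsub>Mor D X Y\<^esub> h) = farr G f \<otimes>\<^bsub>Mor C (fobj G X) (fobj G Y)\<^esub> farr G h"
      if XY: "X \<in> Ob D" "Y \<in> Ob D" "f \<in> Hom D X Y" "h \<in> Hom D X Y" for X Y f h
    proof -
      have fh: "D.in_hom f X Y" "D.in_hom h X Y" using D.in_homI XY by blast+
      have "farr G (D.add f h) = C.add (farr G f) (farr G h)"
      proof (rule GI[of _ X Y])
        show "i Y \<bullet>\<^bsub>D\<^esub> farr F (C.add (farr G f) (farr G h)) = D.add f h \<bullet>\<^bsub>D\<^esub> i X"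
          using fh i[OF XY(1)] i[OF XY(2)] G_eq[of f] G_eq[of h]
          by (simp add: add D.comp_add_left D.comp_add_right)
      qed (use fh in simp_all)
      then show ?thesis using fh by (simp add: C.add_def D.add_def)
    qed
    show "farr G (h \<bullet>\<^bsub>D\<^esub> f) = farr G h \<bullet>\<^bsub>C\<^esub> farr G f"
      if XY: "X \<in> Ob D" "Y \<in> Ob D" "Z \<in> Ob D" "f \<in> Hom D X Y" "h \<in> Hom D Y Z" for X Y Z f h
    proof -
      have fh: "D.in_hom f X Y" "D.in_hom h Y Z" using D.in_homI XY by blast+
      show ?thesis
      proof (rule GI[of _ X Z])
        have "i Z \<bullet>\<^bsub>D\<^esub> farr F (farr G h \<bullet>\<^bsub>C\<^esub> farr G f) = (i Z \<bullet>\<^bsub>D\<^esub> farr F (farr G h)) \<bullet>\<^bsub>D\<^esub> farr F (farr G f)"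
          using fh i[OF XY(3)] by (simp add: comp D.comp_assoc)
        also have "\<dots> = h \<bullet>\<^bsub>D\<^esub> (i Y \<bullet>\<^bsub>D\<^esub> farr F (farr G f))"
          using fh i[OF XY(2)] G_eq[of h] by (simp add: D.comp_assoc)
        also have "\<dots> = (h \<bullet>\<^bsub>D\<^esub> f) \<bullet>\<^bsub>D\<^esub> i X"
          using fh i[OF XY(1)] G_eq[of f] by (simp add: D.comp_assoc)
        finally show "i Z \<bullet>\<^bsub>D\<^esub> farr F (farr G h \<bullet>\<^bsub>C\<^esub> farr G f) = (h \<bullet>\<^bsub>D\<^esub> f) \<bullet>\<^bsub>D\<^esub> i X" .
      qed (use fh in simp_all)
    qed
  qed
  interpret G: additive_functor_between D C G by unfold_locales (rule G)
  \<comment> \<open>The unit at \<open>X\<close> is a preimage of \<open>j (F X)\<close> under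
    \<open>F\<close>. Fullness provides it, and faithfulness reduces its naturality to an identity
    in \<open>D\<close>.\<close>
  have "\<exists>f. C.in_hom f X (g (fobj F X)) \<and> farr F f = j (fobj F X)" if X: "X \<in> Ob C" for X
    using full X g[OF ob[OF X]] j[OF ob[OF X]] unfolding full_def by blast
  then obtain \<eta> where \<eta>: "\<And>X. X \<in> Ob C \<Longrightarrow> C.in_hom (\<eta> X) X (g (fobj F X))"
    "\<And>X. X \<in> Ob C \<Longrightarrow> farr F (\<eta> X) = j (fobj F X)" by metis
  have "\<exists>f. C.in_hom f (g (fobj F X)) X \<and> farr F f = i (fobj F X)" if X: "X \<in> Ob C" for X
    using full X g[OF ob[OF X]] i[OF ob[OF X]] unfolding full_def by blast
  then obtain \<theta> where \<theta>: "\<And>X. X \<in> Ob C \<Longrightarrow> C.in_hom (\<theta> X) (g (fobj F X)) X"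
    "\<And>X. X \<in> Ob C \<Longrightarrow> farr F (\<theta> X) = i (fobj F X)" by metis
  have \<eta>_iso: "iso_in C X (g (fobj F X)) (\<eta> X)" if X: "X \<in> Ob C" for X
    using \<eta>[OF X] \<theta>[OF X] X ij[OF ob[OF X]] ji[OF ob[OF X]]
    by (intro C.iso_inI[where g = "\<theta> X"] unique) (simp_all add: comp)
  have \<eta>_nat: "\<eta> Y \<bullet>\<^bsub>C\<^esub> f = farr G (farr F f) \<bullet>\<^bsub>C\<^esub> \<eta> X" if f: "C.in_hom f X Y" for X Y f
  proof (rule unique)
    have obs: "X \<in> Ob C" "Y \<in> Ob C" using f C.in_homD by blast+
    note [simp] = \<eta>[OF obs(1)] \<eta>[OF obs(2)]
    note ijs = i[OF ob[OF obs(1)]] j[OF ob[OF obs(1)]] j[OF ob[OF obs(2)]] i[OF ob[OF obs(2)]]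
    show "C.par (\<eta> Y \<bullet>\<^bsub>C\<^esub> f) (farr G (farr F f) \<bullet>\<^bsub>C\<^esub> \<eta> X)" using f by simp
    have "i (fobj F Y) \<bullet>\<^bsub>D\<^esub> (j (fobj F Y) \<bullet>\<^bsub>D\<^esub> farr F f) = (i (fobj F Y) \<bullet>\<^bsub>D\<^esub> j (fobj F Y)) \<bullet>\<^bsub>D\<^esub> farr F f"
      using f ijs by (simp add: D.comp_assoc)
    also have "\<dots> = farr F f \<bullet>\<^bsub>D\<^esub> (i (fobj F X) \<bullet>\<^bsub>D\<^esub> j (fobj F X))"
      using f ijs obs by (simp add: ij)
    also have "\<dots> = (i (fobj F Y) \<bullet>\<^bsub>D\<^esub> farr F (farr G (farr F f))) \<bullet>\<^bsub>D\<^esub> j (fobj F X)"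
      using f ijs obs G_eq[of "farr F f"] by (simp add: D.comp_assoc)
    also have "\<dots> = i (fobj F Y) \<bullet>\<^bsub>D\<^esub> (farr F (farr G (farr F f)) \<bullet>\<^bsub>D\<^esub> j (fobj F X))"
      using f ijs obs by (simp add: D.comp_assoc)
    finally have *: "i (fobj F Y) \<bullet>\<^bsub>D\<^esub> (j (fobj F Y) \<bullet>\<^bsub>D\<^esub> farr F f) =
        i (fobj F Y) \<bullet>\<^bsub>D\<^esub> (farr F (farr G (farr F f)) \<bullet>\<^bsub>D\<^esub> j (fobj F X))" .
    have "j (fobj F Y) \<bullet>\<^bsub>D\<^esub> farr F f = farr F (farr G (farr F f)) \<bullet>\<^bsub>D\<^esub> j (fobj F X)"
      by (rule D.iso_mono[OF i_iso[of "fobj F Y"] _ _ _ *, of "fobj F X"]) (use f ijs obs in simp_all)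
    then show "farr F (\<eta> Y \<bullet>\<^bsub>C\<^esub> f) = farr F (farr G (farr F f) \<bullet>\<^bsub>C\<^esub> \<eta> X)"
      using f by (simp add: comp)
  qed
  have idC: "additive_functor C C id_functor" and idD: "additive_functor D D id_functor"
    by (rule additive_functorI; simp)+
  have "nat_trans C C id_functor (G \<circ>\<^sub>F F) \<eta>"
  proof (rule nat_transI[OF idC additive_functor_comp[OF additive G]])
    show "\<eta> X \<in> Hom C (fobj id_functor X) (fobj (G \<circ>\<^sub>F F) X)" if "X \<in> Ob C" for X
      using C.in_homD(3)[OF \<eta>(1)[OF that]] by simp
    show "\<eta> Y \<bullet>\<^bsub>C\<^esub> farr id_functor f = farr (G \<circ>\<^sub>F F) f \<bullet>\<^bsub>C\<^esub> \<eta> X"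
      if "X \<in> Ob C" "Y \<in> Ob C" "f \<in> Hom C X Y" for X Y f
      using \<eta>_nat[OF C.in_homI[OF that]] by simp
  qed
  moreover have "nat_trans D D (F \<circ>\<^sub>F G) id_functor i"
  proof (rule nat_transI[OF additive_functor_comp[OF G additive] idD])
    show "i X \<in> Hom D (fobj (F \<circ>\<^sub>F G) X) (fobj id_functor X)" if "X \<in> Ob D" for X
      using D.in_homD(3)[OF i[OF that]] by simp
    show "i Y \<bullet>\<^bsub>D\<^esub> farr (F \<circ>\<^sub>F G) f = farr id_functor f \<bullet>\<^bsub>D\<^esub> i X"
      if "X \<in> Ob D" "Y \<in> Ob D" "f \<in> Hom D X Y" for X Y f
      using G_eq[of f] D.in_homI[OF that] by simp
  qed
  ultimately have "quasi_inverse C D F G"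
    unfolding quasi_inverse_def nat_isomorphic_def using additive G \<eta>_iso i_iso by auto
  then show ?thesis unfolding category_equivalence_def by blast
qed

end

section \<open>Reflections and coreflections\<close>

context preadditive_category
begin

text \<open>The inclusion is the identity on objects and arrows, so the triangle identities read as
  a universal property: \<open>\<epsilon> Y \<bullet> farr L g\<close> factors \<open>g\<close>
  through the unit, and any \<open>k\<close> into \<open>Y\<close> is recovered from
  \<open>k \<bullet> \<eta> X\<close> as
  \<open>\<epsilon> Y \<bullet> farr L (k \<bullet> \<eta> X)\<close>.\<close>

lemma reflection:
  assumes adj: "adjoint C (full_subcat C S) L id_functor" and S: "S \<subseteq> Ob C"
  obtains \<eta> where "\<And>X. X \<in> Ob C \<Longrightarrow> fobj L X \<in> S"
    "\<And>X. X \<in> Ob C \<Longrightarrow> \<guillemotleft>\<eta> X : X \<rightarrow> fobj L X\<guillemotright>"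
    "\<And>X Y f. \<guillemotleft>f : X \<rightarrow> Y\<guillemotright> \<Longrightarrow> farr L f \<bullet> \<eta> X = \<eta> Y \<bullet> f"
    "\<And>X Y g. \<lbrakk>\<guillemotleft>g : X \<rightarrow> Y\<guillemotright>; Y \<in> S\<rbrakk> \<Longrightarrow> \<exists>h. \<guillemotleft>h : fobj L X \<rightarrow> Y\<guillemotright> \<and> h \<bullet> \<eta> X = g"
    "\<And>X Y h h'. \<lbrakk>X \<in> Ob C; Y \<in> S; \<guillemotleft>h : fobj L X \<rightarrow> Y\<guillemotright>; \<guillemotleft>h' : fobj L X \<rightarrow> Y\<guillemotright>; h \<bullet> \<eta> X = h' \<bullet> \<eta> X\<rbrakk> \<Longrightarrow> h = h'"
proof -
  obtain \<eta> \<epsilon> where L: "additive_functor C (full_subcat C S) L"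
    and \<eta>: "nat_trans C C id_functor (id_functor \<circ>\<^sub>F L) \<eta>"
    and \<epsilon>: "nat_trans (full_subcat C S) (full_subcat C S) (L \<circ>\<^sub>F id_functor) id_functor \<epsilon>"
    and tri: "\<And>X. X \<in> Ob C \<Longrightarrow> \<epsilon> (fobj L X) \<bullet> farr L (\<eta> X) = Ide C (fobj L X)"
      "\<And>Y. Y \<in> S \<Longrightarrow> \<epsilon> Y \<bullet> \<eta> Y = Ide C Y"
    using adj unfolding adjoint_def by auto
  interpret L: additive_functor_between C "full_subcat C S" L
    by (intro additive_functor_between.intro preadditive_full_subcat preadditive_category_axioms
        additive_functor_between_axioms.intro L S)
  have LS: "fobj L X \<in> S" if "X \<in> Ob C" for X using L.ob[OF that] by simp
  have LC: "fobj L X \<in> Ob C" if "X \<in> Ob C" for X using LS S that by blast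
  have L_arr: "\<guillemotleft>farr L f : fobj L (Src C f) \<rightarrow> fobj L (Tgt C f)\<guillemotright>" if "arr f" for f
    using additive_functor_Hom[OF L, of "Src C f" "Tgt C f" f] that by (intro in_homI) (simp_all add: LC)
  have \<eta>_in: "\<guillemotleft>\<eta> X : X \<rightarrow> fobj L X\<guillemotright>" if "X \<in> Ob C" for X
    using nat_trans_component[OF \<eta> that] that by (intro in_homI) (simp_all add: LC)
  have \<epsilon>_in: "\<guillemotleft>\<epsilon> X : fobj L X \<rightarrow> X\<guillemotright>" if "X \<in> S" for X
    using nat_trans_component[OF \<epsilon>, of X] that S by (intro in_homI) (auto simp: LC)
  have \<eta>_nat: "farr L f \<bullet> \<eta> X = \<eta> Y \<bullet> f" if "\<guillemotleft>f : X \<rightarrow> Y\<guillemotright>" for f X Y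
    using nat_trans_natural[OF \<eta> in_homD[OF that]] by simp
  have \<epsilon>_nat: "\<epsilon> Y \<bullet> farr L f = f \<bullet> \<epsilon> X" if "\<guillemotleft>f : X \<rightarrow> Y\<guillemotright>" "X \<in> S" "Y \<in> S" for f X Y
    using nat_trans_natural[OF \<epsilon>, of X Y f] in_homD[OF that(1)] that by simp
  show ?thesis
  proof (rule that[OF LS \<eta>_in \<eta>_nat])
    fix X Y g assume g: "\<guillemotleft>g : X \<rightarrow> Y\<guillemotright>" and Y: "Y \<in> S"
    have obs: "X \<in> Ob C" "Y \<in> Ob C" using in_homD[OF g] by blast+
    note ar = \<eta>_in[OF obs(1)] \<eta>_in[OF obs(2)] \<epsilon>_in[OF Y] L_arr[of g]
    have "(\<epsilon> Y \<bullet> farr L g) \<bullet> \<eta> X = (\<epsilon> Y \<bullet> \<eta> Y) \<bullet> g"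
      using g ar \<eta>_nat[OF g] by (simp add: comp_assoc)
    then have "(\<epsilon> Y \<bullet> farr L g) \<bullet> \<eta> X = g" using tri(2)[OF Y] g by simp
    then show "\<exists>h. \<guillemotleft>h : fobj L X \<rightarrow> Y\<guillemotright> \<and> h \<bullet> \<eta> X = g" using g ar by (intro exI[of _ "\<epsilon> Y \<bullet> farr L g"]) simp
  next
    fix X Y h h' assume X: "X \<in> Ob C" and Y: "Y \<in> S"
      and h: "\<guillemotleft>h : fobj L X \<rightarrow> Y\<guillemotright>" "\<guillemotleft>h' : fobj L X \<rightarrow> Y\<guillemotright>" and eq: "h \<bullet> \<eta> X = h' \<bullet> \<eta> X"
    have "k = \<epsilon> Y \<bullet> farr L (k \<bullet> \<eta> X)" if k: "\<guillemotleft>k : fobj L X \<rightarrow> Y\<guillemotright>" for k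
    proof -
      note ar = \<eta>_in[OF X] \<epsilon>_in[OF Y] L_arr[of k] L_arr[of "\<eta> X"] \<epsilon>_in[OF LS[OF X]]
      have "\<epsilon> Y \<bullet> farr L (k \<bullet> \<eta> X) = (\<epsilon> Y \<bullet> farr L k) \<bullet> farr L (\<eta> X)"
        using ar k additive_functor_Comp[OF L, of X "fobj L X" Y "\<eta> X" k] in_homD[OF k] in_homD(3)[OF ar(1)] X
        by (simp add: comp_assoc)
      also have "\<dots> = k \<bullet> (\<epsilon> (fobj L X) \<bullet> farr L (\<eta> X))"
        using ar k \<epsilon>_nat[OF k LS[OF X] Y] by (simp add: comp_assoc)
      also have "\<dots> = k" using tri(1)[OF X] k by simp
      finally show ?thesis by simp
    qed
    then show "h = h'" using h eq by metis
  qed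
qed

text \<open>The dual argument: \<open>g\<close> lifts through the counit as
  \<open>farr R g \<bullet> \<eta> Y\<close>, and \<open>k\<close> is recovered from
  \<open>\<epsilon> X \<bullet> k\<close>.\<close>

lemma coreflection:
  assumes adj: "adjoint (full_subcat C S) C id_functor R" and S: "S \<subseteq> Ob C"
  obtains \<epsilon> where "\<And>X. X \<in> Ob C \<Longrightarrow> fobj R X \<in> S"
    "\<And>X. X \<in> Ob C \<Longrightarrow> \<guillemotleft>\<epsilon> X : fobj R X \<rightarrow> X\<guillemotright>"
    "\<And>X Y f. \<guillemotleft>f : X \<rightarrow> Y\<guillemotright> \<Longrightarrow> \<epsilon> Y \<bullet> farr R f = f \<bullet> \<epsilon> X"
    "\<And>X Y g. \<lbrakk>\<guillemotleft>g : Y \<rightarrow> X\<guillemotright>; Y \<in> S\<rbrakk> \<Longrightarrow> \<exists>h. \<guillemotleft>h : Y \<rightarrow> fobj R X\<guillemotright> \<and> \<epsilon> X \<bullet> h = g"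
    "\<And>X Y h h'. \<lbrakk>X \<in> Ob C; Y \<in> S; \<guillemotleft>h : Y \<rightarrow> fobj R X\<guillemotright>; \<guillemotleft>h' : Y \<rightarrow> fobj R X\<guillemotright>; \<epsilon> X \<bullet> h = \<epsilon> X \<bullet> h'\<rbrakk> \<Longrightarrow> h = h'"
proof -
  obtain \<eta> \<epsilon> where R: "additive_functor C (full_subcat C S) R"
    and \<eta>: "nat_trans (full_subcat C S) (full_subcat C S) id_functor (R \<circ>\<^sub>F id_functor) \<eta>"
    and \<epsilon>: "nat_trans C C (id_functor \<circ>\<^sub>F R) id_functor \<epsilon>"
    and tri: "\<And>X. X \<in> S \<Longrightarrow> \<epsilon> X \<bullet> \<eta> X = Ide C X"
      "\<And>Y. Y \<in> Ob C \<Longrightarrow> farr R (\<epsilon> Y) \<bullet> \<eta> (fobj R Y) = Ide C (fobj R Y)"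
    using adj unfolding adjoint_def by auto
  have RS: "fobj R X \<in> S" if "X \<in> Ob C" for X using additive_functor_ob[OF R that] by simp
  have RC: "fobj R X \<in> Ob C" if "X \<in> Ob C" for X using RS S that by blast
  have R_arr: "\<guillemotleft>farr R f : fobj R (Src C f) \<rightarrow> fobj R (Tgt C f)\<guillemotright>" if "arr f" for f
    using additive_functor_Hom[OF R, of "Src C f" "Tgt C f" f] that by (intro in_homI) (simp_all add: RC)
  have \<epsilon>_in: "\<guillemotleft>\<epsilon> X : fobj R X \<rightarrow> X\<guillemotright>" if "X \<in> Ob C" for X
    using nat_trans_component[OF \<epsilon> that] that by (intro in_homI) (simp_all add: RC)
  have \<eta>_in: "\<guillemotleft>\<eta> X : X \<rightarrow> fobj R X\<guillemotright>" if "X \<in> S" for X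
    using nat_trans_component[OF \<eta>, of X] that S by (intro in_homI) (auto simp: RC)
  have \<epsilon>_nat: "\<epsilon> Y \<bullet> farr R f = f \<bullet> \<epsilon> X" if "\<guillemotleft>f : X \<rightarrow> Y\<guillemotright>" for f X Y
    using nat_trans_natural[OF \<epsilon> in_homD[OF that]] by simp
  have \<eta>_nat: "farr R f \<bullet> \<eta> X = \<eta> Y \<bullet> f" if "\<guillemotleft>f : X \<rightarrow> Y\<guillemotright>" "X \<in> S" "Y \<in> S" for f X Y
    using nat_trans_natural[OF \<eta>, of X Y f] in_homD[OF that(1)] that by simp
  show ?thesis
  proof (rule that[OF RS \<epsilon>_in \<epsilon>_nat])
    fix X Y g assume g: "\<guillemotleft>g : Y \<rightarrow> X\<guillemotright>" and Y: "Y \<in> S"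
    have obs: "X \<in> Ob C" "Y \<in> Ob C" using in_homD[OF g] by blast+
    note ar = \<epsilon>_in[OF obs(1)] \<epsilon>_in[OF obs(2)] \<eta>_in[OF Y] R_arr[of g]
    have "\<epsilon> X \<bullet> (farr R g \<bullet> \<eta> Y) = (\<epsilon> X \<bullet> farr R g) \<bullet> \<eta> Y"
      using g ar by (simp add: comp_assoc)
    also have "\<dots> = g \<bullet> (\<epsilon> Y \<bullet> \<eta> Y)" using g ar \<epsilon>_nat[OF g] by (simp add: comp_assoc)
    finally have "\<epsilon> X \<bullet> (farr R g \<bullet> \<eta> Y) = g" using tri(1)[OF Y] g by simp
    then show "\<exists>h. \<guillemotleft>h : Y \<rightarrow> fobj R X\<guillemotright> \<and> \<epsilon> X \<bullet> h = g" using g ar by (intro exI[of _ "farr R g \<bullet> \<eta> Y"]) simp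
  next
    fix X Y h h' assume X: "X \<in> Ob C" and Y: "Y \<in> S"
      and h: "\<guillemotleft>h : Y \<rightarrow> fobj R X\<guillemotright>" "\<guillemotleft>h' : Y \<rightarrow> fobj R X\<guillemotright>" and eq: "\<epsilon> X \<bullet> h = \<epsilon> X \<bullet> h'"
    have "k = farr R (\<epsilon> X \<bullet> k) \<bullet> \<eta> Y" if k: "\<guillemotleft>k : Y \<rightarrow> fobj R X\<guillemotright>" for k
    proof -
      note ar = \<epsilon>_in[OF X] \<eta>_in[OF Y] R_arr[of k] R_arr[of "\<epsilon> X"] \<eta>_in[OF RS[OF X]]
      have "farr R (\<epsilon> X \<bullet> k) \<bullet> \<eta> Y = farr R (\<epsilon> X) \<bullet> (farr R k \<bullet> \<eta> Y)"
        using ar k additive_functor_Comp[OF R, of Y "fobj R X" X k "\<epsilon> X"] in_homD[OF k] in_homD(3)[OF ar(1)] X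
        by (simp add: comp_assoc)
      also have "\<dots> = (farr R (\<epsilon> X) \<bullet> \<eta> (fobj R X)) \<bullet> k"
        using ar k \<eta>_nat[OF k Y RS[OF X]] by (simp add: comp_assoc)
      also have "\<dots> = k" using tri(2)[OF X] k by simp
      finally show ?thesis by simp
    qed
    then show "h = h'" using h eq by metis
  qed
qed

end

section \<open>Ideal quotients\<close>

locale ideal_quotient = additive_category C
  for C :: "('o, 'm, 'z) precat_scheme" (structure) +
  fixes W :: "'o set"
  assumes W: "additive_subcat C W"
begin

abbreviation I :: "'o \<Rightarrow> 'o \<Rightarrow> 'm set" where "I X Y \<equiv> factor_ideal C W X Y"

abbreviation cls :: "'m \<Rightarrow> 'm set" where "cls f \<equiv> ideal_class C W f"

abbreviation CW :: "('o, 'm set) precat" where "CW \<equiv> quotient_cat C W"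

lemma W_Ob: "P \<in> W \<Longrightarrow> P \<in> Ob C"
  using W unfolding additive_subcat_def by blast

lemma zero_object_in_W: obtains Z where "Z \<in> W" "zero_object C Z"
  using W unfolding additive_subcat_def by blast

lemma II:
  assumes "\<guillemotleft>a : X \<rightarrow> P\<guillemotright>" "\<guillemotleft>b : P \<rightarrow> Y\<guillemotright>" "P \<in> W"
  shows "b \<bullet> a \<in> I X Y"
proof -
  have "\<guillemotleft>b \<bullet> a : X \<rightarrow> Y\<guillemotright>" using assms by simp
  then have "b \<bullet> a \<in> Hom C X Y" using in_homD(3) by blast
  moreover have "a \<in> Hom C X P" "b \<in> Hom C P Y" using in_homD(3) assms by blast+
  ultimately show ?thesis using assms(3) unfolding factor_ideal_def by blast
qed

lemma IE:
  assumes "f \<in> I X Y" "X \<in> Ob C" "Y \<in> Ob C"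
  obtains P a b where "\<guillemotleft>a : X \<rightarrow> P\<guillemotright>" "\<guillemotleft>b : P \<rightarrow> Y\<guillemotright>" "P \<in> W" "f = b \<bullet> a"
proof -
  obtain P a b where P: "P \<in> W" and ab: "a \<in> Hom C X P" "b \<in> Hom C P Y" "f = b \<bullet> a"
    using assms(1) unfolding factor_ideal_def by blast
  show ?thesis using that[OF in_homI[OF assms(2) W_Ob[OF P] ab(1)] in_homI[OF W_Ob[OF P] assms(3) ab(2)] P ab(3)] .
qed

lemma I_in_hom: assumes "f \<in> I X Y" "X \<in> Ob C" "Y \<in> Ob C" shows "\<guillemotleft>f : X \<rightarrow> Y\<guillemotright>"
proof -
  have "f \<in> Hom C X Y" using assms(1) unfolding factor_ideal_def by blast
  then show ?thesis using in_homI assms by blast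
qed

lemma I_zero: assumes "X \<in> Ob C" "Y \<in> Ob C" shows "zero X Y \<in> I X Y"
proof -
  obtain Z where Z: "Z \<in> W" "zero_object C Z" using zero_object_in_W .
  then have "zero Z Y \<bullet> zero X Z \<in> I X Y" using assms W_Ob[OF Z(1)] by (intro II[of _ X Z]) simp_all
  then show ?thesis using assms W_Ob[OF Z(1)] by simp
qed

lemma I_neg: assumes "f \<in> I X Y" "X \<in> Ob C" "Y \<in> Ob C" shows "neg f \<in> I X Y"
proof -
  obtain P a b where ab: "\<guillemotleft>a : X \<rightarrow> P\<guillemotright>" "\<guillemotleft>b : P \<rightarrow> Y\<guillemotright>" "P \<in> W" "f = b \<bullet> a" using IE[OF assms] .
  have "neg b \<bullet> a \<in> I X Y" using ab by (intro II[of _ X P]) simp_all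
  then show ?thesis using ab by simp
qed

text \<open>A map through \<open>P\<close> and a map through \<open>P'\<close> have a sum through a
  biproduct \<open>R\<close> of the two: enter by \<open>i a + j a'\<close>, leave by
  \<open>b p + b' q\<close>, and the mixed terms vanish. Closure of \<open>W\<close> under
  biproducts enters here.\<close>

lemma I_add:
  assumes "f \<in> I X Y" "f' \<in> I X Y" "X \<in> Ob C" "Y \<in> Ob C" shows "f \<boxplus> f' \<in> I X Y"
proof -
  obtain P a b where ab: "\<guillemotleft>a : X \<rightarrow> P\<guillemotright>" "\<guillemotleft>b : P \<rightarrow> Y\<guillemotright>" "P \<in> W" "f = b \<bullet> a" using IE[OF assms(1,3,4)] .
  obtain P' a' b' where ab': "\<guillemotleft>a' : X \<rightarrow> P'\<guillemotright>" "\<guillemotleft>b' : P' \<rightarrow> Y\<guillemotright>" "P' \<in> W" "f' = b' \<bullet> a'" using IE[OF assms(2-4)] .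
  have obs: "P \<in> Ob C" "P' \<in> Ob C" using W_Ob ab(3) ab'(3) by blast+
  obtain R where R: "biproduct C P P' R" using biproduct_exists[OF obs] by blast
  then have RW: "R \<in> W" using W ab(3) ab'(3) unfolding additive_subcat_def by blast
  obtain i j p q where "i \<in> Hom C P R" "j \<in> Hom C P' R" "p \<in> Hom C R P" "q \<in> Hom C R P'"
    and eqs: "p \<bullet> i = Ide C P" "q \<bullet> j = Ide C P'" "p \<bullet> j = zero P' P" "q \<bullet> i = zero P P'"
    using R unfolding biproduct_def by blast
  then have ijpq: "\<guillemotleft>i : P \<rightarrow> R\<guillemotright>" "\<guillemotleft>j : P' \<rightarrow> R\<guillemotright>" "\<guillemotleft>p : R \<rightarrow> P\<guillemotright>" "\<guillemotleft>q : R \<rightarrow> P'\<guillemotright>"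
    using in_homI W_Ob[OF RW] obs by blast+
  have "(b \<bullet> p \<boxplus> b' \<bullet> q) \<bullet> (i \<bullet> a \<boxplus> j \<bullet> a') \<in> I X Y"
    using ab(1,2) ab'(1,2) ijpq RW by (intro II[of _ X R]) simp_all
  moreover have "(b \<bullet> p) \<bullet> (i \<bullet> a) = b \<bullet> ((p \<bullet> i) \<bullet> a)" "(b \<bullet> p) \<bullet> (j \<bullet> a') = b \<bullet> ((p \<bullet> j) \<bullet> a')"
    "(b' \<bullet> q) \<bullet> (i \<bullet> a) = b' \<bullet> ((q \<bullet> i) \<bullet> a)" "(b' \<bullet> q) \<bullet> (j \<bullet> a') = b' \<bullet> ((q \<bullet> j) \<bullet> a')"
    using ab(1,2) ab'(1,2) ijpq by (simp_all add: comp_assoc)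
  then have "(b \<bullet> p \<boxplus> b' \<bullet> q) \<bullet> (i \<bullet> a \<boxplus> j \<bullet> a') = b \<bullet> a \<boxplus> b' \<bullet> a'"
    using ab(1,2) ab'(1,2) ijpq eqs assms(3,4) obs
    by (simp add: comp_add_left comp_add_right)
  ultimately show ?thesis using ab(4) ab'(4) by simp
qed

lemma I_comp_left: assumes "f \<in> I X Y" "\<guillemotleft>g : Y \<rightarrow> Z\<guillemotright>" "X \<in> Ob C" shows "g \<bullet> f \<in> I X Z"
proof -
  have Y: "Y \<in> Ob C" by (rule in_homD(1)[OF assms(2)])
  obtain P a b where ab: "\<guillemotleft>a : X \<rightarrow> P\<guillemotright>" "\<guillemotleft>b : P \<rightarrow> Y\<guillemotright>" "P \<in> W" "f = b \<bullet> a" using IE[OF assms(1,3) Y] .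
  have "(g \<bullet> b) \<bullet> a \<in> I X Z" using ab(1,2,3) assms by (intro II[of _ X P]) simp_all
  then show ?thesis using ab assms by (simp add: comp_assoc)
qed

lemma I_comp_right: assumes "f \<in> I X Y" "\<guillemotleft>g : Z \<rightarrow> X\<guillemotright>" "Y \<in> Ob C" shows "f \<bullet> g \<in> I Z Y"
proof -
  have X: "X \<in> Ob C" by (rule in_homD(2)[OF assms(2)])
  obtain P a b where ab: "\<guillemotleft>a : X \<rightarrow> P\<guillemotright>" "\<guillemotleft>b : P \<rightarrow> Y\<guillemotright>" "P \<in> W" "f = b \<bullet> a" using IE[OF assms(1) X assms(3)] .
  have "b \<bullet> (a \<bullet> g) \<in> I Z Y" using ab(1,2,3) assms by (intro II[of _ Z P]) simp_all
  then show ?thesis using ab assms by (simp add: comp_assoc)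
qed

lemma I_subgroup: assumes "X \<in> Ob C" "Y \<in> Ob C" shows "subgroup (I X Y) (Mor C X Y)"
proof (rule group.subgroupI[OF Hom_group[OF assms]])
  show "I X Y \<subseteq> Hom C X Y" unfolding factor_ideal_def by blast
  show "I X Y \<noteq> {}" using I_zero[OF assms] by blast
  show "inv\<^bsub>Mor C X Y\<^esub> f \<in> I X Y" if "f \<in> I X Y" for f
    using I_neg[OF that assms] I_in_hom[OF that assms] by (simp add: neg_def)
  show "f \<otimes>\<^bsub>Mor C X Y\<^esub> g \<in> I X Y" if "f \<in> I X Y" "g \<in> I X Y" for f g
    using I_add[OF that assms] I_in_hom[OF that(1) assms] by (simp add: add_def)
qed

lemma cls_eq_coset: "\<guillemotleft>f : X \<rightarrow> Y\<guillemotright> \<Longrightarrow> cls f = I X Y #>\<^bsub>Mor C X Y\<^esub> f"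
  by (simp add: ideal_class_def)

lemma mem_cls_iff: assumes "\<guillemotleft>f : X \<rightarrow> Y\<guillemotright>" shows "g \<in> cls f \<longleftrightarrow> \<guillemotleft>g : X \<rightarrow> Y\<guillemotright> \<and> g \<boxminus> f \<in> I X Y"
proof -
  note obs = in_homD(1,2)[OF assms]
  show ?thesis
  proof
    assume "g \<in> cls f"
    then obtain h where h: "h \<in> I X Y" "g = h \<otimes>\<^bsub>Mor C X Y\<^esub> f"
      unfolding cls_eq_coset[OF assms] r_coset_def by blast
    then have g: "g = h \<boxplus> f" using I_in_hom[OF h(1) obs] by (simp add: add_def)
    have "g \<boxminus> f = h" using I_in_hom[OF h(1) obs] assms unfolding g dif_def by (simp add: add_assoc)
    then show "\<guillemotleft>g : X \<rightarrow> Y\<guillemotright> \<and> g \<boxminus> f \<in> I X Y" using h(1) g I_in_hom[OF h(1) obs] assms by simp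
  next
    assume g: "\<guillemotleft>g : X \<rightarrow> Y\<guillemotright> \<and> g \<boxminus> f \<in> I X Y"
    then have "g = (g \<boxminus> f) \<boxplus> f" using assms by (simp add: dif_add_cancel)
    also have "\<dots> = (g \<boxminus> f) \<otimes>\<^bsub>Mor C X Y\<^esub> f" using g assms by (simp add: add_def)
    finally show "g \<in> cls f" using g unfolding cls_eq_coset[OF assms] r_coset_def by blast
  qed
qed

lemma cls_eq_iff: assumes "\<guillemotleft>f : X \<rightarrow> Y\<guillemotright>" "\<guillemotleft>g : X \<rightarrow> Y\<guillemotright>" shows "cls g = cls f \<longleftrightarrow> g \<boxminus> f \<in> I X Y"
proof
  note obs = in_homD(1,2)[OF assms(1)]
  assume "cls g = cls f"
  moreover have "g \<in> cls g" using mem_cls_iff[OF assms(2)] assms obs I_zero by simp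
  ultimately show "g \<boxminus> f \<in> I X Y" using mem_cls_iff[OF assms(1)] by blast
next
  note obs = in_homD(1,2)[OF assms(1)]
  assume "g \<boxminus> f \<in> I X Y"
  then have "g \<in> cls f" using mem_cls_iff[OF assms(1)] assms(2) by blast
  then show "cls g = cls f"
    using group.repr_independence[OF Hom_group[OF obs] _ in_homD(3)[OF assms(1)] I_subgroup[OF obs]]
    by (simp add: cls_eq_coset[OF assms(1)] cls_eq_coset[OF assms(2)])
qed

lemma self_mem_cls: "\<guillemotleft>f : X \<rightarrow> Y\<guillemotright> \<Longrightarrow> f \<in> cls f"
  using mem_cls_iff[of f X Y f] I_zero[of X Y] in_homD[of f X Y] by simp

lemma mem_cls_eq: "\<lbrakk>\<guillemotleft>f : X \<rightarrow> Y\<guillemotright>; g \<in> cls f\<rbrakk> \<Longrightarrow> cls g = cls f"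
  using mem_cls_iff cls_eq_iff by blast

lemma Ob_CW [simp]: "Ob CW = Ob C" and Ide_CW: "Ide CW X = cls (Ide C X)"
  and Mor_CW: "Mor CW X Y = Mor C X Y Mod I X Y"
  by (simp_all add: quotient_cat_def)

lemma Hom_CW: assumes "X \<in> Ob C" "Y \<in> Ob C" shows "A \<in> Hom CW X Y \<longleftrightarrow> (\<exists>f. \<guillemotleft>f : X \<rightarrow> Y\<guillemotright> \<and> A = cls f)"
proof -
  have "A \<in> Hom CW X Y \<longleftrightarrow> (\<exists>f \<in> Hom C X Y. A = I X Y #>\<^bsub>Mor C X Y\<^esub> f)"
    unfolding Mor_CW FactGroup_def RCOSETS_def by auto
  moreover have "cls f = I X Y #>\<^bsub>Mor C X Y\<^esub> f" if "f \<in> Hom C X Y" for f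
    using cls_eq_coset in_homI[OF assms that] by blast
  ultimately show ?thesis using in_homI[OF assms] in_homD(3) by blast
qed

lemma Hom_CWE:
  assumes "X \<in> Ob C" "Y \<in> Ob C" "A \<in> Hom CW X Y"
  obtains f where "\<guillemotleft>f : X \<rightarrow> Y\<guillemotright>" "A = cls f"
  using assms(3) unfolding Hom_CW[OF assms(1,2)] by blast

lemma cls_Hom: assumes "\<guillemotleft>f : X \<rightarrow> Y\<guillemotright>" shows "cls f \<in> Hom CW X Y"
  unfolding Hom_CW[OF in_homD(1,2)[OF assms]] using assms by blast

lemma mult_CW:
  assumes "\<guillemotleft>f : X \<rightarrow> Y\<guillemotright>" "\<guillemotleft>g : X \<rightarrow> Y\<guillemotright>"
  shows "cls f \<otimes>\<^bsub>Mor CW X Y\<^esub> cls g = cls (f \<boxplus> g)"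
proof -
  note obs = in_homD(1,2)[OF assms(1)]
  have "I X Y \<lhd> Mor C X Y" using comm_group.subgroup_imp_normal[OF hom_comm_group[OF obs] I_subgroup[OF obs]] .
  note [simp] = normal.rcos_sum[OF this in_homD(3)[OF assms(1)] in_homD(3)[OF assms(2)]]
  have "cls f \<otimes>\<^bsub>Mor CW X Y\<^esub> cls g = I X Y #>\<^bsub>Mor C X Y\<^esub> (f \<otimes>\<^bsub>Mor C X Y\<^esub> g)"
    by (simp add: cls_eq_coset[OF assms(1)] cls_eq_coset[OF assms(2)] Mor_CW FactGroup_def)
  also have "f \<otimes>\<^bsub>Mor C X Y\<^esub> g = f \<boxplus> g" using assms by (simp add: add_def)
  also have "I X Y #>\<^bsub>Mor C X Y\<^esub> (f \<boxplus> g) = cls (f \<boxplus> g)"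
    using assms by (intro cls_eq_coset[symmetric]) simp
  finally show ?thesis .
qed

text \<open>Composition in \<open>quotient_cat\<close> is a union over representatives, so all of
  them have to give the same class. The reason is \<open>b a - g f = b (a - f) + (b - g) f\<close>,
  where both summands lie in the two-sided ideal.\<close>

lemma comp_CW:
  assumes "\<guillemotleft>f : X \<rightarrow> Y\<guillemotright>" "\<guillemotleft>g : Y \<rightarrow> Z\<guillemotright>"
  shows "cls g \<bullet>\<^bsub>CW\<^esub> cls f = cls (g \<bullet> f)"
proof -
  have const: "cls (b \<bullet> a) = cls (g \<bullet> f)" if "a \<in> cls f" "b \<in> cls g" for a b
  proof -
    have a: "\<guillemotleft>a : X \<rightarrow> Y\<guillemotright>" "a \<boxminus> f \<in> I X Y" and b: "\<guillemotleft>b : Y \<rightarrow> Z\<guillemotright>" "b \<boxminus> g \<in> I Y Z"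
      using that mem_cls_iff assms by blast+
    have obs: "X \<in> Ob C" "Y \<in> Ob C" "Z \<in> Ob C" using in_homD(1,2)[OF assms(1)] in_homD(2)[OF assms(2)] by blast+
    have "b \<bullet> (a \<boxminus> f) \<boxplus> (b \<boxminus> g) \<bullet> f \<in> I X Z"
      using a b assms obs by (intro I_add I_comp_left[of _ X Y b] I_comp_right[of _ Y Z f]) auto
    moreover have "b \<bullet> (a \<boxminus> f) \<boxplus> (b \<boxminus> g) \<bullet> f = b \<bullet> a \<boxminus> g \<bullet> f"
    proof -
      have "b \<bullet> (a \<boxminus> f) \<boxplus> (b \<boxminus> g) \<bullet> f = (b \<bullet> a \<boxminus> b \<bullet> f) \<boxplus> (b \<bullet> f \<boxminus> g \<bullet> f)"
        using a(1) b(1) assms by (simp add: comp_dif_left comp_dif_right)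
      also have "\<dots> = ((b \<bullet> a \<boxminus> b \<bullet> f) \<boxplus> b \<bullet> f) \<boxminus> g \<bullet> f"
        using a(1) b(1) assms by (simp add: dif_def[of _ "g \<bullet> f"] add_assoc)
      finally show ?thesis using a(1) b(1) assms by (simp add: dif_add_cancel)
    qed
    ultimately show ?thesis using a(1) b(1) assms cls_eq_iff[of "g \<bullet> f" X Z "b \<bullet> a"] by simp
  qed
  have "f \<in> cls f" "g \<in> cls g" using self_mem_cls assms by blast+
  then have "(\<Union>b \<in> cls g. \<Union>a \<in> cls f. cls (b \<bullet> a)) = cls (g \<bullet> f)" using const by blast
  then show ?thesis by (simp add: quotient_cat_def)
qed

lemma Src_CW: assumes "\<guillemotleft>f : X \<rightarrow> Y\<guillemotright>" shows "Src CW (cls f) = X"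
proof -
  have "Src C ` cls f = {X}" using mem_cls_iff[OF assms] self_mem_cls[OF assms] by auto
  then show ?thesis by (simp add: quotient_cat_def)
qed

lemma Tgt_CW: assumes "\<guillemotleft>f : X \<rightarrow> Y\<guillemotright>" shows "Tgt CW (cls f) = Y"
proof -
  have "Tgt C ` cls f = {Y}" using mem_cls_iff[OF assms] self_mem_cls[OF assms] by auto
  then show ?thesis by (simp add: quotient_cat_def)
qed

lemma preadditive_CW: "preadditive_category CW"
proof (rule preadditive_category.intro; unfold Ob_CW)
  show "comm_group (Mor CW X Y)" if "X \<in> Ob C" "Y \<in> Ob C" for X Y
    unfolding Mor_CW using comm_group.abelian_FactGroup[OF hom_comm_group I_subgroup] that by blast
  show "Src CW f = X" "Tgt CW f = Y" if "X \<in> Ob C" "Y \<in> Ob C" "f \<in> Hom CW X Y" for X Y f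
    using Hom_CWE[OF that] Src_CW[of _ X Y] Tgt_CW[of _ X Y] by blast+
  show "Ide CW X \<in> Hom CW X X" if "X \<in> Ob C" for X
    using that cls_Hom[of "Ide C X" X X] unfolding Ide_CW by simp
  show "g \<bullet>\<^bsub>CW\<^esub> f \<in> Hom CW X Z"
    if ob: "X \<in> Ob C" "Y \<in> Ob C" "Z \<in> Ob C" and fg: "f \<in> Hom CW X Y" "g \<in> Hom CW Y Z" for X Y Z f g
  proof -
    obtain f0 where f: "\<guillemotleft>f0 : X \<rightarrow> Y\<guillemotright>" "f = cls f0" using Hom_CWE[OF ob(1,2) fg(1)] .
    obtain g0 where g: "\<guillemotleft>g0 : Y \<rightarrow> Z\<guillemotright>" "g = cls g0" using Hom_CWE[OF ob(2,3) fg(2)] .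
    from f g show ?thesis using comp_CW[of f0 X Y g0 Z] cls_Hom[of "g0 \<bullet> f0" X Z] by simp
  qed
  show "f \<bullet>\<^bsub>CW\<^esub> Ide CW X = f" "Ide CW Y \<bullet>\<^bsub>CW\<^esub> f = f" if ob: "X \<in> Ob C" "Y \<in> Ob C" and f: "f \<in> Hom CW X Y" for X Y f
  proof -
    obtain f0 where "\<guillemotleft>f0 : X \<rightarrow> Y\<guillemotright>" "f = cls f0" using Hom_CWE[OF ob f] .
    then show "f \<bullet>\<^bsub>CW\<^esub> Ide CW X = f" "Ide CW Y \<bullet>\<^bsub>CW\<^esub> f = f"
      using comp_CW[of "Ide C X" X X f0 Y] comp_CW[of f0 X Y "Ide C Y" Y] ob by (simp_all add: Ide_CW)
  qed
  show "(h \<bullet>\<^bsub>CW\<^esub> g) \<bullet>\<^bsub>CW\<^esub> f = h \<bullet>\<^bsub>CW\<^esub> (g \<bullet>\<^bsub>CW\<^esub> f)"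
    if ob: "X \<in> Ob C" "Y \<in> Ob C" "Z \<in> Ob C" "R \<in> Ob C"
      and fg: "f \<in> Hom CW X Y" "g \<in> Hom CW Y Z" "h \<in> Hom CW Z R" for X Y Z R f g h
  proof -
    obtain f0 where f: "\<guillemotleft>f0 : X \<rightarrow> Y\<guillemotright>" "f = cls f0" using Hom_CWE[OF ob(1,2) fg(1)] .
    obtain g0 where g: "\<guillemotleft>g0 : Y \<rightarrow> Z\<guillemotright>" "g = cls g0" using Hom_CWE[OF ob(2,3) fg(2)] .
    obtain h0 where h: "\<guillemotleft>h0 : Z \<rightarrow> R\<guillemotright>" "h = cls h0" using Hom_CWE[OF ob(3,4) fg(3)] .
    have "(h \<bullet>\<^bsub>CW\<^esub> g) \<bullet>\<^bsub>CW\<^esub> f = cls ((h0 \<bullet> g0) \<bullet> f0)"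
      using f g h by (simp add: comp_CW[OF g(1) h(1)] comp_CW[of f0 X Y "h0 \<bullet> g0" R])
    moreover have "h \<bullet>\<^bsub>CW\<^esub> (g \<bullet>\<^bsub>CW\<^esub> f) = cls (h0 \<bullet> (g0 \<bullet> f0))"
      using f g h by (simp add: comp_CW[OF f(1) g(1)] comp_CW[of "g0 \<bullet> f0" X Z h0 R])
    ultimately show ?thesis using f(1) g(1) h(1) by (simp add: comp_assoc)
  qed
  show "(g \<otimes>\<^bsub>Mor CW Y Z\<^esub> g') \<bullet>\<^bsub>CW\<^esub> f = (g \<bullet>\<^bsub>CW\<^esub> f) \<otimes>\<^bsub>Mor CW X Z\<^esub> (g' \<bullet>\<^bsub>CW\<^esub> f)"
    if ob: "X \<in> Ob C" "Y \<in> Ob C" "Z \<in> Ob C"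
      and fg: "f \<in> Hom CW X Y" "g \<in> Hom CW Y Z" "g' \<in> Hom CW Y Z" for X Y Z f g g'
  proof -
    obtain f0 where f: "\<guillemotleft>f0 : X \<rightarrow> Y\<guillemotright>" "f = cls f0" using Hom_CWE[OF ob(1,2) fg(1)] .
    obtain g0 where g: "\<guillemotleft>g0 : Y \<rightarrow> Z\<guillemotright>" "g = cls g0" using Hom_CWE[OF ob(2,3) fg(2)] .
    obtain h0 where h: "\<guillemotleft>h0 : Y \<rightarrow> Z\<guillemotright>" "g' = cls h0" using Hom_CWE[OF ob(2,3) fg(3)] .
    show ?thesis unfolding f(2) g(2) h(2) mult_CW[OF g(1) h(1)] comp_CW[OF f(1) g(1)] comp_CW[OF f(1) h(1)]
      using f(1) g(1) h(1) comp_CW[of f0 X Y "g0 \<boxplus> h0" Z] mult_CW[of "g0 \<bullet> f0" X Z "h0 \<bullet> f0"]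
      by (simp add: comp_add_left)
  qed
  show "g \<bullet>\<^bsub>CW\<^esub> (f \<otimes>\<^bsub>Mor CW X Y\<^esub> f') = (g \<bullet>\<^bsub>CW\<^esub> f) \<otimes>\<^bsub>Mor CW X Z\<^esub> (g \<bullet>\<^bsub>CW\<^esub> f')"
    if ob: "X \<in> Ob C" "Y \<in> Ob C" "Z \<in> Ob C"
      and fg: "f \<in> Hom CW X Y" "f' \<in> Hom CW X Y" "g \<in> Hom CW Y Z" for X Y Z f f' g
  proof -
    obtain f0 where f: "\<guillemotleft>f0 : X \<rightarrow> Y\<guillemotright>" "f = cls f0" using Hom_CWE[OF ob(1,2) fg(1)] .
    obtain g0 where g: "\<guillemotleft>g0 : Y \<rightarrow> Z\<guillemotright>" "g = cls g0" using Hom_CWE[OF ob(2,3) fg(3)] .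
    obtain h0 where h: "\<guillemotleft>h0 : X \<rightarrow> Y\<guillemotright>" "f' = cls h0" using Hom_CWE[OF ob(1,2) fg(2)] .
    show ?thesis unfolding f(2) g(2) h(2) mult_CW[OF f(1) h(1)] comp_CW[OF f(1) g(1)] comp_CW[OF h(1) g(1)]
      using f(1) g(1) h(1) comp_CW[of "f0 \<boxplus> h0" X Y g0 Z] mult_CW[of "g0 \<bullet> f0" X Z "g0 \<bullet> h0"]
      by (simp add: comp_add_right)
  qed
qed

lemma additive_quotient_functor: "additive_functor C CW (quotient_functor C W)"
  unfolding quotient_functor_def
proof (rule additive_functorI; simp)
  show "cls f \<in> Hom CW X Y" if "X \<in> Ob C" "Y \<in> Ob C" "f \<in> Hom C X Y" for X Y f
    using cls_Hom in_homI[OF that] by blast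
  show "cls (f \<otimes>\<^bsub>Mor C X Y\<^esub> g) = cls f \<otimes>\<^bsub>Mor CW X Y\<^esub> cls g"
    if "X \<in> Ob C" "Y \<in> Ob C" "f \<in> Hom C X Y" "g \<in> Hom C X Y" for X Y f g
    using mult_CW[of f X Y g] in_homI that by (simp add: add_def)
  show "cls (Ide C X) = Ide CW X" if "X \<in> Ob C" for X by (simp add: Ide_CW)
  show "cls (g \<bullet> f) = cls g \<bullet>\<^bsub>CW\<^esub> cls f"
    if "X \<in> Ob C" "Y \<in> Ob C" "Z \<in> Ob C" "f \<in> Hom C X Y" "g \<in> Hom C Y Z" for X Y Z f g
    using comp_CW[of f X Y g Z] in_homI that by simp
qed

end

text \<open>The ideal refers to \<open>C\<close> only through Hom-sets and composition, not through
  its object class. The two categories are therefore literally equal, and a single interpretation of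
  \<open>ideal_quotient\<close> serves all stable categories.\<close>

lemma quotient_full_subcat:
  "quotient_cat (full_subcat C S) W = full_subcat (quotient_cat C W) S"
  by (simp add: quotient_cat_def full_subcat_def factor_ideal_def ideal_class_def)

lemma full_subcat_self: "Ob C = S \<Longrightarrow> full_subcat C S = C" for C :: "('o, 'm) precat"
  by (simp add: full_subcat_def)

section \<open>Presheaves of abelian groups\<close>

lemma Ab_Hom: "\<phi> \<in> Hom Ab A B \<longleftrightarrow> (\<exists>h. \<phi> = (A, B, h) \<and> h \<in> hom A B \<and> h \<in> extensional (carrier A))"
  by (simp add: Ab_def)

lemma Ab_HomI: assumes "h \<in> hom A B" "comm_group A" shows "(A, B, \<lambda>x \<in> carrier A. h x) \<in> Hom Ab A B"
proof -
  interpret comm_group A by fact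
  have "(\<lambda>x \<in> carrier A. h x) \<in> hom A B" using assms(1) by (simp add: hom_def Pi_iff)
  then show ?thesis unfolding Ab_Hom by simp
qed

lemma Ab_HomE:
  assumes "\<phi> \<in> Hom Ab A B"
  shows "\<phi> = (A, B, ab_fun \<phi>)" "ab_fun \<phi> \<in> hom A B" "ab_fun \<phi> \<in> extensional (carrier A)"
  using assms unfolding Ab_Hom ab_fun_def by auto

lemma Ab_eqI:
  assumes "\<phi> \<in> Hom Ab A B" "\<psi> \<in> Hom Ab A B" "\<And>x. x \<in> carrier A \<Longrightarrow> ab_fun \<phi> x = ab_fun \<psi> x"
  shows "\<phi> = \<psi>"
proof -
  have "ab_fun \<phi> = ab_fun \<psi>" using Ab_HomE(3)[OF assms(1)] Ab_HomE(3)[OF assms(2)] assms(3) by (rule extensionalityI)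
  then show ?thesis using Ab_HomE(1)[OF assms(1)] Ab_HomE(1)[OF assms(2)] by metis
qed

lemma Ab_Comp:
  "\<lbrakk>\<phi> \<in> Hom Ab A B; \<psi> \<in> Hom Ab B D\<rbrakk> \<Longrightarrow> \<psi> \<bullet>\<^bsub>Ab\<^esub> \<phi> = (A, D, \<lambda>x \<in> carrier A. ab_fun \<psi> (ab_fun \<phi> x))"
  unfolding Ab_Hom ab_fun_def by (auto simp: Ab_def)

lemma Ab_Comp_Hom: assumes "\<phi> \<in> Hom Ab A B" "\<psi> \<in> Hom Ab B D" "comm_group A" shows "\<psi> \<bullet>\<^bsub>Ab\<^esub> \<phi> \<in> Hom Ab A D"
proof -
  have "(\<lambda>x. ab_fun \<psi> (ab_fun \<phi> x)) \<in> hom A D"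
    using Ab_HomE(2)[OF assms(1)] Ab_HomE(2)[OF assms(2)] by (auto simp: hom_def Pi_iff)
  then show ?thesis unfolding Ab_Comp[OF assms(1,2)] using assms(3) by (rule Ab_HomI)
qed

lemma ab_fun_triple [simp]: "ab_fun (A, B, h) = h"
  by (simp add: ab_fun_def)

lemma Ab_mult:
  "\<lbrakk>\<phi> \<in> Hom Ab A B; \<psi> \<in> Hom Ab A B\<rbrakk> \<Longrightarrow>
   \<phi> \<otimes>\<^bsub>Mor Ab A B\<^esub> \<psi> = (A, B, \<lambda>x \<in> carrier A. ab_fun \<phi> x \<otimes>\<^bsub>B\<^esub> ab_fun \<psi> x)"
  unfolding Ab_Hom ab_fun_def by (auto simp: Ab_def)

lemma Ab_mult_Hom:
  assumes "\<phi> \<in> Hom Ab A B" "\<psi> \<in> Hom Ab A B" "comm_group A" "comm_group B"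
  shows "\<phi> \<otimes>\<^bsub>Mor Ab A B\<^esub> \<psi> \<in> Hom Ab A B"
proof -
  interpret comm_group B by fact
  have "(\<lambda>x. ab_fun \<phi> x \<otimes>\<^bsub>B\<^esub> ab_fun \<psi> x) \<in> hom A B"
    using Ab_HomE(2)[OF assms(1)] Ab_HomE(2)[OF assms(2)] by (auto simp: hom_def Pi_iff m_ac)
  then show ?thesis unfolding Ab_mult[OF assms(1,2)] using assms(3) by (rule Ab_HomI)
qed

lemma Ab_Zero: "Zero Ab A B = (A, B, \<lambda>x \<in> carrier A. \<one>\<^bsub>B\<^esub>)"
  by (simp add: Ab_def)

lemma Ab_Ide: "Ide Ab A = (A, A, \<lambda>x \<in> carrier A. x)"
  by (simp add: Ab_def)

lemma Ab_Ide_Hom: "comm_group A \<Longrightarrow> Ide Ab A \<in> Hom Ab A A"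
  unfolding Ab_Ide by (rule Ab_HomI) (simp_all add: hom_def)

lemma Ob_Ab: "A \<in> Ob Ab \<longleftrightarrow> comm_group A"
  by (simp add: Ab_def)

abbreviation El :: "('o, 'm) presheaf \<Rightarrow> 'o \<Rightarrow> 'm set" where "El F Z \<equiv> carrier (fobj F Z)"

abbreviation res :: "('o, 'm) presheaf \<Rightarrow> 'm \<Rightarrow> 'm \<Rightarrow> 'm" where "res F f \<equiv> ab_fun (farr F f)"

text \<open>Arrows of presheaves are nested triples with extensional components. \<open>ev\<close>
  extracts the underlying function at an object and \<open>psh_arr\<close> rebuilds an arrow from
  such functions, so that all calculations take place on elements.\<close>

definition ev :: "('o, 'm) presheaf_arrow \<Rightarrow> 'o \<Rightarrow> 'm \<Rightarrow> 'm" where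
  "ev \<alpha> Z = ab_fun (snd (snd \<alpha>) Z)"

definition psh_arr :: "'o set \<Rightarrow> ('o, 'm) presheaf \<Rightarrow> ('o, 'm) presheaf \<Rightarrow> ('o \<Rightarrow> 'm \<Rightarrow> 'm) \<Rightarrow> ('o, 'm) presheaf_arrow" where
  "psh_arr S F G \<phi> = (F, G, \<lambda>Z \<in> S. (fobj F Z, fobj G Z, \<lambda>x \<in> El F Z. \<phi> Z x))"

lemma ev_psh_arr [simp]: "\<lbrakk>Z \<in> S; x \<in> El F Z\<rbrakk> \<Longrightarrow> ev (psh_arr S F G \<phi>) Z x = \<phi> Z x"
  by (simp add: ev_def psh_arr_def)

lemma psh_arr_cong:
  "(\<And>Z x. \<lbrakk>Z \<in> S; x \<in> El F Z\<rbrakk> \<Longrightarrow> \<phi> Z x = \<psi> Z x) \<Longrightarrow> psh_arr S F G \<phi> = psh_arr S F G \<psi>"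
  by (auto simp: psh_arr_def intro!: restrict_ext)

text \<open>The ambient \<open>C\<close> is kept beside \<open>S\<close> because restrictions of
  \<open>C(-, X)\<close> are needed for objects \<open>X\<close> outside \<open>S\<close> as well.
  Restriction maps are indexed by the morphisms of \<open>C\<close> with both ends in
  \<open>S\<close>.\<close>

locale presheaves = preadditive_category C
  for C :: "('o, 'm, 'z) precat_scheme" (structure) +
  fixes S :: "'o set"
  assumes S: "S \<subseteq> Ob C"
begin

abbreviation PSh :: "(('o, 'm) presheaf, ('o, 'm) presheaf_arrow) precat" where
  "PSh \<equiv> presheaf_cat (full_subcat C S)"

abbreviation SArr :: "'m \<Rightarrow> bool" where "SArr f \<equiv> arr f \<and> Src C f \<in> S \<and> Tgt C f \<in> S"

lemma S_Ob [simp]: "Z \<in> S \<Longrightarrow> Z \<in> Ob C"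
  using S by blast

lemma Ob_PSh: "F \<in> Ob PSh \<longleftrightarrow> additive_functor (opposite (full_subcat C S)) Ab F"
  by (simp add: presheaf_cat_def functor_cat_def)

lemma presheaf_group: "\<lbrakk>F \<in> Ob PSh; Z \<in> S\<rbrakk> \<Longrightarrow> comm_group (fobj F Z)"
  using additive_functor_ob[of "opposite (full_subcat C S)" Ab F Z] by (simp add: Ob_PSh Ob_Ab opposite_def)

lemma presheaf_group': "\<lbrakk>F \<in> Ob PSh; Z \<in> S\<rbrakk> \<Longrightarrow> group (fobj F Z)"
  using presheaf_group comm_group_def by blast

lemma presheaf_farr: "\<lbrakk>F \<in> Ob PSh; SArr f\<rbrakk> \<Longrightarrow> farr F f \<in> Hom Ab (fobj F (Tgt C f)) (fobj F (Src C f))"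
  using additive_functor_Hom[of "opposite (full_subcat C S)" Ab F "Tgt C f" "Src C f" f]
  by (simp add: Ob_PSh opposite_def)

lemma res_hom: "\<lbrakk>F \<in> Ob PSh; SArr f\<rbrakk> \<Longrightarrow> res F f \<in> hom (fobj F (Tgt C f)) (fobj F (Src C f))"
  using Ab_HomE(2) presheaf_farr by blast

lemma res_closed [simp]: "\<lbrakk>F \<in> Ob PSh; SArr f; x \<in> El F (Tgt C f)\<rbrakk> \<Longrightarrow> res F f x \<in> El F (Src C f)"
  using res_hom by (simp add: hom_def Pi_iff)

lemma res_mult:
  "\<lbrakk>F \<in> Ob PSh; SArr f; x \<in> El F (Tgt C f); y \<in> El F (Tgt C f)\<rbrakk>
   \<Longrightarrow> res F f (x \<otimes>\<^bsub>fobj F (Tgt C f)\<^esub> y) = res F f x \<otimes>\<^bsub>fobj F (Src C f)\<^esub> res F f y"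
  using res_hom by (simp add: hom_def)

lemma res_one [simp]: "\<lbrakk>F \<in> Ob PSh; SArr f; Tgt C f = Z\<rbrakk> \<Longrightarrow> res F f \<one>\<^bsub>fobj F Z\<^esub> = \<one>\<^bsub>fobj F (Src C f)\<^esub>"
  using hom_one[OF res_hom[of F f]] presheaf_group' by simp

lemma res_Ide [simp]: "\<lbrakk>F \<in> Ob PSh; Z \<in> S; x \<in> El F Z\<rbrakk> \<Longrightarrow> res F (Ide C Z) x = x"
  using additive_functor_Ide[of "opposite (full_subcat C S)" Ab F Z]
  by (simp add: Ob_PSh opposite_def Ab_Ide)

lemma res_comp:
  assumes "F \<in> Ob PSh" "SArr f" "SArr g" "Src C g = Tgt C f" "x \<in> El F (Tgt C g)"
  shows "res F (g \<bullet> f) x = res F f (res F g x)"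
proof -
  have "farr F (g \<bullet> f) = farr F f \<bullet>\<^bsub>Ab\<^esub> farr F g"
    using additive_functor_Comp[of "opposite (full_subcat C S)" Ab F "Tgt C g" "Tgt C f" "Src C f" g f] assms arr_Hom[of g]
    by (simp add: Ob_PSh opposite_def)
  then show ?thesis
    using Ab_Comp[of "farr F g" "fobj F (Tgt C g)" "fobj F (Tgt C f)" "farr F f" "fobj F (Src C f)"]
      presheaf_farr[of F f] presheaf_farr[of F g] assms by simp
qed

lemma res_add:
  assumes "F \<in> Ob PSh" "SArr f" "par f g" "x \<in> El F (Tgt C f)"
  shows "res F (f \<boxplus> g) x = res F f x \<otimes>\<^bsub>fobj F (Src C f)\<^esub> res F g x"
proof -
  have "farr F (f \<boxplus> g) = farr F f \<otimes>\<^bsub>Mor Ab (fobj F (Tgt C f)) (fobj F (Src C f))\<^esub> farr F g"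
    using additive_functor_mult[of "opposite (full_subcat C S)" Ab F "Tgt C f" "Src C f" f g] assms arr_Hom[of g]
    by (simp add: Ob_PSh opposite_def add_def)
  then show ?thesis
    using Ab_mult[of "farr F f" "fobj F (Tgt C f)" "fobj F (Src C f)" "farr F g"]
      presheaf_farr[of F f] presheaf_farr[of F g] assms by simp
qed

lemma res_zero [simp]:
  assumes "F \<in> Ob PSh" "X \<in> S" "Y \<in> S" "x \<in> El F Y"
  shows "res F (zero X Y) x = \<one>\<^bsub>fobj F X\<^esub>"
proof -
  interpret group "fobj F X" using presheaf_group' assms by blast
  have "res F (zero X Y) x \<otimes>\<^bsub>fobj F X\<^esub> res F (zero X Y) x = res F (zero X Y) x"
    using res_add[of F "zero X Y" "zero X Y" x] assms by simp
  moreover have "res F (zero X Y) x \<in> El F X" using res_closed[of F "zero X Y" x] assms by simp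
  ultimately show ?thesis by simp
qed

lemma presheafI:
  assumes grp: "\<And>Z. Z \<in> S \<Longrightarrow> comm_group (fobj F Z)"
    and farr: "\<And>f. SArr f \<Longrightarrow> farr F f \<in> Hom Ab (fobj F (Tgt C f)) (fobj F (Src C f))"
    and Ide: "\<And>Z x. \<lbrakk>Z \<in> S; x \<in> El F Z\<rbrakk> \<Longrightarrow> res F (Ide C Z) x = x"
    and add: "\<And>f g x. \<lbrakk>SArr f; par f g; x \<in> El F (Tgt C f)\<rbrakk>
      \<Longrightarrow> res F (f \<boxplus> g) x = res F f x \<otimes>\<^bsub>fobj F (Src C f)\<^esub> res F g x"
    and comp: "\<And>f g x. \<lbrakk>SArr f; SArr g; Src C g = Tgt C f; x \<in> El F (Tgt C g)\<rbrakk>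
      \<Longrightarrow> res F (g \<bullet> f) x = res F f (res F g x)"
  shows "F \<in> Ob PSh"
  unfolding Ob_PSh
proof (rule additive_functorI; simp add: opposite_def Ob_Ab grp)
  show F: "farr F f \<in> Hom Ab (fobj F X) (fobj F Y)" if "X \<in> S" "Y \<in> S" "f \<in> Hom C Y X" for X Y f
    using farr[of f] in_homI[of Y X f] that by simp
  show "farr F (Ide C Z) = Ide Ab (fobj F Z)" if Z: "Z \<in> S" for Z
  proof (rule Ab_eqI)
    show "farr F (Ide C Z) \<in> Hom Ab (fobj F Z) (fobj F Z)" using farr[of "Ide C Z"] Z by simp
    show "Ide Ab (fobj F Z) \<in> Hom Ab (fobj F Z) (fobj F Z)" using grp[OF Z] by (rule Ab_Ide_Hom)
    show "res F (Ide C Z) x = ab_fun (Ide Ab (fobj F Z)) x" if "x \<in> El F Z" for x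
      using Ide[OF Z that] that by (simp add: Ab_Ide)
  qed
  show "farr F (f \<otimes>\<^bsub>Mor C Y X\<^esub> g) = farr F f \<otimes>\<^bsub>Mor Ab (fobj F X) (fobj F Y)\<^esub> farr F g"
    if XY: "X \<in> S" "Y \<in> S" and fg: "f \<in> Hom C Y X" "g \<in> Hom C Y X" for X Y f g
  proof -
    note h = in_homI[OF S_Ob[OF XY(2)] S_Ob[OF XY(1)] fg(1)] in_homI[OF S_Ob[OF XY(2)] S_Ob[OF XY(1)] fg(2)]
    have eq: "f \<otimes>\<^bsub>Mor C Y X\<^esub> g = f \<boxplus> g" using h by (simp add: add_def)
    show ?thesis
      unfolding eq
    proof (rule Ab_eqI)
      show "farr F (f \<boxplus> g) \<in> Hom Ab (fobj F X) (fobj F Y)" using farr[of "f \<boxplus> g"] h XY by simp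
      show "farr F f \<otimes>\<^bsub>Mor Ab (fobj F X) (fobj F Y)\<^esub> farr F g \<in> Hom Ab (fobj F X) (fobj F Y)"
        using F[OF XY] fg grp[OF XY(1)] grp[OF XY(2)] by (intro Ab_mult_Hom) simp_all
      show "res F (f \<boxplus> g) x = ab_fun (farr F f \<otimes>\<^bsub>Mor Ab (fobj F X) (fobj F Y)\<^esub> farr F g) x" if "x \<in> El F X" for x
        using add[of f g x] h XY that Ab_mult[OF F[OF XY fg(1)] F[OF XY fg(2)]] by simp
    qed
  qed
  show "farr F (f \<bullet> g) = farr F g \<bullet>\<^bsub>Ab\<^esub> farr F f"
    if XY: "X \<in> S" "Y \<in> S" "Z \<in> S" and fg: "f \<in> Hom C Y X" "g \<in> Hom C Z Y" for X Y Z f g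
  proof -
    note h = in_homI[OF S_Ob[OF XY(2)] S_Ob[OF XY(1)] fg(1)] in_homI[OF S_Ob[OF XY(3)] S_Ob[OF XY(2)] fg(2)]
    note FF = F[OF XY(1,2) fg(1)] F[OF XY(2,3) fg(2)]
    show ?thesis
    proof (rule Ab_eqI)
      show "farr F (f \<bullet> g) \<in> Hom Ab (fobj F X) (fobj F Z)" using farr[of "f \<bullet> g"] h XY by simp
      show "farr F g \<bullet>\<^bsub>Ab\<^esub> farr F f \<in> Hom Ab (fobj F X) (fobj F Z)"
        using Ab_Comp_Hom[OF FF grp[OF XY(1)]] .
      show "res F (f \<bullet> g) x = ab_fun (farr F g \<bullet>\<^bsub>Ab\<^esub> farr F f) x" if "x \<in> El F X" for x
        using comp[of g f x] h XY that Ab_Comp[OF FF] by simp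
    qed
  qed
qed

section \<open>Arrows of presheaves, their sums and composites\<close>

lemma Hom_PSh:
  "\<alpha> \<in> Hom PSh F G \<longleftrightarrow> (\<exists>\<eta>. \<alpha> = (F, G, \<eta>) \<and> nat_trans (opposite (full_subcat C S)) Ab F G \<eta> \<and> \<eta> \<in> extensional S)"
  by (simp add: presheaf_cat_def functor_cat_def opposite_def)

lemma Hom_PSh_Ob: "\<alpha> \<in> Hom PSh F G \<Longrightarrow> F \<in> Ob PSh" "\<alpha> \<in> Hom PSh F G \<Longrightarrow> G \<in> Ob PSh"
  unfolding Hom_PSh Ob_PSh nat_trans_def by blast+

lemma psh_component:
  assumes "\<alpha> \<in> Hom PSh F G" "Z \<in> S"
  shows "snd (snd \<alpha>) Z \<in> Hom Ab (fobj F Z) (fobj G Z)"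
  using assms unfolding Hom_PSh by (auto simp: opposite_def dest: nat_trans_component)

lemma ev_hom: "\<lbrakk>\<alpha> \<in> Hom PSh F G; Z \<in> S\<rbrakk> \<Longrightarrow> ev \<alpha> Z \<in> hom (fobj F Z) (fobj G Z)"
  unfolding ev_def by (rule Ab_HomE(2)[OF psh_component])

lemma ev_closed [simp]: "\<lbrakk>\<alpha> \<in> Hom PSh F G; Z \<in> S; x \<in> El F Z\<rbrakk> \<Longrightarrow> ev \<alpha> Z x \<in> El G Z"
  using ev_hom[of \<alpha> F G Z] by (auto simp: hom_def Pi_iff)

lemma ev_mult:
  "\<lbrakk>\<alpha> \<in> Hom PSh F G; Z \<in> S; x \<in> El F Z; y \<in> El F Z\<rbrakk>
   \<Longrightarrow> ev \<alpha> Z (x \<otimes>\<^bsub>fobj F Z\<^esub> y) = ev \<alpha> Z x \<otimes>\<^bsub>fobj G Z\<^esub> ev \<alpha> Z y"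
  using ev_hom[of \<alpha> F G Z] by (auto simp: hom_def)

lemma ev_one: "\<lbrakk>\<alpha> \<in> Hom PSh F G; Z \<in> S\<rbrakk> \<Longrightarrow> ev \<alpha> Z \<one>\<^bsub>fobj F Z\<^esub> = \<one>\<^bsub>fobj G Z\<^esub>"
  using hom_one[OF ev_hom[of \<alpha> F G Z]] presheaf_group' Hom_PSh_Ob by blast

lemma ev_natural:
  assumes "\<alpha> \<in> Hom PSh F G" "SArr f" "x \<in> El F (Tgt C f)"
  shows "ev \<alpha> (Src C f) (res F f x) = res G f (ev \<alpha> (Tgt C f) x)"
proof -
  obtain \<eta> where \<eta>: "\<alpha> = (F, G, \<eta>)" "nat_trans (opposite (full_subcat C S)) Ab F G \<eta>"
    using assms(1) unfolding Hom_PSh by blast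
  have "\<eta> (Src C f) \<bullet>\<^bsub>Ab\<^esub> farr F f = farr G f \<bullet>\<^bsub>Ab\<^esub> \<eta> (Tgt C f)"
    using nat_trans_natural[OF \<eta>(2), of "Tgt C f" "Src C f" f] assms(2) by (simp add: opposite_def)
  moreover note psh_component[OF assms(1), of "Src C f"] psh_component[OF assms(1), of "Tgt C f"]
  moreover have "farr F f \<in> Hom Ab (fobj F (Tgt C f)) (fobj F (Src C f))"
    "farr G f \<in> Hom Ab (fobj G (Tgt C f)) (fobj G (Src C f))"
    using presheaf_farr Hom_PSh_Ob[OF assms(1)] assms(2) by blast+
  ultimately have "(\<lambda>x \<in> El F (Tgt C f). ab_fun (\<eta> (Src C f)) (res F f x)) =
      (\<lambda>x \<in> El F (Tgt C f). res G f (ab_fun (\<eta> (Tgt C f)) x))"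
    using assms(2) \<eta>(1) by (simp add: Ab_Comp)
  from fun_cong[OF this, of x] show ?thesis using assms(3) \<eta>(1) by (simp add: ev_def)
qed

lemma psh_arr_ev: assumes "\<alpha> \<in> Hom PSh F G" shows "\<alpha> = psh_arr S F G (ev \<alpha>)"
proof -
  obtain \<eta> where \<eta>: "\<alpha> = (F, G, \<eta>)" "\<eta> \<in> extensional S"
    using assms unfolding Hom_PSh by blast
  have "\<eta> = (\<lambda>Z \<in> S. (fobj F Z, fobj G Z, \<lambda>x \<in> El F Z. ev \<alpha> Z x))"
  proof (rule extensionalityI[OF \<eta>(2)])
    fix Z assume Z: "Z \<in> S"
    have *: "\<eta> Z \<in> Hom Ab (fobj F Z) (fobj G Z)" using psh_component[OF assms Z] \<eta>(1) by simp
    have "\<eta> Z = (fobj F Z, fobj G Z, \<lambda>x \<in> El F Z. ab_fun (\<eta> Z) x)"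
      using Ab_HomE(1)[OF *] extensional_restrict[OF Ab_HomE(3)[OF *]] by simp
    then show "\<eta> Z = (\<lambda>Z \<in> S. (fobj F Z, fobj G Z, \<lambda>x \<in> El F Z. ev \<alpha> Z x)) Z"
      using Z \<eta>(1) by (simp add: ev_def)
  qed simp
  then show ?thesis using \<eta>(1) by (simp add: psh_arr_def)
qed

lemma psh_eqI:
  assumes "\<alpha> \<in> Hom PSh F G" "\<beta> \<in> Hom PSh F G" "\<And>Z x. \<lbrakk>Z \<in> S; x \<in> El F Z\<rbrakk> \<Longrightarrow> ev \<alpha> Z x = ev \<beta> Z x"
  shows "\<alpha> = \<beta>"
proof -
  have "psh_arr S F G (ev \<alpha>) = psh_arr S F G (ev \<beta>)" using assms(3) by (rule psh_arr_cong)
  then show ?thesis using psh_arr_ev[OF assms(1)] psh_arr_ev[OF assms(2)] by simp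
qed

lemma psh_arr_Hom:
  assumes F: "F \<in> Ob PSh" and G: "G \<in> Ob PSh"
    and closed: "\<And>Z x. \<lbrakk>Z \<in> S; x \<in> El F Z\<rbrakk> \<Longrightarrow> \<phi> Z x \<in> El G Z"
    and mult: "\<And>Z x y. \<lbrakk>Z \<in> S; x \<in> El F Z; y \<in> El F Z\<rbrakk> \<Longrightarrow> \<phi> Z (x \<otimes>\<^bsub>fobj F Z\<^esub> y) = \<phi> Z x \<otimes>\<^bsub>fobj G Z\<^esub> \<phi> Z y"
    and natural: "\<And>f x. \<lbrakk>SArr f; x \<in> El F (Tgt C f)\<rbrakk> \<Longrightarrow> \<phi> (Src C f) (res F f x) = res G f (\<phi> (Tgt C f) x)"
  shows "psh_arr S F G \<phi> \<in> Hom PSh F G"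
proof -
  let ?\<eta> = "\<lambda>Z \<in> S. (fobj F Z, fobj G Z, \<lambda>x \<in> El F Z. \<phi> Z x)"
  have comp: "(fobj F Z, fobj G Z, \<lambda>x \<in> El F Z. \<phi> Z x) \<in> Hom Ab (fobj F Z) (fobj G Z)" if "Z \<in> S" for Z
    using closed mult that presheaf_group[OF F that] by (intro Ab_HomI) (simp_all add: hom_def Pi_iff)
  have "nat_trans (opposite (full_subcat C S)) Ab F G ?\<eta>"
  proof (rule nat_transI)
    show "additive_functor (opposite (full_subcat C S)) Ab F" "additive_functor (opposite (full_subcat C S)) Ab G"
      using F G Ob_PSh by blast+
    show "?\<eta> Z \<in> Hom Ab (fobj F Z) (fobj G Z)" if "Z \<in> Ob (opposite (full_subcat C S))" for Z
      using comp that by (simp add: opposite_def)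
    show "?\<eta> Y \<bullet>\<^bsub>Ab\<^esub> farr F f = farr G f \<bullet>\<^bsub>Ab\<^esub> ?\<eta> X"
      if "X \<in> Ob (opposite (full_subcat C S))" "Y \<in> Ob (opposite (full_subcat C S))"
        "f \<in> Hom (opposite (full_subcat C S)) X Y" for X Y f
    proof -
      have XY: "X \<in> S" "Y \<in> S" and f: "\<guillemotleft>f : Y \<rightarrow> X\<guillemotright>" using that in_homI[of Y X f] by (simp_all add: opposite_def)
      have "(\<lambda>x \<in> El F X. (\<lambda>x \<in> El F Y. \<phi> Y x) (res F f x)) = (\<lambda>x \<in> El F X. res G f ((\<lambda>x \<in> El F X. \<phi> X x) x))"
        using natural[of f] res_closed[OF F, of f] f XY by (intro restrict_ext) auto
      then show ?thesis
        using Ab_Comp[OF _ comp[OF XY(2)], of "farr F f"] Ab_Comp[OF comp[OF XY(1)], of "farr G f"]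
          presheaf_farr[OF F, of f] presheaf_farr[OF G, of f] f XY by simp
    qed
  qed
  then show ?thesis unfolding Hom_PSh psh_arr_def by blast
qed

lemma psh_Comp:
  assumes "\<alpha> \<in> Hom PSh F G" "\<beta> \<in> Hom PSh G H"
  shows "\<beta> \<bullet>\<^bsub>PSh\<^esub> \<alpha> = psh_arr S F H (\<lambda>Z x. ev \<beta> Z (ev \<alpha> Z x))"
proof -
  obtain \<eta> \<theta> where *: "\<alpha> = (F, G, \<eta>)" "\<beta> = (G, H, \<theta>)" using assms unfolding Hom_PSh by blast
  have "\<theta> Z \<bullet>\<^bsub>Ab\<^esub> \<eta> Z = (fobj F Z, fobj H Z, \<lambda>x \<in> El F Z. ev \<beta> Z (ev \<alpha> Z x))" if "Z \<in> S" for Z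
    using Ab_Comp[OF psh_component[OF assms(1) that] psh_component[OF assms(2) that]] * by (simp add: ev_def)
  then show ?thesis
    by (auto simp: * presheaf_cat_def functor_cat_def opposite_def psh_arr_def intro!: restrict_ext)
qed

lemma psh_Comp_Hom:
  assumes "\<alpha> \<in> Hom PSh F G" "\<beta> \<in> Hom PSh G H" shows "\<beta> \<bullet>\<^bsub>PSh\<^esub> \<alpha> \<in> Hom PSh F H"
  unfolding psh_Comp[OF assms]
  using Hom_PSh_Ob[OF assms(1)] Hom_PSh_Ob[OF assms(2)] assms
  by (intro psh_arr_Hom)
    (simp_all add: ev_mult[OF assms(1)] ev_mult[OF assms(2)] ev_natural[OF assms(1)] ev_natural[OF assms(2)]
      ev_closed[OF assms(1)] ev_closed[OF assms(2)])

lemma ev_comp: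
  "\<lbrakk>\<alpha> \<in> Hom PSh F G; \<beta> \<in> Hom PSh G H; Z \<in> S; x \<in> El F Z\<rbrakk> \<Longrightarrow> ev (\<beta> \<bullet>\<^bsub>PSh\<^esub> \<alpha>) Z x = ev \<beta> Z (ev \<alpha> Z x)"
  by (simp add: psh_Comp)

lemma psh_mult:
  assumes "\<alpha> \<in> Hom PSh F G" "\<beta> \<in> Hom PSh F G"
  shows "\<alpha> \<otimes>\<^bsub>Mor PSh F G\<^esub> \<beta> = psh_arr S F G (\<lambda>Z x. ev \<alpha> Z x \<otimes>\<^bsub>fobj G Z\<^esub> ev \<beta> Z x)"
proof -
  obtain \<eta> \<theta> where *: "\<alpha> = (F, G, \<eta>)" "\<beta> = (F, G, \<theta>)" using assms unfolding Hom_PSh by blast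
  have "\<eta> Z \<otimes>\<^bsub>Mor Ab (fobj F Z) (fobj G Z)\<^esub> \<theta> Z = (fobj F Z, fobj G Z, \<lambda>x \<in> El F Z. ev \<alpha> Z x \<otimes>\<^bsub>fobj G Z\<^esub> ev \<beta> Z x)"
    if "Z \<in> S" for Z
    using Ab_mult[OF psh_component[OF assms(1) that] psh_component[OF assms(2) that]] * by (simp add: ev_def)
  then show ?thesis
    by (auto simp: * presheaf_cat_def functor_cat_def opposite_def psh_arr_def intro!: restrict_ext)
qed

lemma psh_mult_Hom:
  assumes "\<alpha> \<in> Hom PSh F G" "\<beta> \<in> Hom PSh F G" shows "\<alpha> \<otimes>\<^bsub>Mor PSh F G\<^esub> \<beta> \<in> Hom PSh F G"
  unfolding psh_mult[OF assms]
proof (rule psh_arr_Hom)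
  show F: "F \<in> Ob PSh" and G: "G \<in> Ob PSh" using Hom_PSh_Ob[OF assms(1)] .
  show "ev \<alpha> Z x \<otimes>\<^bsub>fobj G Z\<^esub> ev \<beta> Z x \<in> El G Z" if "Z \<in> S" "x \<in> El F Z" for Z x
  proof -
    interpret comm_group "fobj G Z" using presheaf_group[OF G that(1)] .
    show ?thesis using ev_closed[OF assms(1) that] ev_closed[OF assms(2) that] by simp
  qed
  show "ev \<alpha> Z (x \<otimes>\<^bsub>fobj F Z\<^esub> y) \<otimes>\<^bsub>fobj G Z\<^esub> ev \<beta> Z (x \<otimes>\<^bsub>fobj F Z\<^esub> y) =
      (ev \<alpha> Z x \<otimes>\<^bsub>fobj G Z\<^esub> ev \<beta> Z x) \<otimes>\<^bsub>fobj G Z\<^esub> (ev \<alpha> Z y \<otimes>\<^bsub>fobj G Z\<^esub> ev \<beta> Z y)"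
    if "Z \<in> S" "x \<in> El F Z" "y \<in> El F Z" for Z x y
  proof -
    interpret comm_group "fobj G Z" using presheaf_group[OF G that(1)] .
    show ?thesis
      using ev_closed[OF assms(1)] ev_closed[OF assms(2)] that
      by (simp add: ev_mult[OF assms(1)] ev_mult[OF assms(2)] m_ac)
  qed
  show "ev \<alpha> (Src C f) (res F f x) \<otimes>\<^bsub>fobj G (Src C f)\<^esub> ev \<beta> (Src C f) (res F f x) =
      res G f (ev \<alpha> (Tgt C f) x \<otimes>\<^bsub>fobj G (Tgt C f)\<^esub> ev \<beta> (Tgt C f) x)"
    if "SArr f" "x \<in> El F (Tgt C f)" for f x
    using that ev_closed[OF assms(1)] ev_closed[OF assms(2)] G
    by (simp add: ev_natural[OF assms(1)] ev_natural[OF assms(2)] res_mult)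
qed

lemma ev_add:
  "\<lbrakk>\<alpha> \<in> Hom PSh F G; \<beta> \<in> Hom PSh F G; Z \<in> S; x \<in> El F Z\<rbrakk>
   \<Longrightarrow> ev (\<alpha> \<otimes>\<^bsub>Mor PSh F G\<^esub> \<beta>) Z x = ev \<alpha> Z x \<otimes>\<^bsub>fobj G Z\<^esub> ev \<beta> Z x"
  by (simp add: psh_mult)

lemma psh_Zero: "Zero PSh F G = psh_arr S F G (\<lambda>Z x. \<one>\<^bsub>fobj G Z\<^esub>)"
  by (auto simp: presheaf_cat_def functor_cat_def opposite_def psh_arr_def Ab_Zero intro!: restrict_ext)

lemma psh_Zero_Hom: assumes "F \<in> Ob PSh" "G \<in> Ob PSh" shows "Zero PSh F G \<in> Hom PSh F G"
  unfolding psh_Zero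
proof (rule psh_arr_Hom[OF assms])
  show "\<one>\<^bsub>fobj G Z\<^esub> \<in> El G Z" "\<one>\<^bsub>fobj G Z\<^esub> = \<one>\<^bsub>fobj G Z\<^esub> \<otimes>\<^bsub>fobj G Z\<^esub> \<one>\<^bsub>fobj G Z\<^esub>" if "Z \<in> S" for Z
  proof -
    interpret comm_group "fobj G Z" using presheaf_group[OF assms(2) that] .
    show "\<one>\<^bsub>fobj G Z\<^esub> \<in> El G Z" "\<one>\<^bsub>fobj G Z\<^esub> = \<one>\<^bsub>fobj G Z\<^esub> \<otimes>\<^bsub>fobj G Z\<^esub> \<one>\<^bsub>fobj G Z\<^esub>" by simp_all
  qed
qed (simp add: assms)

lemma ev_zero: "\<lbrakk>Z \<in> S; x \<in> El F Z\<rbrakk> \<Longrightarrow> ev (Zero PSh F G) Z x = \<one>\<^bsub>fobj G Z\<^esub>"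
  by (simp add: psh_Zero)

lemma psh_Ide: "Ide PSh F = psh_arr S F F (\<lambda>Z x. x)"
  by (auto simp: presheaf_cat_def functor_cat_def opposite_def psh_arr_def Ab_Ide intro!: restrict_ext)

lemma psh_Ide_Hom: assumes "F \<in> Ob PSh" shows "Ide PSh F \<in> Hom PSh F F"
  unfolding psh_Ide by (rule psh_arr_Hom[OF assms assms]) simp_all

lemma ev_Ide: "\<lbrakk>Z \<in> S; x \<in> El F Z\<rbrakk> \<Longrightarrow> ev (Ide PSh F) Z x = x"
  by (simp add: psh_Ide)

lemma psh_neg_exists:
  assumes \<alpha>: "\<alpha> \<in> Hom PSh F G"
  shows "\<exists>\<beta> \<in> Hom PSh F G. \<beta> \<otimes>\<^bsub>Mor PSh F G\<^esub> \<alpha> = Zero PSh F G"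
proof -
  have F: "F \<in> Ob PSh" and G: "G \<in> Ob PSh" using Hom_PSh_Ob[OF \<alpha>] .
  let ?\<beta> = "psh_arr S F G (\<lambda>Z x. inv\<^bsub>fobj G Z\<^esub> (ev \<alpha> Z x))"
  have \<beta>: "?\<beta> \<in> Hom PSh F G"
  proof (rule psh_arr_Hom[OF F G])
    fix Z x y assume Z: "Z \<in> S" and x: "x \<in> El F Z"
    interpret comm_group "fobj G Z" using presheaf_group[OF G Z] .
    show "inv\<^bsub>fobj G Z\<^esub> (ev \<alpha> Z x) \<in> El G Z" using ev_closed[OF \<alpha> Z x] by simp
    show "inv\<^bsub>fobj G Z\<^esub> (ev \<alpha> Z (x \<otimes>\<^bsub>fobj F Z\<^esub> y)) = inv\<^bsub>fobj G Z\<^esub> (ev \<alpha> Z x) \<otimes>\<^bsub>fobj G Z\<^esub> inv\<^bsub>fobj G Z\<^esub> (ev \<alpha> Z y)"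
      if y: "y \<in> El F Z"
      using ev_closed[OF \<alpha> Z] x y by (simp add: ev_mult[OF \<alpha> Z] inv_mult)
  next
    fix f x assume f: "SArr f" and x: "x \<in> El F (Tgt C f)"
    interpret group_hom "fobj G (Tgt C f)" "fobj G (Src C f)" "res G f"
      using presheaf_group'[OF G] res_hom[OF G f] f by (intro group_hom.intro group_hom_axioms.intro) simp_all
    show "inv\<^bsub>fobj G (Src C f)\<^esub> (ev \<alpha> (Src C f) (res F f x)) = res G f (inv\<^bsub>fobj G (Tgt C f)\<^esub> (ev \<alpha> (Tgt C f) x))"
      using f x ev_closed[OF \<alpha>] by (simp add: ev_natural[OF \<alpha>])
  qed
  have "?\<beta> \<otimes>\<^bsub>Mor PSh F G\<^esub> \<alpha> = Zero PSh F G"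
  proof (rule psh_eqI[OF psh_mult_Hom[OF \<beta> \<alpha>] psh_Zero_Hom[OF F G]])
    fix Z x assume Z: "Z \<in> S" and x: "x \<in> El F Z"
    interpret comm_group "fobj G Z" using presheaf_group[OF G Z] .
    show "ev (?\<beta> \<otimes>\<^bsub>Mor PSh F G\<^esub> \<alpha>) Z x = ev (Zero PSh F G) Z x"
      using ev_closed[OF \<alpha> Z x] by (simp add: ev_add[OF \<beta> \<alpha> Z x] ev_zero[OF Z x] Z x)
  qed
  then show ?thesis using \<beta> by blast
qed

lemma psh_comm_group: assumes F: "F \<in> Ob PSh" and G: "G \<in> Ob PSh" shows "comm_group (Mor PSh F G)"
proof (rule comm_groupI)
  show "\<one>\<^bsub>Mor PSh F G\<^esub> \<in> Hom PSh F G" using psh_Zero_Hom[OF F G] .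
  show "x \<otimes>\<^bsub>Mor PSh F G\<^esub> y \<in> Hom PSh F G" if "x \<in> Hom PSh F G" "y \<in> Hom PSh F G" for x y
    using psh_mult_Hom[OF that] .
  show "\<exists>y \<in> Hom PSh F G. y \<otimes>\<^bsub>Mor PSh F G\<^esub> x = \<one>\<^bsub>Mor PSh F G\<^esub>" if "x \<in> Hom PSh F G" for x
    using psh_neg_exists[OF that] .
next
  fix a assume a: "a \<in> Hom PSh F G"
  show "\<one>\<^bsub>Mor PSh F G\<^esub> \<otimes>\<^bsub>Mor PSh F G\<^esub> a = a"
  proof (rule psh_eqI[OF psh_mult_Hom[OF psh_Zero_Hom[OF F G] a] a])
    fix Z x assume Z: "Z \<in> S" and x: "x \<in> El F Z"
    interpret comm_group "fobj G Z" using presheaf_group[OF G Z] .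
    show "ev (Zero PSh F G \<otimes>\<^bsub>Mor PSh F G\<^esub> a) Z x = ev a Z x"
      using ev_closed[OF a Z x] by (simp add: ev_add[OF psh_Zero_Hom[OF F G] a Z x] ev_zero[OF Z x])
  qed
next
  fix a b assume a: "a \<in> Hom PSh F G" and b: "b \<in> Hom PSh F G"
  show "a \<otimes>\<^bsub>Mor PSh F G\<^esub> b = b \<otimes>\<^bsub>Mor PSh F G\<^esub> a"
  proof (rule psh_eqI[OF psh_mult_Hom[OF a b] psh_mult_Hom[OF b a]])
    fix Z x assume Z: "Z \<in> S" and x: "x \<in> El F Z"
    interpret comm_group "fobj G Z" using presheaf_group[OF G Z] .
    show "ev (a \<otimes>\<^bsub>Mor PSh F G\<^esub> b) Z x = ev (b \<otimes>\<^bsub>Mor PSh F G\<^esub> a) Z x"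
      using ev_closed[OF a Z x] ev_closed[OF b Z x] by (simp add: ev_add[OF a b Z x] ev_add[OF b a Z x] m_comm)
  qed
  fix c assume c: "c \<in> Hom PSh F G"
  note ab = psh_mult_Hom[OF a b] and bc = psh_mult_Hom[OF b c]
  show "a \<otimes>\<^bsub>Mor PSh F G\<^esub> b \<otimes>\<^bsub>Mor PSh F G\<^esub> c = a \<otimes>\<^bsub>Mor PSh F G\<^esub> (b \<otimes>\<^bsub>Mor PSh F G\<^esub> c)"
  proof (rule psh_eqI[OF psh_mult_Hom[OF ab c] psh_mult_Hom[OF a bc]])
    fix Z x assume Z: "Z \<in> S" and x: "x \<in> El F Z"
    interpret comm_group "fobj G Z" using presheaf_group[OF G Z] .
    show "ev (a \<otimes>\<^bsub>Mor PSh F G\<^esub> b \<otimes>\<^bsub>Mor PSh F G\<^esub> c) Z x = ev (a \<otimes>\<^bsub>Mor PSh F G\<^esub> (b \<otimes>\<^bsub>Mor PSh F G\<^esub> c)) Z x"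
      using ev_closed[OF a Z x] ev_closed[OF b Z x] ev_closed[OF c Z x]
      by (simp add: ev_add[OF a b Z x] ev_add[OF b c Z x] ev_add[OF ab c Z x] ev_add[OF a bc Z x] m_assoc)
  qed
qed

lemma preadditive_PSh: "preadditive_category PSh"
proof (rule preadditive_category.intro)
  show "comm_group (Mor PSh F G)" if "F \<in> Ob PSh" "G \<in> Ob PSh" for F G
    using psh_comm_group[OF that] .
  show "Src PSh a = F" "Tgt PSh a = G" if "a \<in> Hom PSh F G" for F G a
    using that unfolding Hom_PSh by (auto simp: presheaf_cat_def functor_cat_def)
  show "Ide PSh F \<in> Hom PSh F F" if "F \<in> Ob PSh" for F using psh_Ide_Hom[OF that] .
  show "b \<bullet>\<^bsub>PSh\<^esub> a \<in> Hom PSh F H" if "a \<in> Hom PSh F G" "b \<in> Hom PSh G H" for F G H a b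
    using psh_Comp_Hom[OF that] .
  show "a \<bullet>\<^bsub>PSh\<^esub> Ide PSh F = a" if "F \<in> Ob PSh" and a: "a \<in> Hom PSh F G" for F G a
    by (rule psh_eqI[OF psh_Comp_Hom[OF psh_Ide_Hom a] a]) (simp_all add: ev_comp[OF psh_Ide_Hom a] ev_Ide that)
  show "Ide PSh G \<bullet>\<^bsub>PSh\<^esub> a = a" if "G \<in> Ob PSh" and a: "a \<in> Hom PSh F G" for F G a
    by (rule psh_eqI[OF psh_Comp_Hom[OF a psh_Ide_Hom] a])
      (simp_all add: ev_comp[OF a psh_Ide_Hom] ev_Ide that ev_closed[OF a])
  show "(c \<bullet>\<^bsub>PSh\<^esub> b) \<bullet>\<^bsub>PSh\<^esub> a = c \<bullet>\<^bsub>PSh\<^esub> (b \<bullet>\<^bsub>PSh\<^esub> a)"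
    if a: "a \<in> Hom PSh F G" and b: "b \<in> Hom PSh G H" and c: "c \<in> Hom PSh H K" for F G H K a b c
    by (rule psh_eqI[OF psh_Comp_Hom[OF a psh_Comp_Hom[OF b c]] psh_Comp_Hom[OF psh_Comp_Hom[OF a b] c]])
      (simp add: ev_comp[OF a psh_Comp_Hom[OF b c]] ev_comp[OF psh_Comp_Hom[OF a b] c] ev_comp[OF a b]
        ev_comp[OF b c] ev_closed[OF a])
  show "(b \<otimes>\<^bsub>Mor PSh G H\<^esub> b') \<bullet>\<^bsub>PSh\<^esub> a = (b \<bullet>\<^bsub>PSh\<^esub> a) \<otimes>\<^bsub>Mor PSh F H\<^esub> (b' \<bullet>\<^bsub>PSh\<^esub> a)"
    if a: "a \<in> Hom PSh F G" and b: "b \<in> Hom PSh G H" "b' \<in> Hom PSh G H" for F G H a b b'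
    by (rule psh_eqI[OF psh_Comp_Hom[OF a psh_mult_Hom[OF b]] psh_mult_Hom[OF psh_Comp_Hom[OF a b(1)] psh_Comp_Hom[OF a b(2)]]])
      (simp add: ev_comp[OF a psh_mult_Hom[OF b]] ev_add[OF psh_Comp_Hom[OF a b(1)] psh_Comp_Hom[OF a b(2)]]
        ev_add[OF b] ev_comp[OF a b(1)] ev_comp[OF a b(2)] ev_closed[OF a])
  show "b \<bullet>\<^bsub>PSh\<^esub> (a \<otimes>\<^bsub>Mor PSh F G\<^esub> a') = (b \<bullet>\<^bsub>PSh\<^esub> a) \<otimes>\<^bsub>Mor PSh F H\<^esub> (b \<bullet>\<^bsub>PSh\<^esub> a')"
    if a: "a \<in> Hom PSh F G" "a' \<in> Hom PSh F G" and b: "b \<in> Hom PSh G H" for F G H a a' b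
    by (rule psh_eqI[OF psh_Comp_Hom[OF psh_mult_Hom[OF a] b] psh_mult_Hom[OF psh_Comp_Hom[OF a(1) b] psh_Comp_Hom[OF a(2) b]]])
      (simp add: ev_comp[OF psh_mult_Hom[OF a] b] ev_add[OF psh_Comp_Hom[OF a(1) b] psh_Comp_Hom[OF a(2) b]]
        ev_add[OF a] ev_comp[OF a(1) b] ev_comp[OF a(2) b] ev_closed[OF a(1)] ev_closed[OF a(2)] ev_mult[OF b])
qed

text \<open>The pointwise inverses are additive and natural because every element of
  \<open>G Z\<close> is a value of \<open>\<alpha>\<close>, so both laws may be checked on such
  values.\<close>

lemma psh_isoI:
  assumes \<alpha>: "\<alpha> \<in> Hom PSh F G"
    and bij: "\<And>Z. Z \<in> S \<Longrightarrow> bij_betw (ev \<alpha> Z) (El F Z) (El G Z)"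
  shows "iso_in PSh F G \<alpha>"
proof -
  have F: "F \<in> Ob PSh" and G: "G \<in> Ob PSh" using Hom_PSh_Ob[OF \<alpha>] .
  let ?j = "\<lambda>Z. inv_into (El F Z) (ev \<alpha> Z)"
  have j1: "?j Z (ev \<alpha> Z x) = x" if "Z \<in> S" "x \<in> El F Z" for Z x
    using bij_betw_inv_into_left[OF bij] that by blast
  have j2: "?j Z y \<in> El F Z" "ev \<alpha> Z (?j Z y) = y" if "Z \<in> S" "y \<in> El G Z" for Z y
    using bij_betw_inv_into_right[OF bij] bij_betw_apply[OF bij_betw_inv_into[OF bij]] that by blast+
  have surj: "\<exists>x \<in> El F Z. y = ev \<alpha> Z x" if "Z \<in> S" "y \<in> El G Z" for Z y
    using j2[OF that] by metis
  let ?\<beta> = "psh_arr S G F ?j"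
  have \<beta>: "?\<beta> \<in> Hom PSh G F"
  proof (rule psh_arr_Hom[OF G F])
    show "?j Z y \<in> El F Z" if "Z \<in> S" "y \<in> El G Z" for Z y using j2 that by blast
    fix Z x y assume Z: "Z \<in> S" and "x \<in> El G Z" "y \<in> El G Z"
    then obtain x' y' where xy: "x' \<in> El F Z" "x = ev \<alpha> Z x'" "y' \<in> El F Z" "y = ev \<alpha> Z y'" using surj by meson
    interpret comm_group "fobj F Z" using presheaf_group[OF F Z] .
    have "?j Z (ev \<alpha> Z (x' \<otimes>\<^bsub>fobj F Z\<^esub> y')) = x' \<otimes>\<^bsub>fobj F Z\<^esub> y'" using j1[OF Z] xy by simp
    then show "?j Z (x \<otimes>\<^bsub>fobj G Z\<^esub> y) = ?j Z x \<otimes>\<^bsub>fobj F Z\<^esub> ?j Z y"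
      using j1[OF Z] xy by (simp add: ev_mult[OF \<alpha> Z])
  next
    fix f y assume f: "SArr f" and "y \<in> El G (Tgt C f)"
    then obtain x where x: "x \<in> El F (Tgt C f)" "y = ev \<alpha> (Tgt C f) x" using surj by meson
    have "?j (Src C f) (ev \<alpha> (Src C f) (res F f x)) = res F f x" using j1[of "Src C f"] x f res_closed[OF F f] by simp
    then show "?j (Src C f) (res G f y) = res F f (?j (Tgt C f) y)"
      using x f j1[of "Tgt C f" x] by (simp add: ev_natural[OF \<alpha>])
  qed
  have "?\<beta> \<bullet>\<^bsub>PSh\<^esub> \<alpha> = Ide PSh F"
    by (rule psh_eqI[OF psh_Comp_Hom[OF \<alpha> \<beta>] psh_Ide_Hom[OF F]])
      (simp add: ev_comp[OF \<alpha> \<beta>] ev_Ide j1 ev_closed[OF \<alpha>])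
  moreover have "\<alpha> \<bullet>\<^bsub>PSh\<^esub> ?\<beta> = Ide PSh G"
    by (rule psh_eqI[OF psh_Comp_Hom[OF \<beta> \<alpha>] psh_Ide_Hom[OF G]])
      (simp add: ev_comp[OF \<beta> \<alpha>] ev_Ide j2)
  ultimately show ?thesis unfolding iso_in_def using \<alpha> \<beta> by blast
qed

end

section \<open>Representable presheaves and cokernels\<close>

text \<open>The quotient group is carried by coset representatives, so it lives on the type of \<open>G\<close>.\<close>

lemma quotient_by_representatives:
  fixes G :: "('a, 'b) monoid_scheme"
  assumes "comm_group G" and N: "subgroup N G"
  obtains Q :: "'a monoid" and r where "comm_group Q" "r \<in> hom G Q" "r ` carrier G = carrier Q"
    "\<And>x. x \<in> carrier G \<Longrightarrow> r x = \<one>\<^bsub>Q\<^esub> \<longleftrightarrow> x \<in> N"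
proof -
  interpret comm_group G by fact
  interpret N: normal N G using subgroup_imp_normal[OF N] .
  \<comment> \<open>The chosen representative depends on the coset alone, which makes
    \<open>r\<close> constant on cosets.\<close>
  define r where "r g = (SOME k. k \<in> N #>\<^bsub>G\<^esub> g)" for g
  have r_mem: "r g \<in> N #>\<^bsub>G\<^esub> g" if "g \<in> carrier G" for g
    unfolding r_def using rcos_self[OF that N] by (rule someI)
  have r_closed: "r g \<in> carrier G" if "g \<in> carrier G" for g
    using r_mem[OF that] r_coset_subset_G[OF N.subset that] by blast
  have r_coset: "N #>\<^bsub>G\<^esub> r g = N #>\<^bsub>G\<^esub> g" if "g \<in> carrier G" for g
    using repr_independence[OF r_mem[OF that] that N] by simp
  have r_cong: "r g = r h" if "N #>\<^bsub>G\<^esub> g = N #>\<^bsub>G\<^esub> h" for g h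
    unfolding r_def using that by simp
  \<comment> \<open>\<open>?H\<close> only serves as the target of a homomorphism and need not be a
    group; the image of \<open>r\<close> inside it is one.\<close>
  let ?H = "\<lparr>carrier = carrier G, monoid.mult = \<lambda>x y. r (x \<otimes>\<^bsub>G\<^esub> y), one = r \<one>\<^bsub>G\<^esub>\<rparr>"
  have hom: "r \<in> hom G ?H"
  proof (rule homI)
    show "r x \<in> carrier ?H" if "x \<in> carrier G" for x using r_closed[OF that] by simp
    fix x y assume xy: "x \<in> carrier G" "y \<in> carrier G"
    have "N #>\<^bsub>G\<^esub> (x \<otimes>\<^bsub>G\<^esub> y) = (N #>\<^bsub>G\<^esub> r x) <#>\<^bsub>G\<^esub> (N #>\<^bsub>G\<^esub> r y)"
      using xy by (simp add: N.rcos_sum r_coset)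
    also have "\<dots> = N #>\<^bsub>G\<^esub> (r x \<otimes>\<^bsub>G\<^esub> r y)" using xy r_closed by (simp add: N.rcos_sum)
    finally show "r (x \<otimes>\<^bsub>G\<^esub> y) = r x \<otimes>\<^bsub>?H\<^esub> r y" using r_cong[of "x \<otimes>\<^bsub>G\<^esub> y" "r x \<otimes>\<^bsub>G\<^esub> r y"] by simp
  qed
  let ?Q = "?H\<lparr>carrier := r ` carrier G, one := r \<one>\<^bsub>G\<^esub>\<rparr>"
  have "comm_group ?Q"
    using hom_imp_img_comm_group[OF hom] by simp
  moreover have "r \<in> hom G ?Q" using hom by (simp add: hom_def)
  moreover have "r x = \<one>\<^bsub>?Q\<^esub> \<longleftrightarrow> x \<in> N" if x: "x \<in> carrier G" for x
  proof
    assume "r x = \<one>\<^bsub>?Q\<^esub>"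
    then have "N #>\<^bsub>G\<^esub> x = N" using r_coset[OF x] r_coset[OF one_closed] coset_mult_one[OF N.subset] by simp
    then show "x \<in> N" using rcos_self[OF x N] by simp
  next
    assume "x \<in> N"
    then have "N #>\<^bsub>G\<^esub> x = N #>\<^bsub>G\<^esub> \<one>\<^bsub>G\<^esub>" using coset_join2[OF x N] coset_mult_one[OF N.subset] by simp
    then show "r x = \<one>\<^bsub>?Q\<^esub>" using r_cong[of x "\<one>\<^bsub>G\<^esub>"] by simp
  qed
  ultimately show ?thesis using that[of ?Q r] by simp
qed

lemma representable_full_subcat [simp]: "representable (full_subcat C S) = representable C"
  by (simp add: representable_def fun_eq_iff)

lemma restricted_yoneda_full_subcat [simp]: "restricted_yoneda (full_subcat C S) R = restricted_yoneda C R"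
  by (simp add: restricted_yoneda_def)

lemma fobj_representable [simp]: "fobj (representable C X) Z = Mor C Z X"
  by (simp add: representable_def)

lemma fobj_restricted_yoneda [simp]: "fobj (restricted_yoneda C S) = representable C"
  by (simp add: restricted_yoneda_def)

context presheaves
begin

abbreviation rep :: "'o \<Rightarrow> ('o, 'm) presheaf" where "rep \<equiv> representable C"

abbreviation yon :: "'m \<Rightarrow> ('o, 'm) presheaf_arrow" where "yon f \<equiv> farr (restricted_yoneda C S) f"

sublocale PSh: preadditive_category PSh
  by (rule preadditive_PSh)

lemma El_rep: "\<lbrakk>Z \<in> S; X \<in> Ob C\<rbrakk> \<Longrightarrow> g \<in> Hom C Z X \<longleftrightarrow> \<guillemotleft>g : Z \<rightarrow> X\<guillemotright>"
  using in_hom_iff by simp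

lemma El_repD: "\<lbrakk>g \<in> Hom C Z X; Z \<in> S; X \<in> Ob C\<rbrakk> \<Longrightarrow> \<guillemotleft>g : Z \<rightarrow> X\<guillemotright>"
  using El_rep by blast

lemma El_repI: "\<guillemotleft>g : Z \<rightarrow> X\<guillemotright> \<Longrightarrow> g \<in> Hom C Z X"
  by (rule in_homD(3))

lemma res_rep: "g \<in> Hom C (Tgt C f) X \<Longrightarrow> res (rep X) f g = g \<bullet> f"
  by (simp add: representable_def)

lemma rep_Ob [simp]: assumes X: "X \<in> Ob C" shows "rep X \<in> Ob PSh"
proof (rule presheafI)
  show "comm_group (fobj (rep X) Z)" if "Z \<in> S" for Z using that X hom_comm_group by simp
  show "farr (rep X) f \<in> Hom Ab (fobj (rep X) (Tgt C f)) (fobj (rep X) (Src C f))" if f: "SArr f" for f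
  proof -
    have "(\<lambda>g. g \<bullet> f) \<in> hom (Mor C (Tgt C f) X) (Mor C (Src C f) X)"
    proof (rule homI)
      fix g assume "g \<in> Hom C (Tgt C f) X"
      then have g: "\<guillemotleft>g : Tgt C f \<rightarrow> X\<guillemotright>" using El_repD f X by blast
      then have "\<guillemotleft>g \<bullet> f : Src C f \<rightarrow> X\<guillemotright>" using f by simp
      then show "g \<bullet> f \<in> Hom C (Src C f) X" by (rule El_repI)
      fix h assume "h \<in> Hom C (Tgt C f) X"
      then have h: "\<guillemotleft>h : Tgt C f \<rightarrow> X\<guillemotright>" using El_repD f X by blast
      show "(g \<otimes>\<^bsub>Mor C (Tgt C f) X\<^esub> h) \<bullet> f = (g \<bullet> f) \<otimes>\<^bsub>Mor C (Src C f) X\<^esub> (h \<bullet> f)"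
        using comp_add_left[of g h f] f g h by (simp add: add_def)
    qed
    from Ab_HomI[OF this] show ?thesis using hom_comm_group[of "Tgt C f" X] f X by (simp add: representable_def)
  qed
  show "res (rep X) (Ide C Z) x = x" if "Z \<in> S" "x \<in> El (rep X) Z" for Z x
    using that X res_rep[of x "Ide C Z" X] El_repD[of x Z X] by simp
  show "res (rep X) (f \<boxplus> g) x = res (rep X) f x \<otimes>\<^bsub>fobj (rep X) (Src C f)\<^esub> res (rep X) g x"
    if f: "SArr f" "par f g" and "x \<in> El (rep X) (Tgt C f)" for f g x
  proof -
    have x: "x \<in> Hom C (Tgt C f) X" "\<guillemotleft>x : Tgt C f \<rightarrow> X\<guillemotright>" using that El_repD[of x "Tgt C f" X] X by simp_all
    have "x \<bullet> (f \<boxplus> g) = (x \<bullet> f) \<otimes>\<^bsub>Mor C (Src C f) X\<^esub> (x \<bullet> g)"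
      using comp_add_right[of f g x] x(2) f by (simp add: add_def[of "x \<bullet> f"])
    then show ?thesis using x(1) f by (simp add: res_rep)
  qed
  show "res (rep X) (g \<bullet> f) x = res (rep X) f (res (rep X) g x)"
    if f: "SArr f" "SArr g" "Src C g = Tgt C f" and "x \<in> El (rep X) (Tgt C g)" for f g x
  proof -
    have x: "x \<in> Hom C (Tgt C g) X" "\<guillemotleft>x : Tgt C g \<rightarrow> X\<guillemotright>" using that El_repD[of x "Tgt C g" X] X by simp_all
    have "\<guillemotleft>x \<bullet> g : Tgt C f \<rightarrow> X\<guillemotright>" using x(2) f by simp
    then have "x \<bullet> g \<in> Hom C (Tgt C f) X" by (rule El_repI)
    then show ?thesis using x f by (simp add: res_rep comp_assoc)
  qed
qed

lemma yon_eq: assumes "\<guillemotleft>f : X \<rightarrow> Y\<guillemotright>" shows "yon f = psh_arr S (rep X) (rep Y) (\<lambda>Z g. f \<bullet> g)"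
  using assms by (simp add: restricted_yoneda_def psh_arr_def)

lemma yon_Hom: assumes f: "\<guillemotleft>f : X \<rightarrow> Y\<guillemotright>" shows "yon f \<in> Hom PSh (rep X) (rep Y)"
  unfolding yon_eq[OF f]
proof (rule psh_arr_Hom)
  have X: "X \<in> Ob C" and Y: "Y \<in> Ob C" using in_homD[OF f] by blast+
  show "rep X \<in> Ob PSh" "rep Y \<in> Ob PSh" using X Y by simp_all
  show "f \<bullet> g \<in> El (rep Y) Z" if "Z \<in> S" "g \<in> El (rep X) Z" for Z g
  proof -
    have "\<guillemotleft>f \<bullet> g : Z \<rightarrow> Y\<guillemotright>" using El_repD[of g Z X] that f X by simp
    from El_repI[OF this] show ?thesis by simp
  qed
  show "f \<bullet> (g \<otimes>\<^bsub>fobj (rep X) Z\<^esub> h) = (f \<bullet> g) \<otimes>\<^bsub>fobj (rep Y) Z\<^esub> (f \<bullet> h)"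
    if "Z \<in> S" "g \<in> El (rep X) Z" "h \<in> El (rep X) Z" for Z g h
    using that El_repD[of g Z X] El_repD[of h Z X] f X comp_add_right[of g h f] by (simp add: add_def)
  show "f \<bullet> res (rep X) k g = res (rep Y) k (f \<bullet> g)" if "SArr k" "g \<in> El (rep X) (Tgt C k)" for k g
  proof -
    have g: "g \<in> Hom C (Tgt C k) X" "\<guillemotleft>g : Tgt C k \<rightarrow> X\<guillemotright>" using El_repD[of g "Tgt C k" X] that X by simp_all
    then have "\<guillemotleft>f \<bullet> g : Tgt C k \<rightarrow> Y\<guillemotright>" using f by simp
    then have "f \<bullet> g \<in> Hom C (Tgt C k) Y" by (rule El_repI)
    then show ?thesis using g f that by (simp add: res_rep comp_assoc)
  qed
qed

lemma ev_yon: "\<lbrakk>\<guillemotleft>f : X \<rightarrow> Y\<guillemotright>; \<guillemotleft>g : Z \<rightarrow> X\<guillemotright>; Z \<in> S\<rbrakk> \<Longrightarrow> ev (yon f) Z g = f \<bullet> g"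
  using yon_eq[of f X Y] El_repI[of g Z X] by simp

lemma additive_restricted_yoneda: "additive_functor C PSh (restricted_yoneda C S)"
proof (rule additive_functorI)
  show "fobj (restricted_yoneda C S) X \<in> Ob PSh" if "X \<in> Ob C" for X using that by simp
  show "yon f \<in> Hom PSh (fobj (restricted_yoneda C S) X) (fobj (restricted_yoneda C S) Y)"
    if "X \<in> Ob C" "Y \<in> Ob C" "f \<in> Hom C X Y" for X Y f
    using yon_Hom[OF in_homI[OF that]] by simp
  show "yon (f \<otimes>\<^bsub>Mor C X Y\<^esub> g) = yon f \<otimes>\<^bsub>Mor PSh (fobj (restricted_yoneda C S) X) (fobj (restricted_yoneda C S) Y)\<^esub> yon g"
    if XY: "X \<in> Ob C" "Y \<in> Ob C" "f \<in> Hom C X Y" "g \<in> Hom C X Y" for X Y f g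
  proof -
    have f: "\<guillemotleft>f : X \<rightarrow> Y\<guillemotright>" and g: "\<guillemotleft>g : X \<rightarrow> Y\<guillemotright>" using in_homI XY by blast+
    have eq: "f \<otimes>\<^bsub>Mor C X Y\<^esub> g = f \<boxplus> g" using f g by (simp add: add_def)
    have fg: "\<guillemotleft>f \<boxplus> g : X \<rightarrow> Y\<guillemotright>" using f g by simp
    show ?thesis
      unfolding eq fobj_restricted_yoneda
    proof (rule psh_eqI[OF yon_Hom[OF fg] psh_mult_Hom[OF yon_Hom[OF f] yon_Hom[OF g]]])
      fix Z k assume Z: "Z \<in> S" and k0: "k \<in> El (rep X) Z"
      then have k: "\<guillemotleft>k : Z \<rightarrow> X\<guillemotright>" using El_repD[of k Z X] XY by simp
      show "ev (yon (f \<boxplus> g)) Z k = ev (yon f \<otimes>\<^bsub>Mor PSh (rep X) (rep Y)\<^esub> yon g) Z k"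
        unfolding ev_add[OF yon_Hom[OF f] yon_Hom[OF g] Z k0] ev_yon[OF f k Z] ev_yon[OF g k Z] ev_yon[OF fg k Z]
        using comp_add_left[of f g k] f g k by (simp add: add_def[of "f \<bullet> k"])
    qed
  qed
  show "yon (Ide C X) = Ide PSh (fobj (restricted_yoneda C S) X)" if X: "X \<in> Ob C" for X
    unfolding fobj_restricted_yoneda
  proof (rule psh_eqI)
    have i: "\<guillemotleft>Ide C X : X \<rightarrow> X\<guillemotright>" using X by simp
    show "yon (Ide C X) \<in> Hom PSh (rep X) (rep X)" using yon_Hom[OF i] .
    show "Ide PSh (rep X) \<in> Hom PSh (rep X) (rep X)" using X by (intro psh_Ide_Hom) simp
    fix Z k assume Z: "Z \<in> S" and k0: "k \<in> El (rep X) Z"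
    then have k: "\<guillemotleft>k : Z \<rightarrow> X\<guillemotright>" using El_repD[of k Z X] X by simp
    show "ev (yon (Ide C X)) Z k = ev (Ide PSh (rep X)) Z k"
      unfolding ev_Ide[OF Z k0] ev_yon[OF i k Z] using k by simp
  qed
  show "yon (g \<bullet> f) = yon g \<bullet>\<^bsub>PSh\<^esub> yon f"
    if XY: "X \<in> Ob C" "Y \<in> Ob C" "Z \<in> Ob C" "f \<in> Hom C X Y" "g \<in> Hom C Y Z" for X Y Z f g
  proof -
    have f: "\<guillemotleft>f : X \<rightarrow> Y\<guillemotright>" and g: "\<guillemotleft>g : Y \<rightarrow> Z\<guillemotright>" using in_homI XY by blast+
    have gf: "\<guillemotleft>g \<bullet> f : X \<rightarrow> Z\<guillemotright>" using f g by simp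
    show ?thesis
    proof (rule psh_eqI[OF yon_Hom[OF gf] psh_Comp_Hom[OF yon_Hom[OF f] yon_Hom[OF g]]])
      fix A k assume A: "A \<in> S" and k0: "k \<in> El (rep X) A"
      then have k: "\<guillemotleft>k : A \<rightarrow> X\<guillemotright>" using El_repD[of k A X] XY by simp
      then have fk: "\<guillemotleft>f \<bullet> k : A \<rightarrow> Y\<guillemotright>" using f by simp
      show "ev (yon (g \<bullet> f)) A k = ev (yon g \<bullet>\<^bsub>PSh\<^esub> yon f) A k"
        unfolding ev_comp[OF yon_Hom[OF f] yon_Hom[OF g] A k0] ev_yon[OF f k A] ev_yon[OF g fk A] ev_yon[OF gf k A]
        using f g k by (simp add: comp_assoc)
    qed
  qed
qed

section \<open>Objectwise cokernels of maps between representable presheaves\<close>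

lemma hom_eq_iff:
  assumes h: "h \<in> hom (Mor C Z X) G" and G: "group G" and a: "\<guillemotleft>a : Z \<rightarrow> X\<guillemotright>" and b: "\<guillemotleft>b : Z \<rightarrow> X\<guillemotright>"
  shows "h a = h b \<longleftrightarrow> h (a \<boxminus> b) = \<one>\<^bsub>G\<^esub>"
proof -
  interpret group_hom "Mor C Z X" G h
    using Hom_group[OF in_homD(1,2)[OF a]] G h by (intro group_hom.intro group_hom_axioms.intro)
  have ab: "a \<in> Hom C Z X" "b \<in> Hom C Z X" using El_repI a b by blast+
  have eq: "a \<boxminus> b = a \<otimes>\<^bsub>Mor C Z X\<^esub> inv\<^bsub>Mor C Z X\<^esub> b" using a b by (simp add: dif_def add_def neg_def)
  show ?thesis unfolding eq using ab H.inv_equality H.inv_solve_right' by (auto simp: H.r_inv)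
qed

text \<open>Exactness of \<open>C(-, Src f) \<rightarrow> C(-, Tgt f) \<rightarrow> K \<rightarrow>
  0\<close> at each object of \<open>S\<close>.\<close>

definition pointwise_cokernel :: "'m \<Rightarrow> ('o, 'm) presheaf \<Rightarrow> ('o, 'm) presheaf_arrow \<Rightarrow> bool" where
  "pointwise_cokernel f K p \<longleftrightarrow> p \<in> Hom PSh (rep (Tgt C f)) K \<and>
     (\<forall>Z \<in> S. \<forall>x \<in> El K Z. \<exists>g. \<guillemotleft>g : Z \<rightarrow> Tgt C f\<guillemotright> \<and> ev p Z g = x) \<and>
     (\<forall>Z \<in> S. \<forall>g. \<guillemotleft>g : Z \<rightarrow> Tgt C f\<guillemotright> \<longrightarrow>
        (ev p Z g = \<one>\<^bsub>fobj K Z\<^esub> \<longleftrightarrow> (\<exists>h. \<guillemotleft>h : Z \<rightarrow> Src C f\<guillemotright> \<and> g = f \<bullet> h)))"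

lemma pointwise_cokernel_is_cokernel:
  assumes f: "\<guillemotleft>f : X \<rightarrow> Y\<guillemotright>" and pk: "pointwise_cokernel f K p"
  shows "is_cokernel PSh (rep X) (rep Y) K (yon f) p"
  unfolding is_cokernel_def
proof (intro conjI ballI impI)
  have X: "X \<in> Ob C" and Y: "Y \<in> Ob C" using in_homD[OF f] by blast+
  have p: "p \<in> Hom PSh (rep Y) K" using pk f unfolding pointwise_cokernel_def by simp
  have surj: "\<exists>g. \<guillemotleft>g : Z \<rightarrow> Y\<guillemotright> \<and> ev p Z g = x" if "Z \<in> S" "x \<in> El K Z" for Z x
    using pk f that unfolding pointwise_cokernel_def by blast
  have ker: "ev p Z g = \<one>\<^bsub>fobj K Z\<^esub> \<longleftrightarrow> (\<exists>h. \<guillemotleft>h : Z \<rightarrow> X\<guillemotright> \<and> g = f \<bullet> h)" if "Z \<in> S" "\<guillemotleft>g : Z \<rightarrow> Y\<guillemotright>" for Z g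
    using pk f that unfolding pointwise_cokernel_def by simp
  have K: "K \<in> Ob PSh" using Hom_PSh_Ob[OF p] by blast
  show "rep X \<in> Ob PSh" "rep Y \<in> Ob PSh" "K \<in> Ob PSh" using X Y K by simp_all
  show "yon f \<in> Hom PSh (rep X) (rep Y)" using yon_Hom[OF f] .
  show "p \<in> Hom PSh (rep Y) K" using p .
  show "p \<bullet>\<^bsub>PSh\<^esub> yon f = Zero PSh (rep X) K"
  proof (rule psh_eqI[OF psh_Comp_Hom[OF yon_Hom[OF f] p] psh_Zero_Hom[OF rep_Ob[OF X] K]])
    fix Z g assume Z: "Z \<in> S" and g0: "g \<in> El (rep X) Z"
    then have g: "\<guillemotleft>g : Z \<rightarrow> X\<guillemotright>" using El_repD[of g Z X] X by simp
    then have fg: "\<guillemotleft>f \<bullet> g : Z \<rightarrow> Y\<guillemotright>" using f by simp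
    show "ev (p \<bullet>\<^bsub>PSh\<^esub> yon f) Z g = ev (Zero PSh (rep X) K) Z g"
      unfolding ev_comp[OF yon_Hom[OF f] p Z g0] ev_zero[OF Z g0] ev_yon[OF f g Z] ker[OF Z fg] using g by blast
  qed
  fix L q assume L: "L \<in> Ob PSh" and q: "q \<in> Hom PSh (rep Y) L" and q0: "q \<bullet>\<^bsub>PSh\<^esub> yon f = Zero PSh (rep X) L"
  have q_ker: "ev q Z (f \<bullet> h) = \<one>\<^bsub>fobj L Z\<^esub>" if Z: "Z \<in> S" and h: "\<guillemotleft>h : Z \<rightarrow> X\<guillemotright>" for Z h
  proof -
    have h0: "h \<in> El (rep X) Z" using El_repI[OF h] by simp
    show ?thesis using ev_comp[OF yon_Hom[OF f] q Z h0] ev_zero[OF Z h0] ev_yon[OF f h Z] q0 by simp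
  qed
  \<comment> \<open>The induced map evaluates \<open>q\<close> on some preimage under
    \<open>p\<close>. Two preimages differ by some \<open>f \<bullet> h\<close>, on which
    \<open>q\<close> vanishes, so the choice does not matter.\<close>
  define \<phi> where "\<phi> Z x = ev q Z (SOME g. \<guillemotleft>g : Z \<rightarrow> Y\<guillemotright> \<and> ev p Z g = x)" for Z x
  have \<phi>: "\<phi> Z (ev p Z g) = ev q Z g" if Z: "Z \<in> S" and g: "\<guillemotleft>g : Z \<rightarrow> Y\<guillemotright>" for Z g
  proof -
    define g' where "g' = (SOME g'. \<guillemotleft>g' : Z \<rightarrow> Y\<guillemotright> \<and> ev p Z g' = ev p Z g)"
    have "\<guillemotleft>g' : Z \<rightarrow> Y\<guillemotright> \<and> ev p Z g' = ev p Z g"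
      unfolding g'_def by (rule someI[of _ g]) (use g in simp)
    then have g': "\<guillemotleft>g' : Z \<rightarrow> Y\<guillemotright>" "ev p Z g' = ev p Z g" by blast+
    have d: "\<guillemotleft>g' \<boxminus> g : Z \<rightarrow> Y\<guillemotright>" using g g' by simp
    have "ev p Z (g' \<boxminus> g) = \<one>\<^bsub>fobj K Z\<^esub>"
      using hom_eq_iff[of "ev p Z" Z Y "fobj K Z" g' g] ev_hom[OF p Z] presheaf_group'[OF K Z] g g' by simp
    then obtain h where h: "\<guillemotleft>h : Z \<rightarrow> X\<guillemotright>" "g' \<boxminus> g = f \<bullet> h" using ker[OF Z d] by blast
    then have "ev q Z (g' \<boxminus> g) = \<one>\<^bsub>fobj L Z\<^esub>" using q_ker[OF Z h(1)] by simp
    then have "ev q Z g' = ev q Z g"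
      using hom_eq_iff[of "ev q Z" Z Y "fobj L Z" g' g] ev_hom[OF q Z] presheaf_group'[OF L Z] g g' by simp
    then show ?thesis by (simp add: \<phi>_def g'_def)
  qed
  let ?u = "psh_arr S K L \<phi>"
  have u: "?u \<in> Hom PSh K L"
  proof (rule psh_arr_Hom[OF K L])
    fix Z x assume Z: "Z \<in> S" and x: "x \<in> El K Z"
    obtain g where g: "\<guillemotleft>g : Z \<rightarrow> Y\<guillemotright>" "ev p Z g = x" using surj[OF Z x] by blast
    have g0: "g \<in> El (rep Y) Z" using El_repI[OF g(1)] by simp
    show "\<phi> Z x \<in> El L Z" using \<phi>[OF Z g(1)] g(2) ev_closed[OF q Z g0] by simp
    fix y assume y: "y \<in> El K Z"
    obtain h where h: "\<guillemotleft>h : Z \<rightarrow> Y\<guillemotright>" "ev p Z h = y" using surj[OF Z y] by blast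
    have h0: "h \<in> El (rep Y) Z" using El_repI[OF h(1)] by simp
    have gh: "\<guillemotleft>g \<otimes>\<^bsub>Mor C Z Y\<^esub> h : Z \<rightarrow> Y\<guillemotright>" using arr_add[of g h] g(1) h(1) by (simp add: add_def)
    show "\<phi> Z (x \<otimes>\<^bsub>fobj K Z\<^esub> y) = \<phi> Z x \<otimes>\<^bsub>fobj L Z\<^esub> \<phi> Z y"
      using \<phi>[OF Z gh] ev_mult[OF p Z g0 h0] ev_mult[OF q Z g0 h0] \<phi>[OF Z g(1)] \<phi>[OF Z h(1)] g(2) h(2) by simp
  next
    fix k x assume k: "SArr k" and x: "x \<in> El K (Tgt C k)"
    have Z: "Tgt C k \<in> S" "Src C k \<in> S" using k by blast+
    obtain g where g: "\<guillemotleft>g : Tgt C k \<rightarrow> Y\<guillemotright>" "ev p (Tgt C k) g = x" using surj[OF Z(1) x] by blast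
    have g0: "g \<in> El (rep Y) (Tgt C k)" "g \<in> Hom C (Tgt C k) Y" using El_repI[OF g(1)] by simp_all
    have gk: "\<guillemotleft>g \<bullet> k : Src C k \<rightarrow> Y\<guillemotright>" using g(1) k by simp
    show "\<phi> (Src C k) (res K k x) = res L k (\<phi> (Tgt C k) x)"
      using ev_natural[OF p k g0(1)] ev_natural[OF q k g0(1)] \<phi>[OF Z(2) gk] \<phi>[OF Z(1) g(1)] g(2) res_rep[OF g0(2)] by simp
  qed
  show "\<exists>!u. u \<in> Hom PSh K L \<and> u \<bullet>\<^bsub>PSh\<^esub> p = q"
  proof (rule ex1I, intro conjI)
    show "?u \<in> Hom PSh K L" by (rule u)
    show "?u \<bullet>\<^bsub>PSh\<^esub> p = q"
    proof (rule psh_eqI[OF psh_Comp_Hom[OF p u] q])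
      fix Z g assume Z: "Z \<in> S" and g: "g \<in> El (rep Y) Z"
      show "ev (?u \<bullet>\<^bsub>PSh\<^esub> p) Z g = ev q Z g"
        using ev_comp[OF p u Z g] \<phi>[OF Z, of g] El_repD[of g Z Y] g Z Y ev_closed[OF p Z g] by simp
    qed
    fix v assume v: "v \<in> Hom PSh K L \<and> v \<bullet>\<^bsub>PSh\<^esub> p = q"
    then have v1: "v \<in> Hom PSh K L" by blast
    show "v = ?u"
    proof (rule psh_eqI[OF v1 u])
      fix Z x assume Z: "Z \<in> S" and x: "x \<in> El K Z"
      obtain g where g: "\<guillemotleft>g : Z \<rightarrow> Y\<guillemotright>" "ev p Z g = x" using surj[OF Z x] by blast
      have g0: "g \<in> El (rep Y) Z" using El_repI[OF g(1)] by simp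
      show "ev v Z x = ev ?u Z x" using ev_comp[OF p v1 Z g0] \<phi>[OF Z g(1)] g(2) v x Z by simp
    qed
  qed
qed

text \<open>At each object \<open>Z\<close> the cokernel is the quotient of \<open>C(Z, Y)\<close>
  by the maps that factor through \<open>f\<close>. Coset representatives keep this quotient on the
  type of morphisms, as the type of presheaves demands.\<close>

lemma pointwise_cokernel_exists:
  assumes f: "\<guillemotleft>f : X \<rightarrow> Y\<guillemotright>"
  obtains K p where "pointwise_cokernel f K p"
proof -
  have X: "X \<in> Ob C" and Y: "Y \<in> Ob C" using in_homD[OF f] by blast+
  let ?N = "\<lambda>Z. {f \<bullet> h | h. \<guillemotleft>h : Z \<rightarrow> X\<guillemotright>}"
  define N where "N = ?N"
  have "\<exists>(Q :: 'm monoid) r. comm_group Q \<and> r \<in> hom (Mor C Z Y) Q \<and> r ` Hom C Z Y = carrier Q \<and>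
      (\<forall>x \<in> Hom C Z Y. r x = \<one>\<^bsub>Q\<^esub> \<longleftrightarrow> x \<in> N Z)" if Z: "Z \<in> S" for Z
  proof -
    have cg: "comm_group (Mor C Z Y)" using hom_comm_group Z Y by simp
    have "subgroup (?N Z) (Mor C Z Y)"
    proof (rule group.subgroupI)
      show "group (Mor C Z Y)" using Hom_group Z Y by simp
      have closed: "\<guillemotleft>f \<bullet> h : Z \<rightarrow> Y\<guillemotright>" if "\<guillemotleft>h : Z \<rightarrow> X\<guillemotright>" for h using that f by simp
      then show "?N Z \<subseteq> Hom C Z Y" using El_repI by blast
      have "\<guillemotleft>zero Z X : Z \<rightarrow> X\<guillemotright>" using X Z by simp
      then show "?N Z \<noteq> {}" by blast
      show "inv\<^bsub>Mor C Z Y\<^esub> a \<in> ?N Z" if a: "a \<in> ?N Z" for a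
      proof -
        obtain h where h: "\<guillemotleft>h : Z \<rightarrow> X\<guillemotright>" "a = f \<bullet> h" using a by auto
        have "inv\<^bsub>Mor C Z Y\<^esub> a = neg (f \<bullet> h)" using h f by (simp add: neg_def)
        also have "\<dots> = f \<bullet> neg h" using h f by simp
        finally have "inv\<^bsub>Mor C Z Y\<^esub> a = f \<bullet> neg h \<and> \<guillemotleft>neg h : Z \<rightarrow> X\<guillemotright>" using h(1) by simp
        then show ?thesis by blast
      qed
      show "a \<otimes>\<^bsub>Mor C Z Y\<^esub> b \<in> ?N Z" if ab: "a \<in> ?N Z" "b \<in> ?N Z" for a b
      proof -
        obtain h where h: "\<guillemotleft>h : Z \<rightarrow> X\<guillemotright>" "a = f \<bullet> h" using ab(1) by auto
        obtain k where k: "\<guillemotleft>k : Z \<rightarrow> X\<guillemotright>" "b = f \<bullet> k" using ab(2) by auto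
        have "a \<otimes>\<^bsub>Mor C Z Y\<^esub> b = f \<bullet> h \<boxplus> f \<bullet> k" using h k f by (simp add: add_def)
        also have "\<dots> = f \<bullet> (h \<boxplus> k)" using h(1) k(1) f by (simp add: comp_add_right)
        finally have "a \<otimes>\<^bsub>Mor C Z Y\<^esub> b = f \<bullet> (h \<boxplus> k) \<and> \<guillemotleft>h \<boxplus> k : Z \<rightarrow> X\<guillemotright>" using h(1) k(1) by simp
        then show ?thesis by blast
      qed
    qed
    from cg this show ?thesis
    proof (rule quotient_by_representatives)
      fix Q :: "'m monoid" and r :: "'m \<Rightarrow> 'm"
      assume Qr: "comm_group Q" "r \<in> hom (Mor C Z Y) Q" "r ` Hom C Z Y = carrier Q"
        "\<And>x. x \<in> Hom C Z Y \<Longrightarrow> r x = \<one>\<^bsub>Q\<^esub> \<longleftrightarrow> x \<in> ?N Z"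
      show ?thesis unfolding N_def by (intro exI[of _ Q] exI[of _ r] conjI ballI Qr)
    qed
  qed
  then obtain Q :: "'o \<Rightarrow> 'm monoid" and r :: "'o \<Rightarrow> 'm \<Rightarrow> 'm" where Q: "\<And>Z. Z \<in> S \<Longrightarrow> comm_group (Q Z)" and r: "\<And>Z. Z \<in> S \<Longrightarrow> r Z \<in> hom (Mor C Z Y) (Q Z)"
    and r_surj: "\<And>Z. Z \<in> S \<Longrightarrow> r Z ` Hom C Z Y = carrier (Q Z)"
    and r_ker0: "\<And>Z x. \<lbrakk>Z \<in> S; x \<in> Hom C Z Y\<rbrakk> \<Longrightarrow> r Z x = \<one>\<^bsub>Q Z\<^esub> \<longleftrightarrow> x \<in> N Z"
    by metis
  have r_ker: "r Z g = \<one>\<^bsub>Q Z\<^esub> \<longleftrightarrow> (\<exists>h. \<guillemotleft>h : Z \<rightarrow> X\<guillemotright> \<and> g = f \<bullet> h)" if "Z \<in> S" "\<guillemotleft>g : Z \<rightarrow> Y\<guillemotright>" for Z g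
    using r_ker0[OF that(1) El_repI[OF that(2)]] unfolding N_def by auto
  have r_surj': "\<exists>g. \<guillemotleft>g : Z \<rightarrow> Y\<guillemotright> \<and> r Z g = x" if Zx: "Z \<in> S" "x \<in> carrier (Q Z)" for Z x
  proof -
    obtain g where g: "g \<in> Hom C Z Y" "r Z g = x" using Zx(2) unfolding r_surj[OF Zx(1), symmetric] by blast
    then have "\<guillemotleft>g : Z \<rightarrow> Y\<guillemotright> \<and> r Z g = x" using El_repD[OF g(1) Zx(1) Y] by simp
    then show ?thesis by (rule exI)
  qed
  have r_closed: "r Z g \<in> carrier (Q Z)" if "Z \<in> S" "\<guillemotleft>g : Z \<rightarrow> Y\<guillemotright>" for Z g
    using r_surj[OF that(1)] El_repI[OF that(2)] by blast
  have r_add: "r Z (g \<boxplus> h) = r Z g \<otimes>\<^bsub>Q Z\<^esub> r Z h" if "Z \<in> S" "\<guillemotleft>g : Z \<rightarrow> Y\<guillemotright>" "\<guillemotleft>h : Z \<rightarrow> Y\<guillemotright>" for Z g h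
    using hom_mult[OF r[OF that(1)] El_repI[OF that(2)] El_repI[OF that(3)]] that by (simp add: add_def)
  \<comment> \<open>Restriction lifts a class to a morphism and precomposes. Two lifts differ by
    some \<open>f \<bullet> h\<close>, and \<open>(f \<bullet> h) \<bullet> k\<close> factors
    through \<open>f\<close> again.\<close>
  define \<rho> where "\<rho> k x = r (Src C k) ((SOME g. \<guillemotleft>g : Tgt C k \<rightarrow> Y\<guillemotright> \<and> r (Tgt C k) g = x) \<bullet> k)" for k x
  have \<rho>: "\<rho> k (r (Tgt C k) g) = r (Src C k) (g \<bullet> k)" if k: "SArr k" and g: "\<guillemotleft>g : Tgt C k \<rightarrow> Y\<guillemotright>" for k g
  proof -
    have Z: "Src C k \<in> S" "Tgt C k \<in> S" using k by blast+
    define g' where "g' = (SOME g'. \<guillemotleft>g' : Tgt C k \<rightarrow> Y\<guillemotright> \<and> r (Tgt C k) g' = r (Tgt C k) g)"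
    have "\<guillemotleft>g' : Tgt C k \<rightarrow> Y\<guillemotright> \<and> r (Tgt C k) g' = r (Tgt C k) g"
      unfolding g'_def by (rule someI[of _ g]) (use g in simp)
    then have g': "\<guillemotleft>g' : Tgt C k \<rightarrow> Y\<guillemotright>" "r (Tgt C k) g' = r (Tgt C k) g" by blast+
    have d: "\<guillemotleft>g' \<boxminus> g : Tgt C k \<rightarrow> Y\<guillemotright>" using g g' by simp
    have grp: "group (Q Z)" if "Z \<in> S" for Z using Q[OF that] comm_group_def by blast
    have "r (Tgt C k) (g' \<boxminus> g) = \<one>\<^bsub>Q (Tgt C k)\<^esub>"
      using hom_eq_iff[OF r[OF Z(2)] grp[OF Z(2)] g'(1) g] g'(2) by simp
    then obtain h where h: "\<guillemotleft>h : Tgt C k \<rightarrow> X\<guillemotright>" "g' \<boxminus> g = f \<bullet> h" using r_ker[OF Z(2) d] by blast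
    have gk: "\<guillemotleft>g' \<bullet> k : Src C k \<rightarrow> Y\<guillemotright>" "\<guillemotleft>g \<bullet> k : Src C k \<rightarrow> Y\<guillemotright>" using g g'(1) k by simp_all
    have "g' \<bullet> k \<boxminus> g \<bullet> k = (g' \<boxminus> g) \<bullet> k" using g g'(1) k by (simp add: comp_dif_left)
    also have "\<dots> = f \<bullet> (h \<bullet> k)" using h f k by (simp add: comp_assoc)
    finally have "g' \<bullet> k \<boxminus> g \<bullet> k = f \<bullet> (h \<bullet> k) \<and> \<guillemotleft>h \<bullet> k : Src C k \<rightarrow> X\<guillemotright>" using h(1) k by simp
    moreover have "\<guillemotleft>g' \<bullet> k \<boxminus> g \<bullet> k : Src C k \<rightarrow> Y\<guillemotright>" using gk by simp
    ultimately have "r (Src C k) (g' \<bullet> k \<boxminus> g \<bullet> k) = \<one>\<^bsub>Q (Src C k)\<^esub>" using r_ker[OF Z(1)] by blast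
    then have "r (Src C k) (g' \<bullet> k) = r (Src C k) (g \<bullet> k)"
      using hom_eq_iff[OF r[OF Z(1)] grp[OF Z(1)] gk] by simp
    then show ?thesis by (simp add: \<rho>_def g'_def)
  qed
  define K :: "('o, 'm) presheaf" where
    "K = \<lparr>fobj = Q, farr = (\<lambda>k. (Q (Tgt C k), Q (Src C k), \<lambda>x \<in> carrier (Q (Tgt C k)). \<rho> k x))\<rparr>"
  have K_fobj [simp]: "fobj K = Q" by (simp add: K_def)
  have K_res: "res K k (r (Tgt C k) g) = r (Src C k) (g \<bullet> k)" if "SArr k" "\<guillemotleft>g : Tgt C k \<rightarrow> Y\<guillemotright>" for k g
    using \<rho>[OF that] r_closed[of "Tgt C k" g] that by (simp add: K_def)
  have K: "K \<in> Ob PSh"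
  proof (rule presheafI)
    show "comm_group (fobj K Z)" if "Z \<in> S" for Z using Q[OF that] by simp
    show "farr K k \<in> Hom Ab (fobj K (Tgt C k)) (fobj K (Src C k))" if k: "SArr k" for k
    proof -
      have Z: "Src C k \<in> S" "Tgt C k \<in> S" using k by blast+
      have "\<rho> k \<in> hom (Q (Tgt C k)) (Q (Src C k))"
      proof (rule homI)
        fix x assume "x \<in> carrier (Q (Tgt C k))"
        then obtain g where g: "\<guillemotleft>g : Tgt C k \<rightarrow> Y\<guillemotright>" "r (Tgt C k) g = x" using r_surj'[OF Z(2)] by blast
        have gk: "\<guillemotleft>g \<bullet> k : Src C k \<rightarrow> Y\<guillemotright>" using g(1) k by simp
        show "\<rho> k x \<in> carrier (Q (Src C k))" using \<rho>[OF k g(1)] r_closed[OF Z(1) gk] g(2) by simp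
        fix y assume "y \<in> carrier (Q (Tgt C k))"
        then obtain h where h: "\<guillemotleft>h : Tgt C k \<rightarrow> Y\<guillemotright>" "r (Tgt C k) h = y" using r_surj'[OF Z(2)] by blast
        have hk: "\<guillemotleft>h \<bullet> k : Src C k \<rightarrow> Y\<guillemotright>" using h(1) k by simp
        have gh: "\<guillemotleft>g \<boxplus> h : Tgt C k \<rightarrow> Y\<guillemotright>" using g(1) h(1) by simp
        have "\<rho> k (x \<otimes>\<^bsub>Q (Tgt C k)\<^esub> y) = r (Src C k) ((g \<boxplus> h) \<bullet> k)"
          using \<rho>[OF k gh] r_add[OF Z(2) g(1) h(1)] g(2) h(2) by simp
        also have "(g \<boxplus> h) \<bullet> k = g \<bullet> k \<boxplus> h \<bullet> k" using g(1) h(1) k by (simp add: comp_add_left)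
        finally show "\<rho> k (x \<otimes>\<^bsub>Q (Tgt C k)\<^esub> y) = \<rho> k x \<otimes>\<^bsub>Q (Src C k)\<^esub> \<rho> k y"
          using r_add[OF Z(1) gk hk] \<rho>[OF k g(1)] \<rho>[OF k h(1)] g(2) h(2) by simp
      qed
      then show ?thesis using Ab_HomI Q[OF Z(2)] by (simp add: K_def)
    qed
    show "res K (Ide C Z) x = x" if Z: "Z \<in> S" and x: "x \<in> El K Z" for Z x
    proof -
      obtain g where g: "\<guillemotleft>g : Z \<rightarrow> Y\<guillemotright>" "r Z g = x" using r_surj'[OF Z] x by auto
      then show ?thesis using K_res[of "Ide C Z" g] Z by simp
    qed
    show "res K (k \<boxplus> l) x = res K k x \<otimes>\<^bsub>fobj K (Src C k)\<^esub> res K l x"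
      if k: "SArr k" and l: "par k l" and x: "x \<in> El K (Tgt C k)" for k l x
    proof -
      have Z: "Src C k \<in> S" "Tgt C k \<in> S" using k by blast+
      obtain g where g: "\<guillemotleft>g : Tgt C k \<rightarrow> Y\<guillemotright>" "r (Tgt C k) g = x" using r_surj'[OF Z(2)] x by auto
      have "\<guillemotleft>g \<bullet> k : Src C k \<rightarrow> Y\<guillemotright>" "\<guillemotleft>g \<bullet> l : Src C k \<rightarrow> Y\<guillemotright>" using g(1) k l by simp_all
      from r_add[OF Z(1) this] have "r (Src C k) (g \<bullet> (k \<boxplus> l)) = r (Src C k) (g \<bullet> k) \<otimes>\<^bsub>Q (Src C k)\<^esub> r (Src C k) (g \<bullet> l)"
        using g(1) l k by (simp add: comp_add_right)
      then show ?thesis using K_res[of "k \<boxplus> l" g] K_res[of k g] K_res[of l g] g k l by simp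
    qed
    show "res K (l \<bullet> k) x = res K k (res K l x)"
      if k: "SArr k" and l: "SArr l" "Src C l = Tgt C k" and x: "x \<in> El K (Tgt C l)" for k l x
    proof -
      obtain g where g: "\<guillemotleft>g : Tgt C l \<rightarrow> Y\<guillemotright>" "r (Tgt C l) g = x" using r_surj'[of "Tgt C l" x] l x by auto
      have gl: "\<guillemotleft>g \<bullet> l : Tgt C k \<rightarrow> Y\<guillemotright>" using g(1) l by simp
      show ?thesis using K_res[of "l \<bullet> k" g] K_res[of l g] K_res[OF k gl] g k l by (simp add: comp_assoc)
    qed
  qed
  let ?p = "psh_arr S (rep Y) K r"
  have p: "?p \<in> Hom PSh (rep Y) K"
  proof (rule psh_arr_Hom[OF rep_Ob[OF Y] K])
    show "r Z x \<in> El K Z" if "Z \<in> S" "x \<in> El (rep Y) Z" for Z x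
      using r_closed[OF that(1)] El_repD[of x Z Y] that Y by simp
    show "r Z (x \<otimes>\<^bsub>fobj (rep Y) Z\<^esub> y) = r Z x \<otimes>\<^bsub>fobj K Z\<^esub> r Z y"
      if "Z \<in> S" "x \<in> El (rep Y) Z" "y \<in> El (rep Y) Z" for Z x y
      using hom_mult[OF r[OF that(1)]] that by simp
    show "r (Src C k) (res (rep Y) k x) = res K k (r (Tgt C k) x)" if "SArr k" "x \<in> El (rep Y) (Tgt C k)" for k x
      using K_res[of k x] El_repD[of x "Tgt C k" Y] res_rep[of x k Y] that Y by simp
  qed
  have ev_p: "ev ?p Z g = r Z g" if "Z \<in> S" "\<guillemotleft>g : Z \<rightarrow> Y\<guillemotright>" for Z g
    using El_repI[OF that(2)] that(1) by simp
  have "pointwise_cokernel f K ?p"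
    unfolding pointwise_cokernel_def
  proof (intro conjI ballI allI impI)
    show "?p \<in> Hom PSh (rep (Tgt C f)) K" using p f by simp
    show "\<exists>g. \<guillemotleft>g : Z \<rightarrow> Tgt C f\<guillemotright> \<and> ev ?p Z g = x" if Zx: "Z \<in> S" "x \<in> El K Z" for Z x
    proof -
      obtain g where g: "\<guillemotleft>g : Z \<rightarrow> Y\<guillemotright>" "r Z g = x" using r_surj'[OF Zx(1)] Zx(2) by auto
      then have "\<guillemotleft>g : Z \<rightarrow> Tgt C f\<guillemotright> \<and> ev ?p Z g = x" using ev_p[OF Zx(1) g(1)] f by simp
      then show ?thesis by blast
    qed
    show "ev ?p Z g = \<one>\<^bsub>fobj K Z\<^esub> \<longleftrightarrow> (\<exists>h. \<guillemotleft>h : Z \<rightarrow> Src C f\<guillemotright> \<and> g = f \<bullet> h)"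
      if "Z \<in> S" "\<guillemotleft>g : Z \<rightarrow> Tgt C f\<guillemotright>" for Z g
    proof -
      have g: "\<guillemotleft>g : Z \<rightarrow> Y\<guillemotright>" using that f by simp
      show ?thesis using ev_p[OF that(1) g] r_ker[OF that(1) g] f by simp
    qed
  qed
  then show ?thesis using that by blast
qed

text \<open>Finite presentation is stated with a universal property, while the later arguments work
  with elements. Comparison with the objectwise cokernel bridges the two: the induced maps
  \<open>u\<close> and \<open>v\<close> carry \<open>p\<close> and \<open>q\<close> into each other,
  so surjectivity and the kernel pass from \<open>q\<close> to \<open>p\<close>.\<close>

lemma cokernel_pointwise:
  assumes f: "\<guillemotleft>f : X \<rightarrow> Y\<guillemotright>" and coker: "is_cokernel PSh (rep X) (rep Y) F (yon f) p"
  shows "pointwise_cokernel f F p"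
proof -
  have Y: "Y \<in> Ob C" using in_homD[OF f] by blast
  obtain K q where pw: "pointwise_cokernel f K q" using pointwise_cokernel_exists[OF f] .
  note coker' = pointwise_cokernel_is_cokernel[OF f pw]
  have F: "F \<in> Ob PSh" and K: "K \<in> Ob PSh" and p: "p \<in> Hom PSh (rep Y) F" and q: "q \<in> Hom PSh (rep Y) K"
    and p0: "p \<bullet>\<^bsub>PSh\<^esub> yon f = Zero PSh (rep X) F" and q0: "q \<bullet>\<^bsub>PSh\<^esub> yon f = Zero PSh (rep X) K"
    using coker coker' unfolding is_cokernel_def by blast+
  have univ: "\<exists>!u. u \<in> Hom PSh F L \<and> u \<bullet>\<^bsub>PSh\<^esub> p = l"
    if "L \<in> Ob PSh" "l \<in> Hom PSh (rep Y) L" "l \<bullet>\<^bsub>PSh\<^esub> yon f = Zero PSh (rep X) L" for L l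
    using coker that unfolding is_cokernel_def by blast
  have univ': "\<exists>!u. u \<in> Hom PSh K L \<and> u \<bullet>\<^bsub>PSh\<^esub> q = l"
    if "L \<in> Ob PSh" "l \<in> Hom PSh (rep Y) L" "l \<bullet>\<^bsub>PSh\<^esub> yon f = Zero PSh (rep X) L" for L l
    using coker' that unfolding is_cokernel_def by blast
  obtain u where u: "u \<in> Hom PSh F K" "u \<bullet>\<^bsub>PSh\<^esub> p = q" using univ[OF K q q0] by blast
  obtain v where v: "v \<in> Hom PSh K F" "v \<bullet>\<^bsub>PSh\<^esub> q = p" using univ'[OF F p p0] by blast
  have "(v \<bullet>\<^bsub>PSh\<^esub> u) \<bullet>\<^bsub>PSh\<^esub> p = p"
    using PSh.Comp_assoc[OF _ F K F p u(1) v(1)] u(2) v(2) rep_Ob[OF Y] by simp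
  moreover have "Ide PSh F \<bullet>\<^bsub>PSh\<^esub> p = p" using PSh.Ide_Comp[OF _ F p] rep_Ob[OF Y] by simp
  ultimately have vu: "v \<bullet>\<^bsub>PSh\<^esub> u = Ide PSh F"
    using univ[OF F p p0] psh_Comp_Hom[OF u(1) v(1)] psh_Ide_Hom[OF F] by blast
  have vu_x: "ev v Z (ev u Z x) = x" if "Z \<in> S" "x \<in> El F Z" for Z x
    using ev_comp[OF u(1) v(1) that] ev_Ide[OF that] vu by simp
  have up: "ev u Z (ev p Z g) = ev q Z g" and vq: "ev v Z (ev q Z g) = ev p Z g"
    if "Z \<in> S" "\<guillemotleft>g : Z \<rightarrow> Y\<guillemotright>" for Z g
    using ev_comp[OF p u(1) that(1)] ev_comp[OF q v(1) that(1)] El_repI[OF that(2)] u(2) v(2) by simp_all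
  have surj: "\<exists>g. \<guillemotleft>g : Z \<rightarrow> Y\<guillemotright> \<and> ev q Z g = x" if "Z \<in> S" "x \<in> El K Z" for Z x
    using pw f that unfolding pointwise_cokernel_def by blast
  have ker: "ev q Z g = \<one>\<^bsub>fobj K Z\<^esub> \<longleftrightarrow> (\<exists>h. \<guillemotleft>h : Z \<rightarrow> X\<guillemotright> \<and> g = f \<bullet> h)" if "Z \<in> S" "\<guillemotleft>g : Z \<rightarrow> Y\<guillemotright>" for Z g
    using pw f that unfolding pointwise_cokernel_def by simp
  show ?thesis
    unfolding pointwise_cokernel_def
  proof (intro conjI ballI allI impI)
    show "p \<in> Hom PSh (rep (Tgt C f)) F" using p f by simp
    show "\<exists>g. \<guillemotleft>g : Z \<rightarrow> Tgt C f\<guillemotright> \<and> ev p Z g = x" if Z: "Z \<in> S" and x: "x \<in> El F Z" for Z x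
    proof -
      obtain g where g: "\<guillemotleft>g : Z \<rightarrow> Y\<guillemotright>" "ev q Z g = ev u Z x" using surj[OF Z ev_closed[OF u(1) Z x]] by blast
      then have "\<guillemotleft>g : Z \<rightarrow> Tgt C f\<guillemotright> \<and> ev p Z g = x" using vq[OF Z g(1)] vu_x[OF Z x] f by simp
      then show ?thesis by blast
    qed
    show "ev p Z g = \<one>\<^bsub>fobj F Z\<^esub> \<longleftrightarrow> (\<exists>h. \<guillemotleft>h : Z \<rightarrow> Src C f\<guillemotright> \<and> g = f \<bullet> h)"
      if Z: "Z \<in> S" and g: "\<guillemotleft>g : Z \<rightarrow> Tgt C f\<guillemotright>" for Z g
    proof -
      have g: "\<guillemotleft>g : Z \<rightarrow> Y\<guillemotright>" using g f by simp
      have "ev p Z g = \<one>\<^bsub>fobj F Z\<^esub> \<longleftrightarrow> ev q Z g = \<one>\<^bsub>fobj K Z\<^esub>"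
        using up[OF Z g] vq[OF Z g] ev_one[OF u(1) Z] ev_one[OF v(1) Z] by auto
      then show ?thesis using ker[OF Z g] f by simp
    qed
  qed
qed

lemma finitely_presentedI:
  assumes f: "\<guillemotleft>f : X \<rightarrow> Y\<guillemotright>" "X \<in> S" "Y \<in> S" and pw: "pointwise_cokernel f F p"
  shows "finitely_presented (full_subcat C S) F"
proof -
  have "f \<in> Hom C X Y" using in_homD(3)[OF f(1)] .
  then show ?thesis
    using pointwise_cokernel_is_cokernel[OF f(1) pw] f(2,3)
    unfolding finitely_presented_def full_subcat_simps representable_full_subcat restricted_yoneda_full_subcat
    by blast
qed

lemma finitely_presentedE:
  assumes "finitely_presented (full_subcat C S) F"
  obtains X Y f p where "\<guillemotleft>f : X \<rightarrow> Y\<guillemotright>" "X \<in> S" "Y \<in> S" "pointwise_cokernel f F p" "F \<in> Ob PSh"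
proof -
  obtain X Y f p where XY: "X \<in> S" "Y \<in> S" "f \<in> Hom C X Y" and coker: "is_cokernel PSh (rep X) (rep Y) F (yon f) p"
    using assms
    unfolding finitely_presented_def full_subcat_simps representable_full_subcat restricted_yoneda_full_subcat
    by blast
  have f: "\<guillemotleft>f : X \<rightarrow> Y\<guillemotright>" using in_homI[OF _ _ XY(3)] XY(1,2) by simp
  have "F \<in> Ob PSh" using coker unfolding is_cokernel_def by blast
  then show ?thesis using that[OF f XY(1,2) cokernel_pointwise[OF f coker]] by blast
qed

lemma pointwise_cokernel_factor:
  assumes f: "\<guillemotleft>f : X \<rightarrow> Y\<guillemotright>" and pw: "pointwise_cokernel f F p" and q: "q \<in> Hom PSh (rep Y) L"
    and q0: "\<And>Z h. \<lbrakk>Z \<in> S; \<guillemotleft>h : Z \<rightarrow> X\<guillemotright>\<rbrakk> \<Longrightarrow> ev q Z (f \<bullet> h) = \<one>\<^bsub>fobj L Z\<^esub>"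
  obtains u where "u \<in> Hom PSh F L" "\<And>Z g. \<lbrakk>Z \<in> S; \<guillemotleft>g : Z \<rightarrow> Y\<guillemotright>\<rbrakk> \<Longrightarrow> ev u Z (ev p Z g) = ev q Z g"
proof -
  have X: "X \<in> Ob C" and Y: "Y \<in> Ob C" using in_homD[OF f] by blast+
  have L: "L \<in> Ob PSh" using Hom_PSh_Ob[OF q] by blast
  have p: "p \<in> Hom PSh (rep Y) F" using pw f unfolding pointwise_cokernel_def by simp
  have "q \<bullet>\<^bsub>PSh\<^esub> yon f = Zero PSh (rep X) L"
  proof (rule psh_eqI[OF psh_Comp_Hom[OF yon_Hom[OF f] q] psh_Zero_Hom[OF rep_Ob[OF X] L]])
    fix Z g assume Z: "Z \<in> S" and g0: "g \<in> El (rep X) Z"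
    then have g: "\<guillemotleft>g : Z \<rightarrow> X\<guillemotright>" using El_repD[of g Z X] X by simp
    show "ev (q \<bullet>\<^bsub>PSh\<^esub> yon f) Z g = ev (Zero PSh (rep X) L) Z g"
      unfolding ev_comp[OF yon_Hom[OF f] q Z g0] ev_zero[OF Z g0] ev_yon[OF f g Z] using q0[OF Z g] .
  qed
  then obtain u where u: "u \<in> Hom PSh F L" "u \<bullet>\<^bsub>PSh\<^esub> p = q"
    using pointwise_cokernel_is_cokernel[OF f pw] L q unfolding is_cokernel_def by blast
  have "ev u Z (ev p Z g) = ev q Z g" if "Z \<in> S" "\<guillemotleft>g : Z \<rightarrow> Y\<guillemotright>" for Z g
    using ev_comp[OF p u(1) that(1)] El_repI[OF that(2)] u(2) by simp
  then show ?thesis using that u(1) by blast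
qed

end

section \<open>Triangulated categories\<close>

context triangulated_category
begin

abbreviation sh :: "'o \<Rightarrow> 'o" where "sh \<equiv> shift_ob T"

abbreviation sa :: "'m \<Rightarrow> 'm" where "sa \<equiv> shift_arr T"

abbreviation tri :: "'o \<Rightarrow> 'o \<Rightarrow> 'o \<Rightarrow> 'm \<Rightarrow> 'm \<Rightarrow> 'm \<Rightarrow> bool" where "tri \<equiv> triangle T"

lemma additive_shift: "additive_functor T T (Shift T)"
  using shift_equivalence unfolding category_equivalence_def quasi_inverse_def by blast

sublocale shift: additive_functor_between T T "Shift T"
  by unfold_locales (rule additive_shift)

notation in_hom (\<open>\<guillemotleft>_ : _ \<rightarrow> _\<guillemotright>\<close>) and add (infixl \<open>\<boxplus>\<close> 65) and dif (infixl \<open>\<boxminus>\<close> 65)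

lemma shift_faithful: "\<lbrakk>par f g; sa f = sa g\<rbrakk> \<Longrightarrow> f = g"
  using shift.equivalence_faithful[OF shift_equivalence] unfolding shift.faithful_def by blast

lemma shift_full:
  assumes "X \<in> Ob T" "Y \<in> Ob T" "\<guillemotleft>h : sh X \<rightarrow> sh Y\<guillemotright>"
  obtains f where "\<guillemotleft>f : X \<rightarrow> Y\<guillemotright>" "sa f = h"
  using shift.equivalence_full[OF shift_equivalence] assms unfolding shift.full_def by blast

lemma shift_ess_surj:
  assumes "Y \<in> Ob T" obtains X \<sigma> where "X \<in> Ob T" "iso_in T (sh X) Y \<sigma>"
  using shift.equivalence_ess_surj[OF shift_equivalence assms] unfolding isomorphic_def by blast

lemma triD:
  assumes "tri X Y Z f g h"
  shows "X \<in> Ob T" "Y \<in> Ob T" "Z \<in> Ob T" "\<guillemotleft>f : X \<rightarrow> Y\<guillemotright>" "\<guillemotleft>g : Y \<rightarrow> Z\<guillemotright>" "\<guillemotleft>h : Z \<rightarrow> sh X\<guillemotright>"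
proof -
  have *: "X \<in> Ob T" "Y \<in> Ob T" "Z \<in> Ob T" "f \<in> Hom T X Y" "g \<in> Hom T Y Z" "h \<in> Hom T Z (sh X)"
    using assms unfolding triangle_def by blast+
  show "X \<in> Ob T" "Y \<in> Ob T" "Z \<in> Ob T" by fact+
  show "\<guillemotleft>f : X \<rightarrow> Y\<guillemotright>" by (rule in_homI) fact+
  show "\<guillemotleft>g : Y \<rightarrow> Z\<guillemotright>" by (rule in_homI) fact+
  show "\<guillemotleft>h : Z \<rightarrow> sh X\<guillemotright>" using * by (intro in_homI) simp_all
qed

lemma rotate: assumes "tri X Y Z f g h" shows "tri Y Z (sh X) g h (neg (sa f))"
  using triangle_rotate[of X Y Z f g h] triD[OF assms] in_homD(3)[OF triD(4)[OF assms]] in_homD(3)[OF triD(5)[OF assms]]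
    in_homD(3)[OF triD(6)[OF assms]] assms
  by (simp add: neg_def)

lemma unrotate: assumes "tri Y Z (sh X) g h (neg (sa f))" "\<guillemotleft>f : X \<rightarrow> Y\<guillemotright>" shows "tri X Y Z f g h"
  using triangle_rotate[of X Y Z f g h] in_homD[OF assms(2)] in_homD[OF triD(4)[OF assms(1)]]
    in_homD(3)[OF triD(5)[OF assms(1)]] assms
  by (simp add: neg_def)

text \<open>Rotation negates the translated map, so a triangle that ends in \<open>sa f\<close>
  rotates back to one that starts with \<open>neg f\<close>.\<close>

lemma unrotate_neg:
  assumes t: "tri Y Z (sh X) g h k" and f: "\<guillemotleft>f : X \<rightarrow> Y\<guillemotright>" "sa f = k" shows "tri X Y Z (neg f) g h"
proof (rule unrotate)
  have "neg (sa (neg f)) = k" using triD(6)[OF t] f by (simp add: shift.neg)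
  then show "tri Y Z (sh X) g h (neg (sa (neg f)))" using t by simp
qed (use f in simp)

lemma tri_iso3:
  assumes t: "tri X Y Z f g h" and c: "\<guillemotleft>c : Z \<rightarrow> Z'\<guillemotright>" "\<guillemotleft>d : Z' \<rightarrow> Z\<guillemotright>" "d \<bullet> c = Ide T Z" "c \<bullet> d = Ide T Z'"
  shows "tri X Y Z' f (c \<bullet> g) (h \<bullet> d)"
proof -
  note ar = triD[OF t]
  have gh: "\<guillemotleft>c \<bullet> g : Y \<rightarrow> Z'\<guillemotright>" "\<guillemotleft>h \<bullet> d : Z' \<rightarrow> sh X\<guillemotright>" using ar c(1,2) by simp_all
  have h: "(h \<bullet> d) \<bullet> c = h" using ar c by (simp add: comp_assoc)
  show ?thesis
  proof (rule triangle_iso[OF t ar(1,2) in_homD(2)[OF c(1)] in_homD(3)[OF ar(4)] in_homD(3)[OF gh(1)] in_homD(3)[OF gh(2)]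
        iso_in_Ide[OF ar(1)] iso_in_Ide[OF ar(2)] iso_inI[OF c]])
    show "Ide T Y \<bullet> f = f \<bullet> Ide T X" "c \<bullet> g = c \<bullet> g \<bullet> Ide T Y" "sa (Ide T X) \<bullet> h = h \<bullet> d \<bullet> c"
      using ar c h gh by simp_all
  qed
qed

lemma tri_iso1:
  assumes t: "tri X Y Z f g h" and c: "\<guillemotleft>c : X' \<rightarrow> X\<guillemotright>" "\<guillemotleft>d : X \<rightarrow> X'\<guillemotright>" "d \<bullet> c = Ide T X'" "c \<bullet> d = Ide T X"
  shows "tri X' Y Z (f \<bullet> c) g (sa d \<bullet> h)"
proof -
  note ar = triD[OF t]
  have gh: "\<guillemotleft>f \<bullet> c : X' \<rightarrow> Y\<guillemotright>" "\<guillemotleft>sa d \<bullet> h : Z \<rightarrow> sh X'\<guillemotright>" using ar c(1,2) by simp_all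
  have h: "(f \<bullet> c) \<bullet> d = f" using ar c by (simp add: comp_assoc)
  show ?thesis
  proof (rule triangle_iso[OF t in_homD(1)[OF c(1)] ar(2,3) in_homD(3)[OF gh(1)] in_homD(3)[OF ar(5)] in_homD(3)[OF gh(2)]
        iso_inI[OF c(2,1,4,3)] iso_in_Ide[OF ar(2)] iso_in_Ide[OF ar(3)]])
    show "Ide T Y \<bullet> f = f \<bullet> c \<bullet> d" "Ide T Z \<bullet> g = g \<bullet> Ide T Y" "sa d \<bullet> h = sa d \<bullet> h \<bullet> Ide T Z"
      using ar c h gh by simp_all
  qed
qed

text \<open>The components identity, minus identity, identity form an isomorphism of triangles. It
  supplies the signs needed to rotate a triangle back three times.\<close>

lemma tri_neg:
  assumes t: "tri X Y Z f g h" shows "tri X Y Z (neg f) (neg g) h"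
proof -
  note ar = triD[OF t]
  have gh: "\<guillemotleft>neg f : X \<rightarrow> Y\<guillemotright>" "\<guillemotleft>neg g : Y \<rightarrow> Z\<guillemotright>" using ar by simp_all
  have i: "iso_in T Y Y (neg (Ide T Y))"
    using ar by (intro iso_inI[where g = "neg (Ide T Y)"]) simp_all
  show ?thesis
  proof (rule triangle_iso[OF t ar(1-3) in_homD(3)[OF gh(1)] in_homD(3)[OF gh(2)] in_homD(3)[OF ar(6)]
        iso_in_Ide[OF ar(1)] i iso_in_Ide[OF ar(3)]])
    show "neg (Ide T Y) \<bullet> f = neg f \<bullet> Ide T X" "Ide T Z \<bullet> g = neg g \<bullet> neg (Ide T Y)" "sa (Ide T X) \<bullet> h = h \<bullet> Ide T Z"
      using ar gh by simp_all
  qed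
qed

section \<open>Zero objects and exactness of Hom along triangles\<close>

lemma zero_objectD:
  assumes "zero_object T Z"
  shows "Z \<in> Ob T" "\<guillemotleft>f : X \<rightarrow> Z\<guillemotright> \<Longrightarrow> f = zero X Z" "\<guillemotleft>f : Z \<rightarrow> X\<guillemotright> \<Longrightarrow> f = zero Z X"
proof -
  show "Z \<in> Ob T" using assms unfolding zero_object_def by blast
  show "f = zero X Z" if "\<guillemotleft>f : X \<rightarrow> Z\<guillemotright>" using assms in_homD[OF that] unfolding zero_object_def by blast
  show "f = zero Z X" if "\<guillemotleft>f : Z \<rightarrow> X\<guillemotright>" using assms in_homD[OF that] unfolding zero_object_def by blast
qed

lemma zero_object_shift: assumes "zero_object T Z" shows "zero_object T (sh Z)"
proof -
  note Z = zero_objectD[OF assms]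
  have "Ide T Z = zero Z Z" using Z(1) by (intro Z(2)) simp
  then have id: "Ide T (sh Z) = zero (sh Z) (sh Z)" using shift.Ide[OF Z(1)] shift.zero[OF Z(1) Z(1)] by simp
  have shZ: "sh Z \<in> Ob T" using Z(1) by simp
  show ?thesis
    unfolding zero_object_def
  proof (intro conjI ballI shZ)
    fix X assume X: "X \<in> Ob T"
    have "f = zero X (sh Z)" if "f \<in> Hom T X (sh Z)" for f
    proof -
      have f: "\<guillemotleft>f : X \<rightarrow> sh Z\<guillemotright>" using in_homI[OF X shZ that] .
      have "f = Ide T (sh Z) \<bullet> f" using f by simp
      also have "\<dots> = zero X (sh Z)" using f X shZ unfolding id by simp
      finally show ?thesis .
    qed
    moreover have "zero X (sh Z) \<in> Hom T X (sh Z)" using X shZ by (intro in_homD(3)) simp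
    ultimately show "Hom T X (sh Z) = {zero X (sh Z)}" by blast
    have "f = zero (sh Z) X" if "f \<in> Hom T (sh Z) X" for f
    proof -
      have f: "\<guillemotleft>f : sh Z \<rightarrow> X\<guillemotright>" using in_homI[OF shZ X that] .
      have "f = f \<bullet> Ide T (sh Z)" using f by simp
      also have "\<dots> = zero (sh Z) X" using f X shZ unfolding id by simp
      finally show ?thesis .
    qed
    moreover have "zero (sh Z) X \<in> Hom T (sh Z) X" using X shZ by (intro in_homD(3)) simp
    ultimately show "Hom T (sh Z) X = {zero (sh Z) X}" by blast
  qed
qed

text \<open>The identity of \<open>X\<close> and \<open>f\<close> begin a morphism from the triangle
  \<open>X = X -> 0\<close> to the given one; its completion factors \<open>g \<bullet> f\<close>
  through a zero object.\<close>

lemma tri_comp_zero: assumes t: "tri X Y Z f g h" shows "g \<bullet> f = zero X Z"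
proof -
  note ar = triD[OF t]
  obtain N where N: "zero_object T N" using zero_object_exists by blast
  have a: "\<guillemotleft>Ide T X : X \<rightarrow> X\<guillemotright>" using ar by simp
  obtain c where c: "c \<in> Hom T N Z" "c \<bullet> zero X N = g \<bullet> f"
    using triangle_morphism[OF triangle_Ide[OF ar(1) N] t in_homD(3)[OF a] in_homD(3)[OF ar(4)]] by blast
  have "\<guillemotleft>c : N \<rightarrow> Z\<guillemotright>" using in_homI[OF zero_objectD(1)[OF N] ar(3) c(1)] .
  then have "c \<bullet> zero X N = zero X Z" using ar(1) by simp
  then show ?thesis using c(2) by simp
qed

text \<open>Exactness of \<open>T(A, -)\<close> at \<open>Y\<close>. The axiom on morphisms
  completes only the third map, so the triangles on \<open>A\<close> and on \<open>X\<close> are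
  both rotated once; the completion \<open>A[1] -> X[1]\<close> comes back to \<open>A -> X\<close>
  because the translation is full and faithful.\<close>

lemma tri_exact:
  assumes t: "tri X Y Z f g h" and s: "\<guillemotleft>s : A \<rightarrow> Y\<guillemotright>" "g \<bullet> s = zero A Z"
  obtains u where "\<guillemotleft>u : A \<rightarrow> X\<guillemotright>" "f \<bullet> u = s"
proof -
  note ar = triD[OF t]
  have A: "A \<in> Ob T" using in_homD[OF s(1)] by blast
  obtain N where N: "zero_object T N" using zero_object_exists by blast
  note N0 = zero_objectD(1)[OF N]
  have t1: "tri A N (sh A) (zero A N) (zero N (sh A)) (neg (sa (Ide T A)))" by (rule rotate[OF triangle_Ide[OF A N]])
  have b: "\<guillemotleft>zero N Z : N \<rightarrow> Z\<guillemotright>" using N0 ar by simp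
  have "zero N Z \<bullet> zero A N = g \<bullet> s" using N0 ar A s by simp
  from triangle_morphism[OF t1 rotate[OF t] in_homD(3)[OF s(1)] in_homD(3)[OF b] this]
  obtain c where c: "c \<in> Hom T (sh A) (sh X)" "sa s \<bullet> neg (sa (Ide T A)) = neg (sa f) \<bullet> c" by blast
  have c1: "\<guillemotleft>c : sh A \<rightarrow> sh X\<guillemotright>" using c(1) A ar by (intro in_homI) simp_all
  obtain u where u: "\<guillemotleft>u : A \<rightarrow> X\<guillemotright>" "sa u = c" using shift_full[OF A ar(1) c1] .
  have "neg (sa s) = neg (sa (f \<bullet> u))" using c(2) u(1) u(2)[symmetric] s(1) ar A by (simp add: shift.comp)
  moreover have "arr (sa s)" "arr (sa (f \<bullet> u))" using s(1) u(1) ar by simp_all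
  ultimately have "sa s = sa (f \<bullet> u)" using neg_neg by metis
  then have "s = f \<bullet> u" using shift_faithful[of s "f \<bullet> u"] s(1) u(1) ar by simp
  then show ?thesis using that u(1) by blast
qed

text \<open>Exactness of \<open>T(-, A)\<close> at \<open>Y\<close>, by mapping the given triangle
  to \<open>0 -> A = A\<close>; the completed third map is the required \<open>u\<close>.\<close>

lemma tri_exact_contra:
  assumes t: "tri X Y Z f g h" and s: "\<guillemotleft>s : Y \<rightarrow> A\<guillemotright>" "s \<bullet> f = zero X A"
  obtains u where "\<guillemotleft>u : Z \<rightarrow> A\<guillemotright>" "u \<bullet> g = s"
proof -
  note ar = triD[OF t]
  have A: "A \<in> Ob T" using in_homD[OF s(1)] by blast
  obtain N where N: "zero_object T N" using zero_object_exists by blast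
  note N0 = zero_objectD(1)[OF N]
  have z: "\<guillemotleft>zero N A : N \<rightarrow> A\<guillemotright>" using N0 A by simp
  have "neg (sa (zero N A)) = zero (sh N) (sh A)" using N0 A by simp
  then have t1: "tri N A A (zero N A) (Ide T A) (zero A (sh N))"
    using unrotate[OF _ z] triangle_Ide[OF A zero_object_shift[OF N]] by simp
  have b: "\<guillemotleft>zero X N : X \<rightarrow> N\<guillemotright>" using N0 ar by simp
  have "s \<bullet> f = zero N A \<bullet> zero X N" using N0 ar A s by simp
  from triangle_morphism[OF t t1 in_homD(3)[OF b] in_homD(3)[OF s(1)] this]
  obtain c where c: "c \<in> Hom T Z A" "c \<bullet> g = Ide T A \<bullet> s" by blast
  have "\<guillemotleft>c : Z \<rightarrow> A\<guillemotright>" using in_homI[OF ar(3) A c(1)] .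
  moreover have "c \<bullet> g = s" using c(2) s(1) by simp
  ultimately show ?thesis using that by blast
qed

text \<open>The translation is an equivalence and need not be bijective on objects, so
  \<open>Z\<close> is replaced by an isomorphic \<open>sh D\<close> before the triangle is rotated
  back.\<close>

lemma fibre:
  assumes t: "tri X Y Z f g h"
  obtains D w h' \<sigma> where "tri D X Y w f h'" "D \<in> Ob T" "iso_in T (sh D) Z \<sigma>"
proof -
  note ar = triD[OF t]
  obtain D \<sigma> where D: "D \<in> Ob T" and \<sigma>: "iso_in T (sh D) Z \<sigma>" using shift_ess_surj[OF ar(3)] .
  obtain \<rho> where \<rho>: "\<guillemotleft>\<sigma> : sh D \<rightarrow> Z\<guillemotright>" "\<guillemotleft>\<rho> : Z \<rightarrow> sh D\<guillemotright>" "\<rho> \<bullet> \<sigma> = Ide T (sh D)" "\<sigma> \<bullet> \<rho> = Ide T Z"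
    using iso_inE[OF \<sigma>] D ar(3) by auto
  have t1: "tri X Y (sh D) f (\<rho> \<bullet> g) (h \<bullet> \<sigma>)" using tri_iso3[OF t \<rho>(2,1,4,3)] .
  obtain w where w: "\<guillemotleft>w : D \<rightarrow> X\<guillemotright>" "sa w = h \<bullet> \<sigma>" using shift_full[OF D ar(1) triD(6)[OF t1]] .
  have "tri D X Y (neg w) f (\<rho> \<bullet> g)" by (rule unrotate_neg[OF t1 w])
  then show ?thesis using that D \<sigma> by blast
qed

text \<open>Every element of \<open>T(B, Z[1])\<close> is realised by an extension of
  \<open>B\<close> by \<open>Z\<close>: take the fibre of \<open>w\<close> and rotate back.\<close>

lemma fibre_of_connecting:
  assumes "\<guillemotleft>w : B \<rightarrow> sh Z\<guillemotright>" "Z \<in> Ob T"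
  obtains D a b where "tri Z D B a b w"
proof -
  obtain C g h where "tri B (sh Z) C w g h" using triangle_exists in_homD[OF assms(1)] by blast
  then obtain D b h' where t: "tri D B (sh Z) b w h'" using fibre by blast
  note ar = triD[OF t]
  obtain a where a: "\<guillemotleft>a : Z \<rightarrow> D\<guillemotright>" "sa a = h'" using shift_full[OF assms(2) ar(1,6)] .
  have "tri Z D B (neg a) b w" by (rule unrotate_neg[OF t a])
  then show ?thesis using that by blast
qed

text \<open>Closure under summands is phrased with biproducts, while the arguments below produce
  retracts. The complement of the split monomorphism \<open>s\<close> is its cone: the connecting
  map satisfies \<open>sa s \<bullet> h = 0\<close>, hence is zero, and the triangle splits.\<close>

lemma retract_biproduct:
  assumes s: "\<guillemotleft>s : X \<rightarrow> P\<guillemotright>" and r: "\<guillemotleft>r : P \<rightarrow> X\<guillemotright>" and rs: "r \<bullet> s = Ide T X"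
  obtains Y where "Y \<in> Ob T" "biproduct T X Y P"
proof -
  have X: "X \<in> Ob T" and P: "P \<in> Ob T" using in_homD[OF s] by blast+
  obtain Y q h where t: "tri X P Y s q h" using triangle_exists[OF X P in_homD(3)[OF s]] by blast
  note ar = triD[OF t]
  have Y: "Y \<in> Ob T" by (rule ar)
  have "neg (sa s) \<bullet> h = zero Y (sh P)" using tri_comp_zero[OF rotate[OF t]] tri_comp_zero[OF rotate[OF rotate[OF t]]] by simp
  then have "neg (sa s \<bullet> h) = zero Y (sh P)" using ar by simp
  moreover have "arr (sa s \<bullet> h)" using ar by simp
  ultimately have "sa s \<bullet> h = neg (zero Y (sh P))" using neg_neg by metis
  then have sh0: "sa s \<bullet> h = zero Y (sh P)" using Y P by simp
  have id: "sa r \<bullet> sa s = Ide T (sh X)" using rs shift.comp[of s r] s r X by simp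
  have "h = (sa r \<bullet> sa s) \<bullet> h" unfolding id using ar X by simp
  also have "\<dots> = zero Y (sh X)" using sh0 ar s r P Y by (simp add: comp_assoc)
  finally have h0: "h = zero Y (sh X)" .
  have "h \<bullet> Ide T Y = zero Y (sh X)" using h0 X Y by simp
  then obtain t0 where t0: "\<guillemotleft>t0 : Y \<rightarrow> P\<guillemotright>" "q \<bullet> t0 = Ide T Y"
    using tri_exact[OF rotate[OF t], of "Ide T Y" Y] Y by auto
  \<comment> \<open>\<open>?e\<close> kills \<open>s\<close>, hence factors as
    \<open>j \<bullet> q\<close>. Comparing with the section \<open>t0\<close> of \<open>q\<close>
    gives \<open>j = ?e \<bullet> t0\<close>, that is \<open>t0\<close> corrected so that
    \<open>r\<close> vanishes on it.\<close>
  let ?e = "Ide T P \<boxminus> s \<bullet> r"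
  have e: "\<guillemotleft>?e : P \<rightarrow> P\<guillemotright>" using s r P by simp
  have "?e \<bullet> s = zero X P" using s r P X rs by (simp add: comp_dif_left comp_assoc)
  then obtain j where j: "\<guillemotleft>j : Y \<rightarrow> P\<guillemotright>" "j \<bullet> q = ?e" using tri_exact_contra[OF t e] by blast
  have qs: "q \<bullet> s = zero X Y" by (rule tri_comp_zero[OF t])
  have j_eq: "j = ?e \<bullet> t0"
  proof -
    have "(j \<bullet> q) \<bullet> t0 = j \<bullet> (q \<bullet> t0)" using j(1) ar t0(1) by (simp add: comp_assoc)
    then show ?thesis using t0 j by simp
  qed
  have "q \<bullet> ?e = q"
  proof -
    have "q \<bullet> ?e = q \<boxminus> (q \<bullet> s) \<bullet> r" using ar s r P by (simp add: comp_dif_right comp_assoc)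
    also have "\<dots> = q" using qs r X Y P ar by (simp add: dif_def)
    finally show ?thesis .
  qed
  then have qj: "q \<bullet> j = Ide T Y" unfolding j_eq using t0 e ar by (simp add: comp_assoc[symmetric])
  have "r \<bullet> ?e = zero P X"
  proof -
    have "r \<bullet> ?e = r \<boxminus> (r \<bullet> s) \<bullet> r" using s r P by (simp add: comp_dif_right comp_assoc)
    then show ?thesis using rs r by simp
  qed
  then have rj: "r \<bullet> j = zero Y X" unfolding j_eq using t0 e r X by (simp add: comp_assoc[symmetric])
  have sum: "s \<bullet> r \<boxplus> j \<bullet> q = Ide T P"
  proof -
    have "s \<bullet> r \<boxplus> ?e = ?e \<boxplus> s \<bullet> r" using s r P by (intro add_comm) simp
    then show ?thesis using j(2) dif_add_cancel[of "Ide T P" "s \<bullet> r"] s r P by simp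
  qed
  then have "(s \<bullet> r) \<otimes>\<^bsub>Mor T P P\<^esub> (j \<bullet> q) = Ide T P" using s r by (simp add: add_def)
  then have "biproduct T X Y P"
    unfolding biproduct_def
    using P rs qj rj qs in_homD(3)[OF s] in_homD(3)[OF j(1)] in_homD(3)[OF r] in_homD(3)[OF ar(5)] by blast
  then show ?thesis using that Y by blast
qed

end

section \<open>Cotorsion pairs\<close>

locale cotorsion = triangulated_category T
  for T :: "('o, 'm, 'z) tricat_scheme" (structure) +
  fixes U V :: "'o set"
  assumes cotorsion: "cotorsion_pair T U V"
begin

abbreviation A :: "'o set" where "A \<equiv> unshift_class T U"

abbreviation W :: "'o set" where "W \<equiv> U \<inter> V"

abbreviation Tp :: "'o set" where "Tp \<equiv> tplus T U V"

abbreviation Tm :: "'o set" where "Tm \<equiv> tminus T U V"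

lemma U_Ob: "X \<in> U \<Longrightarrow> X \<in> Ob T" and V_Ob: "X \<in> V \<Longrightarrow> X \<in> Ob T"
  using cotorsion unfolding cotorsion_pair_def additive_subcat_def by blast+

lemma orthogonal: assumes "X \<in> U" "Y \<in> V" "\<guillemotleft>f : X \<rightarrow> sh Y\<guillemotright>" shows "f = zero X (sh Y)"
proof -
  have "Hom T X (sh Y) = {zero X (sh Y)}" using cotorsion assms(1,2) unfolding cotorsion_pair_def by blast
  then show ?thesis using in_homD(3)[OF assms(3)] by blast
qed

lemma cotorsion_triangle:
  assumes "X \<in> Ob T"
  obtains U0 V0 f g h where "U0 \<in> U" "V0 \<in> V" "tri U0 X (sh V0) f g h"
  using cotorsion assms unfolding cotorsion_pair_def by blast

lemma W_additive: "additive_subcat T W"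
proof -
  have U: "additive_subcat T U" and V: "additive_subcat T V" using cotorsion unfolding cotorsion_pair_def by blast+
  obtain Z where Z: "Z \<in> U" "zero_object T Z" using U unfolding additive_subcat_def by blast
  obtain Z' where Z': "Z' \<in> V" "zero_object T Z'" using V unfolding additive_subcat_def by blast
  note o = zero_objectD(1)[OF Z(2)] zero_objectD(1)[OF Z'(2)]
  \<comment> \<open>\<open>U\<close> and \<open>V\<close> come with possibly different zero objects;
    the isomorphism between them puts \<open>Z\<close> into both classes.\<close>
  have "iso_in T Z' Z (zero Z' Z)"
  proof (rule iso_inI)
    show "zero Z Z' \<bullet> zero Z' Z = Ide T Z'" using zero_objectD(2)[OF Z'(2), of "Ide T Z'" Z'] o by simp
    show "zero Z' Z \<bullet> zero Z Z' = Ide T Z" using zero_objectD(2)[OF Z(2), of "Ide T Z" Z] o by simp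
  qed (use o in simp_all)
  then have "Z \<in> V" using V Z' o unfolding additive_subcat_def isomorphic_def by blast
  then show ?thesis using U V Z unfolding additive_subcat_def by blast
qed

sublocale ideal_quotient T W
  by unfold_locales (rule W_additive)

section \<open>Closure properties of \<open>U\<close>, \<open>V\<close> and \<open>A\<close>\<close>

lemma U_retract:
  assumes "P \<in> U" "\<guillemotleft>s : X \<rightarrow> P\<guillemotright>" "\<guillemotleft>r : P \<rightarrow> X\<guillemotright>" "r \<bullet> s = Ide T X" shows "X \<in> U"
proof -
  obtain Y where "Y \<in> Ob T" "biproduct T X Y P" using retract_biproduct[OF assms(2-4)] .
  moreover have "closed_under_summands T U" using cotorsion unfolding cotorsion_pair_def by blast
  ultimately show ?thesis using assms(1) in_homD(1)[OF assms(2)] unfolding closed_under_summands_def by blast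
qed

lemma V_retract:
  assumes "P \<in> V" "\<guillemotleft>s : X \<rightarrow> P\<guillemotright>" "\<guillemotleft>r : P \<rightarrow> X\<guillemotright>" "r \<bullet> s = Ide T X" shows "X \<in> V"
proof -
  obtain Y where "Y \<in> Ob T" "biproduct T X Y P" using retract_biproduct[OF assms(2-4)] .
  moreover have "closed_under_summands T V" using cotorsion unfolding cotorsion_pair_def by blast
  ultimately show ?thesis using assms(1) in_homD(1)[OF assms(2)] unfolding closed_under_summands_def by blast
qed

text \<open>The hypothesis kills the map \<open>X -> V0[1]\<close> of the cotorsion triangle, so the
  identity of \<open>X\<close> lifts to \<open>U0\<close> and \<open>X\<close> is a retract of an
  object of \<open>U\<close>. Thus \<open>U\<close> is the whole left orthogonal of
  \<open>V[1]\<close>.\<close>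

lemma U_I:
  assumes X: "X \<in> Ob T" and orth: "\<And>V0 f. \<lbrakk>V0 \<in> V; \<guillemotleft>f : X \<rightarrow> sh V0\<guillemotright>\<rbrakk> \<Longrightarrow> f = zero X (sh V0)"
  shows "X \<in> U"
proof -
  obtain U0 V0 f g h where U0: "U0 \<in> U" and V0: "V0 \<in> V" and t: "tri U0 X (sh V0) f g h" using cotorsion_triangle[OF X] .
  note ar = triD[OF t]
  have "g \<bullet> Ide T X = zero X (sh V0)" using orth[OF V0 ar(5)] X ar(3) by simp
  then obtain s where "\<guillemotleft>s : X \<rightarrow> U0\<guillemotright>" "f \<bullet> s = Ide T X" using tri_exact[OF t, of "Ide T X" X] X by auto
  then show ?thesis using U_retract[OF U0] ar(4) by blast
qed

text \<open>In the cotorsion triangle of \<open>X[1]\<close> the first map vanishes, so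
  \<open>X[1]\<close> is a retract of \<open>V0[1]\<close>; full faithfulness of the translation
  then removes the shift.\<close>

lemma V_I:
  assumes X: "X \<in> Ob T" and orth: "\<And>U0 f. \<lbrakk>U0 \<in> U; \<guillemotleft>f : U0 \<rightarrow> sh X\<guillemotright>\<rbrakk> \<Longrightarrow> f = zero U0 (sh X)"
  shows "X \<in> V"
proof -
  obtain U0 V0 f g h where U0: "U0 \<in> U" and V0: "V0 \<in> V" and t: "tri U0 (sh X) (sh V0) f g h"
    using cotorsion_triangle[OF shift.ob[OF X]] .
  note ar = triD[OF t]
  have "Ide T (sh X) \<bullet> f = zero U0 (sh X)" using orth[OF U0 ar(4)] X ar(1) by simp
  then obtain r where r: "\<guillemotleft>r : sh V0 \<rightarrow> sh X\<guillemotright>" "r \<bullet> g = Ide T (sh X)"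
    using tri_exact_contra[OF t, of "Ide T (sh X)" "sh X"] X by auto
  obtain g' where g': "\<guillemotleft>g' : X \<rightarrow> V0\<guillemotright>" "sa g' = g" using shift_full[OF X V_Ob[OF V0] ar(5)] .
  obtain r' where r': "\<guillemotleft>r' : V0 \<rightarrow> X\<guillemotright>" "sa r' = r" using shift_full[OF V_Ob[OF V0] X r(1)] .
  have "sa (r' \<bullet> g') = sa (Ide T X)" using r(2) g' r' X by (simp add: shift.comp)
  then have "r' \<bullet> g' = Ide T X" using shift_faithful[of "r' \<bullet> g'" "Ide T X"] g' r' X by simp
  then show ?thesis using V_retract[OF V0 g'(1) r'(1)] by blast
qed

text \<open>By \<open>U_I\<close> the class \<open>U\<close> is cut out by the vanishing of maps to
  \<open>V[1]\<close>, a condition that passes from the ends of a triangle to its middle.\<close>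

lemma U_extension: assumes t: "tri X Y Z f g h" and "X \<in> U" "Z \<in> U" shows "Y \<in> U"
proof (rule U_I)
  note ar = triD[OF t]
  show "Y \<in> Ob T" by (rule ar)
  fix V0 k assume V0: "V0 \<in> V" and k: "\<guillemotleft>k : Y \<rightarrow> sh V0\<guillemotright>"
  have "k \<bullet> f = zero X (sh V0)" using orthogonal[OF assms(2) V0] k ar by simp
  then obtain u where u: "\<guillemotleft>u : Z \<rightarrow> sh V0\<guillemotright>" "u \<bullet> g = k" using tri_exact_contra[OF t k] by blast
  have "zero Z (sh V0) \<bullet> g = k" using orthogonal[OF assms(3) V0 u(1)] u(2) by simp
  then show "k = zero Y (sh V0)" using ar V_Ob[OF V0] by simp
qed

lemma U_iso: assumes "X \<in> U" "iso_in T X Y f" "Y \<in> Ob T" shows "Y \<in> U"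
  using assms cotorsion unfolding cotorsion_pair_def additive_subcat_def isomorphic_def by blast

lemma A_iff: "X \<in> A \<longleftrightarrow> X \<in> Ob T \<and> sh X \<in> U"
proof
  assume "X \<in> A"
  then obtain Y where X: "X \<in> Ob T" and Y: "Y \<in> U" "isomorphic T (sh X) Y" unfolding unshift_class_def by blast
  then have "isomorphic T Y (sh X)" using isomorphic_sym[OF Y(2)] U_Ob[OF Y(1)] by simp
  then show "X \<in> Ob T \<and> sh X \<in> U" using X Y U_iso unfolding isomorphic_def by auto
next
  assume "X \<in> Ob T \<and> sh X \<in> U"
  then show "X \<in> A" using isomorphic_refl[OF U_Ob[of "sh X"]] unfolding unshift_class_def by auto
qed

lemma A_Ob: "X \<in> A \<Longrightarrow> X \<in> Ob T" and A_shift: "X \<in> A \<Longrightarrow> sh X \<in> U"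
  using A_iff by blast+

sublocale presheaves T A
  by unfold_locales (use A_Ob in blast)

lemma unshift_U: assumes "X \<in> U" "iso_in T (sh D) X \<sigma>" "D \<in> Ob T" shows "D \<in> A"
  using assms unfolding unshift_class_def isomorphic_def by blast

text \<open>The orthogonality of \<open>U\<close> and \<open>V[1]\<close>, moved back by one
  translation. It makes morphisms through \<open>W\<close> invisible to maps from
  \<open>A\<close>.\<close>

lemma A_V_zero: assumes X: "X \<in> A" and Y: "Y \<in> V" and f: "\<guillemotleft>f : X \<rightarrow> Y\<guillemotright>" shows "f = zero X Y"
proof -
  have "sa f = zero (sh X) (sh Y)" using f by (intro orthogonal[OF A_shift[OF X] Y]) simp
  also have "\<dots> = sa (zero X Y)" using A_Ob[OF X] V_Ob[OF Y] by simp
  finally show ?thesis using shift_faithful[of f "zero X Y"] f A_Ob[OF X] V_Ob[OF Y] by simp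
qed

lemma A_I: assumes X: "X \<in> Ob T" and orth: "\<And>V0 f. \<lbrakk>V0 \<in> V; \<guillemotleft>f : X \<rightarrow> V0\<guillemotright>\<rbrakk> \<Longrightarrow> f = zero X V0" shows "X \<in> A"
proof -
  have "sh X \<in> U"
  proof (rule U_I)
    show "sh X \<in> Ob T" using X by simp
    fix V0 f assume V0: "V0 \<in> V" and f: "\<guillemotleft>f : sh X \<rightarrow> sh V0\<guillemotright>"
    obtain g where g: "\<guillemotleft>g : X \<rightarrow> V0\<guillemotright>" "sa g = f" using shift_full[OF X V_Ob[OF V0] f] .
    show "f = zero (sh X) (sh V0)" using orth[OF V0 g(1)] g(2) X V_Ob[OF V0] by simp
  qed
  then show ?thesis using A_iff X by blast
qed

lemma A_extension: assumes t: "tri X Y Z f g h" and "X \<in> A" "Z \<in> A" shows "Y \<in> A"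
proof (rule A_I)
  note ar = triD[OF t]
  show "Y \<in> Ob T" by (rule ar)
  fix V0 k assume V0: "V0 \<in> V" and k: "\<guillemotleft>k : Y \<rightarrow> V0\<guillemotright>"
  have "k \<bullet> f = zero X V0" using A_V_zero[OF assms(2) V0] k ar by simp
  then obtain u where u: "\<guillemotleft>u : Z \<rightarrow> V0\<guillemotright>" "u \<bullet> g = k" using tri_exact_contra[OF t k] by blast
  have "zero Z V0 \<bullet> g = k" using A_V_zero[OF assms(3) V0 u(1)] u(2) by simp
  then show "k = zero Y V0" using ar V_Ob[OF V0] by simp
qed

section \<open>Morphisms modulo \<open>W\<close>, tested by maps from \<open>A\<close>\<close>

lemma I_comp_A_zero:
  assumes "f \<in> I X Y" "\<guillemotleft>k : B \<rightarrow> X\<guillemotright>" "B \<in> A" "Y \<in> Ob T" shows "f \<bullet> k = zero B Y"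
proof -
  have X: "X \<in> Ob T" by (rule in_homD(2)[OF assms(2)])
  obtain P a b where ab: "\<guillemotleft>a : X \<rightarrow> P\<guillemotright>" "\<guillemotleft>b : P \<rightarrow> Y\<guillemotright>" "P \<in> W" "f = b \<bullet> a" using IE[OF assms(1) X assms(4)] .
  have "a \<bullet> k = zero B P" using A_V_zero[OF assms(3), of P "a \<bullet> k"] ab assms(2) by simp
  then show ?thesis using ab(1,2,4) assms(2) A_Ob[OF assms(3)] by (simp add: comp_assoc)
qed

text \<open>The passage from residue classes to equations: the difference of \<open>f\<close> and
  \<open>g\<close> factors through \<open>W\<close>, and a map from \<open>A\<close> to
  \<open>W\<close> is zero.\<close>

lemma cls_comp_A:
  assumes "cls f = cls g" "\<guillemotleft>f : X \<rightarrow> Y\<guillemotright>" "\<guillemotleft>g : X \<rightarrow> Y\<guillemotright>" "\<guillemotleft>k : B \<rightarrow> X\<guillemotright>" "B \<in> A" shows "f \<bullet> k = g \<bullet> k"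
proof -
  have Y: "Y \<in> Ob T" by (rule in_homD(2)[OF assms(2)])
  have "f \<boxminus> g \<in> I X Y" using cls_eq_iff[OF assms(3,2)] assms(1) by blast
  then have "(f \<boxminus> g) \<bullet> k = zero B Y" using I_comp_A_zero assms(4,5) Y by blast
  then have "f \<bullet> k \<boxminus> g \<bullet> k = zero B Y" using assms(2,3,4) by (simp add: comp_dif_left)
  then show ?thesis using dif_eq_zero[of "f \<bullet> k" "g \<bullet> k"] assms(2,3,4) by simp
qed

lemma cls_inj_A:
  assumes "cls f = cls g" "\<guillemotleft>f : B \<rightarrow> Y\<guillemotright>" "\<guillemotleft>g : B \<rightarrow> Y\<guillemotright>" "B \<in> A" shows "f = g"
  using cls_comp_A[OF assms(1-3), of "Ide T B" B] assms A_Ob[OF assms(4)] by simp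

text \<open>The cotorsion triangle of \<open>X[1]\<close>, translated back. Since maps from
  \<open>A\<close> to \<open>V0\<close> vanish, \<open>E -> X\<close> is a right approximation of
  \<open>X\<close> by objects of \<open>A\<close>.\<close>

lemma cotorsion_triangle_unshifted:
  assumes X: "X \<in> Ob T"
  obtains E V0 p r k where "E \<in> A" "V0 \<in> V" "tri E X V0 p r k"
proof -
  obtain U0 V0 f g h where U0: "U0 \<in> U" and V0: "V0 \<in> V" and t: "tri U0 (sh X) (sh V0) f g h"
    using cotorsion_triangle[OF shift.ob[OF X]] .
  note ar = triD[OF t] and V0' = V_Ob[OF V0]
  obtain E \<sigma> where E: "E \<in> Ob T" and \<sigma>: "iso_in T (sh E) U0 \<sigma>" using shift_ess_surj[OF ar(1)] .
  obtain \<rho> where \<rho>: "\<guillemotleft>\<sigma> : sh E \<rightarrow> U0\<guillemotright>" "\<guillemotleft>\<rho> : U0 \<rightarrow> sh E\<guillemotright>" "\<rho> \<bullet> \<sigma> = Ide T (sh E)" "\<sigma> \<bullet> \<rho> = Ide T U0"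
    using iso_inE[OF \<sigma>] E ar(1) by auto
  have t1: "tri (sh E) (sh X) (sh V0) (f \<bullet> \<sigma>) g (sa \<rho> \<bullet> h)" using tri_iso1[OF t \<rho>] .
  note ar1 = triD[OF t1]
  have shE: "sh E \<in> Ob T" using E by simp
  obtain p where p: "\<guillemotleft>p : E \<rightarrow> X\<guillemotright>" "sa p = f \<bullet> \<sigma>" using shift_full[OF E X ar1(4)] .
  obtain r where r: "\<guillemotleft>r : X \<rightarrow> V0\<guillemotright>" "sa r = g" using shift_full[OF X V0' ar1(5)] .
  obtain k where k: "\<guillemotleft>k : V0 \<rightarrow> sh E\<guillemotright>" "sa k = sa \<rho> \<bullet> h" using shift_full[OF V0' shE ar1(6)] .
  \<comment> \<open>The first rotation back moves a sign to \<open>k\<close>; the two signs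
    introduced here are consumed by the second and third.\<close>
  have "tri (sh E) (sh X) (sh V0) (neg (sa p)) (neg (sa r)) (sa k)"
    using tri_neg[OF t1] unfolding p(2) r(2) k(2) .
  then have "tri V0 (sh E) (sh X) (neg k) (neg (sa p)) (neg (sa r))" by (rule unrotate_neg[OF _ k(1) refl])
  then have "tri X V0 (sh E) r (neg k) (neg (sa p))" by (rule unrotate[OF _ r(1)])
  then have "tri E X V0 p r (neg k)" by (rule unrotate[OF _ p(1)])
  then show ?thesis using that unshift_U[OF U0 \<sigma> E] V0 by blast
qed

lemma cotorsion_triangle_rotated:
  assumes X: "X \<in> Ob T"
  obtains V0 U0 d b g where "U0 \<in> U" "V0 \<in> V" "tri V0 U0 X d b g"
proof -
  obtain U0 V0 f g h where U0: "U0 \<in> U" and V0: "V0 \<in> V" and t: "tri U0 X (sh V0) f g h" using cotorsion_triangle[OF X] .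
  note ar = triD[OF t]
  obtain d where d: "\<guillemotleft>d : V0 \<rightarrow> U0\<guillemotright>" "sa d = h" using shift_full[OF V_Ob[OF V0] ar(1,6)] .
  have "tri V0 U0 X (neg d) f g" by (rule unrotate_neg[OF t d])
  then show ?thesis using that U0 V0 by blast
qed

section \<open>Objects of \<open>T^+\<close> and \<open>T^-\<close>\<close>

lemma shift_class_V_zero:
  assumes "X \<in> U" "Y \<in> shift_class T V" "\<guillemotleft>f : X \<rightarrow> Y\<guillemotright>" shows "f = zero X Y"
proof -
  obtain V0 \<sigma> where V0: "V0 \<in> V" and Y: "Y \<in> Ob T" and \<sigma>: "iso_in T (sh V0) Y \<sigma>"
    using assms(2) unfolding shift_class_def isomorphic_def by blast
  obtain \<rho> where \<rho>: "\<guillemotleft>\<sigma> : sh V0 \<rightarrow> Y\<guillemotright>" "\<guillemotleft>\<rho> : Y \<rightarrow> sh V0\<guillemotright>" "\<rho> \<bullet> \<sigma> = Ide T (sh V0)" "\<sigma> \<bullet> \<rho> = Ide T Y"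
    using iso_inE[OF \<sigma>] V_Ob[OF V0] Y by auto
  have "\<rho> \<bullet> f = zero X (sh V0)" using orthogonal[OF assms(1) V0] \<rho>(2) assms(3) by simp
  have "f = (\<sigma> \<bullet> \<rho>) \<bullet> f" using \<rho>(4) assms(3) by simp
  also have "\<dots> = \<sigma> \<bullet> (\<rho> \<bullet> f)" using \<rho>(1,2) assms(3) by (simp add: comp_assoc)
  also have "\<dots> = zero X Y" using \<open>\<rho> \<bullet> f = zero X (sh V0)\<close> \<rho>(1) U_Ob[OF assms(1)] by simp
  finally show ?thesis .
qed

lemma tplus_I:
  assumes "tri W0 X (sh V0) f g h" "W0 \<in> W" "V0 \<in> V" shows "X \<in> Tp"
proof -
  have "sh V0 \<in> shift_class T V" using assms(3) V_Ob[OF assms(3)] isomorphic_refl[of "sh V0"] unfolding shift_class_def by auto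
  then show ?thesis using assms(1,2) unfolding tplus_def star_def by blast
qed

lemma tplus_Ob: "X \<in> Tp \<Longrightarrow> X \<in> Ob T" and tminus_Ob: "X \<in> Tm \<Longrightarrow> X \<in> Ob T"
  unfolding tplus_def tminus_def star_def using triD(2) by blast+

text \<open>A map from \<open>U\<close> to \<open>X\<close> lifts to the object \<open>W0\<close> of
  the defining triangle, because there are no nonzero maps from \<open>U\<close> to
  \<open>V[1]\<close>. Its composite with \<open>a\<close> then passes through a map from
  \<open>A\<close> to \<open>W0\<close>, which is zero.\<close>

lemma tplus_zero:
  assumes X: "X \<in> Tp" and B: "B \<in> A" and U2: "U2 \<in> U" and a: "\<guillemotleft>a : B \<rightarrow> U2\<guillemotright>" and b: "\<guillemotleft>b : U2 \<rightarrow> X\<guillemotright>"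
  shows "b \<bullet> a = zero B X"
proof -
  obtain W0 V1 f g h where W0: "W0 \<in> W" and V1: "V1 \<in> shift_class T V" and t: "tri W0 X V1 f g h"
    using X unfolding tplus_def star_def by blast
  note ar = triD[OF t]
  have "g \<bullet> b = zero U2 V1" using shift_class_V_zero[OF U2 V1, of "g \<bullet> b"] ar b by simp
  then obtain u where u: "\<guillemotleft>u : U2 \<rightarrow> W0\<guillemotright>" "f \<bullet> u = b" using tri_exact[OF t b] by blast
  have ua: "u \<bullet> a = zero B W0" using A_V_zero[OF B, of W0 "u \<bullet> a"] W0 u(1) a by simp
  have "b \<bullet> a = f \<bullet> (u \<bullet> a)" unfolding u(2)[symmetric] using u(1) a ar by (simp add: comp_assoc)
  then show ?thesis using ua ar A_Ob[OF B] by simp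
qed

text \<open>The criterion says that the restriction of \<open>T(-, X)\<close> is left exact.\<close>

lemma tplus_criterion:
  assumes X: "X \<in> Ob T"
    and zero: "\<And>B U2 a b. \<lbrakk>B \<in> A; U2 \<in> U; \<guillemotleft>a : B \<rightarrow> U2\<guillemotright>; \<guillemotleft>b : U2 \<rightarrow> X\<guillemotright>\<rbrakk> \<Longrightarrow> b \<bullet> a = zero B X"
  shows "X \<in> Tp"
proof -
  \<comment> \<open>Rotated forward, this triangle reads \<open>U0 -> X -> V0[1]\<close>, so it
    remains to show that \<open>U0\<close> lies in \<open>V\<close>.\<close>
  obtain V0 U0 d b g where U0: "U0 \<in> U" and V0: "V0 \<in> V" and t: "tri V0 U0 X d b g" using cotorsion_triangle_rotated[OF X] .
  note ar = triD[OF t]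
  obtain E V1 a f1 f2 where E: "E \<in> A" and V1: "V1 \<in> V" and t1: "tri E U0 V1 a f1 f2"
    using cotorsion_triangle_unshifted[OF U_Ob[OF U0]] .
  note ar1 = triD[OF t1]
  \<comment> \<open>\<open>V1\<close> is an extension of \<open>E[1]\<close> by \<open>U0\<close>,
    both in \<open>U\<close>; so it lies in \<open>W\<close>.\<close>
  have V1U: "V1 \<in> U" using U_extension[OF rotate[OF t1] U0 A_shift[OF E]] .
  have "b \<bullet> a = zero E X" using zero[OF E U0 ar1(4) ar(5)] .
  then obtain c where c: "\<guillemotleft>c : V1 \<rightarrow> X\<guillemotright>" "c \<bullet> f1 = b" using tri_exact_contra[OF t1 ar(5)] by blast
  have "g \<bullet> c = zero V1 (sh V0)" using orthogonal[OF V1U V0] ar(6) c(1) by simp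
  then obtain e where e: "\<guillemotleft>e : V1 \<rightarrow> U0\<guillemotright>" "b \<bullet> e = c" using tri_exact[OF rotate[OF t] c(1)] by blast
  let ?k = "Ide T U0 \<boxminus> e \<bullet> f1"
  have k: "\<guillemotleft>?k : U0 \<rightarrow> U0\<guillemotright>" using e(1) ar1 by simp
  have "b \<bullet> ?k = b \<boxminus> (b \<bullet> e) \<bullet> f1" using ar ar1 e(1) by (simp add: comp_dif_right comp_assoc)
  also have "\<dots> = zero U0 X" using e(2) c(2) ar by simp
  finally obtain l where l: "\<guillemotleft>l : U0 \<rightarrow> V0\<guillemotright>" "d \<bullet> l = ?k" using tri_exact[OF t k] by blast
  \<comment> \<open>The identity of \<open>U0\<close> is a sum of a map through \<open>V0\<close>
    and a map through \<open>V1\<close>, both in \<open>V\<close>. Hence every map from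
    \<open>U\<close> to \<open>U0[1]\<close> vanishes, and \<open>U0\<close> lies in
    \<open>V\<close>.\<close>
  have id: "Ide T U0 = d \<bullet> l \<boxplus> e \<bullet> f1" using l(2) dif_add_cancel[of "Ide T U0" "e \<bullet> f1"] ar ar1 e(1) by simp
  have "U0 \<in> V"
  proof (rule V_I[OF ar(2)])
    fix U2 m assume U2: "U2 \<in> U" and m: "\<guillemotleft>m : U2 \<rightarrow> sh U0\<guillemotright>"
    note U2' = U_Ob[OF U2]
    have 1: "sa l \<bullet> m = zero U2 (sh V0)" using orthogonal[OF U2 V0] l(1) m by simp
    have 2: "sa f1 \<bullet> m = zero U2 (sh V1)" using orthogonal[OF U2 V1] ar1 m by simp
    have "m = sa (d \<bullet> l \<boxplus> e \<bullet> f1) \<bullet> m" using m id[symmetric] ar by simp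
    also have "\<dots> = sa d \<bullet> (sa l \<bullet> m) \<boxplus> sa e \<bullet> (sa f1 \<bullet> m)"
      using ar ar1 l(1) e(1) m by (simp add: shift.add shift.comp comp_add_left comp_assoc)
    also have "\<dots> = zero U2 (sh U0)" unfolding 1 2 using ar e(1) U2' by simp
    finally show "m = zero U2 (sh U0)" .
  qed
  then show ?thesis using tplus_I[OF rotate[OF t]] U0 V0 by blast
qed

text \<open>The reflection of \<open>X\<close> into \<open>T\<^sup>+\<close>, up to maps through \<open>W\<close>.\<close>

lemma plus_triangle:
  assumes X: "X \<in> Ob T"
  obtains E U0 Y a b m c where "E \<in> A" "U0 \<in> U" "\<guillemotleft>a : E \<rightarrow> U0\<guillemotright>" "\<guillemotleft>b : U0 \<rightarrow> X\<guillemotright>" "tri E X Y (b \<bullet> a) c m" "Y \<in> Tp"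
proof -
  obtain U0 V0 b g1 g2 where U0: "U0 \<in> U" and V0: "V0 \<in> V" and t: "tri U0 X (sh V0) b g1 g2" using cotorsion_triangle[OF X] .
  note ar = triD[OF t]
  obtain E V1 a f1 f2 where E: "E \<in> A" and V1: "V1 \<in> V" and t1: "tri E U0 V1 a f1 f2"
    using cotorsion_triangle_unshifted[OF U_Ob[OF U0]] .
  note ar1 = triD[OF t1]
  have V1U: "V1 \<in> U" using U_extension[OF rotate[OF t1] U0 A_shift[OF E]] .
  have ba: "\<guillemotleft>b \<bullet> a : E \<rightarrow> X\<guillemotright>" using ar ar1 by simp
  obtain Y c m where t2: "tri E X Y (b \<bullet> a) c m" using triangle_exists[OF A_Ob[OF E] X in_homD(3)[OF ba]] by blast
  \<comment> \<open>By the octahedral axiom the cone \<open>Y\<close> of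
    \<open>b \<bullet> a\<close> is an extension of \<open>V0[1]\<close>, the cone of
    \<open>b\<close>, by \<open>V1\<close>, the cone of \<open>a\<close>, and \<open>V1\<close> lies
    in \<open>W\<close>.\<close>
  obtain u v where "tri V1 Y (sh V0) u v (sa f1 \<bullet> g2)" using octahedral[OF t1 t t2] by blast
  then have "Y \<in> Tp" using tplus_I V1 V1U V0 by blast
  then show ?thesis using that E U0 ar1(4) ar(4) t2 by blast
qed

lemma A_tminus: assumes B: "B \<in> A" shows "B \<in> Tm"
proof -
  obtain Z where Z: "Z \<in> W" "zero_object T Z" using zero_object_in_W .
  have "tri B B Z (Ide T B) (zero B Z) (zero Z (sh B))" using triangle_Ide[OF A_Ob[OF B] Z(2)] .
  then show ?thesis using B Z unfolding tminus_def star_def by blast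
qed

text \<open>The fibre \<open>D\<close> of \<open>p\<close> is \<open>W0[-1]\<close>, which lies in
  \<open>A\<close> because \<open>W0\<close> lies in \<open>U\<close>. On \<open>A\<close> the maps
  \<open>D -> E -> N\<close> give a presentation of \<open>T(-, N)\<close>.\<close>

lemma tminus_triangle:
  assumes N: "N \<in> Tm"
  obtains D E W0 w p q k h where "D \<in> A" "E \<in> A" "W0 \<in> W" "tri E N W0 p q k" "tri D E N w p h"
proof -
  obtain E W0 p q k where E: "E \<in> A" and W0: "W0 \<in> W" and t: "tri E N W0 p q k"
    using N unfolding tminus_def star_def by blast
  obtain D w h \<sigma> where "tri D E N w p h" "D \<in> Ob T" "iso_in T (sh D) W0 \<sigma>" using fibre[OF t] .
  then show ?thesis using that E W0 t unshift_U by blast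
qed

section \<open>Deflations as coverings\<close>

definition cover :: "'m \<Rightarrow> 'o \<Rightarrow> 'o \<Rightarrow> bool" where
  "cover b D B \<longleftrightarrow> (\<exists>Z a. conflation T A Z D B a b)"

lemma coverE:
  assumes "cover b D B"
  obtains Z a h where "Z \<in> A" "D \<in> A" "B \<in> A" "tri Z D B a b h" "conflation T A Z D B a b" "\<guillemotleft>b : D \<rightarrow> B\<guillemotright>"
  using assms triD(5) unfolding cover_def conflation_def by blast

text \<open>Here \<open>\<rho>\<close> identifies \<open>U2\<close> with a translate
  \<open>Z[1]\<close>, so \<open>\<rho> \<bullet> v\<close> can be realised as a connecting map; it
  composes to zero with the map before it in the triangle.\<close>

lemma cover_kills:
  assumes B: "B \<in> A" and U2: "U2 \<in> U" and v: "\<guillemotleft>v : B \<rightarrow> U2\<guillemotright>"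
  obtains D b where "cover b D B" "v \<bullet> b = zero D U2"
proof -
  obtain Z \<sigma> where Z: "Z \<in> Ob T" and \<sigma>: "iso_in T (sh Z) U2 \<sigma>" using shift_ess_surj[OF U_Ob[OF U2]] .
  obtain \<rho> where \<rho>: "\<guillemotleft>\<sigma> : sh Z \<rightarrow> U2\<guillemotright>" "\<guillemotleft>\<rho> : U2 \<rightarrow> sh Z\<guillemotright>" "\<rho> \<bullet> \<sigma> = Ide T (sh Z)" "\<sigma> \<bullet> \<rho> = Ide T U2"
    using iso_inE[OF \<sigma>] Z U_Ob[OF U2] by auto
  have ZA: "Z \<in> A" using unshift_U[OF U2 \<sigma> Z] .
  have "\<guillemotleft>\<rho> \<bullet> v : B \<rightarrow> sh Z\<guillemotright>" using \<rho>(2) v by simp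
  then obtain D a b where t: "tri Z D B a b (\<rho> \<bullet> v)" using fibre_of_connecting Z by blast
  note ar = triD[OF t]
  have D: "D \<in> A" using A_extension[OF t ZA B] .
  have "cover b D B" unfolding cover_def conflation_def using ZA D B t by blast
  moreover have "v \<bullet> b = zero D U2"
  proof -
    have 0: "(\<rho> \<bullet> v) \<bullet> b = zero D (sh Z)" using tri_comp_zero[OF rotate[OF t]] .
    have "v \<bullet> b = (\<sigma> \<bullet> \<rho>) \<bullet> (v \<bullet> b)" using \<rho>(4) v ar by simp
    also have "\<dots> = \<sigma> \<bullet> ((\<rho> \<bullet> v) \<bullet> b)" using \<rho>(1,2) v ar by (simp add: comp_assoc)
    finally show ?thesis unfolding 0 using \<rho>(1) ar by simp
  qed
  ultimately show ?thesis using that by blast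
qed

text \<open>No pullback is formed. The obstruction to lifting \<open>l\<close> through
  \<open>b\<close> is \<open>h \<bullet> l : B -> Z[1]\<close>, with \<open>Z[1]\<close> in
  \<open>U\<close>, and a covering of \<open>B\<close> kills it.\<close>

lemma cover_pullback:
  assumes b: "cover b D E" and l: "\<guillemotleft>l : B \<rightarrow> E\<guillemotright>" and B: "B \<in> A"
  obtains D' b' m where "cover b' D' B" "\<guillemotleft>m : D' \<rightarrow> D\<guillemotright>" "b \<bullet> m = l \<bullet> b'"
proof -
  obtain Z a h where Z: "Z \<in> A" and t: "tri Z D E a b h" using coverE[OF b] by blast
  note ar = triD[OF t]
  have "\<guillemotleft>h \<bullet> l : B \<rightarrow> sh Z\<guillemotright>" using ar l by simp
  then obtain D' b' where b': "cover b' D' B" and 0: "(h \<bullet> l) \<bullet> b' = zero D' (sh Z)" using cover_kills[OF B A_shift[OF Z]] by blast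
  have b'1: "\<guillemotleft>b' : D' \<rightarrow> B\<guillemotright>" using coverE[OF b'] by blast
  have lb: "\<guillemotleft>l \<bullet> b' : D' \<rightarrow> E\<guillemotright>" using l b'1 by simp
  have "h \<bullet> (l \<bullet> b') = zero D' (sh Z)" using 0 ar l b'1 by (simp add: comp_assoc)
  then obtain m where "\<guillemotleft>m : D' \<rightarrow> D\<guillemotright>" "b \<bullet> m = l \<bullet> b'" using tri_exact[OF rotate[OF t] lb] by blast
  then show ?thesis using that b' by blast
qed

end

section \<open>Left exact presheaves\<close>

context cotorsion
begin

lemma lex_inj:
  assumes lex: "left_exact T A F" and b: "cover b D B" and x: "x \<in> El F B" "y \<in> El F B" and eq: "res F b x = res F b y"
  shows "x = y"
proof -
  obtain Z a where "conflation T A Z D B a b" using b unfolding cover_def by blast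
  then have "inj_on (res F b) (El F B)" using lex unfolding left_exact_def by blast
  then show ?thesis using x eq unfolding inj_on_def by blast
qed

lemma lex_descend:
  assumes lex: "left_exact T A F" and "conflation T A Z D B a b" and y: "y \<in> El F D" "res F a y = \<one>\<^bsub>fobj F Z\<^esub>"
  obtains x where "x \<in> El F B" "res F b x = y"
proof -
  have "res F b ` El F B = kernel (fobj F D) (fobj F Z) (res F a)" using lex assms(2) unfolding left_exact_def by blast
  moreover have "y \<in> kernel (fobj F D) (fobj F Z) (res F a)" using y unfolding kernel_def by blast
  ultimately have "y \<in> res F b ` El F B" by simp
  then obtain x where "y = res F b x" "x \<in> El F B" by (rule imageE)
  then show ?thesis using that[of x] by simp
qed

text \<open>Exactness in the middle holds for every triangle. Injectivity is where
  \<open>T^+\<close> enters: the difference of two maps that agree after \<open>b\<close> factors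
  through \<open>h : B -> Z[1]\<close>, so it runs from \<open>A\<close> through \<open>U\<close> to
  \<open>X\<close> and is zero.\<close>

lemma rep_lex: assumes X: "X \<in> Tp" shows "left_exact T A (rep X)"
  unfolding left_exact_def
proof (intro allI impI conjI)
  fix Z Y B a b assume c: "conflation T A Z Y B a b"
  then obtain h where A: "Z \<in> A" "Y \<in> A" "B \<in> A" and t: "tri Z Y B a b h" unfolding conflation_def by blast
  note ar = triD[OF t] and X' = tplus_Ob[OF X]
  have res_b: "res (rep X) b g = g \<bullet> b" if "\<guillemotleft>g : B \<rightarrow> X\<guillemotright>" for g
    using res_rep[of g b X] El_repI[OF that] ar(5) by simp
  have res_a: "res (rep X) a g = g \<bullet> a" if "\<guillemotleft>g : Y \<rightarrow> X\<guillemotright>" for g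
    using res_rep[of g a X] El_repI[OF that] ar(4) by simp
  show "inj_on (res (rep X) b) (El (rep X) B)"
  proof (rule inj_onI)
    fix g g' assume "g \<in> El (rep X) B" "g' \<in> El (rep X) B" and eq: "res (rep X) b g = res (rep X) b g'"
    then have g: "\<guillemotleft>g : B \<rightarrow> X\<guillemotright>" "\<guillemotleft>g' : B \<rightarrow> X\<guillemotright>" using El_repD[of _ B X] A X' by simp_all
    have d: "\<guillemotleft>g \<boxminus> g' : B \<rightarrow> X\<guillemotright>" using g by simp
    have "g \<bullet> b = g' \<bullet> b" using eq res_b g by simp
    then have "(g \<boxminus> g') \<bullet> b = zero Y X" using g ar by (simp add: comp_dif_left)
    then obtain u where u: "\<guillemotleft>u : sh Z \<rightarrow> X\<guillemotright>" "u \<bullet> h = g \<boxminus> g'" using tri_exact_contra[OF rotate[OF t] d] by blast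
    have "u \<bullet> h = zero B X" using tplus_zero[OF X A(3) A_shift[OF A(1)] ar(6) u(1)] .
    then show "g = g'" using u(2) dif_eq_zero[of g g'] g by simp
  qed
  show "res (rep X) b ` El (rep X) B = kernel (fobj (rep X) Y) (fobj (rep X) Z) (res (rep X) a)"
  proof (intro equalityI subsetI)
    fix y assume "y \<in> res (rep X) b ` El (rep X) B"
    then obtain g where "g \<in> El (rep X) B" and y: "y = res (rep X) b g" by blast
    then have g: "\<guillemotleft>g : B \<rightarrow> X\<guillemotright>" using El_repD[of _ B X] A X' by simp
    have y1: "y = g \<bullet> b" using y res_b[OF g] by simp
    have yX: "\<guillemotleft>y : Y \<rightarrow> X\<guillemotright>" unfolding y1 using g ar by simp
    have "b \<bullet> a = zero Z B" by (rule tri_comp_zero[OF t])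
    then have "y \<bullet> a = zero Z X" unfolding y1 using g ar by (simp add: comp_assoc)
    then show "y \<in> kernel (fobj (rep X) Y) (fobj (rep X) Z) (res (rep X) a)"
      unfolding kernel_def using res_a[OF yX] El_repI[OF yX] by simp
  next
    fix y assume "y \<in> kernel (fobj (rep X) Y) (fobj (rep X) Z) (res (rep X) a)"
    then have "y \<in> Hom T Y X" and 0: "res (rep X) a y = zero Z X" unfolding kernel_def by auto
    then have y: "\<guillemotleft>y : Y \<rightarrow> X\<guillemotright>" using El_repD[of _ Y X] A X' by blast
    have "y \<bullet> a = zero Z X" using 0 res_a[OF y] by simp
    then obtain g where g: "\<guillemotleft>g : B \<rightarrow> X\<guillemotright>" "g \<bullet> b = y" using tri_exact_contra[OF t y] by blast
    then have "y = res (rep X) b g" "g \<in> El (rep X) B" using res_b[OF g(1)] El_repI[OF g(1)] by simp_all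
    then show "y \<in> res (rep X) b ` El (rep X) B" by blast
  qed
qed

lemma rep_pointwise_cokernel:
  assumes f: "\<guillemotleft>f : D \<rightarrow> E\<guillemotright>" and p: "\<guillemotleft>p : E \<rightarrow> X\<guillemotright>" and pf: "p \<bullet> f = zero D X"
    and lift: "\<And>B n. \<lbrakk>B \<in> A; \<guillemotleft>n : B \<rightarrow> X\<guillemotright>\<rbrakk> \<Longrightarrow> \<exists>l. \<guillemotleft>l : B \<rightarrow> E\<guillemotright> \<and> p \<bullet> l = n"
    and ker: "\<And>B l. \<lbrakk>B \<in> A; \<guillemotleft>l : B \<rightarrow> E\<guillemotright>; p \<bullet> l = zero B X\<rbrakk> \<Longrightarrow> \<exists>h. \<guillemotleft>h : B \<rightarrow> D\<guillemotright> \<and> l = f \<bullet> h"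
  shows "pointwise_cokernel f (rep X) (yon p)"
  unfolding pointwise_cokernel_def
proof (intro conjI ballI allI impI)
  have X: "X \<in> Ob T" using in_homD[OF p] by blast
  show "yon p \<in> Hom PSh (rep (Tgt T f)) (rep X)" using yon_Hom[OF p] f by simp
  show "\<exists>g. \<guillemotleft>g : B \<rightarrow> Tgt T f\<guillemotright> \<and> ev (yon p) B g = x" if B: "B \<in> A" and x: "x \<in> El (rep X) B" for B x
  proof -
    have x1: "\<guillemotleft>x : B \<rightarrow> X\<guillemotright>" using El_repD[of x B X] x B X by simp
    obtain l where l: "\<guillemotleft>l : B \<rightarrow> E\<guillemotright>" "p \<bullet> l = x" using lift[OF B x1] by blast
    have "\<guillemotleft>l : B \<rightarrow> Tgt T f\<guillemotright> \<and> ev (yon p) B l = x" using ev_yon[OF p l(1) B] l f by simp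
    then show ?thesis by (rule exI)
  qed
  show "ev (yon p) B g = \<one>\<^bsub>fobj (rep X) B\<^esub> \<longleftrightarrow> (\<exists>h. \<guillemotleft>h : B \<rightarrow> Src T f\<guillemotright> \<and> g = f \<bullet> h)"
    if B: "B \<in> A" and g0: "\<guillemotleft>g : B \<rightarrow> Tgt T f\<guillemotright>" for B g
  proof -
    have g: "\<guillemotleft>g : B \<rightarrow> E\<guillemotright>" using g0 f by simp
    have 1: "p \<bullet> g = zero B X" if "\<guillemotleft>h : B \<rightarrow> D\<guillemotright>" "g = f \<bullet> h" for h
    proof -
      have "p \<bullet> g = (p \<bullet> f) \<bullet> h" unfolding that(2) using that(1) p f by (simp add: comp_assoc)
      then show ?thesis unfolding pf using that(1) X by simp
    qed
    have "p \<bullet> g = zero B X \<longleftrightarrow> (\<exists>h. \<guillemotleft>h : B \<rightarrow> D\<guillemotright> \<and> g = f \<bullet> h)" using 1 ker[OF B g] by blast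
    then show ?thesis using ev_yon[OF p g B] f by simp
  qed
qed

text \<open>Approximate twice by objects of \<open>A\<close>: first \<open>X\<close> by
  \<open>E\<close>, then the fibre \<open>Z\<close> of \<open>E -> X\<close> by \<open>E'\<close>.
  Both approximations are onto on maps from \<open>A\<close>, so \<open>E' -> E\<close> presents
  \<open>T(-, X)\<close>, and restricted Yoneda lands in \<open>mod_cat\<close>.\<close>

lemma rep_finitely_presented: assumes X: "X \<in> Ob T" shows "finitely_presented (full_subcat T A) (rep X)"
proof -
  obtain E V0 p r k where E: "E \<in> A" and V0: "V0 \<in> V" and t: "tri E X V0 p r k" using cotorsion_triangle_unshifted[OF X] .
  obtain Z z h where t1: "tri Z E X z p h" using fibre[OF t] by blast
  have Z: "Z \<in> Ob T" by (rule triD(1)[OF t1])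
  obtain E' V1 q r' k' where E': "E' \<in> A" and V1: "V1 \<in> V" and t2: "tri E' Z V1 q r' k'" using cotorsion_triangle_unshifted[OF Z] .
  note ar = triD[OF t] and ar1 = triD[OF t1] and ar2 = triD[OF t2]
  have f: "\<guillemotleft>z \<bullet> q : E' \<rightarrow> E\<guillemotright>" using ar1 ar2 by simp
  have "pointwise_cokernel (z \<bullet> q) (rep X) (yon p)"
  proof (rule rep_pointwise_cokernel[OF f ar(4)])
    have "p \<bullet> (z \<bullet> q) = (p \<bullet> z) \<bullet> q" using ar1 ar2 by (simp add: comp_assoc)
    then show "p \<bullet> (z \<bullet> q) = zero E' X" unfolding tri_comp_zero[OF t1] using ar1 ar2 by simp
    show "\<exists>l. \<guillemotleft>l : B \<rightarrow> E\<guillemotright> \<and> p \<bullet> l = n" if B: "B \<in> A" and n: "\<guillemotleft>n : B \<rightarrow> X\<guillemotright>" for B n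
    proof -
      have "r \<bullet> n = zero B V0" using A_V_zero[OF B V0] n ar by simp
      then show ?thesis using tri_exact[OF t n] by blast
    qed
    show "\<exists>h. \<guillemotleft>h : B \<rightarrow> E'\<guillemotright> \<and> l = z \<bullet> q \<bullet> h" if B: "B \<in> A" and l: "\<guillemotleft>l : B \<rightarrow> E\<guillemotright>" "p \<bullet> l = zero B X" for B l
    proof -
      obtain m where m: "\<guillemotleft>m : B \<rightarrow> Z\<guillemotright>" "z \<bullet> m = l" using tri_exact[OF t1 l] by blast
      have "r' \<bullet> m = zero B V1" using A_V_zero[OF B V1] m(1) ar2 by simp
      then obtain h where h: "\<guillemotleft>h : B \<rightarrow> E'\<guillemotright>" "q \<bullet> h = m" using tri_exact[OF t2 m(1)] by blast
      have "l = z \<bullet> q \<bullet> h" using h m(2) ar1 ar2 by (simp add: comp_assoc)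
      then show ?thesis using h(1) by blast
    qed
  qed
  from finitely_presentedI[OF f E' E this] show ?thesis .
qed

lemma tminus_lift:
  assumes t: "tri E N W0 p q k" and W0: "W0 \<in> W" and B: "B \<in> A" and n: "\<guillemotleft>n : B \<rightarrow> N\<guillemotright>"
  obtains l where "\<guillemotleft>l : B \<rightarrow> E\<guillemotright>" "p \<bullet> l = n"
proof -
  have "q \<bullet> n = zero B W0" using A_V_zero[OF B, of W0 "q \<bullet> n"] W0 n triD[OF t] by simp
  then show ?thesis using tri_exact[OF t n] that by blast
qed

text \<open>The arrow that the Yoneda lemma attaches to the element \<open>e\<close> of
  \<open>F(E)\<close>.\<close>

lemma yoneda_arrow:
  assumes F: "F \<in> Ob PSh" and E: "E \<in> A" and e: "e \<in> El F E"
  shows "psh_arr A (rep E) F (\<lambda>B l. res F l e) \<in> Hom PSh (rep E) F"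
proof (rule psh_arr_Hom[OF rep_Ob[OF A_Ob[OF E]] F])
  note E' = A_Ob[OF E]
  fix B l assume B: "B \<in> A" and "l \<in> El (rep E) B"
  then have l: "\<guillemotleft>l : B \<rightarrow> E\<guillemotright>" using El_repD[of l B E] E' by simp
  show "res F l e \<in> El F B" using res_closed[OF F, of l e] l B E e by simp
  fix l' assume "l' \<in> El (rep E) B"
  then have l': "\<guillemotleft>l' : B \<rightarrow> E\<guillemotright>" using El_repD[of l' B E] E' B by simp
  show "res F (l \<otimes>\<^bsub>fobj (rep E) B\<^esub> l') e = res F l e \<otimes>\<^bsub>fobj F B\<^esub> res F l' e"
    using res_add[OF F, of l l' e] l l' B E e by (simp add: add_def)
next
  note E' = A_Ob[OF E]
  fix f l assume f: "SArr f" and l0: "l \<in> El (rep E) (Tgt T f)"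
  then have l: "\<guillemotleft>l : Tgt T f \<rightarrow> E\<guillemotright>" using El_repD[of l "Tgt T f" E] E' by simp
  show "res F (res (rep E) f l) e = res F f (res F l e)"
    using res_comp[OF F f, of l e] res_rep[of l f E] l l0 f E e by simp
qed

section \<open>Local isomorphisms and left exact presheaves\<close>

definition locally_inj :: "('o, 'm) presheaf_arrow \<Rightarrow> 'o \<Rightarrow> bool" where
  "locally_inj \<phi> X \<longleftrightarrow> (\<forall>B \<in> A. \<forall>k. \<guillemotleft>k : B \<rightarrow> X\<guillemotright> \<longrightarrow> ev \<phi> B k = ev \<phi> B (zero B X) \<longrightarrow>
     (\<exists>D b. cover b D B \<and> k \<bullet> b = zero D X))"

definition locally_surj :: "('o, 'm) presheaf_arrow \<Rightarrow> 'o \<Rightarrow> ('o, 'm) presheaf \<Rightarrow> bool" where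
  "locally_surj \<phi> X G \<longleftrightarrow> (\<forall>B \<in> A. \<forall>y \<in> El G B. \<exists>D b x. cover b D B \<and> \<guillemotleft>x : D \<rightarrow> X\<guillemotright> \<and> ev \<phi> D x = res G b y)"

text \<open>The difference of \<open>k\<close> and \<open>k'\<close> dies on a covering by local
  injectivity. There \<open>\<alpha>\<close> takes equal values, and a left exact \<open>F\<close>
  is separated for coverings.\<close>

lemma locally_inj_lex:
  assumes \<phi>: "\<phi> \<in> Hom PSh (rep X) G" and inj: "locally_inj \<phi> X"
    and \<alpha>: "\<alpha> \<in> Hom PSh (rep X) F" and lex: "left_exact T A F"
    and X: "X \<in> Ob T" and B: "B \<in> A" and k: "\<guillemotleft>k : B \<rightarrow> X\<guillemotright>" "\<guillemotleft>k' : B \<rightarrow> X\<guillemotright>" and eq: "ev \<phi> B k = ev \<phi> B k'"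
  shows "ev \<alpha> B k = ev \<alpha> B k'"
proof -
  note G = Hom_PSh_Ob(2)[OF \<phi>] and F = Hom_PSh_Ob(2)[OF \<alpha>] and B' = A_Ob[OF B]
  have hom: "ev \<phi> B \<in> hom (Mor T B X) (fobj G B)" using ev_hom[OF \<phi> B] by simp
  have "ev \<phi> B (k \<boxminus> k') = \<one>\<^bsub>fobj G B\<^esub>"
    using hom_eq_iff[OF hom presheaf_group'[OF G B] k] eq by simp
  also have "\<dots> = ev \<phi> B (zero B X)" using ev_one[OF \<phi> B] by simp
  finally obtain D b where b: "cover b D B" and 0: "(k \<boxminus> k') \<bullet> b = zero D X"
    using inj B k unfolding locally_inj_def by (metis arr_dif)
  obtain D: "D \<in> A" and b1: "\<guillemotleft>b : D \<rightarrow> B\<guillemotright>" using coverE[OF b] by blast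
  have "k \<bullet> b \<boxminus> k' \<bullet> b = zero D X" using 0 k b1 by (simp add: comp_dif_left)
  then have kb: "k \<bullet> b = k' \<bullet> b" using dif_eq_zero[of "k \<bullet> b" "k' \<bullet> b"] k b1 by simp
  have nat: "res F b (ev \<alpha> B l) = ev \<alpha> D (l \<bullet> b)" if l: "\<guillemotleft>l : B \<rightarrow> X\<guillemotright>" for l
    using ev_natural[OF \<alpha>, of b l] El_repI[OF l] res_rep[of l b X] b1 B D by simp
  have closed: "ev \<alpha> B l \<in> El F B" if l: "\<guillemotleft>l : B \<rightarrow> X\<guillemotright>" for l
    using ev_closed[OF \<alpha> B] El_repI[OF l] by simp
  show ?thesis using lex_inj[OF lex b closed[OF k(1)] closed[OF k(2)]] nat[OF k(1)] nat[OF k(2)] kb by simp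
qed

text \<open>
  Left exact functors are the sheaves for the deflations, so a local isomorphism \<open>\<phi>\<close> is
  inverted by maps into them.
\<close>

lemma locally_iso_unique:
  assumes \<phi>: "\<phi> \<in> Hom PSh (rep X) G" and surj: "locally_surj \<phi> X G" and lex: "left_exact T A F"
    and \<beta>: "\<beta> \<in> Hom PSh G F" "\<beta>' \<in> Hom PSh G F" and eq: "\<beta> \<bullet>\<^bsub>PSh\<^esub> \<phi> = \<beta>' \<bullet>\<^bsub>PSh\<^esub> \<phi>"
  shows "\<beta> = \<beta>'"
proof (rule psh_eqI[OF \<beta>])
  fix B y assume B: "B \<in> A" and y: "y \<in> El G B"
  obtain D b x where b: "cover b D B" and x: "\<guillemotleft>x : D \<rightarrow> X\<guillemotright>" "ev \<phi> D x = res G b y"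
    using surj B y unfolding locally_surj_def by blast
  obtain D: "D \<in> A" and b1: "\<guillemotleft>b : D \<rightarrow> B\<guillemotright>" using coverE[OF b] by blast
  have x0: "x \<in> El (rep X) D" using El_repI[OF x(1)] by simp
  have "res F b (ev \<beta> B y) = ev \<beta> D (res G b y)" using ev_natural[OF \<beta>(1), of b y] b1 B D y by simp
  also have "\<dots> = ev \<beta>' D (res G b y)"
    using ev_comp[OF \<phi> \<beta>(1) D x0] ev_comp[OF \<phi> \<beta>(2) D x0] eq x(2) by simp
  also have "\<dots> = res F b (ev \<beta>' B y)" using ev_natural[OF \<beta>(2), of b y] b1 B D y by simp
  finally show "ev \<beta> B y = ev \<beta>' B y"
    using lex_inj[OF lex b ev_closed[OF \<beta>(1) B y] ev_closed[OF \<beta>(2) B y]] by blast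
qed

text \<open>\<open>T(-, N)\<close> is the cokernel of \<open>T(-, D0) -> T(-, E)\<close>, so a map
  from it to \<open>F\<close> amounts to an element of \<open>F(E)\<close> that \<open>w\<close>
  restricts to zero. That element has to be the value of \<open>\<beta>\<close> at
  \<open>p : E -> N\<close>: on a covering \<open>p\<close> lifts through \<open>\<phi>\<close> to
  some \<open>x\<close>, and the value of \<open>\<alpha>\<close> at \<open>x\<close>
  descends.\<close>

lemma locally_iso_extend:
  assumes N: "N \<in> Tm" and \<phi>: "\<phi> \<in> Hom PSh (rep X) (rep N)" and inj: "locally_inj \<phi> X" and surj: "locally_surj \<phi> X (rep N)"
    and \<alpha>: "\<alpha> \<in> Hom PSh (rep X) F" and lex: "left_exact T A F" and X: "X \<in> Ob T"
  obtains \<beta> where "\<beta> \<in> Hom PSh (rep N) F" "\<beta> \<bullet>\<^bsub>PSh\<^esub> \<phi> = \<alpha>"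
proof -
  have F: "F \<in> Ob PSh" using Hom_PSh_Ob[OF \<alpha>] by blast
  obtain D0 E W0 w p q k h where D0: "D0 \<in> A" and E: "E \<in> A" and W0: "W0 \<in> W" and t: "tri E N W0 p q k"
    and t1: "tri D0 E N w p h" using tminus_triangle[OF N] .
  note ar = triD[OF t] and ar1 = triD[OF t1]
  have p0: "p \<in> El (rep N) E" using El_repI[OF ar(4)] by simp
  obtain D b x where b: "cover b D E" and x: "\<guillemotleft>x : D \<rightarrow> X\<guillemotright>" and \<phi>x0: "ev \<phi> D x = res (rep N) b p"
    using surj E p0 unfolding locally_surj_def by blast
  obtain Z a c where Z: "Z \<in> A" and D: "D \<in> A" and t2: "tri Z D E a b c" and conf: "conflation T A Z D E a b"
    using coverE[OF b] by blast
  note ar2 = triD[OF t2]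
  have \<phi>x: "ev \<phi> D x = p \<bullet> b" using \<phi>x0 res_rep[of p b N] p0 ar2 by simp
  have nat\<phi>: "ev \<phi> B' (l \<bullet> m) = ev \<phi> B l \<bullet> m" if "B \<in> A" "B' \<in> A" "\<guillemotleft>m : B' \<rightarrow> B\<guillemotright>" "\<guillemotleft>l : B \<rightarrow> X\<guillemotright>" for B B' l m
  proof -
    have l: "l \<in> El (rep X) B" "l \<in> Hom T B X" using El_repI[OF that(4)] by simp_all
    have "ev \<phi> B l \<in> Hom T B N" using ev_closed[OF \<phi> that(1) l(1)] by simp
    then show ?thesis using ev_natural[OF \<phi>, of m l] res_rep[of l m X] res_rep[of "ev \<phi> B l" m N] l that by simp
  qed
  have nat\<alpha>: "ev \<alpha> B' (l \<bullet> m) = res F m (ev \<alpha> B l)" if "B \<in> A" "B' \<in> A" "\<guillemotleft>m : B' \<rightarrow> B\<guillemotright>" "\<guillemotleft>l : B \<rightarrow> X\<guillemotright>" for B B' l m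
    using ev_natural[OF \<alpha>, of m l] El_repI[OF that(4)] res_rep[of l m X] that by simp
  have \<alpha>_closed: "ev \<alpha> B l \<in> El F B" if "B \<in> A" "\<guillemotleft>l : B \<rightarrow> X\<guillemotright>" for B l
    using ev_closed[OF \<alpha> that(1)] El_repI[OF that(2)] by simp
  have \<phi>0: "ev \<phi> B (zero B X) = zero B N" and \<alpha>0: "ev \<alpha> B (zero B X) = \<one>\<^bsub>fobj F B\<^esub>" if "B \<in> A" for B
    using ev_one[OF \<phi> that] ev_one[OF \<alpha> that] by simp_all
  note indep = locally_inj_lex[OF \<phi> inj \<alpha> lex X]
  \<comment> \<open>The descent condition: \<open>\<phi>\<close> sends \<open>x \<bullet> a\<close>
    to \<open>p \<bullet> b \<bullet> a\<close>, which is zero, and by local injectivity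
    \<open>\<alpha>\<close> then sends \<open>x \<bullet> a\<close> to the neutral element.\<close>
  have "res F a (ev \<alpha> D x) = \<one>\<^bsub>fobj F Z\<^esub>"
  proof -
    have xa: "\<guillemotleft>x \<bullet> a : Z \<rightarrow> X\<guillemotright>" "\<guillemotleft>zero Z X : Z \<rightarrow> X\<guillemotright>" using x ar2 X by simp_all
    have "ev \<phi> Z (x \<bullet> a) = (p \<bullet> b) \<bullet> a" using nat\<phi>[OF D Z ar2(4) x] \<phi>x by simp
    also have "\<dots> = p \<bullet> (b \<bullet> a)" using ar ar2 by (simp add: comp_assoc)
    also have "\<dots> = zero Z N" unfolding tri_comp_zero[OF t2] using ar ar2 by simp
    finally have "ev \<phi> Z (x \<bullet> a) = ev \<phi> Z (zero Z X)" using \<phi>0[OF Z] by simp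
    from indep[OF Z xa this] show ?thesis using nat\<alpha>[OF D Z ar2(4) x] \<alpha>0[OF Z] by simp
  qed
  then obtain e where e: "e \<in> El F E" "res F b e = ev \<alpha> D x" using lex_descend[OF lex conf \<alpha>_closed[OF D x]] by blast
  \<comment> \<open>Used twice: with \<open>j\<close> zero it shows that \<open>e\<close> dies on
    \<open>D0\<close>, and with arbitrary \<open>j\<close> it yields the factorisation of
    \<open>\<alpha>\<close>. It is verified on a covering of \<open>B\<close> over which
    \<open>l\<close> lifts through \<open>b\<close>.\<close>
  have key: "res F l e = ev \<alpha> B j" if B: "B \<in> A" and l: "\<guillemotleft>l : B \<rightarrow> E\<guillemotright>" and j: "\<guillemotleft>j : B \<rightarrow> X\<guillemotright>" and eq: "ev \<phi> B j = p \<bullet> l" for B l j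
  proof -
    obtain D' b' m where b': "cover b' D' B" and m: "\<guillemotleft>m : D' \<rightarrow> D\<guillemotright>" "b \<bullet> m = l \<bullet> b'" using cover_pullback[OF b l B] .
    obtain D': "D' \<in> A" and b'1: "\<guillemotleft>b' : D' \<rightarrow> B\<guillemotright>" using coverE[OF b'] by blast
    have xm: "\<guillemotleft>x \<bullet> m : D' \<rightarrow> X\<guillemotright>" and jb: "\<guillemotleft>j \<bullet> b' : D' \<rightarrow> X\<guillemotright>" using x m(1) j b'1 by simp_all
    have "ev \<phi> D' (x \<bullet> m) = p \<bullet> (b \<bullet> m)" using nat\<phi>[OF D D' m(1) x] \<phi>x ar ar2 m(1) by (simp add: comp_assoc)
    also have "\<dots> = ev \<phi> D' (j \<bullet> b')" using nat\<phi>[OF B D' b'1 j] eq m(2) ar l b'1 by (simp add: comp_assoc)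
    finally have 1: "ev \<alpha> D' (x \<bullet> m) = ev \<alpha> D' (j \<bullet> b')" using indep[OF D' xm jb] by blast
    have le: "res F l e \<in> El F B" using res_closed[OF F, of l e] l B E e by simp
    have "res F b' (res F l e) = res F (l \<bullet> b') e" using res_comp[OF F, of b' l e] b'1 l B D' E e by simp
    also have "\<dots> = res F (b \<bullet> m) e" using m(2) by simp
    also have "\<dots> = res F m (ev \<alpha> D x)" using res_comp[OF F, of m b e] m(1) ar2 D D' E e by simp
    also have "\<dots> = res F b' (ev \<alpha> B j)" using 1 nat\<alpha>[OF D D' m(1) x] nat\<alpha>[OF B D' b'1 j] by simp
    finally show ?thesis using lex_inj[OF lex b' le \<alpha>_closed[OF B j]] by blast
  qed
  have pw: "pointwise_cokernel w (rep N) (yon p)"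
  proof (rule rep_pointwise_cokernel[OF ar1(4) ar(4) tri_comp_zero[OF t1]])
    show "\<exists>l. \<guillemotleft>l : B \<rightarrow> E\<guillemotright> \<and> p \<bullet> l = n" if "B \<in> A" "\<guillemotleft>n : B \<rightarrow> N\<guillemotright>" for B n
      using tminus_lift[OF t W0 that(1) that(2)] by blast
    show "\<exists>h. \<guillemotleft>h : B \<rightarrow> D0\<guillemotright> \<and> l = w \<bullet> h" if "B \<in> A" "\<guillemotleft>l : B \<rightarrow> E\<guillemotright>" "p \<bullet> l = zero B N" for B l
      using tri_exact[OF t1 that(2) that(3)] by blast
  qed
  let ?q = "psh_arr A (rep E) F (\<lambda>B l. res F l e)"
  have q: "?q \<in> Hom PSh (rep E) F" using yoneda_arrow[OF F E e(1)] .
  have ev_q: "ev ?q B l = res F l e" if "B \<in> A" "\<guillemotleft>l : B \<rightarrow> E\<guillemotright>" for B l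
    using El_repI[OF that(2)] that(1) by simp
  obtain \<beta> where \<beta>: "\<beta> \<in> Hom PSh (rep N) F" and \<beta>p0: "\<And>B l. \<lbrakk>B \<in> A; \<guillemotleft>l : B \<rightarrow> E\<guillemotright>\<rbrakk> \<Longrightarrow> ev \<beta> B (ev (yon p) B l) = ev ?q B l"
  proof (rule pointwise_cokernel_factor[OF ar1(4) pw q])
    fix B g assume B: "B \<in> A" and g: "\<guillemotleft>g : B \<rightarrow> D0\<guillemotright>"
    have wg: "\<guillemotleft>w \<bullet> g : B \<rightarrow> E\<guillemotright>" using g ar1 by simp
    have z: "\<guillemotleft>zero B X : B \<rightarrow> X\<guillemotright>" using B X by simp
    have "p \<bullet> (w \<bullet> g) = (p \<bullet> w) \<bullet> g" using g ar1 ar by (simp add: comp_assoc)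
    also have "\<dots> = zero B N" unfolding tri_comp_zero[OF t1] using g ar by simp
    finally have "ev \<phi> B (zero B X) = p \<bullet> (w \<bullet> g)" using \<phi>0[OF B] by simp
    from key[OF B wg z this] show "ev ?q B (w \<bullet> g) = \<one>\<^bsub>fobj F B\<^esub>" using ev_q[OF B wg] \<alpha>0[OF B] by simp
  qed (use that in blast)
  have "\<beta> \<bullet>\<^bsub>PSh\<^esub> \<phi> = \<alpha>"
  proof (rule psh_eqI[OF psh_Comp_Hom[OF \<phi> \<beta>] \<alpha>])
    fix B j assume B: "B \<in> A" and j0: "j \<in> El (rep X) B"
    then have j: "\<guillemotleft>j : B \<rightarrow> X\<guillemotright>" using El_repD[of j B X] X by simp
    have n: "\<guillemotleft>ev \<phi> B j : B \<rightarrow> N\<guillemotright>" using ev_closed[OF \<phi> B j0] El_repD[of _ B N] B ar by simp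
    obtain l where l: "\<guillemotleft>l : B \<rightarrow> E\<guillemotright>" "p \<bullet> l = ev \<phi> B j" using tminus_lift[OF t W0 B n] .
    have "ev (\<beta> \<bullet>\<^bsub>PSh\<^esub> \<phi>) B j = ev \<beta> B (p \<bullet> l)" using ev_comp[OF \<phi> \<beta> B j0] l(2) by simp
    also have "\<dots> = res F l e" using \<beta>p0[OF B l(1)] ev_yon[OF ar(4) l(1) B] ev_q[OF B l(1)] by simp
    also have "\<dots> = ev \<alpha> B j" using key[OF B l(1) j] l(2) by simp
    finally show "ev (\<beta> \<bullet>\<^bsub>PSh\<^esub> \<phi>) B j = ev \<alpha> B j" .
  qed
  then show ?thesis using that \<beta> by blast
qed

text \<open>A section of \<open>G\<close> that comes from \<open>F\<close> on a covering comes from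
  \<open>F\<close>. The restriction of the local preimage \<open>y\<close> to \<open>Z\<close> has
  image \<open>res G (b \<bullet> a) n\<close>, which is trivial; so by injectivity \<open>y\<close>
  meets the descent condition.\<close>

lemma lex_local_surj:
  assumes \<sigma>: "\<sigma> \<in> Hom PSh F G" and lexF: "left_exact T A F" and lexG: "left_exact T A G"
    and inj: "\<And>B x. \<lbrakk>B \<in> A; x \<in> El F B; ev \<sigma> B x = \<one>\<^bsub>fobj G B\<^esub>\<rbrakk> \<Longrightarrow> x = \<one>\<^bsub>fobj F B\<^esub>"
    and b: "cover b D B" and n: "n \<in> El G B" and y: "y \<in> El F D" "ev \<sigma> D y = res G b n"
  obtains x where "x \<in> El F B" "ev \<sigma> B x = n"
proof -
  note F = Hom_PSh_Ob(1)[OF \<sigma>] and G = Hom_PSh_Ob(2)[OF \<sigma>]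
  obtain Z a h where Z: "Z \<in> A" and D: "D \<in> A" and B: "B \<in> A" and t: "tri Z D B a b h" and conf: "conflation T A Z D B a b"
    using coverE[OF b] by blast
  note ar = triD[OF t]
  have "ev \<sigma> Z (res F a y) = res G a (res G b n)" using ev_natural[OF \<sigma>, of a y] ar Z D y by simp
  also have "\<dots> = res G (b \<bullet> a) n" using res_comp[OF G, of a b n] ar Z D B n by simp
  also have "\<dots> = \<one>\<^bsub>fobj G Z\<^esub>" unfolding tri_comp_zero[OF t] using G Z B n by simp
  finally have "res F a y = \<one>\<^bsub>fobj F Z\<^esub>" using inj[OF Z] res_closed[OF F, of a y] ar Z D y by simp
  then obtain x where x: "x \<in> El F B" "res F b x = y" using lex_descend[OF lexF conf y(1)] by blast
  have "res G b (ev \<sigma> B x) = res G b n" using ev_natural[OF \<sigma>, of b x] ar D B x y by simp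
  then have "ev \<sigma> B x = n" using lex_inj[OF lexG b ev_closed[OF \<sigma> B x(1)] n] by blast
  then show ?thesis using that x(1) by blast
qed

text \<open>Evaluated at \<open>p : E -> N\<close>, the hypothesis says that \<open>f - g\<close>
  kills \<open>p\<close>; hence \<open>f - g\<close> factors through the third object
  \<open>W0\<close> of the triangle.\<close>

lemma yon_faithful:
  assumes N: "N \<in> Tm" and f: "\<guillemotleft>f : N \<rightarrow> X\<guillemotright>" "\<guillemotleft>g : N \<rightarrow> X\<guillemotright>" and eq: "yon f = yon g"
  shows "cls f = cls g"
proof -
  obtain D E W0 w p q k h where E: "E \<in> A" and W0: "W0 \<in> W" and t: "tri E N W0 p q k" using tminus_triangle[OF N] .
  note ar = triD[OF t]
  have X: "X \<in> Ob T" using in_homD[OF f(1)] by blast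
  have d: "\<guillemotleft>f \<boxminus> g : N \<rightarrow> X\<guillemotright>" using f by simp
  have "f \<bullet> p = g \<bullet> p" using ev_yon[OF f(1) ar(4) E] ev_yon[OF f(2) ar(4) E] eq by simp
  then have "(f \<boxminus> g) \<bullet> p = zero E X" using f ar X by (simp add: comp_dif_left)
  then obtain u where u: "\<guillemotleft>u : W0 \<rightarrow> X\<guillemotright>" "u \<bullet> q = f \<boxminus> g" using tri_exact_contra[OF t d] by blast
  have "f \<boxminus> g \<in> I N X" using II[OF ar(5) u(1) W0] u(2) by simp
  then show ?thesis using cls_eq_iff[OF f(2,1)] by blast
qed

lemma yon_cls:
  assumes f: "\<guillemotleft>f : X \<rightarrow> Y\<guillemotright>" "\<guillemotleft>g : X \<rightarrow> Y\<guillemotright>" and eq: "cls f = cls g"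
  shows "yon f = yon g"
proof (rule psh_eqI[OF yon_Hom[OF f(1)] yon_Hom[OF f(2)]])
  have X: "X \<in> Ob T" using in_homD[OF f(1)] by blast
  fix B k assume B: "B \<in> A" and "k \<in> El (rep X) B"
  then have k: "\<guillemotleft>k : B \<rightarrow> X\<guillemotright>" using El_repD[of k B X] X by simp
  show "ev (yon f) B k = ev (yon g) B k"
    using ev_yon[OF f(1) k B] ev_yon[OF f(2) k B] cls_comp_A[OF eq f k B] by simp
qed

text \<open>The value of \<open>\<alpha>\<close> at \<open>p\<close> is a map \<open>E -> X\<close>
  that vanishes on \<open>D\<close>, so exactness extends it to \<open>f\<close> on
  \<open>N\<close>. Every map from \<open>A\<close> to \<open>N\<close> lifts to \<open>E\<close>,
  and by naturality \<open>\<alpha>\<close> agrees with composition by \<open>f\<close>.\<close>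

lemma yon_full:
  assumes N: "N \<in> Tm" and X: "X \<in> Ob T" and \<alpha>: "\<alpha> \<in> Hom PSh (rep N) (rep X)"
  obtains f where "\<guillemotleft>f : N \<rightarrow> X\<guillemotright>" "yon f = \<alpha>"
proof -
  obtain D E W0 w p q k h where D: "D \<in> A" and E: "E \<in> A" and W0: "W0 \<in> W" and t: "tri E N W0 p q k"
    and t1: "tri D E N w p h" using tminus_triangle[OF N] .
  note ar = triD[OF t] and ar1 = triD[OF t1]
  have nat: "ev \<alpha> B' (l \<bullet> m) = ev \<alpha> B l \<bullet> m \<and> \<guillemotleft>ev \<alpha> B l : B \<rightarrow> X\<guillemotright>"
    if "B \<in> A" "B' \<in> A" "\<guillemotleft>m : B' \<rightarrow> B\<guillemotright>" "\<guillemotleft>l : B \<rightarrow> N\<guillemotright>" for B B' l m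
  proof -
    have l: "l \<in> El (rep N) B" "l \<in> Hom T B N" using El_repI[OF that(4)] by simp_all
    have *: "ev \<alpha> B l \<in> Hom T B X" using ev_closed[OF \<alpha> that(1) l(1)] by simp
    then show ?thesis using ev_natural[OF \<alpha>, of m l] res_rep[of l m N] res_rep[of "ev \<alpha> B l" m X] l that
        El_repD[OF *] X by simp
  qed
  let ?e = "ev \<alpha> E p"
  have e: "\<guillemotleft>?e : E \<rightarrow> X\<guillemotright>" using nat[OF E D ar1(4) ar(4)] by blast
  have "?e \<bullet> w = ev \<alpha> D (p \<bullet> w)" using nat[OF E D ar1(4) ar(4)] by simp
  also have "\<dots> = zero D X" unfolding tri_comp_zero[OF t1] using ev_one[OF \<alpha> D] by simp
  finally obtain f where f: "\<guillemotleft>f : N \<rightarrow> X\<guillemotright>" "f \<bullet> p = ?e" using tri_exact_contra[OF t1 e] by blast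
  have "yon f = \<alpha>"
  proof (rule psh_eqI[OF yon_Hom[OF f(1)] \<alpha>])
    fix B n assume B: "B \<in> A" and "n \<in> El (rep N) B"
    then have n: "\<guillemotleft>n : B \<rightarrow> N\<guillemotright>" using El_repD[of n B N] ar by simp
    obtain l where l: "\<guillemotleft>l : B \<rightarrow> E\<guillemotright>" "p \<bullet> l = n" using tminus_lift[OF t W0 B n] .
    have "ev \<alpha> B n = ?e \<bullet> l" using nat[OF E B l(1) ar(4)] l(2) by simp
    also have "\<dots> = f \<bullet> n" unfolding f(2)[symmetric] l(2)[symmetric] using f(1) ar l(1) by (simp add: comp_assoc)
    finally show "ev (yon f) B n = ev \<alpha> B n" using ev_yon[OF f(1) n B] by simp
  qed
  then show ?thesis using that f(1) by blast
qed

end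

section \<open>Reflection into the heart\<close>

text \<open>
  \<open>e\<close> represents the unit \<open>X \<rightarrow> \<tau>\<^sup>+ X\<close> and \<open>i\<close> the counit \<open>\<tau>\<^sup>- \<tau>\<^sup>+ X \<rightarrow> \<tau>\<^sup>+ X\<close>.
\<close>

locale heart_reflection = cotorsion T U V
  for T :: "('o, 'm, 'z) tricat_scheme" (structure) and U V +
  fixes X P N :: 'o and e i :: 'm
  assumes P: "P \<in> Tp" and N: "N \<in> Tm" and e: "in_hom e X P" and i: "in_hom i N P"
    and e_universal: "\<And>Y g. \<lbrakk>Y \<in> Tp; in_hom g X Y\<rbrakk> \<Longrightarrow> \<exists>h. in_hom h P Y \<and> cls (h \<bullet> e) = cls g"
    and e_unique: "\<And>Y h h'. \<lbrakk>Y \<in> Tp; in_hom h P Y; in_hom h' P Y; cls (h \<bullet> e) = cls (h' \<bullet> e)\<rbrakk> \<Longrightarrow> cls h = cls h'"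
    and i_lift: "\<And>B g. \<lbrakk>B \<in> A; in_hom g B P\<rbrakk> \<Longrightarrow> \<exists>n. in_hom n B N \<and> i \<bullet> n = g"
    and i_mono: "\<And>B n n'. \<lbrakk>B \<in> A; in_hom n B N; in_hom n' B N; i \<bullet> n = i \<bullet> n'\<rbrakk> \<Longrightarrow> n = n'"
begin

notation in_hom (\<open>\<guillemotleft>_ : _ \<rightarrow> _\<guillemotright>\<close>)

lemma X_Ob: "X \<in> Ob T" and N_Ob: "N \<in> Ob T" and P_Ob: "P \<in> Ob T"
  using in_homD[OF e] in_homD[OF i] by blast+

text \<open>A composite \<open>B -> U2 -> N\<close> becomes zero after \<open>i\<close>, because
  \<open>P\<close> lies in \<open>T^+\<close>, and \<open>i\<close> is injective on maps from
  \<open>A\<close>. This is what places the values of \<open>\<tau>^- \<tau>^+\<close> in the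
  heart.\<close>

lemma N_Tp: "N \<in> Tp"
proof (rule tplus_criterion[OF N_Ob])
  fix B U2 a b assume B: "B \<in> A" and U2: "U2 \<in> U" and a: "\<guillemotleft>a : B \<rightarrow> U2\<guillemotright>" and b: "\<guillemotleft>b : U2 \<rightarrow> N\<guillemotright>"
  have ib: "\<guillemotleft>i \<bullet> b : U2 \<rightarrow> P\<guillemotright>" using i b by simp
  have "i \<bullet> (b \<bullet> a) = (i \<bullet> b) \<bullet> a" using i a b by (simp add: comp_assoc)
  also have "\<dots> = zero B P" using tplus_zero[OF P B U2 a ib] .
  also have "\<dots> = i \<bullet> zero B N" using i A_Ob[OF B] by simp
  finally show "b \<bullet> a = zero B N" using i_mono[OF B] a b A_Ob[OF B] N_Ob by simp
qed

lemma N_heart: "N \<in> heart_objects T U V"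
  using N N_Tp unfolding heart_objects_def by blast

text \<open>On maps from \<open>A\<close>, composition with \<open>i\<close> is a bijection from
  \<open>T(-, N)\<close> to \<open>T(-, P)\<close>. So \<open>\<theta>\<close> is composition with
  the unit \<open>e\<close>, followed by the inverse of that bijection.\<close>

definition \<theta> :: "('o, 'm) presheaf_arrow" where
  "\<theta> = psh_arr A (rep X) (rep N) (\<lambda>B k. THE n. \<guillemotleft>n : B \<rightarrow> N\<guillemotright> \<and> i \<bullet> n = e \<bullet> k)"

lemma the_lift: assumes "B \<in> A" "\<guillemotleft>n : B \<rightarrow> N\<guillemotright>" "i \<bullet> n = e \<bullet> k"
  shows "(THE n. \<guillemotleft>n : B \<rightarrow> N\<guillemotright> \<and> i \<bullet> n = e \<bullet> k) = n"
proof (rule the_equality)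
  show "\<guillemotleft>n : B \<rightarrow> N\<guillemotright> \<and> i \<bullet> n = e \<bullet> k" using assms by blast
  show "n' = n" if "\<guillemotleft>n' : B \<rightarrow> N\<guillemotright> \<and> i \<bullet> n' = e \<bullet> k" for n'
    using i_mono[of B n' n] that assms by simp
qed

lemma lift_exists: assumes B: "B \<in> A" and k: "\<guillemotleft>k : B \<rightarrow> X\<guillemotright>"
  obtains n where "\<guillemotleft>n : B \<rightarrow> N\<guillemotright>" "i \<bullet> n = e \<bullet> k"
proof -
  have "\<guillemotleft>e \<bullet> k : B \<rightarrow> P\<guillemotright>" using e k by simp
  then show ?thesis using i_lift[OF B] that by blast
qed

lemma ev_\<theta>: assumes "B \<in> A" "\<guillemotleft>k : B \<rightarrow> X\<guillemotright>" "\<guillemotleft>n : B \<rightarrow> N\<guillemotright>" "i \<bullet> n = e \<bullet> k" shows "ev \<theta> B k = n"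
  unfolding \<theta>_def using the_lift[OF assms(1,3,4)] El_repI[OF assms(2)] assms(1) by simp

lemma \<theta>_Hom: "\<theta> \<in> Hom PSh (rep X) (rep N)"
  unfolding \<theta>_def
proof (rule psh_arr_Hom[OF rep_Ob[OF X_Ob] rep_Ob[OF N_Ob]])
  let ?t = "\<lambda>B k. THE n. \<guillemotleft>n : B \<rightarrow> N\<guillemotright> \<and> i \<bullet> n = e \<bullet> k"
  fix B k assume B: "B \<in> A" and "k \<in> El (rep X) B"
  then have k: "\<guillemotleft>k : B \<rightarrow> X\<guillemotright>" using El_repD[of k B X] X_Ob by simp
  obtain n where n: "\<guillemotleft>n : B \<rightarrow> N\<guillemotright>" "i \<bullet> n = e \<bullet> k" using lift_exists[OF B k] .
  show "?t B k \<in> El (rep N) B" using the_lift[OF B n] El_repI[OF n(1)] by simp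
  fix k' assume "k' \<in> El (rep X) B"
  then have k': "\<guillemotleft>k' : B \<rightarrow> X\<guillemotright>" using El_repD[of k' B X] X_Ob B by simp
  obtain n' where n': "\<guillemotleft>n' : B \<rightarrow> N\<guillemotright>" "i \<bullet> n' = e \<bullet> k'" using lift_exists[OF B k'] .
  have "\<guillemotleft>add n n' : B \<rightarrow> N\<guillemotright>" "i \<bullet> add n n' = e \<bullet> add k k'"
    using n n' k k' e i by (simp_all add: comp_add_right)
  from the_lift[OF B this] show "?t B (k \<otimes>\<^bsub>fobj (rep X) B\<^esub> k') = ?t B k \<otimes>\<^bsub>fobj (rep N) B\<^esub> ?t B k'"
    using the_lift[OF B n] the_lift[OF B n'] k k' n(1) n'(1) by (simp add: add_def)
next
  let ?t = "\<lambda>B k. THE n. \<guillemotleft>n : B \<rightarrow> N\<guillemotright> \<and> i \<bullet> n = e \<bullet> k"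
  fix f k assume f: "SArr f" and k0: "k \<in> El (rep X) (Tgt T f)"
  then have k: "\<guillemotleft>k : Tgt T f \<rightarrow> X\<guillemotright>" using El_repD[of k "Tgt T f" X] X_Ob by simp
  have B: "Src T f \<in> A" "Tgt T f \<in> A" using f by blast+
  obtain n where n: "\<guillemotleft>n : Tgt T f \<rightarrow> N\<guillemotright>" "i \<bullet> n = e \<bullet> k" using lift_exists[OF B(2) k] .
  have "\<guillemotleft>n \<bullet> f : Src T f \<rightarrow> N\<guillemotright>" using n(1) f by simp
  moreover have "i \<bullet> (n \<bullet> f) = e \<bullet> (k \<bullet> f)"
  proof -
    have "i \<bullet> (n \<bullet> f) = (i \<bullet> n) \<bullet> f" using n(1) f i by (simp add: comp_assoc)
    also have "\<dots> = e \<bullet> (k \<bullet> f)" unfolding n(2) using k f e by (simp add: comp_assoc)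
    finally show ?thesis .
  qed
  ultimately have "?t (Src T f) (k \<bullet> f) = n \<bullet> f" by (rule the_lift[OF B(1)])
  then show "?t (Src T f) (res (rep X) f k) = res (rep N) f (?t (Tgt T f) k)"
    using the_lift[OF B(2) n] res_rep[of k f X] res_rep[of n f N] k0 El_repI[OF n(1)] by simp
qed

lemma \<theta>_spec: assumes B: "B \<in> A" and k: "\<guillemotleft>k : B \<rightarrow> X\<guillemotright>"
  shows "\<guillemotleft>ev \<theta> B k : B \<rightarrow> N\<guillemotright>" "i \<bullet> ev \<theta> B k = e \<bullet> k"
proof -
  obtain n where n: "\<guillemotleft>n : B \<rightarrow> N\<guillemotright>" "i \<bullet> n = e \<bullet> k" using lift_exists[OF B k] .
  show "\<guillemotleft>ev \<theta> B k : B \<rightarrow> N\<guillemotright>" "i \<bullet> ev \<theta> B k = e \<bullet> k" using n ev_\<theta>[OF B k n] by simp_all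
qed

text \<open>Since \<open>P\<close> is given by a universal property, it is compared with the
  explicit cone \<open>Y\<close> of \<open>E -> U0 -> X\<close>. On \<open>A\<close> the map
  \<open>c' : P -> Y\<close> is a split monomorphism compatible with \<open>e\<close> and
  \<open>c\<close>, and both local statements can be read off from the triangle of
  \<open>Y\<close>.\<close>

lemma \<theta>_local:
  shows \<theta>_locally_inj: "locally_inj \<theta> X" and \<theta>_locally_surj: "locally_surj \<theta> X (rep N)"
proof -
  obtain E U0 Y a b m c where E: "E \<in> A" and U0: "U0 \<in> U" and a: "\<guillemotleft>a : E \<rightarrow> U0\<guillemotright>" and b: "\<guillemotleft>b : U0 \<rightarrow> X\<guillemotright>"
    and t: "tri E X Y (b \<bullet> a) c m" and Y: "Y \<in> Tp" using plus_triangle[OF X_Ob] .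
  note ar = triD[OF t]
  obtain c' where c': "\<guillemotleft>c' : P \<rightarrow> Y\<guillemotright>" "cls (c' \<bullet> e) = cls c" using e_universal[OF Y ar(5)] by blast
  \<comment> \<open>\<open>e \<bullet> b \<bullet> a\<close> runs from \<open>A\<close> through
    \<open>U\<close> to \<open>P\<close> in \<open>T^+\<close>, so it is zero and \<open>e\<close>
    factors through the cone.\<close>
  have "e \<bullet> (b \<bullet> a) = (e \<bullet> b) \<bullet> a" using e a b by (simp add: comp_assoc)
  also have "\<dots> = zero E P" using e b by (intro tplus_zero[OF P E U0 a]) simp
  finally obtain d where d: "\<guillemotleft>d : Y \<rightarrow> P\<guillemotright>" "d \<bullet> c = e" using tri_exact_contra[OF t e] by blast
  have c'e: "\<guillemotleft>c' \<bullet> e : X \<rightarrow> Y\<guillemotright>" and dc': "\<guillemotleft>d \<bullet> c' : P \<rightarrow> P\<guillemotright>" and idP: "\<guillemotleft>Ide T P : P \<rightarrow> P\<guillemotright>"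
    using c' d e P_Ob by simp_all
  have "cls ((d \<bullet> c') \<bullet> e) = cls d \<bullet>\<^bsub>CW\<^esub> cls (c' \<bullet> e)"
    using comp_CW[OF c'e d(1)] c' d(1) e by (simp add: comp_assoc)
  also have "\<dots> = cls (Ide T P \<bullet> e)" unfolding c'(2) comp_CW[OF ar(5) d(1)] d(2) using e by simp
  \<comment> \<open>Modulo \<open>W\<close>, both \<open>d \<bullet> c'\<close> and the identity
    compose with \<open>e\<close> to \<open>e\<close>; uniqueness in the universal property
    identifies them.\<close>
  finally have dc'_id: "cls (d \<bullet> c') = cls (Ide T P)" using e_unique[OF P dc' idP] by blast
  have dc'_comp: "(d \<bullet> c') \<bullet> k = k" if "B \<in> A" "\<guillemotleft>k : B \<rightarrow> P\<guillemotright>" for B k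
    using cls_comp_A[OF dc'_id dc' idP that(2,1)] that by simp
  show "locally_inj \<theta> X"
    unfolding locally_inj_def
  proof (intro ballI allI impI)
    fix B k assume B: "B \<in> A" and k: "\<guillemotleft>k : B \<rightarrow> X\<guillemotright>" and eq: "ev \<theta> B k = ev \<theta> B (zero B X)"
    note B' = A_Ob[OF B]
    have "e \<bullet> k = i \<bullet> zero B N" using \<theta>_spec(2)[OF B k] eq ev_one[OF \<theta>_Hom B] by simp
    also have "\<dots> = zero B P" using i B' by simp
    finally have ek: "e \<bullet> k = zero B P" .
    have "c \<bullet> k = (c' \<bullet> e) \<bullet> k" using cls_comp_A[OF c'(2) c'e ar(5) k B] by simp
    also have "\<dots> = c' \<bullet> (e \<bullet> k)" using c'(1) e k by (simp add: comp_assoc)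
    also have "\<dots> = zero B Y" unfolding ek using c'(1) B' by simp
    finally obtain l where l: "\<guillemotleft>l : B \<rightarrow> E\<guillemotright>" "b \<bullet> a \<bullet> l = k" using tri_exact[OF t k] by blast
    \<comment> \<open>\<open>k\<close> equals \<open>b \<bullet> a \<bullet> l\<close>, and its part
      \<open>a \<bullet> l\<close> is a map from \<open>A\<close> to \<open>U\<close>, which a
      covering kills.\<close>
    have "\<guillemotleft>a \<bullet> l : B \<rightarrow> U0\<guillemotright>" using a l(1) by simp
    then obtain D g where g: "cover g D B" "(a \<bullet> l) \<bullet> g = zero D U0" using cover_kills[OF B U0] by blast
    have g1: "\<guillemotleft>g : D \<rightarrow> B\<guillemotright>" using coverE[OF g(1)] by blast
    have "k \<bullet> g = b \<bullet> ((a \<bullet> l) \<bullet> g)" unfolding l(2)[symmetric] using a b l(1) g1 by (simp add: comp_assoc)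
    also have "\<dots> = zero D X" unfolding g(2) using b in_homD[OF g1] by simp
    finally show "\<exists>D b. cover b D B \<and> k \<bullet> b = zero D X" using g(1) by blast
  qed
  show "locally_surj \<theta> X (rep N)"
    unfolding locally_surj_def
  proof (intro ballI)
    fix B n assume B: "B \<in> A" and n0: "n \<in> El (rep N) B"
    then have n: "\<guillemotleft>n : B \<rightarrow> N\<guillemotright>" using El_repD[of n B N] N_Ob by simp
    have y: "\<guillemotleft>c' \<bullet> (i \<bullet> n) : B \<rightarrow> Y\<guillemotright>" using c'(1) i n by simp
    \<comment> \<open>The obstruction to lifting \<open>c' \<bullet> i \<bullet> n\<close> from
      \<open>Y\<close> to \<open>X\<close> takes values in \<open>E[1]\<close>, an object of
      \<open>U\<close>, and dies on a covering.\<close>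
    then have "\<guillemotleft>m \<bullet> (c' \<bullet> (i \<bullet> n)) : B \<rightarrow> sh E\<guillemotright>" using ar by simp
    then obtain D g where g: "cover g D B" "(m \<bullet> (c' \<bullet> (i \<bullet> n))) \<bullet> g = zero D (sh E)" using cover_kills[OF B A_shift[OF E]] by blast
    obtain D: "D \<in> A" and g1: "\<guillemotleft>g : D \<rightarrow> B\<guillemotright>" using coverE[OF g(1)] by blast
    have ng: "\<guillemotleft>n \<bullet> g : D \<rightarrow> N\<guillemotright>" "\<guillemotleft>i \<bullet> (n \<bullet> g) : D \<rightarrow> P\<guillemotright>" using i n g1 by simp_all
    have yg: "\<guillemotleft>c' \<bullet> (i \<bullet> (n \<bullet> g)) : D \<rightarrow> Y\<guillemotright>" using c'(1) i n g1 by simp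
    have "m \<bullet> (c' \<bullet> (i \<bullet> (n \<bullet> g))) = zero D (sh E)" using g(2) c'(1) i n g1 ar by (simp add: comp_assoc)
    then obtain x where x: "\<guillemotleft>x : D \<rightarrow> X\<guillemotright>" "c \<bullet> x = c' \<bullet> (i \<bullet> (n \<bullet> g))" using tri_exact[OF rotate[OF t] yg] by blast
    have "e \<bullet> x = d \<bullet> (c \<bullet> x)" unfolding d(2)[symmetric] using d(1) ar x(1) by (simp add: comp_assoc)
    also have "\<dots> = (d \<bullet> c') \<bullet> (i \<bullet> (n \<bullet> g))" unfolding x(2) using c'(1) d(1) i n g1 by (simp add: comp_assoc)
    also have "\<dots> = i \<bullet> (n \<bullet> g)" by (rule dc'_comp[OF D ng(2)])
    finally have "ev \<theta> D x = n \<bullet> g" using ev_\<theta>[OF D x(1) ng(1)] by simp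
    also have "\<dots> = res (rep N) g n" using res_rep[of n g N] El_repI[OF n] g1 by simp
    finally show "\<exists>D b x. cover b D B \<and> \<guillemotleft>x : D \<rightarrow> X\<guillemotright> \<and> ev \<theta> D x = res (rep N) b n" using g(1) x(1) by blast
  qed
qed

end

section \<open>The functor from the heart to the left exact functors\<close>

lemma additive_functor_from_full_subcat:
  "\<lbrakk>additive_functor C (full_subcat D S) F; S \<subseteq> Ob D\<rbrakk> \<Longrightarrow> additive_functor C D F"
  by (auto simp: additive_functor_def)

lemma stable_cat_eq: "stable_cat T U V S = full_subcat (quotient_cat T (U \<inter> V)) S"
  by (simp add: stable_cat_def quotient_full_subcat)

context cotorsion
begin

abbreviation Hh :: "'o set" where "Hh \<equiv> heart_objects T U V"

abbreviation heartC :: "('o, 'm set) precat" where "heartC \<equiv> heart T U V"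

abbreviation M :: "(('o, 'm) presheaf, ('o, 'm) presheaf_arrow) precat" where "M \<equiv> mod_cat (full_subcat T A)"

abbreviation L :: "(('o, 'm) presheaf, ('o, 'm) presheaf_arrow) precat" where "L \<equiv> lex_cat T A"

lemma Hh_Tm: "X \<in> Hh \<Longrightarrow> X \<in> Tm" and Hh_Tp: "X \<in> Hh \<Longrightarrow> X \<in> Tp"
  by (simp_all add: heart_objects_def)

lemma Hh_Ob: "X \<in> Hh \<Longrightarrow> X \<in> Ob T"
  using tplus_Ob Hh_Tp by blast

lemma heartC_eq: "heartC = full_subcat CW Hh"
  by (simp add: heart_def stable_cat_eq)

lemma heartC_simps [simp]:
  "Ob heartC = Hh" "Mor heartC = Mor CW" "Comp heartC = Comp CW" "Ide heartC = Ide CW"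
  "Src heartC = Src CW" "Tgt heartC = Tgt CW"
  by (simp_all add: heartC_eq)

lemma M_simps [simp]: "Mor M = Mor PSh" "Comp M = Comp PSh" "Ide M = Ide PSh" "Src M = Src PSh" "Tgt M = Tgt PSh"
  by (simp_all add: mod_cat_def)

lemma L_simps [simp]: "Mor L = Mor PSh" "Comp L = Comp PSh" "Ide L = Ide PSh" "Src L = Src PSh" "Tgt L = Tgt PSh"
  by (simp_all add: lex_cat_def)

lemma Ob_M: "F \<in> Ob M \<longleftrightarrow> finitely_presented (full_subcat T A) F"
  by (simp add: mod_cat_def)

lemma Ob_L: "F \<in> Ob L \<longleftrightarrow> F \<in> Ob M \<and> left_exact T A F"
  by (simp add: lex_cat_def)

lemma Ob_M_PSh: "F \<in> Ob M \<Longrightarrow> F \<in> Ob PSh"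
  using finitely_presentedE unfolding Ob_M by blast

lemma L_lex: "F \<in> Ob L \<Longrightarrow> left_exact T A F" and L_M: "F \<in> Ob L \<Longrightarrow> F \<in> Ob M" and L_PSh: "F \<in> Ob L \<Longrightarrow> F \<in> Ob PSh"
  using Ob_L Ob_M_PSh by blast+

lemma preadditive_M: "preadditive_category M"
  unfolding mod_cat_def by (rule PSh.preadditive_full_subcat) (use Ob_M_PSh Ob_M in blast)

lemma L_eq: "L = full_subcat M (Ob L)" and L_sub_M: "Ob L \<subseteq> Ob M"
  by (auto simp: lex_cat_def)

lemma preadditive_L: "preadditive_category L"
  using preadditive_category.preadditive_full_subcat[OF preadditive_M L_sub_M] L_eq by simp

lemma preadditive_heartC: "preadditive_category heartC"
  unfolding heartC_eq by (rule preadditive_category.preadditive_full_subcat[OF preadditive_CW]) (use Hh_Ob in auto)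

lemma rep_M: "X \<in> Ob T \<Longrightarrow> rep X \<in> Ob M"
  using rep_finitely_presented Ob_M by blast

lemma rep_L: "X \<in> Hh \<Longrightarrow> rep X \<in> Ob L"
  using rep_M rep_lex Hh_Tp Hh_Ob Ob_L by blast

lemma additive_yoneda_M: "additive_functor T M (restricted_yoneda T A)"
  unfolding mod_cat_def
  by (rule additive_functor_full_subcat[OF additive_restricted_yoneda]) (use rep_M Ob_M in simp)

text \<open>A residue class is sent to the value at a chosen representative. By
  \<open>yon_cls\<close> the choice has no influence, because maps from \<open>A\<close> do not see
  morphisms through \<open>W\<close>.\<close>

definition \<Psi> :: "('o, 'm set, ('o, 'm) presheaf, ('o, 'm) presheaf_arrow) cfunctor" where
  "\<Psi> = \<lparr>fobj = rep, farr = (\<lambda>a. yon (SOME f. f \<in> a))\<rparr>"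

lemma fobj_\<Psi> [simp]: "fobj \<Psi> X = rep X"
  by (simp add: \<Psi>_def)

lemma farr_\<Psi>: assumes f: "\<guillemotleft>f : X \<rightarrow> Y\<guillemotright>" shows "farr \<Psi> (cls f) = yon f"
proof -
  let ?g = "SOME f'. f' \<in> cls f"
  have g: "?g \<in> cls f" using self_mem_cls[OF f] by (rule someI)
  have g1: "\<guillemotleft>?g : X \<rightarrow> Y\<guillemotright>" using mem_cls_iff[OF f] g by blast
  show ?thesis using yon_cls[OF g1 f mem_cls_eq[OF f g]] by (simp add: \<Psi>_def)
qed

lemma additive_\<Psi>_PSh: "additive_functor CW PSh \<Psi>"
proof (rule additive_functorI; unfold Ob_CW fobj_\<Psi>)
  note Y = additive_restricted_yoneda
  show "rep X \<in> Ob PSh" if "X \<in> Ob T" for X using that by simp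
  show "farr \<Psi> a \<in> Hom PSh (rep X) (rep Y)" if XY: "X \<in> Ob T" "Y \<in> Ob T" and a: "a \<in> Hom CW X Y" for X Y a
  proof -
    obtain f where f: "\<guillemotleft>f : X \<rightarrow> Y\<guillemotright>" "a = cls f" using Hom_CWE[OF XY a] .
    show ?thesis unfolding f(2) farr_\<Psi>[OF f(1)] by (rule yon_Hom[OF f(1)])
  qed
  show "farr \<Psi> (a \<otimes>\<^bsub>Mor CW X Y\<^esub> b) = farr \<Psi> a \<otimes>\<^bsub>Mor PSh (rep X) (rep Y)\<^esub> farr \<Psi> b"
    if XY: "X \<in> Ob T" "Y \<in> Ob T" and a: "a \<in> Hom CW X Y" and b: "b \<in> Hom CW X Y" for X Y a b
  proof -
    obtain f where f: "\<guillemotleft>f : X \<rightarrow> Y\<guillemotright>" "a = cls f" using Hom_CWE[OF XY a] .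
    obtain g where g: "\<guillemotleft>g : X \<rightarrow> Y\<guillemotright>" "b = cls g" using Hom_CWE[OF XY b] .
    have fg: "\<guillemotleft>f \<boxplus> g : X \<rightarrow> Y\<guillemotright>" using f(1) g(1) by simp
    have "yon (f \<otimes>\<^bsub>Mor T X Y\<^esub> g) = yon f \<otimes>\<^bsub>Mor PSh (rep X) (rep Y)\<^esub> yon g"
      using additive_functor_mult[OF Y XY in_homD(3)[OF f(1)] in_homD(3)[OF g(1)]] by simp
    moreover have "f \<otimes>\<^bsub>Mor T X Y\<^esub> g = f \<boxplus> g" using f(1) g(1) by (simp add: add_def)
    ultimately show ?thesis unfolding f(2) g(2) mult_CW[OF f(1) g(1)] farr_\<Psi>[OF f(1)] farr_\<Psi>[OF g(1)] farr_\<Psi>[OF fg] by simp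
  qed
  show "farr \<Psi> (Ide CW X) = Ide PSh (rep X)" if X: "X \<in> Ob T" for X
    using additive_functor_Ide[OF Y X] farr_\<Psi>[of "Ide T X" X X] X by (simp add: Ide_CW)
  show "farr \<Psi> (b \<bullet>\<^bsub>CW\<^esub> a) = farr \<Psi> b \<bullet>\<^bsub>PSh\<^esub> farr \<Psi> a"
    if XY: "X \<in> Ob T" "Y \<in> Ob T" "Z \<in> Ob T" and a: "a \<in> Hom CW X Y" and b: "b \<in> Hom CW Y Z" for X Y Z a b
  proof -
    obtain f where f: "\<guillemotleft>f : X \<rightarrow> Y\<guillemotright>" "a = cls f" using Hom_CWE[OF XY(1,2) a] .
    obtain g where g: "\<guillemotleft>g : Y \<rightarrow> Z\<guillemotright>" "b = cls g" using Hom_CWE[OF XY(2,3) b] .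
    have gf: "\<guillemotleft>g \<bullet> f : X \<rightarrow> Z\<guillemotright>" using f(1) g(1) by simp
    show ?thesis unfolding f(2) g(2) comp_CW[OF f(1) g(1)] farr_\<Psi>[OF f(1)] farr_\<Psi>[OF g(1)] farr_\<Psi>[OF gf]
      using additive_functor_Comp[OF Y XY in_homD(3)[OF f(1)] in_homD(3)[OF g(1)]] .
  qed
qed

lemma additive_\<Psi>: "additive_functor heartC L \<Psi>"
proof -
  have "additive_functor heartC PSh \<Psi>"
    unfolding heartC_eq by (rule additive_functor_restrict[OF additive_\<Psi>_PSh]) (use Hh_Ob in auto)
  then have "additive_functor heartC (full_subcat PSh (Ob L)) \<Psi>"
    by (rule additive_functor_full_subcat) (use rep_L in simp)
  moreover have "full_subcat PSh (Ob L) = L" by (simp add: full_subcat_def lex_cat_def mod_cat_def)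
  ultimately show ?thesis by simp
qed

lemma isomorphic_L: assumes "F \<in> Ob L" "G \<in> Ob L" "iso_in PSh F G \<sigma>" shows "iso_in L F G \<sigma>"
  using assms by (simp add: iso_in_def)

end

section \<open>Reflection of every object into the heart by the given adjoints\<close>

locale heart_adjoints = cotorsion T U V
  for T :: "('o, 'm, 'z) tricat_scheme" (structure) and U V +
  fixes tp tm :: "('o, 'm set, 'o, 'm set) cfunctor"
  assumes tau_plus: "is_tau_plus T U V tp" and tau_minus: "is_tau_minus T U V tm"
begin

notation in_hom (\<open>\<guillemotleft>_ : _ \<rightarrow> _\<guillemotright>\<close>)

abbreviation P :: "'o \<Rightarrow> 'o" where "P X \<equiv> fobj tp X"

abbreviation N :: "'o \<Rightarrow> 'o" where "N X \<equiv> fobj tm (P X)"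

lemma tp_adjoint: "adjoint CW (full_subcat CW Tp) tp id_functor"
  using tau_plus full_subcat_self[of CW "Ob T"] by (simp add: is_tau_plus_def stable_cat_eq)

lemma tm_adjoint: "adjoint (full_subcat CW Tm) CW id_functor tm"
  using tau_minus full_subcat_self[of CW "Ob T"] by (simp add: is_tau_minus_def stable_cat_eq)

lemma tplus_sub: "Tp \<subseteq> Ob CW" and tminus_sub: "Tm \<subseteq> Ob CW"
  using tplus_Ob tminus_Ob by auto

lemma tp_additive: "additive_functor CW CW tp"
  using additive_functor_from_full_subcat[OF _ tplus_sub] tp_adjoint unfolding adjoint_def by blast

lemma tm_additive: "additive_functor CW CW tm"
  using additive_functor_from_full_subcat[OF _ tminus_sub] tm_adjoint unfolding adjoint_def by blast

text \<open>Carries the two adjunctions from the quotient category to morphisms of \<open>T\<close>.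
  The last clause describes the action of \<open>\<tau>^- \<tau>^+\<close> on \<open>f\<close> by a
  representative \<open>\<phi>\<close>; its square commutes only modulo \<open>W\<close>, so it is
  stated as an honest equation after composition with maps from \<open>A\<close>.\<close>

lemma reflection_data:
  obtains e i where "\<And>X. X \<in> Ob T \<Longrightarrow> heart_reflection T U V X (P X) (N X) (e X) (i X)"
    "\<And>X Y f. \<guillemotleft>f : X \<rightarrow> Y\<guillemotright> \<Longrightarrow> \<exists>\<phi>. \<guillemotleft>\<phi> : N X \<rightarrow> N Y\<guillemotright> \<and> farr tm (farr tp (cls f)) = cls \<phi> \<and>
      (\<forall>B k n. B \<in> A \<longrightarrow> \<guillemotleft>k : B \<rightarrow> X\<guillemotright> \<longrightarrow> \<guillemotleft>n : B \<rightarrow> N X\<guillemotright> \<longrightarrow> i X \<bullet> n = e X \<bullet> k \<longrightarrow> i Y \<bullet> (\<phi> \<bullet> n) = e Y \<bullet> (f \<bullet> k))"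
proof -
  interpret CW: preadditive_category CW by (rule preadditive_CW)
  have CW_in: "CW.in_hom (cls f) X Y" if f: "\<guillemotleft>f : X \<rightarrow> Y\<guillemotright>" for f X Y
    using CW.in_homI[OF _ _ cls_Hom[OF f]] in_homD[OF f] by simp
  have CW_rep: "\<exists>f. \<guillemotleft>f : X \<rightarrow> Y\<guillemotright> \<and> a = cls f" if "CW.in_hom a X Y" for a X Y
    using CW.in_homD[OF that] Hom_CW[of X Y a] by simp
  obtain \<eta> where PTp0: "\<And>X. X \<in> Ob CW \<Longrightarrow> P X \<in> Tp"
    and \<eta>: "\<And>X. X \<in> Ob CW \<Longrightarrow> CW.in_hom (\<eta> X) X (P X)"
    and \<eta>_nat: "\<And>X Y f. CW.in_hom f X Y \<Longrightarrow> farr tp f \<bullet>\<^bsub>CW\<^esub> \<eta> X = \<eta> Y \<bullet>\<^bsub>CW\<^esub> f"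
    and \<eta>_ex: "\<And>X Y g. \<lbrakk>CW.in_hom g X Y; Y \<in> Tp\<rbrakk> \<Longrightarrow> \<exists>h. CW.in_hom h (P X) Y \<and> h \<bullet>\<^bsub>CW\<^esub> \<eta> X = g"
    and \<eta>_uniq: "\<And>X Y h h'. \<lbrakk>X \<in> Ob CW; Y \<in> Tp; CW.in_hom h (P X) Y; CW.in_hom h' (P X) Y; h \<bullet>\<^bsub>CW\<^esub> \<eta> X = h' \<bullet>\<^bsub>CW\<^esub> \<eta> X\<rbrakk> \<Longrightarrow> h = h'"
    using CW.reflection[OF tp_adjoint tplus_sub] by blast
  obtain \<epsilon> where NTm0: "\<And>X. X \<in> Ob CW \<Longrightarrow> fobj tm X \<in> Tm"
    and \<epsilon>: "\<And>X. X \<in> Ob CW \<Longrightarrow> CW.in_hom (\<epsilon> X) (fobj tm X) X"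
    and \<epsilon>_nat: "\<And>X Y f. CW.in_hom f X Y \<Longrightarrow> \<epsilon> Y \<bullet>\<^bsub>CW\<^esub> farr tm f = f \<bullet>\<^bsub>CW\<^esub> \<epsilon> X"
    and \<epsilon>_ex: "\<And>X Y g. \<lbrakk>CW.in_hom g Y X; Y \<in> Tm\<rbrakk> \<Longrightarrow> \<exists>h. CW.in_hom h Y (fobj tm X) \<and> \<epsilon> X \<bullet>\<^bsub>CW\<^esub> h = g"
    and \<epsilon>_uniq: "\<And>X Y h h'. \<lbrakk>X \<in> Ob CW; Y \<in> Tm; CW.in_hom h Y (fobj tm X); CW.in_hom h' Y (fobj tm X); \<epsilon> X \<bullet>\<^bsub>CW\<^esub> h = \<epsilon> X \<bullet>\<^bsub>CW\<^esub> h'\<rbrakk> \<Longrightarrow> h = h'"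
    using CW.coreflection[OF tm_adjoint tminus_sub] by blast
  have PTp: "P X \<in> Tp" and NTm: "N X \<in> Tm" and PO: "P X \<in> Ob T" and NO: "N X \<in> Ob T" if "X \<in> Ob T" for X
    using PTp0[of X] NTm0[of "P X"] tplus_Ob[of "P X"] tminus_Ob[of "N X"] that by simp_all
  define e where "e X = (SOME f. \<guillemotleft>f : X \<rightarrow> P X\<guillemotright> \<and> \<eta> X = cls f)" for X
  define i where "i X = (SOME f. \<guillemotleft>f : N X \<rightarrow> P X\<guillemotright> \<and> \<epsilon> (P X) = cls f)" for X
  have e0: "\<guillemotleft>e X : X \<rightarrow> P X\<guillemotright> \<and> \<eta> X = cls (e X)" if X: "X \<in> Ob T" for X
    unfolding e_def by (rule someI_ex[OF CW_rep[OF \<eta>]]) (use X in simp)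
  have i0: "\<guillemotleft>i X : N X \<rightarrow> P X\<guillemotright> \<and> \<epsilon> (P X) = cls (i X)" if X: "X \<in> Ob T" for X
    unfolding i_def by (rule someI_ex[OF CW_rep[OF \<epsilon>]]) (use PO[OF X] in simp)
  have e: "\<guillemotleft>e X : X \<rightarrow> P X\<guillemotright>" and e_cls: "\<eta> X = cls (e X)" if "X \<in> Ob T" for X using e0[OF that] by blast+
  have i: "\<guillemotleft>i X : N X \<rightarrow> P X\<guillemotright>" and i_cls: "\<epsilon> (P X) = cls (i X)" if "X \<in> Ob T" for X using i0[OF that] by blast+
  show ?thesis
  proof (rule that[of e i])
    fix X assume X: "X \<in> Ob T"
    show "heart_reflection T U V X (P X) (N X) (e X) (i X)"
    proof unfold_locales
      show "P X \<in> Tp" "N X \<in> Tm" using PTp[OF X] NTm[OF X] .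
      show "\<guillemotleft>e X : X \<rightarrow> P X\<guillemotright>" "\<guillemotleft>i X : N X \<rightarrow> P X\<guillemotright>" using e[OF X] i[OF X] .
      show "\<exists>h. \<guillemotleft>h : P X \<rightarrow> Y\<guillemotright> \<and> cls (h \<bullet> e X) = cls g" if Y: "Y \<in> Tp" and g: "\<guillemotleft>g : X \<rightarrow> Y\<guillemotright>" for Y g
      proof -
        obtain a where a: "CW.in_hom a (P X) Y" "a \<bullet>\<^bsub>CW\<^esub> \<eta> X = cls g" using \<eta>_ex[OF CW_in[OF g] Y] by blast
        obtain h where h: "\<guillemotleft>h : P X \<rightarrow> Y\<guillemotright>" "a = cls h" using CW_rep[OF a(1)] by blast
        have "cls (h \<bullet> e X) = cls g" using a(2) unfolding h(2) e_cls[OF X] comp_CW[OF e[OF X] h(1)] .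
        then show ?thesis using h(1) by blast
      qed
      show "cls h = cls h'" if Y: "Y \<in> Tp" and h: "\<guillemotleft>h : P X \<rightarrow> Y\<guillemotright>" "\<guillemotleft>h' : P X \<rightarrow> Y\<guillemotright>"
        and eq: "cls (h \<bullet> e X) = cls (h' \<bullet> e X)" for Y h h'
      proof (rule \<eta>_uniq[OF _ Y CW_in[OF h(1)] CW_in[OF h(2)]])
        show "X \<in> Ob CW" using X by simp
        show "cls h \<bullet>\<^bsub>CW\<^esub> \<eta> X = cls h' \<bullet>\<^bsub>CW\<^esub> \<eta> X"
          unfolding e_cls[OF X] comp_CW[OF e[OF X] h(1)] comp_CW[OF e[OF X] h(2)] by (rule eq)
      qed
      \<comment> \<open>Objects of \<open>A\<close> belong to \<open>T^-\<close>, so the counit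
        lifts maps from them. The class of a map from \<open>A\<close> is a singleton, so the lift
        is exact and not only modulo \<open>W\<close>.\<close>
      show "\<exists>n. \<guillemotleft>n : B \<rightarrow> N X\<guillemotright> \<and> i X \<bullet> n = g" if B: "B \<in> A" and g: "\<guillemotleft>g : B \<rightarrow> P X\<guillemotright>" for B g
      proof -
        obtain a where a: "CW.in_hom a B (N X)" "\<epsilon> (P X) \<bullet>\<^bsub>CW\<^esub> a = cls g" using \<epsilon>_ex[OF CW_in[OF g] A_tminus[OF B]] by blast
        obtain n where n: "\<guillemotleft>n : B \<rightarrow> N X\<guillemotright>" "a = cls n" using CW_rep[OF a(1)] by blast
        have "cls (i X \<bullet> n) = cls g" using a(2) unfolding n(2) i_cls[OF X] comp_CW[OF n(1) i[OF X]] .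
        moreover have "\<guillemotleft>i X \<bullet> n : B \<rightarrow> P X\<guillemotright>" using i[OF X] n(1) by simp
        ultimately have "i X \<bullet> n = g" using cls_inj_A g B by blast
        then show ?thesis using n(1) by blast
      qed
      show "n = n'" if B: "B \<in> A" and n: "\<guillemotleft>n : B \<rightarrow> N X\<guillemotright>" "\<guillemotleft>n' : B \<rightarrow> N X\<guillemotright>" and eq: "i X \<bullet> n = i X \<bullet> n'" for B n n'
      proof -
        have "cls n = cls n'"
        proof (rule \<epsilon>_uniq[OF _ A_tminus[OF B] CW_in[OF n(1)] CW_in[OF n(2)]])
          show "P X \<in> Ob CW" using PO[OF X] by simp
          show "\<epsilon> (P X) \<bullet>\<^bsub>CW\<^esub> cls n = \<epsilon> (P X) \<bullet>\<^bsub>CW\<^esub> cls n'"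
            unfolding i_cls[OF X] comp_CW[OF n(1) i[OF X]] comp_CW[OF n(2) i[OF X]] eq ..
        qed
        then show ?thesis using cls_inj_A n B by blast
      qed
    qed
  next
    fix X Y f assume f: "\<guillemotleft>f : X \<rightarrow> Y\<guillemotright>"
    have X: "X \<in> Ob T" and Y: "Y \<in> Ob T" using in_homD[OF f] by blast+
    have "farr tp (cls f) \<in> Hom CW (P X) (P Y)" using additive_functor_Hom[OF tp_additive _ _ cls_Hom[OF f]] X Y by simp
    then obtain a where a: "\<guillemotleft>a : P X \<rightarrow> P Y\<guillemotright>" "farr tp (cls f) = cls a" using Hom_CWE[OF PO[OF X] PO[OF Y]] by blast
    have "farr tm (cls a) \<in> Hom CW (N X) (N Y)" using additive_functor_Hom[OF tm_additive _ _ cls_Hom[OF a(1)]] PO X Y by simp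
    then obtain \<phi> where \<phi>: "\<guillemotleft>\<phi> : N X \<rightarrow> N Y\<guillemotright>" "farr tm (cls a) = cls \<phi>" using Hom_CWE[OF NO[OF X] NO[OF Y]] by blast
    have 1: "cls (a \<bullet> e X) = cls (e Y \<bullet> f)"
      using \<eta>_nat[OF CW_in[OF f]] unfolding a(2) e_cls[OF X] e_cls[OF Y] comp_CW[OF e[OF X] a(1)] comp_CW[OF f e[OF Y]] .
    have 2: "cls (i Y \<bullet> \<phi>) = cls (a \<bullet> i X)"
      using \<epsilon>_nat[OF CW_in[OF a(1)]] unfolding \<phi>(2) i_cls[OF X] i_cls[OF Y] comp_CW[OF i[OF X] a(1)] comp_CW[OF \<phi>(1) i[OF Y]] .
    have "i Y \<bullet> (\<phi> \<bullet> n) = e Y \<bullet> (f \<bullet> k)"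
      if B: "B \<in> A" and k: "\<guillemotleft>k : B \<rightarrow> X\<guillemotright>" and n: "\<guillemotleft>n : B \<rightarrow> N X\<guillemotright>" and eq: "i X \<bullet> n = e X \<bullet> k" for B k n
    proof -
      have ar: "\<guillemotleft>a \<bullet> e X : X \<rightarrow> P Y\<guillemotright>" "\<guillemotleft>e Y \<bullet> f : X \<rightarrow> P Y\<guillemotright>" "\<guillemotleft>i Y \<bullet> \<phi> : N X \<rightarrow> P Y\<guillemotright>" "\<guillemotleft>a \<bullet> i X : N X \<rightarrow> P Y\<guillemotright>"
        using a(1) \<phi>(1) f e[OF X] e[OF Y] i[OF X] i[OF Y] by simp_all
      have "i Y \<bullet> (\<phi> \<bullet> n) = (i Y \<bullet> \<phi>) \<bullet> n" using \<phi>(1) i[OF Y] n by (simp add: comp_assoc)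
      also have "\<dots> = (a \<bullet> i X) \<bullet> n" by (rule cls_comp_A[OF 2 ar(3,4) n B])
      also have "\<dots> = a \<bullet> (e X \<bullet> k)" unfolding eq[symmetric] using a(1) i[OF X] n by (simp add: comp_assoc)
      also have "\<dots> = (a \<bullet> e X) \<bullet> k" using a(1) e[OF X] k by (simp add: comp_assoc)
      also have "\<dots> = (e Y \<bullet> f) \<bullet> k" by (rule cls_comp_A[OF 1 ar(1,2) k B])
      also have "\<dots> = e Y \<bullet> (f \<bullet> k)" using f e[OF Y] k by (simp add: comp_assoc)
      finally show ?thesis .
    qed
    then show "\<exists>\<phi>. \<guillemotleft>\<phi> : N X \<rightarrow> N Y\<guillemotright> \<and> farr tm (farr tp (cls f)) = cls \<phi> \<and>
      (\<forall>B k n. B \<in> A \<longrightarrow> \<guillemotleft>k : B \<rightarrow> X\<guillemotright> \<longrightarrow> \<guillemotleft>n : B \<rightarrow> N X\<guillemotright> \<longrightarrow> i X \<bullet> n = e X \<bullet> k \<longrightarrow> i Y \<bullet> (\<phi> \<bullet> n) = e Y \<bullet> (f \<bullet> k))"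
      using \<phi> a(2) by (intro exI[of _ \<phi>]) simp
  qed
qed

text \<open>Fixes one local isomorphism for each object and makes it natural with respect to
  \<open>\<tau>^- \<tau>^+\<close>, with no further reference to representatives of the unit and
  counit.\<close>

lemma theta_data:
  obtains \<theta> where "\<And>X. X \<in> Ob T \<Longrightarrow> N X \<in> Hh"
    "\<And>X. X \<in> Ob T \<Longrightarrow> \<theta> X \<in> Hom PSh (rep X) (rep (N X))"
    "\<And>X. X \<in> Ob T \<Longrightarrow> locally_inj (\<theta> X) X" "\<And>X. X \<in> Ob T \<Longrightarrow> locally_surj (\<theta> X) X (rep (N X))"
    "\<And>X Y f. \<guillemotleft>f : X \<rightarrow> Y\<guillemotright> \<Longrightarrow> \<exists>\<phi>. \<guillemotleft>\<phi> : N X \<rightarrow> N Y\<guillemotright> \<and> farr tm (farr tp (cls f)) = cls \<phi> \<and>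
      yon \<phi> \<bullet>\<^bsub>PSh\<^esub> \<theta> X = \<theta> Y \<bullet>\<^bsub>PSh\<^esub> yon f"
proof -
  obtain e i where hr: "\<And>X. X \<in> Ob T \<Longrightarrow> heart_reflection T U V X (P X) (N X) (e X) (i X)"
    and nat: "\<And>X Y f. \<guillemotleft>f : X \<rightarrow> Y\<guillemotright> \<Longrightarrow> \<exists>\<phi>. \<guillemotleft>\<phi> : N X \<rightarrow> N Y\<guillemotright> \<and> farr tm (farr tp (cls f)) = cls \<phi> \<and>
      (\<forall>B k n. B \<in> A \<longrightarrow> \<guillemotleft>k : B \<rightarrow> X\<guillemotright> \<longrightarrow> \<guillemotleft>n : B \<rightarrow> N X\<guillemotright> \<longrightarrow> i X \<bullet> n = e X \<bullet> k \<longrightarrow> i Y \<bullet> (\<phi> \<bullet> n) = e Y \<bullet> (f \<bullet> k))"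
    using reflection_data by blast
  let ?\<theta> = "\<lambda>X. heart_reflection.\<theta> T U X (N X) (e X) (i X)"
  show ?thesis
  proof (rule that[of ?\<theta>])
    show "N X \<in> Hh" if "X \<in> Ob T" for X using heart_reflection.N_heart[OF hr[OF that]] .
    show th: "?\<theta> X \<in> Hom PSh (rep X) (rep (N X))" if "X \<in> Ob T" for X using heart_reflection.\<theta>_Hom[OF hr[OF that]] .
    show "locally_inj (?\<theta> X) X" if "X \<in> Ob T" for X using heart_reflection.\<theta>_locally_inj[OF hr[OF that]] .
    show "locally_surj (?\<theta> X) X (rep (N X))" if "X \<in> Ob T" for X using heart_reflection.\<theta>_locally_surj[OF hr[OF that]] .
    fix X Y f assume f: "\<guillemotleft>f : X \<rightarrow> Y\<guillemotright>"
    have X: "X \<in> Ob T" and Y: "Y \<in> Ob T" using in_homD[OF f] by blast+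
    obtain \<phi> where \<phi>: "\<guillemotleft>\<phi> : N X \<rightarrow> N Y\<guillemotright>" "farr tm (farr tp (cls f)) = cls \<phi>"
      and \<phi>_nat: "\<And>B k n. \<lbrakk>B \<in> A; \<guillemotleft>k : B \<rightarrow> X\<guillemotright>; \<guillemotleft>n : B \<rightarrow> N X\<guillemotright>; i X \<bullet> n = e X \<bullet> k\<rbrakk> \<Longrightarrow> i Y \<bullet> (\<phi> \<bullet> n) = e Y \<bullet> (f \<bullet> k)"
      using nat[OF f] by blast
    have "yon \<phi> \<bullet>\<^bsub>PSh\<^esub> ?\<theta> X = ?\<theta> Y \<bullet>\<^bsub>PSh\<^esub> yon f"
    proof (rule psh_eqI[OF psh_Comp_Hom[OF th[OF X] yon_Hom[OF \<phi>(1)]] psh_Comp_Hom[OF yon_Hom[OF f] th[OF Y]]])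
      fix B k assume B: "B \<in> A" and k0: "k \<in> El (rep X) B"
      then have k: "\<guillemotleft>k : B \<rightarrow> X\<guillemotright>" using El_repD[of k B X] X by simp
      note n = heart_reflection.\<theta>_spec[OF hr[OF X] B k]
      have fk: "\<guillemotleft>f \<bullet> k : B \<rightarrow> Y\<guillemotright>" using f k by simp
      have \<phi>n: "\<guillemotleft>\<phi> \<bullet> ev (?\<theta> X) B k : B \<rightarrow> N Y\<guillemotright>" using \<phi>(1) n(1) by simp
      have "ev (?\<theta> Y) B (f \<bullet> k) = \<phi> \<bullet> ev (?\<theta> X) B k"
        by (rule heart_reflection.ev_\<theta>[OF hr[OF Y] B fk \<phi>n \<phi>_nat[OF B k n]])
      then show "ev (yon \<phi> \<bullet>\<^bsub>PSh\<^esub> ?\<theta> X) B k = ev (?\<theta> Y \<bullet>\<^bsub>PSh\<^esub> yon f) B k"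
        using ev_comp[OF th[OF X] yon_Hom[OF \<phi>(1)] B k0] ev_comp[OF yon_Hom[OF f] th[OF Y] B k0]
          ev_yon[OF \<phi>(1) n(1) B] ev_yon[OF f k B] by simp
    qed
    then show "\<exists>\<phi>. \<guillemotleft>\<phi> : N X \<rightarrow> N Y\<guillemotright> \<and> farr tm (farr tp (cls f)) = cls \<phi> \<and> yon \<phi> \<bullet>\<^bsub>PSh\<^esub> ?\<theta> X = ?\<theta> Y \<bullet>\<^bsub>PSh\<^esub> yon f"
      using \<phi> by blast
  qed
qed

text \<open>
  A left exact cokernel of \<open>T(-, X) \<rightarrow> T(-, Y)\<close> is locally isomorphic, hence isomorphic, to
  \<open>T(-, H)\<close> for the reflection \<open>H\<close> of the cone of \<open>X \<rightarrow> Y\<close>.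
\<close>

lemma lex_representable:
  assumes F: "F \<in> Ob L" obtains H \<sigma> where "H \<in> Hh" "iso_in PSh F (rep H) \<sigma>"
proof -
  note lexF = L_lex[OF F]
  have FM: "finitely_presented (full_subcat T A) F" using L_M[OF F] Ob_M by blast
  obtain X Y f p where f: "\<guillemotleft>f : X \<rightarrow> Y\<guillemotright>" and X: "X \<in> A" and Y: "Y \<in> A" and pw: "pointwise_cokernel f F p" and FP: "F \<in> Ob PSh"
    using finitely_presentedE[OF FM] .
  obtain C q h where t: "tri X Y C f q h" using triangle_exists[OF A_Ob[OF X] A_Ob[OF Y] in_homD(3)[OF f]] by blast
  note ar = triD[OF t]
  obtain \<theta> where NH: "N C \<in> Hh" and \<theta>: "\<theta> C \<in> Hom PSh (rep C) (rep (N C))"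
    and inj: "locally_inj (\<theta> C) C" and surj: "locally_surj (\<theta> C) C (rep (N C))"
    using theta_data ar(3) by metis
  note lexN = rep_lex[OF Hh_Tp[OF NH]]
  have p: "p \<in> Hom PSh (rep Y) F" using pw f unfolding pointwise_cokernel_def by simp
  have p_surj: "\<exists>g. \<guillemotleft>g : B \<rightarrow> Y\<guillemotright> \<and> ev p B g = x" if "B \<in> A" "x \<in> El F B" for B x
    using pw f that unfolding pointwise_cokernel_def by blast
  have p_ker: "ev p B g = \<one>\<^bsub>fobj F B\<^esub> \<longleftrightarrow> (\<exists>h. \<guillemotleft>h : B \<rightarrow> X\<guillemotright> \<and> g = f \<bullet> h)" if "B \<in> A" "\<guillemotleft>g : B \<rightarrow> Y\<guillemotright>" for B g
    using pw f that unfolding pointwise_cokernel_def by simp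
  note q\<theta> = psh_Comp_Hom[OF yon_Hom[OF ar(5)] \<theta>]
  have ev_q\<theta>: "ev (\<theta> C \<bullet>\<^bsub>PSh\<^esub> yon q) B g = ev (\<theta> C) B (q \<bullet> g)" if "B \<in> A" "\<guillemotleft>g : B \<rightarrow> Y\<guillemotright>" for B g
    using ev_comp[OF yon_Hom[OF ar(5)] \<theta> that(1), of g] ev_yon[OF ar(5) that(2,1)] El_repI[OF that(2)] by simp
  have \<theta>0: "ev (\<theta> C) B (zero B C) = \<one>\<^bsub>fobj (rep (N C)) B\<^esub>" if "B \<in> A" for B
    using ev_one[OF \<theta> that] by simp
  \<comment> \<open>\<open>q\<close> followed by \<open>\<theta> C\<close> kills the image of
    \<open>f\<close>, hence induces a map on the cokernel \<open>F\<close>.\<close>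
  obtain \<sigma> where \<sigma>: "\<sigma> \<in> Hom PSh F (rep (N C))"
    and \<sigma>p0: "\<And>B g. \<lbrakk>B \<in> A; \<guillemotleft>g : B \<rightarrow> Y\<guillemotright>\<rbrakk> \<Longrightarrow> ev \<sigma> B (ev p B g) = ev (\<theta> C \<bullet>\<^bsub>PSh\<^esub> yon q) B g"
  proof (rule pointwise_cokernel_factor[OF f pw q\<theta>])
    fix B g assume B: "B \<in> A" and g: "\<guillemotleft>g : B \<rightarrow> X\<guillemotright>"
    have fg: "\<guillemotleft>f \<bullet> g : B \<rightarrow> Y\<guillemotright>" using f g by simp
    have "q \<bullet> (f \<bullet> g) = (q \<bullet> f) \<bullet> g" using ar g by (simp add: comp_assoc)
    also have "\<dots> = zero B C" unfolding tri_comp_zero[OF t] using g ar by simp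
    finally show "ev (\<theta> C \<bullet>\<^bsub>PSh\<^esub> yon q) B (f \<bullet> g) = \<one>\<^bsub>fobj (rep (N C)) B\<^esub>" using ev_q\<theta>[OF B fg] \<theta>0[OF B] by simp
  qed (use that in blast)
  have \<sigma>p: "ev \<sigma> B (ev p B g) = ev (\<theta> C) B (q \<bullet> g)" if "B \<in> A" "\<guillemotleft>g : B \<rightarrow> Y\<guillemotright>" for B g
    using \<sigma>p0[OF that] ev_q\<theta>[OF that] by simp
  have res_p: "res F b (ev p B g) = ev p D (g \<bullet> b)" if "B \<in> A" "D \<in> A" "\<guillemotleft>b : D \<rightarrow> B\<guillemotright>" "\<guillemotleft>g : B \<rightarrow> Y\<guillemotright>" for B D b g
    using ev_natural[OF p, of b g] El_repI[OF that(4)] res_rep[of g b Y] that by simp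
  \<comment> \<open>A kernel element comes from some \<open>g\<close> for which
    \<open>q \<bullet> g\<close> is zero on a covering. There \<open>g\<close> factors through
    \<open>f\<close>, so \<open>p\<close> kills it, and \<open>F\<close> is separated.\<close>
  have \<sigma>_inj: "x = \<one>\<^bsub>fobj F B\<^esub>" if B: "B \<in> A" and x: "x \<in> El F B" and 1: "ev \<sigma> B x = \<one>\<^bsub>fobj (rep (N C)) B\<^esub>" for B x
  proof -
    obtain g where g: "\<guillemotleft>g : B \<rightarrow> Y\<guillemotright>" "ev p B g = x" using p_surj[OF B x] by blast
    have qg: "\<guillemotleft>q \<bullet> g : B \<rightarrow> C\<guillemotright>" using ar g by simp
    have "ev (\<theta> C) B (q \<bullet> g) = ev (\<theta> C) B (zero B C)" using \<sigma>p[OF B g(1)] g(2) 1 \<theta>0[OF B] by simp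
    then obtain D b where b: "cover b D B" and 0: "(q \<bullet> g) \<bullet> b = zero D C" using inj B qg unfolding locally_inj_def by blast
    obtain D: "D \<in> A" and b1: "\<guillemotleft>b : D \<rightarrow> B\<guillemotright>" using coverE[OF b] by blast
    have gb: "\<guillemotleft>g \<bullet> b : D \<rightarrow> Y\<guillemotright>" using g b1 by simp
    have "q \<bullet> (g \<bullet> b) = zero D C" using 0 ar g(1) b1 by (simp add: comp_assoc)
    then obtain l where l: "\<guillemotleft>l : D \<rightarrow> X\<guillemotright>" "f \<bullet> l = g \<bullet> b" using tri_exact[OF t gb] by blast
    have "ev p D (g \<bullet> b) = \<one>\<^bsub>fobj F D\<^esub>" using p_ker[OF D gb] l(1) l(2)[symmetric] by blast
    then have "res F b x = res F b \<one>\<^bsub>fobj F B\<^esub>" using res_p[OF B D b1 g(1)] g(2) res_one[OF FP, of b B] b1 B D by simp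
    moreover have "\<one>\<^bsub>fobj F B\<^esub> \<in> El F B" using group.is_monoid[OF presheaf_group'[OF FP B]] monoid.one_closed by blast
    ultimately show ?thesis using lex_inj[OF lexF b x] by blast
  qed
  have "iso_in PSh F (rep (N C)) \<sigma>"
  proof (rule psh_isoI[OF \<sigma>])
    fix B assume B: "B \<in> A"
    interpret group_hom "fobj F B" "fobj (rep (N C)) B" "ev \<sigma> B"
      using presheaf_group'[OF FP B] presheaf_group'[OF Hom_PSh_Ob(2)[OF \<sigma>] B] ev_hom[OF \<sigma> B]
      by (intro group_hom.intro group_hom_axioms.intro)
    have "inj_on (ev \<sigma> B) (El F B)" using \<sigma>_inj[OF B] inj_on_one_iff by blast
    moreover have "n \<in> ev \<sigma> B ` El F B" if n: "n \<in> El (rep (N C)) B" for n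
    proof -
      obtain D b x where b: "cover b D B" and x: "\<guillemotleft>x : D \<rightarrow> C\<guillemotright>" "ev (\<theta> C) D x = res (rep (N C)) b n"
        using surj B n unfolding locally_surj_def by blast
      obtain D: "D \<in> A" and b1: "\<guillemotleft>b : D \<rightarrow> B\<guillemotright>" using coverE[OF b] by blast
      \<comment> \<open>Two coverings are needed: on the first, \<open>n\<close> is the value of
        \<open>\<theta> C\<close> at \<open>x\<close>; on the second, the obstruction
        \<open>h \<bullet> x\<close> to lifting \<open>x\<close> to \<open>Y\<close>, a map to
        \<open>X[1]\<close> in \<open>U\<close>, vanishes. The preimage then descends along
        \<open>b'\<close> and along \<open>b\<close>.\<close>
      have "\<guillemotleft>h \<bullet> x : D \<rightarrow> sh X\<guillemotright>" using ar x(1) by simp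
      then obtain D' b' where b': "cover b' D' D" and 0: "(h \<bullet> x) \<bullet> b' = zero D' (sh X)" using cover_kills[OF D A_shift[OF X]] by blast
      obtain D': "D' \<in> A" and b'1: "\<guillemotleft>b' : D' \<rightarrow> D\<guillemotright>" using coverE[OF b'] by blast
      have xb: "\<guillemotleft>x \<bullet> b' : D' \<rightarrow> C\<guillemotright>" using x(1) b'1 by simp
      have "h \<bullet> (x \<bullet> b') = zero D' (sh X)" using 0 ar x(1) b'1 by (simp add: comp_assoc)
      then obtain g where g: "\<guillemotleft>g : D' \<rightarrow> Y\<guillemotright>" "q \<bullet> g = x \<bullet> b'" using tri_exact[OF rotate[OF t] xb] by blast
      have y: "ev p D' g \<in> El F D'" using ev_closed[OF p D'] El_repI[OF g(1)] by simp
      have x0: "x \<in> El (rep C) D" "x \<in> Hom T D C" using El_repI[OF x(1)] by simp_all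
      have "ev \<sigma> D' (ev p D' g) = ev (\<theta> C) D' (x \<bullet> b')" using \<sigma>p[OF D' g(1)] g(2) by simp
      also have "\<dots> = res (rep (N C)) b' (ev (\<theta> C) D x)"
        using ev_natural[OF \<theta>, of b' x] x0 res_rep[of x b' C] b'1 D D' by simp
      finally obtain y' where y': "y' \<in> El F D" "ev \<sigma> D y' = ev (\<theta> C) D x"
        using lex_local_surj[OF \<sigma> lexF lexN \<sigma>_inj b' ev_closed[OF \<theta> D x0(1)] y] by blast
      then have "ev \<sigma> D y' = res (rep (N C)) b n" using x(2) by simp
      then obtain z where "z \<in> El F B" "ev \<sigma> B z = n"
        using lex_local_surj[OF \<sigma> lexF lexN \<sigma>_inj b n y'(1)] by blast
      then show ?thesis by blast
    qed
    ultimately show "bij_betw (ev \<sigma> B) (El F B) (El (rep (N C)) B)"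
      unfolding bij_betw_def using ev_closed[OF \<sigma> B] by blast
  qed
  then show ?thesis using that NH by blast
qed

text \<open>Full and faithful because heart objects lie in \<open>T^-\<close>. Density draws on the
  given adjoints, since the preimage of a left exact functor is the reflection of a cone.\<close>

lemma \<Psi>_equivalence: "category_equivalence heartC L \<Psi>"
proof -
  interpret \<Psi>: additive_functor_between heartC L \<Psi>
    using preadditive_heartC preadditive_L additive_\<Psi>
    by (intro additive_functor_between.intro additive_functor_between_axioms.intro)
  show ?thesis
  proof (rule \<Psi>.equivalenceI)
    show "\<Psi>.faithful"
      unfolding \<Psi>.faithful_def
    proof (intro allI impI)
      fix a b assume ab: "\<Psi>.C.par a b" and eq: "farr \<Psi> a = farr \<Psi> b"
      define X Y where "X = Src CW a" and "Y = Tgt CW a"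
      have X: "X \<in> Hh" and Y: "Y \<in> Hh" using ab \<Psi>.C.arr_Src[of a] \<Psi>.C.arr_Tgt[of a] by (simp_all add: X_def Y_def)
      have a: "a \<in> Hom CW X Y" and b: "b \<in> Hom CW X Y"
        using ab \<Psi>.C.arr_Hom[of a] \<Psi>.C.arr_Hom[of b] by (simp_all add: X_def Y_def)
      obtain f where f: "\<guillemotleft>f : X \<rightarrow> Y\<guillemotright>" "a = cls f" using Hom_CWE[OF Hh_Ob[OF X] Hh_Ob[OF Y] a] .
      obtain g where g: "\<guillemotleft>g : X \<rightarrow> Y\<guillemotright>" "b = cls g" using Hom_CWE[OF Hh_Ob[OF X] Hh_Ob[OF Y] b] .
      have "yon f = yon g" using eq unfolding f(2) g(2) farr_\<Psi>[OF f(1)] farr_\<Psi>[OF g(1)] .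
      then show "a = b" unfolding f(2) g(2) by (rule yon_faithful[OF Hh_Tm[OF X] f(1) g(1)])
    qed
    show "\<Psi>.full"
      unfolding \<Psi>.full_def
    proof (intro ballI allI impI)
      fix X Y \<alpha> assume "X \<in> Ob heartC" "Y \<in> Ob heartC" and \<alpha>: "\<Psi>.D.in_hom \<alpha> (fobj \<Psi> X) (fobj \<Psi> Y)"
      then have X: "X \<in> Hh" and Y: "Y \<in> Hh" by simp_all
      have "\<alpha> \<in> Hom PSh (rep X) (rep Y)" using \<Psi>.D.in_homD(3)[OF \<alpha>] by simp
      then obtain f where f: "\<guillemotleft>f : X \<rightarrow> Y\<guillemotright>" "yon f = \<alpha>" using yon_full[OF Hh_Tm[OF X] Hh_Ob[OF Y]] by blast
      have "\<Psi>.C.in_hom (cls f) X Y" using cls_Hom[OF f(1)] X Y by (intro \<Psi>.C.in_homI) simp_all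
      then show "\<exists>a. \<Psi>.C.in_hom a X Y \<and> farr \<Psi> a = \<alpha>" using farr_\<Psi>[OF f(1)] f(2) by blast
    qed
    fix F assume F: "F \<in> Ob L"
    obtain H \<sigma> where H: "H \<in> Hh" and \<sigma>: "iso_in PSh F (rep H) \<sigma>" using lex_representable[OF F] .
    have "isomorphic L F (rep H)" using isomorphic_L[OF F rep_L[OF H] \<sigma>] unfolding isomorphic_def by blast
    then have "isomorphic L (rep H) F" using \<Psi>.D.isomorphic_sym F rep_L[OF H] by blast
    then show "\<exists>X \<in> Ob heartC. isomorphic L (fobj \<Psi> X) F" using H by auto
  qed
qed

text \<open>Both \<open>\<theta> X\<close> and the unit of \<open>Q\<close> are reflections of
  \<open>T(-, X)\<close> into the left exact functors, so they differ by an isomorphism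
  \<open>\<zeta> X\<close> from \<open>T(-, N X)\<close> to the value of \<open>Q\<close>. Applying
  \<open>G\<close> and the unit of the equivalence turns it into the isomorphism of functors to the
  heart.\<close>

lemma heart_functor_iso:
  assumes Q: "adjoint M L Q id_functor" and G: "quasi_inverse heartC L \<Psi> G"
  shows "nat_isomorphic T heartC (heart_functor T U V tp tm) (G \<circ>\<^sub>F Q \<circ>\<^sub>F restricted_yoneda T A)"
proof -
  interpret M: preadditive_category M by (rule preadditive_M)
  interpret HC: preadditive_category heartC by (rule preadditive_heartC)
  obtain \<theta> where NH: "\<And>X. X \<in> Ob T \<Longrightarrow> N X \<in> Hh"
    and \<theta>: "\<And>X. X \<in> Ob T \<Longrightarrow> \<theta> X \<in> Hom PSh (rep X) (rep (N X))"
    and \<theta>_inj: "\<And>X. X \<in> Ob T \<Longrightarrow> locally_inj (\<theta> X) X" and \<theta>_surj: "\<And>X. X \<in> Ob T \<Longrightarrow> locally_surj (\<theta> X) X (rep (N X))"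
    and \<theta>_nat: "\<And>X Y f. \<guillemotleft>f : X \<rightarrow> Y\<guillemotright> \<Longrightarrow> \<exists>\<phi>. \<guillemotleft>\<phi> : N X \<rightarrow> N Y\<guillemotright> \<and> farr tm (farr tp (cls f)) = cls \<phi> \<and>
      yon \<phi> \<bullet>\<^bsub>PSh\<^esub> \<theta> X = \<theta> Y \<bullet>\<^bsub>PSh\<^esub> yon f"
    using theta_data by blast
  have Q': "adjoint M (full_subcat M (Ob L)) Q id_functor" unfolding L_eq[symmetric] by (rule Q)
  obtain u where QL: "\<And>F. F \<in> Ob M \<Longrightarrow> fobj Q F \<in> Ob L"
    and u: "\<And>F. F \<in> Ob M \<Longrightarrow> M.in_hom (u F) F (fobj Q F)"
    and u_nat: "\<And>F G \<alpha>. M.in_hom \<alpha> F G \<Longrightarrow> farr Q \<alpha> \<bullet>\<^bsub>M\<^esub> u F = u G \<bullet>\<^bsub>M\<^esub> \<alpha>"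
    and u_ex: "\<And>F G \<alpha>. \<lbrakk>M.in_hom \<alpha> F G; G \<in> Ob L\<rbrakk> \<Longrightarrow> \<exists>\<beta>. M.in_hom \<beta> (fobj Q F) G \<and> \<beta> \<bullet>\<^bsub>M\<^esub> u F = \<alpha>"
    and u_uniq: "\<And>F G \<beta> \<beta>'. \<lbrakk>F \<in> Ob M; G \<in> Ob L; M.in_hom \<beta> (fobj Q F) G; M.in_hom \<beta>' (fobj Q F) G; \<beta> \<bullet>\<^bsub>M\<^esub> u F = \<beta>' \<bullet>\<^bsub>M\<^esub> u F\<rbrakk> \<Longrightarrow> \<beta> = \<beta>'"
    using M.reflection[OF Q' L_sub_M] by blast
  have Q_additive: "additive_functor M L Q" using Q unfolding adjoint_def by blast
  let ?Q = "\<lambda>X. fobj Q (rep X)"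
  have QX: "?Q X \<in> Ob L" and QM: "?Q X \<in> Ob M" and repN: "rep (N X) \<in> Ob L" if "X \<in> Ob T" for X
    using QL[OF rep_M[OF that]] L_M rep_L[OF NH[OF that]] by blast+
  have uX: "u (rep X) \<in> Hom PSh (rep X) (?Q X)" if "X \<in> Ob T" for X
    using M.in_homD(3)[OF u[OF rep_M[OF that]]] by simp
  have M_in: "M.in_hom \<alpha> F G" if "F \<in> Ob M" "G \<in> Ob M" "\<alpha> \<in> Hom PSh F G" for \<alpha> F G
    using M.in_homI[OF that(1,2)] that(3) by simp
  have "\<exists>\<zeta>. \<zeta> \<in> Hom PSh (rep (N X)) (?Q X) \<and> \<zeta> \<bullet>\<^bsub>PSh\<^esub> \<theta> X = u (rep X)" if X: "X \<in> Ob T" for X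
    using locally_iso_extend[OF Hh_Tm[OF NH[OF X]] \<theta>[OF X] \<theta>_inj[OF X] \<theta>_surj[OF X] uX[OF X] L_lex[OF QX[OF X]] X] by blast
  then obtain \<zeta> where \<zeta>: "\<And>X. X \<in> Ob T \<Longrightarrow> \<zeta> X \<in> Hom PSh (rep (N X)) (?Q X)"
    and \<zeta>\<theta>: "\<And>X. X \<in> Ob T \<Longrightarrow> \<zeta> X \<bullet>\<^bsub>PSh\<^esub> \<theta> X = u (rep X)" by metis
  note \<theta>_unique = locally_iso_unique[OF \<theta> \<theta>_surj]
  note assoc = PSh.Comp_assoc
  have \<zeta>_iso: "iso_in L (rep (N X)) (?Q X) (\<zeta> X)" if X: "X \<in> Ob T" for X
  proof -
    note obs = rep_Ob[OF X] L_PSh[OF repN[OF X]] L_PSh[OF QX[OF X]]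
    have "M.in_hom (\<theta> X) (rep X) (rep (N X))" by (rule M_in[OF rep_M[OF X] L_M[OF repN[OF X]] \<theta>[OF X]])
    then obtain \<kappa> where \<kappa>0: "M.in_hom \<kappa> (?Q X) (rep (N X))" "\<kappa> \<bullet>\<^bsub>M\<^esub> u (rep X) = \<theta> X" using u_ex repN[OF X] by blast
    have \<kappa>: "\<kappa> \<in> Hom PSh (?Q X) (rep (N X))" "\<kappa> \<bullet>\<^bsub>PSh\<^esub> u (rep X) = \<theta> X" using M.in_homD(3)[OF \<kappa>0(1)] \<kappa>0(2) by simp_all
    have "(\<kappa> \<bullet>\<^bsub>PSh\<^esub> \<zeta> X) \<bullet>\<^bsub>PSh\<^esub> \<theta> X = Ide PSh (rep (N X)) \<bullet>\<^bsub>PSh\<^esub> \<theta> X"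
      using assoc[OF obs(1,2,3,2) \<theta>[OF X] \<zeta>[OF X] \<kappa>(1)] \<zeta>\<theta>[OF X] \<kappa>(2) PSh.Ide_Comp[OF obs(1,2) \<theta>[OF X]] by simp
    then have 1: "\<kappa> \<bullet>\<^bsub>PSh\<^esub> \<zeta> X = Ide PSh (rep (N X))"
      by (rule \<theta>_unique[OF X X L_lex[OF repN[OF X]] psh_Comp_Hom[OF \<zeta>[OF X] \<kappa>(1)] psh_Ide_Hom[OF obs(2)]])
    have "(\<zeta> X \<bullet>\<^bsub>PSh\<^esub> \<kappa>) \<bullet>\<^bsub>PSh\<^esub> u (rep X) = Ide PSh (?Q X) \<bullet>\<^bsub>PSh\<^esub> u (rep X)"
      using assoc[OF obs(1,3,2,3) uX[OF X] \<kappa>(1) \<zeta>[OF X]] \<zeta>\<theta>[OF X] \<kappa>(2) PSh.Ide_Comp[OF obs(1,3) uX[OF X]] by simp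
    then have 2: "\<zeta> X \<bullet>\<^bsub>PSh\<^esub> \<kappa> = Ide PSh (?Q X)"
      using u_uniq[OF rep_M[OF X] QX[OF X] M_in[OF QM[OF X] QM[OF X] psh_Comp_Hom[OF \<kappa>(1) \<zeta>[OF X]]]
          M_in[OF QM[OF X] QM[OF X] psh_Ide_Hom[OF obs(3)]]] by simp
    show ?thesis unfolding iso_in_def using \<zeta>[OF X] \<kappa>(1) 1 2 by auto
  qed
  \<comment> \<open>Both sides agree after composition with \<open>\<theta> X\<close>, because
    \<open>\<theta>\<close> and the unit of \<open>Q\<close> are natural. A map from
    \<open>T(-, N X)\<close> to a left exact functor is determined by that composite.\<close>
  have \<zeta>_nat: "\<zeta> Y \<bullet>\<^bsub>PSh\<^esub> yon \<phi> = farr Q (yon f) \<bullet>\<^bsub>PSh\<^esub> \<zeta> X"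
    if f: "\<guillemotleft>f : X \<rightarrow> Y\<guillemotright>" and \<phi>: "\<guillemotleft>\<phi> : N X \<rightarrow> N Y\<guillemotright>" and nat: "yon \<phi> \<bullet>\<^bsub>PSh\<^esub> \<theta> X = \<theta> Y \<bullet>\<^bsub>PSh\<^esub> yon f" for X Y f \<phi>
  proof -
    have X: "X \<in> Ob T" and Y: "Y \<in> Ob T" using in_homD[OF f] by blast+
    note obs = rep_Ob[OF X] L_PSh[OF repN[OF X]] L_PSh[OF QX[OF X]] rep_Ob[OF Y] L_PSh[OF repN[OF Y]] L_PSh[OF QX[OF Y]]
    have Mf: "M.in_hom (yon f) (rep X) (rep Y)" by (rule M_in[OF rep_M[OF X] rep_M[OF Y] yon_Hom[OF f]])
    have Qf: "farr Q (yon f) \<in> Hom PSh (?Q X) (?Q Y)"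
      using additive_functor_Hom[OF Q_additive rep_M[OF X] rep_M[OF Y]] yon_Hom[OF f] by simp
    have "(\<zeta> Y \<bullet>\<^bsub>PSh\<^esub> yon \<phi>) \<bullet>\<^bsub>PSh\<^esub> \<theta> X = (\<zeta> Y \<bullet>\<^bsub>PSh\<^esub> \<theta> Y) \<bullet>\<^bsub>PSh\<^esub> yon f"
      using assoc[OF obs(1,2,5,6) \<theta>[OF X] yon_Hom[OF \<phi>] \<zeta>[OF Y]] assoc[OF obs(1,4,5,6) yon_Hom[OF f] \<theta>[OF Y] \<zeta>[OF Y]] nat by simp
    also have "\<dots> = (farr Q (yon f) \<bullet>\<^bsub>PSh\<^esub> \<zeta> X) \<bullet>\<^bsub>PSh\<^esub> \<theta> X"
      using assoc[OF obs(1,2,3,6) \<theta>[OF X] \<zeta>[OF X] Qf] \<zeta>\<theta>[OF X] \<zeta>\<theta>[OF Y] u_nat[OF Mf] by simp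
    finally show ?thesis
      by (rule \<theta>_unique[OF X X L_lex[OF QX[OF Y]] psh_Comp_Hom[OF yon_Hom[OF \<phi>] \<zeta>[OF Y]] psh_Comp_Hom[OF \<zeta>[OF X] Qf]])
  qed
  obtain \<kappa> where G_additive: "additive_functor L heartC G" and \<kappa>: "nat_trans heartC heartC id_functor (G \<circ>\<^sub>F \<Psi>) \<kappa>"
    and \<kappa>_iso0: "\<And>X. X \<in> Hh \<Longrightarrow> iso_in heartC X (fobj G (rep X)) (\<kappa> X)"
    using G unfolding quasi_inverse_def nat_isomorphic_def by auto
  interpret G: additive_functor_between L heartC G
    using preadditive_heartC preadditive_L G_additive
    by (intro additive_functor_between.intro additive_functor_between_axioms.intro)
  have GL: "fobj G F \<in> Hh" if "F \<in> Ob L" for F using G.ob[OF that] by simp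
  \<comment> \<open>The unit \<open>N X \<rightarrow> G (T(-, N X))\<close> of the equivalence,
    followed by the image under \<open>G\<close> of the comparison \<open>\<zeta> X\<close>.\<close>
  let ?\<mu> = "\<lambda>X. farr G (\<zeta> X) \<bullet>\<^bsub>heartC\<^esub> \<kappa> (N X)"
  have \<mu>_iso: "iso_in heartC (N X) (fobj G (?Q X)) (?\<mu> X)" if X: "X \<in> Ob T" for X
  proof (rule HC.iso_in_comp)
    show "iso_in heartC (N X) (fobj G (rep (N X))) (\<kappa> (N X))" using \<kappa>_iso0[of "N X"] NH[OF X] by simp
    show "iso_in heartC (fobj G (rep (N X))) (fobj G (?Q X)) (farr G (\<zeta> X))"
      by (rule G.iso[OF \<zeta>_iso[OF X] repN[OF X] QX[OF X]])
  qed (use NH[OF X] GL[OF repN[OF X]] GL[OF QX[OF X]] in simp_all)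
  have H_additive: "additive_functor T heartC (heart_functor T U V tp tm)"
    unfolding heartC_eq heart_functor_def
  proof (rule additive_functor_full_subcat)
    show "additive_functor T CW (tm \<circ>\<^sub>F tp \<circ>\<^sub>F quotient_functor T W)"
      by (intro additive_functor_comp[OF additive_quotient_functor] additive_functor_comp[OF tp_additive] tm_additive)
    show "fobj (tm \<circ>\<^sub>F tp \<circ>\<^sub>F quotient_functor T W) X \<in> Hh" if "X \<in> Ob T" for X
      using NH[OF that] by (simp add: quotient_functor_def)
  qed
  have R_additive: "additive_functor T heartC (G \<circ>\<^sub>F Q \<circ>\<^sub>F restricted_yoneda T A)"
    by (intro additive_functor_comp[OF additive_yoneda_M] additive_functor_comp[OF Q_additive] G_additive)
  have "nat_trans T heartC (heart_functor T U V tp tm) (G \<circ>\<^sub>F Q \<circ>\<^sub>F restricted_yoneda T A) ?\<mu>"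
  proof (rule nat_transI[OF H_additive R_additive])
    show "?\<mu> X \<in> Hom heartC (fobj (heart_functor T U V tp tm) X) (fobj (G \<circ>\<^sub>F Q \<circ>\<^sub>F restricted_yoneda T A) X)" if "X \<in> Ob T" for X
      using \<mu>_iso[OF that] by (simp add: iso_in_def heart_functor_def quotient_functor_def)
    fix X Y f assume "X \<in> Ob T" "Y \<in> Ob T" "f \<in> Hom T X Y"
    then have f: "\<guillemotleft>f : X \<rightarrow> Y\<guillemotright>" and X: "X \<in> Ob T" and Y: "Y \<in> Ob T" using in_homI by blast+
    obtain \<phi> where \<phi>: "\<guillemotleft>\<phi> : N X \<rightarrow> N Y\<guillemotright>" "farr tm (farr tp (cls f)) = cls \<phi>" "yon \<phi> \<bullet>\<^bsub>PSh\<^esub> \<theta> X = \<theta> Y \<bullet>\<^bsub>PSh\<^esub> yon f"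
      using \<theta>_nat[OF f] by blast
    note nH = NH[OF X] NH[OF Y] and gL = GL[OF repN[OF X]] GL[OF repN[OF Y]] GL[OF QX[OF X]] GL[OF QX[OF Y]]
    have Qf: "farr Q (yon f) \<in> Hom PSh (?Q X) (?Q Y)"
      using additive_functor_Hom[OF Q_additive rep_M[OF X] rep_M[OF Y]] yon_Hom[OF f] by simp
    have k: "\<kappa> (N X) \<in> Hom CW (N X) (fobj G (rep (N X)))" "\<kappa> (N Y) \<in> Hom CW (N Y) (fobj G (rep (N Y)))"
      using nat_trans_component[OF \<kappa>, of "N X"] nat_trans_component[OF \<kappa>, of "N Y"] nH by simp_all
    have c\<phi>: "cls \<phi> \<in> Hom CW (N X) (N Y)" by (rule cls_Hom[OF \<phi>(1)])
    have k_nat: "\<kappa> (N Y) \<bullet>\<^bsub>CW\<^esub> cls \<phi> = farr G (yon \<phi>) \<bullet>\<^bsub>CW\<^esub> \<kappa> (N X)"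
      using nat_trans_natural[OF \<kappa>, of "N X" "N Y" "cls \<phi>"] c\<phi> nH farr_\<Psi>[OF \<phi>(1)] by simp
    have G\<zeta>: "farr G (\<zeta> X) \<in> Hom CW (fobj G (rep (N X))) (fobj G (?Q X))"
      "farr G (\<zeta> Y) \<in> Hom CW (fobj G (rep (N Y))) (fobj G (?Q Y))"
      "farr G (yon \<phi>) \<in> Hom CW (fobj G (rep (N X))) (fobj G (rep (N Y)))"
      "farr G (farr Q (yon f)) \<in> Hom CW (fobj G (?Q X)) (fobj G (?Q Y))"
      using additive_functor_Hom[OF G_additive repN[OF X] QX[OF X]] additive_functor_Hom[OF G_additive repN[OF Y] QX[OF Y]]
        additive_functor_Hom[OF G_additive repN[OF X] repN[OF Y]] additive_functor_Hom[OF G_additive QX[OF X] QX[OF Y]]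
        \<zeta>[OF X] \<zeta>[OF Y] yon_Hom[OF \<phi>(1)] Qf by simp_all
    have "(farr G (\<zeta> Y) \<bullet>\<^bsub>CW\<^esub> \<kappa> (N Y)) \<bullet>\<^bsub>CW\<^esub> cls \<phi> = farr G (\<zeta> Y) \<bullet>\<^bsub>CW\<^esub> (\<kappa> (N Y) \<bullet>\<^bsub>CW\<^esub> cls \<phi>)"
      using HC.Comp_assoc[of "N X" "N Y" "fobj G (rep (N Y))" "fobj G (?Q Y)"] nH gL c\<phi> k G\<zeta> by simp
    also have "\<dots> = (farr G (\<zeta> Y) \<bullet>\<^bsub>CW\<^esub> farr G (yon \<phi>)) \<bullet>\<^bsub>CW\<^esub> \<kappa> (N X)"
      unfolding k_nat using HC.Comp_assoc[of "N X" "fobj G (rep (N X))" "fobj G (rep (N Y))" "fobj G (?Q Y)"] nH gL k G\<zeta> by simp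
    also have "farr G (\<zeta> Y) \<bullet>\<^bsub>CW\<^esub> farr G (yon \<phi>) = farr G (farr Q (yon f)) \<bullet>\<^bsub>CW\<^esub> farr G (\<zeta> X)"
      using additive_functor_Comp[OF G_additive repN[OF X] repN[OF Y] QX[OF Y], of "yon \<phi>" "\<zeta> Y"]
        additive_functor_Comp[OF G_additive repN[OF X] QX[OF X] QX[OF Y], of "\<zeta> X" "farr Q (yon f)"]
        \<zeta>_nat[OF f \<phi>(1,3)] \<zeta>[OF X] \<zeta>[OF Y] yon_Hom[OF \<phi>(1)] Qf by simp
    also have "(farr G (farr Q (yon f)) \<bullet>\<^bsub>CW\<^esub> farr G (\<zeta> X)) \<bullet>\<^bsub>CW\<^esub> \<kappa> (N X) =
        farr G (farr Q (yon f)) \<bullet>\<^bsub>CW\<^esub> (farr G (\<zeta> X) \<bullet>\<^bsub>CW\<^esub> \<kappa> (N X))"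
      using HC.Comp_assoc[of "N X" "fobj G (rep (N X))" "fobj G (?Q X)" "fobj G (?Q Y)"] nH gL k G\<zeta> by simp
    finally show "?\<mu> Y \<bullet>\<^bsub>heartC\<^esub> farr (heart_functor T U V tp tm) f =
        farr (G \<circ>\<^sub>F Q \<circ>\<^sub>F restricted_yoneda T A) f \<bullet>\<^bsub>heartC\<^esub> ?\<mu> X"
      using \<phi>(2) by (simp add: heart_functor_def quotient_functor_def)
  qed
  then show ?thesis
    unfolding nat_isomorphic_def using \<mu>_iso by (auto simp: heart_functor_def quotient_functor_def)
qed

end

theorem theorem4p7:
  fixes T :: "('o, 'm) tricat"
    and U V :: "'o set"
    and \<tau>\<^sub>p \<tau>\<^sub>m :: "('o, 'm set, 'o, 'm set) cfunctor"
    and Q :: "(('o, 'm) presheaf, ('o, 'm) presheaf_arrow,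
               ('o, 'm) presheaf, ('o, 'm) presheaf_arrow) cfunctor"
  defines "\<U> \<equiv> unshift_class T U"
  assumes "triangulated_category T"
    and "cotorsion_pair T U V"
    and "is_tau_plus T U V \<tau>\<^sub>p"
    and "is_tau_minus T U V \<tau>\<^sub>m"
    and "adjoint (mod_cat (full_subcat T \<U>)) (lex_cat T \<U>) Q id_functor"
  shows "\<exists>\<Psi> :: ('o, 'm set, ('o, 'm) presheaf, ('o, 'm) presheaf_arrow) cfunctor.
           category_equivalence (heart T U V) (lex_cat T \<U>) \<Psi> \<and>
           (\<forall>H \<in> heart_objects T U V.
              fobj \<Psi> (fobj (quotient_functor T (U \<inter> V)) H) = fobj (restricted_yoneda T \<U>) H) \<and>
           (\<forall>H \<in> heart_objects T U V. \<forall>H' \<in> heart_objects T U V. \<forall>f \<in> Hom T H H'.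
              farr \<Psi> (farr (quotient_functor T (U \<inter> V)) f) = farr (restricted_yoneda T \<U>) f) \<and>
           additive_functor T (mod_cat (full_subcat T \<U>)) (restricted_yoneda T \<U>) \<and>
           (\<forall>\<Psi>'. quasi_inverse (heart T U V) (lex_cat T \<U>) \<Psi> \<Psi>' \<longrightarrow>
              nat_isomorphic T (heart T U V)
                (heart_functor T U V \<tau>\<^sub>p \<tau>\<^sub>m) (\<Psi>' \<circ>\<^sub>F Q \<circ>\<^sub>F restricted_yoneda T \<U>))"
proof -
  interpret cotorsion T U V
    using assms(2,3) by (intro cotorsion.intro cotorsion_axioms.intro)
  interpret heart_adjoints T U V \<tau>\<^sub>p \<tau>\<^sub>m
    using assms(4,5) by unfold_locales
  have Q: "adjoint M L Q id_functor" using assms(6) unfolding \<U>_def .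
  show ?thesis
    unfolding \<U>_def
  proof (intro exI[of _ \<Psi>] conjI ballI allI impI)
    show "category_equivalence heartC L \<Psi>" by (rule \<Psi>_equivalence)
    show "fobj \<Psi> (fobj (quotient_functor T W) H) = fobj (restricted_yoneda T A) H" for H
      by (simp add: quotient_functor_def)
    show "farr \<Psi> (farr (quotient_functor T W) f) = yon f" if "H \<in> Hh" "H' \<in> Hh" "f \<in> Hom T H H'" for H H' f
      using farr_\<Psi>[OF in_homI[OF Hh_Ob Hh_Ob]] that by (simp add: quotient_functor_def)
    show "additive_functor T M (restricted_yoneda T A)" by (rule additive_yoneda_M)
    show "nat_isomorphic T heartC (heart_functor T U V \<tau>\<^sub>p \<tau>\<^sub>m) (G \<circ>\<^sub>F Q \<circ>\<^sub>F restricted_yoneda T A)"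
      if "quasi_inverse heartC L \<Psi> G" for G
      using heart_functor_iso[OF Q that] .
  qed
qed

end
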